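(* There is an absolute constant $C>0$ such that the following holds. In the generalized linear model described in the context, suppose the columns of the matrices $X_i\in\mathbb R^{d\times k}$, $i=1,\dots,n$, span $\mathbb R^d$. Suppose that for some $s\geq 12$ we have $$\mathcal U^*(2s)\subset\Theta,\qquad 2s\,\delta_3^*(2s)\sqrt{d/n}\leq \tfrac14,\qquad \delta_{01}^*(2s)\leq \sqrt{nd}/6 .$$ Then on an event of probability at least $1-\exp(-ds^2/10)$ with respect to the distribution of the $Y_i$, we have $$\mathrm{TV}(\pi_v,\gamma^* )\leq C\left(\frac{\delta_{01}^*(2s)}{\sqrt n}+s\,\delta_3^*(2s)\frac{d}{\sqrt n}+e^{d(M_0^*-(s/12)^2)}\right).$$
   Context: Model. Let $\mu$ be a measure on $\mathcal Y\subseteq\mathbb R^k$, $\psi(\omega)=\log\int_{\mathcal Y}e^{\omega^\top y}d\mu(y)$, $\Omega=\{\omega\in\mathbb R^k:\int_{\mathcal Y} e^{\omega^\top y}d\mu(y)<\infty\}$, and $p(y\mid\omega)=\exp(\omega^\top y-\psi(\omega))$, $\omega\in\Omega$. This exponential family is assumed full, minimal and regular (the parameter space is all of $\Omega$, $\Omega$ is open, and $\mu$ is not concentrated on a proper affine subspace), so $\Omega$ is open and convex and $\psi$ is $C^\infty$ and strictly convex on $\Omega$. Fixed matrices $X_1,\dots,X_n\in\mathbb R^{d\times k}$ are given, and $\Theta=\{\theta\in\mathbb R^d: X_i^\top\theta\in\Omega\ \forall i=1,\dots,n\}$. For a ground truth $\theta^*\in\Theta$, the observations $Y_1,\dots,Y_n$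 are independent with $Y_i\sim p(\cdot\mid X_i^\top\theta^* )\,d\mu$. Normalized negative log likelihood: $\ell(\theta)=\frac1n\sum_{i=1}^n[\psi(X_i^\top\theta)-Y_i^\top X_i^\top\theta]$, $\theta\in\Theta$. The MLE is $\hat\theta=\arg\min_{\theta\in\Theta}\ell(\theta)$ when it exists and is unique. The Fisher information matrix is $F^*=\frac1n\sum_{i=1}^nX_i\nabla^2\psi(X_i^\top\theta^* )X_i^\top$. The prior is a probability density $\pi_0$, strictly positive on $\Theta$; the posterior is $\pi_v(\theta)\propto e^{-n\ell(\theta)}\pi_0(\theta)$, $\theta\in\Theta$. The Gaussian is $\gamma^*=\mathcal N(\hat\theta,(nF^* )^{-1})$ (the assertion that a bound on $\mathrm{TV}(\pi_v,\gamma^* )$ holds on an event includes that $\hat\theta$ exists and is unique on that event). Norms: $|u|_A=|A^{1/2}u|$ for vectors $u$ and positive definite $A$; for a gradient vector $S$, $\|S\|_A=|A^{-1/2}S|$. $\mathrm{TV}(P,Q)=\sup_B|P(B)-Q(B)|$. Quantities: $\mathcal U^*(s)=\{\theta\in\mathbb R^d:|\theta-\theta^*|_{F^*}\le s\sqrt{d/n}\}$; $$\delta_3^*(s)=\sup_{\theta\in\mathcal U^*(s),\,u\neq0}\frac{\frac1n\sum_{i=1}^n\langle\nabla^3\psi(X_i^\top\theta),(X_i^\top u)^{\otimes3}\rangle}{\big(\frac1n\sum_{i=1}^n\langle\nabla^2\psi(X_i^\top\theta^* ),(X_i^\top u)^{\otimes2}\rangle\big)^{3/2}};$$ $\delta_{01}^*(s)=\sup_{\theta\in\mathcal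 U^*(s)}\|\nabla\log\pi_0(\theta)\|_{F^*}$, with $\delta_{01}^*(s)=\infty$ if $\pi_0$ is not $C^1$ or not strictly positive on $\mathcal U^*(s)$; $M_0^*=d^{-1}\log\sup_{\theta\in\Theta}\pi_0(\theta)/\pi_0(\theta^* )$. *)

theory Defs
  imports
    "HOL-Probability.Probability"
    "Jordan_Normal_Form.Determinant"
    "Jordan_Normal_Form.Gauss_Jordan_Elimination"
    "Jordan_Normal_Form.VS_Connect"
begin

(* The constant in the theorem must not depend on the dimensions d and k, so these are
   quantified natural numbers: R^d is carrier_vec d and matrices are those of
   Jordan_Normal_Form. Symbols that HOL-Analysis shares with it refer to the latter below. *)

unbundle no inner_syntax
unbundle no vec_syntax

section \<open>Euclidean space of variable dimension\<close>

definition vnorm :: "real Matrix.vec \<Rightarrow> real" where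
  "vnorm u = sqrt (u \<bullet> u)"

(* Equal to vnorm (x - y) on carrier_vec d. Written with coordinates because Metric_space
   demands symmetry for all x and y of the type, also those of different dimensions. *)
definition vdist :: "nat \<Rightarrow> real Matrix.vec \<Rightarrow> real Matrix.vec \<Rightarrow> real" where
  "vdist d x y = L2_set (\<lambda>i. x $ i - y $ i) {..<d}"

lemma Metric_space_vdist: "Metric_space (carrier_vec d) (vdist d)"
proof
  fix x y z :: "real Matrix.vec"
  show "0 \<le> vdist d x y" by (simp add: vdist_def)
  show "vdist d x y = vdist d y x"
    by (simp add: vdist_def L2_set_def power2_commute)
  show "vdist d x y = 0 \<longleftrightarrow> x = y" if "x \<in> carrier_vec d" "y \<in> carrier_vec d"
    using that by (auto simp: vdist_def L2_set_eq_0_iff)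
  show "vdist d x z \<le> vdist d x y + vdist d y z"
    using L2_set_triangle_ineq[of "\<lambda>i. x $ i - y $ i" "\<lambda>i. y $ i - z $ i" "{..<d}"]
    by (simp add: vdist_def)
qed

lemma vdist_eq: "x \<in> carrier_vec d \<Longrightarrow> y \<in> carrier_vec d \<Longrightarrow> vdist d x y = vnorm (x - y)"
  by (simp add: vdist_def vnorm_def L2_set_def scalar_prod_def power2_eq_square lessThan_atLeast0)

definition vec_topology :: "nat \<Rightarrow> real Matrix.vec topology" where
  "vec_topology d = Metric_space.mtopology (carrier_vec d) (vdist d)"

(* Lebesgue measure on R^d; its sigma-algebra is the Borel one. *)
definition lborel_vec :: "nat \<Rightarrow> real Matrix.vec measure" where
  "lborel_vec d = embed_measure (\<Pi>\<^sub>M i\<in>{..<d}. lborel) (Matrix.vec d)"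

lemma space_lborel_vec: "space (lborel_vec d) = carrier_vec d"
proof -
  have "v \<in> Matrix.vec d ` (\<Pi>\<^sub>E i\<in>{..<d}. UNIV)" if "v \<in> carrier_vec d" for v :: "real Matrix.vec"
    using that by (intro image_eqI[where x = "\<lambda>i\<in>{..<d}. v $ i"]) auto
  then show ?thesis
    by (auto simp: lborel_vec_def space_embed_measure space_PiM)
qed

definition affine_vec :: "nat \<Rightarrow> real Matrix.vec set \<Rightarrow> bool" where
  "affine_vec d A \<longleftrightarrow> A \<subseteq> carrier_vec d \<and>
     (\<forall>x\<in>A. \<forall>y\<in>A. \<forall>u v. u + v = 1 \<longrightarrow> u \<cdot>\<^sub>v x + v \<cdot>\<^sub>v y \<in> A)"

definition partial :: "nat \<Rightarrow> (real Matrix.vec \<Rightarrow> real) \<Rightarrow> real Matrix.vec \<Rightarrow> real" where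
  "partial j f x = deriv (\<lambda>t. f (x + t \<cdot>\<^sub>v unit_vec (dim_vec x) j)) 0"

definition gradient :: "(real Matrix.vec \<Rightarrow> real) \<Rightarrow> real Matrix.vec \<Rightarrow> real Matrix.vec" where
  "gradient f x = Matrix.vec (dim_vec x) (\<lambda>j. partial j f x)"

definition hessian :: "(real Matrix.vec \<Rightarrow> real) \<Rightarrow> real Matrix.vec \<Rightarrow> real Matrix.mat" where
  "hessian f x = Matrix.mat (dim_vec x) (dim_vec x) (\<lambda>(a, b). partial a (partial b f) x)"

(* hessian_form f x v is <D^2 f(x), v (x) v>; third_form f x v is <D^3 f(x), v (x) v (x) v>. *)
definition hessian_form :: "(real Matrix.vec \<Rightarrow> real) \<Rightarrow> real Matrix.vec \<Rightarrow> real Matrix.vec \<Rightarrow> real" where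
  "hessian_form f x v =
     (\<Sum>a<dim_vec x. \<Sum>b<dim_vec x. partial a (partial b f) x * (v $ a * v $ b))"

definition third_form :: "(real Matrix.vec \<Rightarrow> real) \<Rightarrow> real Matrix.vec \<Rightarrow> real Matrix.vec \<Rightarrow> real" where
  "third_form f x v =
     (\<Sum>a<dim_vec x. \<Sum>b<dim_vec x. \<Sum>c<dim_vec x.
        partial a (partial b (partial c f)) x * (v $ a * v $ b * v $ c))"

(* S need not be open: the partial derivatives are those of f itself (two-sided, also at
   boundary points of S), and their restrictions to S are required to be continuous. *)
definition C1_on :: "nat \<Rightarrow> real Matrix.vec set \<Rightarrow> (real Matrix.vec \<Rightarrow> real) \<Rightarrow> bool" where
  "C1_on d S f \<longleftrightarrow> (\<forall>j<d.
     (\<forall>x\<in>S. (\<lambda>t. f (x + t \<cdot>\<^sub>v unit_vec d j)) differentiable (at 0)) \<and>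
     continuous_map (subtopology (vec_topology d) S) euclideanreal (partial j f))"

definition pos_def_mat :: "nat \<Rightarrow> real Matrix.mat \<Rightarrow> bool" where
  "pos_def_mat d A \<longleftrightarrow> A \<in> carrier_mat d d \<and> transpose_mat A = A \<and>
     (\<forall>u\<in>carrier_vec d. u \<noteq> 0\<^sub>v d \<longrightarrow> u \<bullet> (A *\<^sub>v u) > 0)"

(* The unique positive definite square root of a positive definite matrix. *)
definition mat_sqrt :: "real Matrix.mat \<Rightarrow> real Matrix.mat" where
  "mat_sqrt A = (THE B. pos_def_mat (dim_row A) B \<and> B * B = A)"

definition mat_inv :: "real Matrix.mat \<Rightarrow> real Matrix.mat" where
  "mat_inv A = the (mat_inverse A)"

definition norm_wrt :: "real Matrix.mat \<Rightarrow> real Matrix.vec \<Rightarrow> real" where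
  "norm_wrt A u = vnorm (mat_sqrt A *\<^sub>v u)"

definition dual_norm_wrt :: "real Matrix.mat \<Rightarrow> real Matrix.vec \<Rightarrow> real" where
  "dual_norm_wrt A S = vnorm (mat_inv (mat_sqrt A) *\<^sub>v S)"

definition gaussian :: "nat \<Rightarrow> real Matrix.vec \<Rightarrow> real Matrix.mat \<Rightarrow> real Matrix.vec measure" where
  "gaussian d m \<Sigma> = density (lborel_vec d) (\<lambda>x. ennreal
     (exp (- ((x - m) \<bullet> (mat_inv \<Sigma> *\<^sub>v (x - m))) / 2) / sqrt ((2 * pi) ^ d * Determinant.det \<Sigma>)))"

definition TV :: "'a measure \<Rightarrow> 'a measure \<Rightarrow> ereal" where
  "TV P Q = (SUP B\<in>sets P. ereal \<bar>measure P B - measure Q B\<bar>)"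

definition exp_ereal :: "ereal \<Rightarrow> ereal" where
  "exp_ereal x = (case x of ereal r \<Rightarrow> ereal (exp r) | PInfty \<Rightarrow> \<infinity> | MInfty \<Rightarrow> 0)"

(* Only used for arguments greater than 0. *)
definition ln_ereal :: "ereal \<Rightarrow> ereal" where
  "ln_ereal x = (case x of ereal r \<Rightarrow> ereal (ln r) | PInfty \<Rightarrow> \<infinity> | MInfty \<Rightarrow> -\<infinity>)"

section \<open>The generalized linear model\<close>

definition log_partition :: "real Matrix.vec measure \<Rightarrow> real Matrix.vec \<Rightarrow> real" where
  "log_partition \<mu> \<omega> = ln (\<integral>y. exp (\<omega> \<bullet> y) \<partial>\<mu>)"

definition natural_params :: "nat \<Rightarrow> real Matrix.vec measure \<Rightarrow> real Matrix.vec set" where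
  "natural_params k \<mu> = {\<omega> \<in> carrier_vec k. (\<integral>\<^sup>+y. ennreal (exp (\<omega> \<bullet> y)) \<partial>\<mu>) < \<infinity>}"

(* mu is a Borel measure on YY. Fullness is built in, since natural_params is the parameter
   space; the other two conditions are regularity and minimality. *)
definition regular_minimal_family ::
  "nat \<Rightarrow> real Matrix.vec set \<Rightarrow> real Matrix.vec measure \<Rightarrow> bool" where
  "regular_minimal_family k YY \<mu> \<longleftrightarrow>
     YY \<subseteq> carrier_vec k \<and>
     sets \<mu> = sets (restrict_space (lborel_vec k) YY) \<and>
     openin (vec_topology k) (natural_params k \<mu>) \<and>
     \<not> (\<exists>A. affine_vec k A \<and> A \<noteq> carrier_vec k \<and> (AE y in \<mu>. y \<in> A))"

definition expfam :: "real Matrix.vec measure \<Rightarrow> real Matrix.vec \<Rightarrow> real Matrix.vec measure" where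
  "expfam \<mu> \<omega> = density \<mu> (\<lambda>y. ennreal (exp (\<omega> \<bullet> y - log_partition \<mu> \<omega>)))"

(* Below, n is the sample size, X i (i < n) are the d x k design matrices, th0 is the ground
   truth and p0 the prior density. *)

definition param_space ::
  "nat \<Rightarrow> nat \<Rightarrow> nat \<Rightarrow> real Matrix.vec measure \<Rightarrow> (nat \<Rightarrow> real Matrix.mat) \<Rightarrow> real Matrix.vec set" where
  "param_space d k n \<mu> X =
     {\<theta> \<in> carrier_vec d. \<forall>i<n. transpose_mat (X i) *\<^sub>v \<theta> \<in> natural_params k \<mu>}"

(* The joint law of the independent observations Y i, i < n. *)
definition sample_law ::
  "nat \<Rightarrow> real Matrix.vec measure \<Rightarrow> (nat \<Rightarrow> real Matrix.mat) \<Rightarrow> real Matrix.vec \<Rightarrow>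
   (nat \<Rightarrow> real Matrix.vec) measure" where
  "sample_law n \<mu> X th0 = (\<Pi>\<^sub>M i\<in>{..<n}. expfam \<mu> (transpose_mat (X i) *\<^sub>v th0))"

definition nll ::
  "nat \<Rightarrow> real Matrix.vec measure \<Rightarrow> (nat \<Rightarrow> real Matrix.mat) \<Rightarrow> (nat \<Rightarrow> real Matrix.vec) \<Rightarrow>
   real Matrix.vec \<Rightarrow> real" where
  "nll n \<mu> X Y \<theta> = (\<Sum>i<n. log_partition \<mu> (transpose_mat (X i) *\<^sub>v \<theta>)
     - Y i \<bullet> (transpose_mat (X i) *\<^sub>v \<theta>)) / real n"

definition MLE_unique ::
  "nat \<Rightarrow> nat \<Rightarrow> nat \<Rightarrow> real Matrix.vec measure \<Rightarrow> (nat \<Rightarrow> real Matrix.mat) \<Rightarrow>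
   (nat \<Rightarrow> real Matrix.vec) \<Rightarrow> bool" where
  "MLE_unique d k n \<mu> X Y \<longleftrightarrow>
     (\<exists>!\<theta>. is_arg_min (nll n \<mu> X Y) (\<lambda>\<theta>. \<theta> \<in> param_space d k n \<mu> X) \<theta>)"

definition MLE ::
  "nat \<Rightarrow> nat \<Rightarrow> nat \<Rightarrow> real Matrix.vec measure \<Rightarrow> (nat \<Rightarrow> real Matrix.mat) \<Rightarrow>
   (nat \<Rightarrow> real Matrix.vec) \<Rightarrow> real Matrix.vec" where
  "MLE d k n \<mu> X Y = arg_min (nll n \<mu> X Y) (\<lambda>\<theta>. \<theta> \<in> param_space d k n \<mu> X)"

definition fisher ::
  "nat \<Rightarrow> nat \<Rightarrow> real Matrix.vec measure \<Rightarrow> (nat \<Rightarrow> real Matrix.mat) \<Rightarrow> real Matrix.vec \<Rightarrow>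
   real Matrix.mat" where
  "fisher d n \<mu> X th0 = Matrix.mat d d (\<lambda>(a, b). (\<Sum>i<n.
     (X i * hessian (log_partition \<mu>) (transpose_mat (X i) *\<^sub>v th0) * transpose_mat (X i)) $$ (a, b))
     / real n)"

definition prior_density :: "nat \<Rightarrow> (real Matrix.vec \<Rightarrow> real) \<Rightarrow> bool" where
  "prior_density d p0 \<longleftrightarrow> p0 \<in> borel_measurable (lborel_vec d) \<and>
     (\<forall>\<theta>\<in>carrier_vec d. p0 \<theta> \<ge> 0) \<and> (\<integral>\<^sup>+\<theta>. ennreal (p0 \<theta>) \<partial>lborel_vec d) = 1"

(* Extended by zero from param_space to a measure on all of R^d. *)
definition posterior ::
  "nat \<Rightarrow> nat \<Rightarrow> nat \<Rightarrow> real Matrix.vec measure \<Rightarrow> (nat \<Rightarrow> real Matrix.mat) \<Rightarrow>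
   (real Matrix.vec \<Rightarrow> real) \<Rightarrow> (nat \<Rightarrow> real Matrix.vec) \<Rightarrow> real Matrix.vec measure" where
  "posterior d k n \<mu> X p0 Y =
     (let w = (\<lambda>\<theta>. ennreal (indicator (param_space d k n \<mu> X) \<theta>
                * (exp (- real n * nll n \<mu> X Y \<theta>) * p0 \<theta>)))
      in density (lborel_vec d) (\<lambda>\<theta>. w \<theta> / (\<integral>\<^sup>+\<theta>'. w \<theta>' \<partial>lborel_vec d)))"

definition laplace_gaussian ::
  "nat \<Rightarrow> nat \<Rightarrow> nat \<Rightarrow> real Matrix.vec measure \<Rightarrow> (nat \<Rightarrow> real Matrix.mat) \<Rightarrow> real Matrix.vec \<Rightarrow>
   (nat \<Rightarrow> real Matrix.vec) \<Rightarrow> real Matrix.vec measure" where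
  "laplace_gaussian d k n \<mu> X th0 Y =
     gaussian d (MLE d k n \<mu> X Y) (mat_inv (real n \<cdot>\<^sub>m fisher d n \<mu> X th0))"

definition nbhd ::
  "nat \<Rightarrow> nat \<Rightarrow> real Matrix.vec measure \<Rightarrow> (nat \<Rightarrow> real Matrix.mat) \<Rightarrow> real Matrix.vec \<Rightarrow> real \<Rightarrow>
   real Matrix.vec set" where
  "nbhd d n \<mu> X th0 s = {\<theta> \<in> carrier_vec d.
     norm_wrt (fisher d n \<mu> X th0) (\<theta> - th0) \<le> s * sqrt (real d / real n)}"

definition delta3 ::
  "nat \<Rightarrow> nat \<Rightarrow> real Matrix.vec measure \<Rightarrow> (nat \<Rightarrow> real Matrix.mat) \<Rightarrow> real Matrix.vec \<Rightarrow> real \<Rightarrow> ereal"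
  where
  "delta3 d n \<mu> X th0 s =
     (SUP (\<theta>, u) \<in> nbhd d n \<mu> X th0 s \<times> (carrier_vec d - {0\<^sub>v d}). ereal
        (((\<Sum>i<n. third_form (log_partition \<mu>) (transpose_mat (X i) *\<^sub>v \<theta>)
                    (transpose_mat (X i) *\<^sub>v u)) / real n)
         / ((\<Sum>i<n. hessian_form (log_partition \<mu>) (transpose_mat (X i) *\<^sub>v th0)
                    (transpose_mat (X i) *\<^sub>v u)) / real n) powr (3 / 2)))"

definition delta01 ::
  "nat \<Rightarrow> nat \<Rightarrow> real Matrix.vec measure \<Rightarrow> (nat \<Rightarrow> real Matrix.mat) \<Rightarrow> real Matrix.vec \<Rightarrow>
   (real Matrix.vec \<Rightarrow> real) \<Rightarrow> real \<Rightarrow> ereal" where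
  "delta01 d n \<mu> X th0 p0 s =
     (if C1_on d (nbhd d n \<mu> X th0 s) p0 \<and> (\<forall>\<theta>\<in>nbhd d n \<mu> X th0 s. p0 \<theta> > 0)
      then SUP \<theta>\<in>nbhd d n \<mu> X th0 s.
             ereal (dual_norm_wrt (fisher d n \<mu> X th0) (gradient (\<lambda>\<theta>. ln (p0 \<theta>)) \<theta>))
      else \<infinity>)"

definition M0 ::
  "nat \<Rightarrow> nat \<Rightarrow> nat \<Rightarrow> real Matrix.vec measure \<Rightarrow> (nat \<Rightarrow> real Matrix.mat) \<Rightarrow> real Matrix.vec \<Rightarrow>
   (real Matrix.vec \<Rightarrow> real) \<Rightarrow> ereal" where
  "M0 d k n \<mu> X th0 p0 =
     ln_ereal (SUP \<theta>\<in>param_space d k n \<mu> X. ereal (p0 \<theta> / p0 th0)) / ereal (real d)"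

(* The columns of X 0, ..., X (n-1) jointly span R^d. *)
definition columns_span :: "nat \<Rightarrow> nat \<Rightarrow> (nat \<Rightarrow> real Matrix.mat) \<Rightarrow> bool" where
  "columns_span d n X \<longleftrightarrow>
     LinearCombinations.module.span class_ring (module_vec TYPE(real) d) (\<Union>i<n. set (cols (X i)))
       = carrier_vec d"

end

theory Submission
  imports Defs
begin

text \<open>In coordinates z that whiten the matrix n F* and put th0 at the origin, n times the negative
  log likelihood is a convex potential V whose Hessian is the identity at 0 and, by the bound on
  delta3, stays within a constant factor of the identity for |z| up to 2 s sqrt d.
  Hence the score grad V 0 has a Gaussian moment generating function there. Averaging Chernoff's
  bound over a truncated Gaussian tilt gives |grad V 0| \<le> (7/10) s sqrt d with the stated probability.
  On this event the gradient step z - grad V z is a contraction, so V has a critical point zh near 0;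
  by convexity it is the unique minimiser and V grows at least linearly away from it, which makes the
  posterior mass far from zh at most of the order of exp (d (M0 - (s/12)^2)).
  Near zh the posterior is exp h times the Gaussian, with |grad h x| \<le> eta (1 + |x| / sqrt d) and
  eta of the order of delta01 / sqrt n + s delta3 d / sqrt n. An L1 Poincare inequality with a
  dimension-free constant (Maurey and Pisier) bounds the total variation distance to the Gaussian by
  the weighted mean of |grad h|, and the moment of |x| / sqrt d under the tilted Gaussian is bounded
  by comparing it with dilated copies.\<close>

section \<open>Gaussian integrals on a translation-invariant measure space\<close>

text \<open>In units of s sqrt d the radii fit together as follows. The Hessian is controlled up to
  2. A score of at most 7/10 keeps zh within 4/5, so the ball of radius 1 around zh stays inside.
  The arcs of the Maurey-Pisier argument join points within 7/10 < 1 / sqrt 2 of zh and never leave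
  that ball; what lies beyond 7/10 is left to the linear growth of V. The moment generating function
  is bounded only where V is controlled, hence the truncation of the tilt. The log-ratio h may be of
  size sqrt d at typical points, so its exponential admits no dimension-free bound; the main terms
  are therefore estimated relative to the perturbed mass itself. The condition s \<ge> 12 pays for
  the volume factors, for the guaranteed mass exp (- sqrt d) and for Chernoff's prefactor. Smallness
  of eta is no loss, since total variation is at most 1. The dimension is a variable, so all R^d
  live inside one space of finitely supported sequences. Whitening uses a triangular factor of n F*
  because Lebesgue measure transforms under triangular maps one coordinate at a time.\<close>

lemma FTC_nn_integral:
  fixes F D :: "real \<Rightarrow> real"
  assumes "a \<le> b"
    and deriv: "\<And>t. t \<in> {a..b} \<Longrightarrow> (F has_vector_derivative D t) (at t within {a..b})"
    and [measurable]: "D \<in> borel_measurable borel"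
    and bound: "\<And>t. t \<in> {a..b} \<Longrightarrow> \<bar>D t\<bar> \<le> B"
  shows "ennreal \<bar>F b - F a\<bar> \<le> (\<integral>\<^sup>+t. ennreal \<bar>D t\<bar> * indicator {a..b} t \<partial>lborel)"
proof -
  \<comment> \<open>\<open>D\<close> is assumed bounded and measurable but not continuous: the gauge
    integral gives the increment of \<open>F\<close>, and boundedness identifies it with the
    Lebesgue integral.\<close>
  have "(D has_integral (F b - F a)) {a..b}"
    using fundamental_theorem_of_calculus[OF assms(1) deriv] by simp
  moreover have int: "set_integrable lborel {a..b} D"
    unfolding set_integrable_def
  proof (rule integrableI_bounded_set[where A = "{a..b}" and B = B])
    show "AE x in lborel. x \<in> {a..b} \<longrightarrow> norm (indicat_real {a..b} x *\<^sub>R D x) \<le> B"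
      using bound by (auto simp: indicator_def)
  qed (auto simp: emeasure_lborel_Icc_eq)
  ultimately have "F b - F a = (LINT t:{a..b}|lborel. D t)"
    using set_borel_integral_eq_integral(2)[OF int] by (metis integral_unique)
  also have "\<bar>\<dots>\<bar> \<le> (\<integral>t. \<bar>indicator {a..b} t *\<^sub>R D t\<bar> \<partial>lborel)"
    unfolding set_lebesgue_integral_def by (rule integral_abs_bound)
  finally have "ennreal \<bar>F b - F a\<bar> \<le> ennreal (\<integral>t. \<bar>indicator {a..b} t *\<^sub>R D t\<bar> \<partial>lborel)"
    by (rule ennreal_leI)
  also have "\<dots> = (\<integral>\<^sup>+t. ennreal \<bar>indicator {a..b} t *\<^sub>R D t\<bar> \<partial>lborel)"
    using int unfolding set_integrable_def
    by (intro nn_integral_eq_integral[symmetric]) auto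
  also have "\<dots> = (\<integral>\<^sup>+t. ennreal \<bar>D t\<bar> * indicator {a..b} t \<partial>lborel)"
    by (intro nn_integral_cong) (auto simp: indicator_def)
  finally show ?thesis .
qed

text \<open>Lebesgue measure on a space of dimension \<open>d\<close>, seen only through its
  invariances. The dimension is a number that enters through \<open>scaling\<close>, not a property
  of the type \<open>'a\<close>, which may be infinite-dimensional; so the estimates hold with
  constants uniform in \<open>d\<close>. The measurability of the vector operations is assumed
  because \<open>sets M\<close> is not tied to the topology of \<open>'a\<close>. \<open>Z\<close>
  is the total Gaussian mass.\<close>

locale translation_invariant_space =
  fixes M :: "'a::real_inner measure" and d :: nat and Z :: real
  assumes sigma_finite: "sigma_finite_measure M"
    and subspace_space: "Real_Vector_Spaces.subspace (space M)"
    and dim_pos: "d \<ge> 1"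
    and measurable_add: "(\<lambda>(x, y). x + y) \<in> M \<Otimes>\<^sub>M M \<rightarrow>\<^sub>M M"
    and measurable_scale: "(\<lambda>(c, x). c *\<^sub>R x) \<in> borel \<Otimes>\<^sub>M M \<rightarrow>\<^sub>M M"
    and measurable_inner: "(\<lambda>(x, y). inner x y) \<in> M \<Otimes>\<^sub>M M \<rightarrow>\<^sub>M (borel :: real measure)"
    and translation: "\<And>f a. f \<in> borel_measurable M \<Longrightarrow> a \<in> space M \<Longrightarrow>
      (\<integral>\<^sup>+x. f (x + a) \<partial>M) = (\<integral>\<^sup>+x. f x \<partial>M)"
    and scaling: "\<And>f c. f \<in> borel_measurable M \<Longrightarrow> c > 0 \<Longrightarrow>
      (\<integral>\<^sup>+x. f (c *\<^sub>R x) \<partial>M) = ennreal (1 / c ^ d) * (\<integral>\<^sup>+x. f x \<partial>M)"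
    and reflection: "\<And>f. f \<in> borel_measurable M \<Longrightarrow> (\<integral>\<^sup>+x. f (- x) \<partial>M) = (\<integral>\<^sup>+x. f x \<partial>M)"
    and gaussian_integral: "(\<integral>\<^sup>+x. ennreal (exp (- (norm x)\<^sup>2 / 2)) \<partial>M) = ennreal Z"
    and Z_pos: "Z > 0"
begin

sublocale sigma_finite_measure M by (rule sigma_finite)

sublocale MM: pair_sigma_finite M M ..

abbreviation S :: "'a set" where "S \<equiv> space M"

lemma S_intros [simp, intro]:
  "0 \<in> S" "x \<in> S \<Longrightarrow> y \<in> S \<Longrightarrow> x + y \<in> S" "x \<in> S \<Longrightarrow> y \<in> S \<Longrightarrow> x - y \<in> S"
  "x \<in> S \<Longrightarrow> c *\<^sub>R x \<in> S" "x \<in> S \<Longrightarrow> - x \<in> S"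
  using subspace_space
  by (simp_all add: subspace_0 subspace_add subspace_diff subspace_mul subspace_neg)

lemma measurable_add' [measurable (raw)]:
  "f \<in> N \<rightarrow>\<^sub>M M \<Longrightarrow> g \<in> N \<rightarrow>\<^sub>M M \<Longrightarrow> (\<lambda>x. f x + g x) \<in> N \<rightarrow>\<^sub>M M"
  using measurable_compose[OF measurable_Pair measurable_add, of f N g] by simp

lemma measurable_scale' [measurable (raw)]:
  "f \<in> borel_measurable N \<Longrightarrow> g \<in> N \<rightarrow>\<^sub>M M \<Longrightarrow> (\<lambda>x. f x *\<^sub>R g x) \<in> N \<rightarrow>\<^sub>M M"
  using measurable_compose[OF measurable_Pair measurable_scale, of f N g] by simp

lemma measurable_inner' [measurable (raw)]:
  "f \<in> N \<rightarrow>\<^sub>M M \<Longrightarrow> g \<in> N \<rightarrow>\<^sub>M M \<Longrightarrow> (\<lambda>x. inner (f x) (g x)) \<in> borel_measurable N"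
  using measurable_compose[OF measurable_Pair measurable_inner, of f N g] by simp

lemma measurable_norm' [measurable (raw)]:
  assumes [measurable]: "f \<in> N \<rightarrow>\<^sub>M M"
  shows "(\<lambda>x. norm (f x)) \<in> borel_measurable N"
  unfolding norm_eq_sqrt_inner by measurable

lemma measurable_diff' [measurable (raw)]:
  assumes [measurable]: "f \<in> N \<rightarrow>\<^sub>M M" "g \<in> N \<rightarrow>\<^sub>M M"
  shows "(\<lambda>x. f x - g x) \<in> N \<rightarrow>\<^sub>M M"
proof -
  have "(\<lambda>x. f x + (-1) *\<^sub>R g x) \<in> N \<rightarrow>\<^sub>M M" by measurable
  then show ?thesis by simp
qed

definition w :: "'a \<Rightarrow> real" where "w x = exp (- (norm x)\<^sup>2 / 2)"

lemma w_measurable [measurable]: "w \<in> borel_measurable M"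
  unfolding w_def by measurable

lemma w_pos [simp]: "w x > 0" and w_nonneg [simp]: "w x \<ge> 0"
  by (simp_all add: w_def)

lemma integral_w: "(\<integral>\<^sup>+x. ennreal (w x) \<partial>M) = ennreal Z"
  using gaussian_integral by (simp add: w_def)

text \<open>With the second component frozen a shear is a translation, so Tonelli's theorem reduces
  it to \<open>translation\<close>. Shears are the building blocks of the rotations below.\<close>

lemma shear_fst:
  assumes f [measurable]: "f \<in> borel_measurable (M \<Otimes>\<^sub>M M)"
  shows "(\<integral>\<^sup>+p. f (fst p + c *\<^sub>R snd p, snd p) \<partial>(M \<Otimes>\<^sub>M M)) = (\<integral>\<^sup>+p. f p \<partial>(M \<Otimes>\<^sub>M M))"
proof -
  have "(\<integral>\<^sup>+p. f (fst p + c *\<^sub>R snd p, snd p) \<partial>(M \<Otimes>\<^sub>M M))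
      = (\<integral>\<^sup>+y. \<integral>\<^sup>+x. f (x + c *\<^sub>R y, y) \<partial>M \<partial>M)"
    by (subst MM.nn_integral_snd[symmetric]) auto
  also have "\<dots> = (\<integral>\<^sup>+y. \<integral>\<^sup>+x. f (x, y) \<partial>M \<partial>M)"
    by (intro nn_integral_cong translation) auto
  also have "\<dots> = (\<integral>\<^sup>+p. f p \<partial>(M \<Otimes>\<^sub>M M))"
    by (rule MM.nn_integral_snd) auto
  finally show ?thesis .
qed

lemma shear_snd:
  assumes f [measurable]: "f \<in> borel_measurable (M \<Otimes>\<^sub>M M)"
  shows "(\<integral>\<^sup>+p. f (fst p, snd p + c *\<^sub>R fst p) \<partial>(M \<Otimes>\<^sub>M M)) = (\<integral>\<^sup>+p. f p \<partial>(M \<Otimes>\<^sub>M M))"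
proof -
  have "(\<integral>\<^sup>+p. f (fst p, snd p + c *\<^sub>R fst p) \<partial>(M \<Otimes>\<^sub>M M))
      = (\<integral>\<^sup>+x. \<integral>\<^sup>+y. f (x, y + c *\<^sub>R x) \<partial>M \<partial>M)"
    by (subst nn_integral_fst[symmetric]) auto
  also have "\<dots> = (\<integral>\<^sup>+x. \<integral>\<^sup>+y. f (x, y) \<partial>M \<partial>M)"
    by (intro nn_integral_cong translation) auto
  also have "\<dots> = (\<integral>\<^sup>+p. f p \<partial>(M \<Otimes>\<^sub>M M))"
    by (rule nn_integral_fst) auto
  finally show ?thesis .
qed

text \<open>A plane rotation is a product of three shears.\<close>

lemma rotation_invariance:
  assumes f [measurable]: "f \<in> borel_measurable (M \<Otimes>\<^sub>M M)"
    and cs: "c\<^sup>2 + s\<^sup>2 = 1" and c: "c \<ge> 0"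
  shows "(\<integral>\<^sup>+p. f (c *\<^sub>R fst p + s *\<^sub>R snd p, c *\<^sub>R snd p - s *\<^sub>R fst p) \<partial>(M \<Otimes>\<^sub>M M))
    = (\<integral>\<^sup>+p. f p \<partial>(M \<Otimes>\<^sub>M M))"
proof -
  \<comment> \<open>\<open>a\<close> is the tangent of half the rotation angle;
    \<open>c \<ge> 0\<close> keeps the denominator away from 0. The rotation is the shear by
    \<open>a\<close>, then by \<open>- s\<close>, then by \<open>a\<close> again.\<close>
  define a where "a = s / (1 + c)"
  have as: "1 - a * s = c"
  proof -
    have "s * s = (1 - c) * (1 + c)" using cs by (simp add: power2_eq_square algebra_simps)
    then show ?thesis using c by (simp add: a_def field_simps)
  qed
  have as2: "a * (1 + c) = s" using c by (simp add: a_def)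
  define f1 where "f1 = (\<lambda>p. f (fst p + a *\<^sub>R snd p, snd p))"
  define f2 where "f2 = (\<lambda>p. f1 (fst p, snd p + (- s) *\<^sub>R fst p))"
  have f1 [measurable]: "f1 \<in> borel_measurable (M \<Otimes>\<^sub>M M)" unfolding f1_def by measurable
  have f2 [measurable]: "f2 \<in> borel_measurable (M \<Otimes>\<^sub>M M)" unfolding f2_def by measurable
  have "f (c *\<^sub>R x + s *\<^sub>R y, c *\<^sub>R y - s *\<^sub>R x) = f2 (x + a *\<^sub>R y, y)" for x y
  proof -
    have e: "y + (- s) *\<^sub>R (x + a *\<^sub>R y) = c *\<^sub>R y - s *\<^sub>R x"
      unfolding as[symmetric] by (simp add: algebra_simps)
    have "x + a *\<^sub>R y + a *\<^sub>R (c *\<^sub>R y - s *\<^sub>R x) = (1 - a * s) *\<^sub>R x + (a * (1 + c)) *\<^sub>R y"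
      by (simp add: algebra_simps)
    then have "x + a *\<^sub>R y + a *\<^sub>R (c *\<^sub>R y - s *\<^sub>R x) = c *\<^sub>R x + s *\<^sub>R y"
      unfolding as as2 .
    with e show ?thesis by (simp add: f2_def f1_def)
  qed
  then have "(\<integral>\<^sup>+p. f (c *\<^sub>R fst p + s *\<^sub>R snd p, c *\<^sub>R snd p - s *\<^sub>R fst p) \<partial>(M \<Otimes>\<^sub>M M))
    = (\<integral>\<^sup>+p. f2 (fst p + a *\<^sub>R snd p, snd p) \<partial>(M \<Otimes>\<^sub>M M))" by simp
  also have "\<dots> = (\<integral>\<^sup>+p. f2 p \<partial>(M \<Otimes>\<^sub>M M))" by (rule shear_fst[OF f2])
  also have "\<dots> = (\<integral>\<^sup>+p. f1 p \<partial>(M \<Otimes>\<^sub>M M))" unfolding f2_def by (rule shear_snd[OF f1])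
  also have "\<dots> = (\<integral>\<^sup>+p. f p \<partial>(M \<Otimes>\<^sub>M M))" unfolding f1_def by (rule shear_fst[OF f])
  finally show ?thesis .
qed

section \<open>Gaussian integrals of linear functionals and the L1 Poincare inequality\<close>

lemma norm_rotation:
  assumes "c\<^sup>2 + s\<^sup>2 = (1::real)"
  shows "(norm (c *\<^sub>R x + s *\<^sub>R y))\<^sup>2 + (norm (c *\<^sub>R y - s *\<^sub>R x))\<^sup>2 = (norm x)\<^sup>2 + (norm (y :: 'a))\<^sup>2"
proof -
  have "(norm (c *\<^sub>R x + s *\<^sub>R y))\<^sup>2 + (norm (c *\<^sub>R y - s *\<^sub>R x))\<^sup>2
      = (c\<^sup>2 + s\<^sup>2) * ((norm x)\<^sup>2 + (norm y)\<^sup>2)"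
    unfolding power2_norm_eq_inner
    by (simp add: inner_add_left inner_add_right inner_diff_left inner_diff_right
        inner_commute power2_eq_square algebra_simps)
  then show ?thesis using assms by simp
qed

text \<open>Completing the square turns the integrand into a translate of \<open>w\<close>. This is
  the Gaussian moment generating function.\<close>

lemma exp_inner_integral:
  assumes "u \<in> S"
  shows "(\<integral>\<^sup>+y. ennreal (exp (inner u y) * w y) \<partial>M) = ennreal (exp ((norm u)\<^sup>2 / 2) * Z)"
proof -
  have "exp (inner u y) * w y = exp ((norm u)\<^sup>2 / 2) * w (y + - u)" for y
  proof -
    have "inner u y - (norm y)\<^sup>2 / 2 = (norm u)\<^sup>2 / 2 - (norm (y + - u))\<^sup>2 / 2"
      unfolding power2_norm_eq_inner
      by (simp add: inner_diff_left inner_diff_right inner_commute field_simps)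
    then show ?thesis unfolding w_def by (simp flip: exp_add)
  qed
  then have "(\<integral>\<^sup>+y. ennreal (exp (inner u y) * w y) \<partial>M)
      = (\<integral>\<^sup>+y. ennreal (exp ((norm u)\<^sup>2 / 2)) * ennreal (w (y + - u)) \<partial>M)"
    by (simp add: ennreal_mult)
  also have "\<dots> = ennreal (exp ((norm u)\<^sup>2 / 2)) * (\<integral>\<^sup>+y. ennreal (w (y + - u)) \<partial>M)"
    using assms by (intro nn_integral_cmult) auto
  also have "(\<integral>\<^sup>+y. ennreal (w (y + - u)) \<partial>M) = (\<integral>\<^sup>+y. ennreal (w y) \<partial>M)"
    using assms by (intro translation) auto
  finally show ?thesis using Z_pos by (simp add: integral_w ennreal_mult)
qed

text \<open>A crude form of the Gaussian mean \<open>sqrt (2 / pi) * norm g\<close>, from |x| \<le>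
  exp x + exp (- x) along the unit vector of \<open>g\<close>. What matters is that the constant is
  free of the dimension.\<close>

lemma abs_inner_integral:
  assumes g: "g \<in> S"
  shows "(\<integral>\<^sup>+y. ennreal (\<bar>inner g y\<bar> * w y) \<partial>M) \<le> ennreal (2 * exp (1 / 2) * Z * norm g)"
proof (cases "g = 0")
  case False
  define u where "u = (1 / norm g) *\<^sub>R g"
  have u: "u \<in> S" "norm u = 1" "- u \<in> S" using g False by (auto simp: u_def)
  have "\<bar>inner g y\<bar> * w y \<le> norm g * (exp (inner u y) * w y + exp (inner (- u) y) * w y)" for y
  proof -
    have g_eq: "inner g y = norm g * inner u y" using False by (simp add: u_def)
    have "\<bar>inner u y\<bar> \<le> exp (inner u y) + exp (- inner u y)"
      using exp_ge_add_one_self[of "inner u y"] exp_ge_add_one_self[of "- inner u y"]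
        exp_gt_zero[of "inner u y"] exp_gt_zero[of "- inner u y"] by linarith
    then have "norm g * \<bar>inner u y\<bar> * w y \<le> norm g * (exp (inner u y) + exp (- inner u y)) * w y"
      by (intro mult_right_mono mult_left_mono) auto
    then show ?thesis by (simp add: g_eq abs_mult algebra_simps)
  qed
  then have "(\<integral>\<^sup>+y. ennreal (\<bar>inner g y\<bar> * w y) \<partial>M)
      \<le> (\<integral>\<^sup>+y. ennreal (norm g) * (ennreal (exp (inner u y) * w y) + ennreal (exp (inner (- u) y) * w y)) \<partial>M)"
    by (intro nn_integral_mono)
      (simp add: ennreal_leI flip: ennreal_plus ennreal_mult)
  also have "\<dots> = ennreal (norm g) * (ennreal (exp ((norm u)\<^sup>2 / 2) * Z) + ennreal (exp ((norm (- u))\<^sup>2 / 2) * Z))"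
  proof -
    note [measurable] = u
    show ?thesis
      by (subst nn_integral_cmult, measurable) 
        (subst nn_integral_add, measurable, use exp_inner_integral[OF u(1)] exp_inner_integral[OF u(3)] in simp)
  qed
  also have "\<dots> = ennreal (2 * exp (1 / 2) * Z * norm g)"
    using Z_pos u(2) by (simp flip: ennreal_plus ennreal_mult add: algebra_simps)
  finally show ?thesis .
qed simp

text \<open>Maurey and Pisier's argument: the arc from x to y is rotated
  so that its points and its velocities become independent Gaussian vectors.\<close>

lemma maurey_pisier:
  fixes \<phi> :: "'a \<Rightarrow> real" and G :: "'a \<Rightarrow> 'a"
  assumes [measurable]: "\<phi> \<in> borel_measurable M" "G \<in> M \<rightarrow>\<^sub>M M"
    and deriv: "\<And>x. x \<in> S \<Longrightarrow> norm x < R2 \<Longrightarrow> (\<phi> has_derivative (\<lambda>u. inner (G x) u)) (at x within S)"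
    and bound: "\<And>x. x \<in> S \<Longrightarrow> norm x < R2 \<Longrightarrow> norm (G x) \<le> B"
    and R: "sqrt 2 * R1 \<le> R2" "R1 \<ge> 0"
  shows "(\<integral>\<^sup>+p. indicator {p. norm (fst p) < R1 \<and> norm (snd p) < R1} p *
      ennreal (\<bar>\<phi> (fst p) - \<phi> (snd p)\<bar> * w (fst p) * w (snd p)) \<partial>(M \<Otimes>\<^sub>M M))
    \<le> ennreal (pi * exp (1 / 2) * Z) * (\<integral>\<^sup>+x. indicator {x. norm x < R2} x * ennreal (norm (G x) * w x) \<partial>M)"
proof -
  define P where "P = M \<Otimes>\<^sub>M M"
  interpret P: sigma_finite_measure P unfolding P_def ..
  interpret PL: pair_sigma_finite P lborel ..
  define T where "T = {0..pi / 2 :: real}"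
  define \<rho> where "\<rho> = (\<lambda>t (p :: 'a \<times> 'a). cos t *\<^sub>R fst p + sin t *\<^sub>R snd p)"
  define \<rho>' where "\<rho>' = (\<lambda>t (p :: 'a \<times> 'a). cos t *\<^sub>R snd p - sin t *\<^sub>R fst p)"
  define A where "A = {p :: 'a \<times> 'a. norm (fst p) < R1 \<and> norm (snd p) < R1}"
  define Q where "Q = (\<lambda>p :: 'a \<times> 'a. indicator {x. norm x < R2} (fst p) *
     (ennreal (w (fst p)) * ennreal (\<bar>inner (G (fst p)) (snd p)\<bar> * w (snd p))))"
  have [measurable]: "fst \<in> P \<rightarrow>\<^sub>M M" "snd \<in> P \<rightarrow>\<^sub>M M" unfolding P_def by auto
  have [measurable]: "Measurable.pred M (\<lambda>x. norm x < R2)" by measurable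
  have A_pred [measurable]: "Measurable.pred P (\<lambda>p. p \<in> A)" unfolding A_def mem_Collect_eq by measurable
  have Q_meas: "Q \<in> borel_measurable (M \<Otimes>\<^sub>M M)"
    unfolding Q_def indicator_def mem_Collect_eq of_bool_def by measurable
  have \<rho>_norm: "(norm (\<rho> t p))\<^sup>2 + (norm (\<rho>' t p))\<^sup>2 = (norm (fst p))\<^sup>2 + (norm (snd p))\<^sup>2" for t p
    unfolding \<rho>_def \<rho>'_def by (rule norm_rotation) simp
  \<comment> \<open>Since the squared norms of position and velocity add up to those of the
    endpoints, the arc can leave the ball of radius \<open>R1\<close> but not that of radius
    \<open>sqrt 2 * R1\<close>. This is why two radii appear.\<close>
  have \<rho>_less: "norm (\<rho> t p) < R2" if "p \<in> A" for t p
  proof -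
    have "(norm (fst p))\<^sup>2 < R1\<^sup>2" "(norm (snd p))\<^sup>2 < R1\<^sup>2"
      using that by (auto simp: A_def intro: power_strict_mono)
    then have "(norm (\<rho> t p))\<^sup>2 < 2 * R1\<^sup>2"
      using \<rho>_norm[of t p] zero_le_power2[of "norm (\<rho>' t p)"] by linarith
    then have "(norm (\<rho> t p))\<^sup>2 < (sqrt 2 * R1)\<^sup>2" by (simp add: power_mult_distrib)
    then have "norm (\<rho> t p) < sqrt 2 * R1" by (rule power2_less_imp_less) (use R in simp)
    then show ?thesis using R by simp
  qed
  have \<rho>_S: "\<rho> t p \<in> S" "\<rho>' t p \<in> S" if "p \<in> space P" for t p
    using that by (auto simp: \<rho>_def \<rho>'_def P_def space_pair_measure)
  have ww: "w (fst p) * w (snd p) = w (\<rho> t p) * w (\<rho>' t p)" for t p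
    using \<rho>_norm[of t p] by (simp add: w_def field_simps flip: exp_add)
  have path: "ennreal \<bar>\<phi> (fst p) - \<phi> (snd p)\<bar>
      \<le> (\<integral>\<^sup>+t. ennreal \<bar>inner (G (\<rho> t p)) (\<rho>' t p)\<bar> * indicator T t \<partial>lborel)"
    if p: "p \<in> A" "p \<in> space P" for p
  proof -
    have [measurable]: "(\<lambda>t. \<rho> t p) \<in> borel \<rightarrow>\<^sub>M M" "(\<lambda>t. \<rho>' t p) \<in> borel \<rightarrow>\<^sub>M M"
      using p unfolding \<rho>_def \<rho>'_def P_def space_pair_measure by auto
    have "ennreal \<bar>\<phi> (\<rho> (pi / 2) p) - \<phi> (\<rho> 0 p)\<bar>
      \<le> (\<integral>\<^sup>+t. ennreal \<bar>inner (G (\<rho> t p)) (\<rho>' t p)\<bar> * indicator {0..pi/2} t \<partial>lborel)"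
    proof (rule FTC_nn_integral[where B = "B * (norm (fst p) + norm (snd p))"])
      fix t :: real
      have "((\<lambda>t. \<rho> t p) has_derivative (\<lambda>h. h *\<^sub>R \<rho>' t p)) (at t within {0..pi/2})"
        unfolding \<rho>_def \<rho>'_def
        by (auto intro!: derivative_eq_intros simp: algebra_simps)
      moreover have "(\<phi> has_derivative (\<lambda>u. inner (G (\<rho> t p)) u)) (at (\<rho> t p) within (\<lambda>t. \<rho> t p) ` {0..pi/2})"
        by (rule has_derivative_subset[OF deriv[OF \<rho>_S(1)[OF p(2)] \<rho>_less[OF p(1)]]])
            (auto intro: \<rho>_S(1)[OF p(2)])
      ultimately have "((\<lambda>t. \<phi> (\<rho> t p)) has_derivative (\<lambda>h. inner (G (\<rho> t p)) (h *\<^sub>R \<rho>' t p))) (at t within {0..pi/2})"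
        by (rule has_derivative_in_compose)
      then show "((\<lambda>t. \<phi> (\<rho> t p)) has_vector_derivative inner (G (\<rho> t p)) (\<rho>' t p)) (at t within {0..pi/2})"
        by (simp add: has_vector_derivative_def)
      have "norm (\<rho>' t p) \<le> norm (cos t *\<^sub>R snd p) + norm (sin t *\<^sub>R fst p)"
        unfolding \<rho>'_def by (rule norm_triangle_ineq4)
      also have "\<dots> \<le> norm (fst p) + norm (snd p)"
        using mult_right_mono[OF abs_cos_le_one[of t], of "norm (snd p)"]
          mult_right_mono[OF abs_sin_le_one[of t], of "norm (fst p)"] by simp
      finally have *: "norm (\<rho>' t p) \<le> norm (fst p) + norm (snd p)" .
      have "norm (G (\<rho> t p)) \<le> B" by (rule bound) (use p \<rho>_S \<rho>_less in auto)
      then have "norm (G (\<rho> t p)) * norm (\<rho>' t p) \<le> B * (norm (fst p) + norm (snd p))"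
        using * by (intro mult_mono) (auto intro: order_trans[OF norm_ge_zero])
      then show "\<bar>inner (G (\<rho> t p)) (\<rho>' t p)\<bar> \<le> B * (norm (fst p) + norm (snd p))"
        using Cauchy_Schwarz_ineq2 order_trans by blast
    qed (simp, measurable)
    then show ?thesis by (simp add: \<rho>_def T_def abs_minus_commute)
  qed
  have jm: "(\<lambda>q. indicator A (fst q) * (ennreal (w (fst (fst q)) * w (snd (fst q))) *
      (ennreal \<bar>inner (G (\<rho> (snd q) (fst q))) (\<rho>' (snd q) (fst q))\<bar> * indicator T (snd q))))
      \<in> borel_measurable (P \<Otimes>\<^sub>M lborel)"
    unfolding \<rho>_def \<rho>'_def T_def by measurable
  have "(\<integral>\<^sup>+p. indicator A p * ennreal (\<bar>\<phi> (fst p) - \<phi> (snd p)\<bar> * w (fst p) * w (snd p)) \<partial>P)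
     \<le> (\<integral>\<^sup>+p. \<integral>\<^sup>+t. indicator A p * (ennreal (w (fst p) * w (snd p)) *
        (ennreal \<bar>inner (G (\<rho> t p)) (\<rho>' t p)\<bar> * indicator T t)) \<partial>lborel \<partial>P)"
  proof (rule nn_integral_mono)
    fix p assume p: "p \<in> space P"
    have [measurable]: "(\<lambda>t. \<rho> t p) \<in> borel \<rightarrow>\<^sub>M M" "(\<lambda>t. \<rho>' t p) \<in> borel \<rightarrow>\<^sub>M M"
      using p unfolding \<rho>_def \<rho>'_def P_def space_pair_measure by auto
    have [measurable]: "T \<in> sets borel" by (simp add: T_def)
    have "indicator A p * ennreal (\<bar>\<phi> (fst p) - \<phi> (snd p)\<bar> * w (fst p) * w (snd p))
      = indicator A p * (ennreal (w (fst p) * w (snd p)) * ennreal \<bar>\<phi> (fst p) - \<phi> (snd p)\<bar>)"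
      by (simp add: mult_ac flip: ennreal_mult)
    also have "\<dots> \<le> indicator A p * (ennreal (w (fst p) * w (snd p)) *
       (\<integral>\<^sup>+t. ennreal \<bar>inner (G (\<rho> t p)) (\<rho>' t p)\<bar> * indicator T t \<partial>lborel))"
      using path[OF _ p] by (auto simp: indicator_def intro!: mult_left_mono)
    also have "\<dots> = (\<integral>\<^sup>+t. indicator A p * (ennreal (w (fst p) * w (snd p)) *
        (ennreal \<bar>inner (G (\<rho> t p)) (\<rho>' t p)\<bar> * indicator T t)) \<partial>lborel)"
      by (subst nn_integral_cmult[symmetric], measurable)+ 
    finally show "indicator A p * ennreal (\<bar>\<phi> (fst p) - \<phi> (snd p)\<bar> * w (fst p) * w (snd p)) \<le> \<dots>" .
  qed
  also have "\<dots> = (\<integral>\<^sup>+t. \<integral>\<^sup>+p. indicator A p * (ennreal (w (fst p) * w (snd p)) *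
        (ennreal \<bar>inner (G (\<rho> t p)) (\<rho>' t p)\<bar> * indicator T t)) \<partial>P \<partial>lborel)"
    using PL.Fubini[of "\<lambda>q. indicator A (fst q) * (ennreal (w (fst (fst q)) * w (snd (fst q))) *
      (ennreal \<bar>inner (G (\<rho> (snd q) (fst q))) (\<rho>' (snd q) (fst q))\<bar> * indicator T (snd q)))", OF jm]
    by simp
  \<comment> \<open>For each angle the integrand is bounded by \<open>Q\<close> at the rotated pair:
    the event \<open>A\<close> is relaxed to a condition on the rotated first component alone.
    Rotation invariance then removes the angle, which contributes only the length of
    \<open>T\<close>.\<close>
  also have "\<dots> \<le> (\<integral>\<^sup>+t. (\<integral>\<^sup>+p. Q p \<partial>P) * indicator T t \<partial>lborel)"
  proof (rule nn_integral_mono)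
    fix t :: real
    show "(\<integral>\<^sup>+p. indicator A p * (ennreal (w (fst p) * w (snd p)) *
        (ennreal \<bar>inner (G (\<rho> t p)) (\<rho>' t p)\<bar> * indicator T t)) \<partial>P) \<le> (\<integral>\<^sup>+p. Q p \<partial>P) * indicator T t"
    proof (cases "t \<in> T")
      case True
      have "(\<integral>\<^sup>+p. indicator A p * (ennreal (w (fst p) * w (snd p)) *
          (ennreal \<bar>inner (G (\<rho> t p)) (\<rho>' t p)\<bar> * indicator T t)) \<partial>P)
        \<le> (\<integral>\<^sup>+p. Q (\<rho> t p, \<rho>' t p) \<partial>P)"
      proof (rule nn_integral_mono)
        fix p assume "p \<in> space P"
        show "indicator A p * (ennreal (w (fst p) * w (snd p)) *
          (ennreal \<bar>inner (G (\<rho> t p)) (\<rho>' t p)\<bar> * indicator T t)) \<le> Q (\<rho> t p, \<rho>' t p)"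
          using True \<rho>_less[of p t]
          by (auto simp: Q_def ww[of p t] indicator_def mult_ac simp flip: ennreal_mult)
      qed
      also have "\<dots> = (\<integral>\<^sup>+p. Q p \<partial>P)"
        unfolding \<rho>_def \<rho>'_def P_def
        using True by (intro rotation_invariance Q_meas) (auto simp: T_def cos_ge_zero)
      finally show ?thesis using True by simp
    qed simp
  qed
  also have "\<dots> = (\<integral>\<^sup>+p. Q p \<partial>P) * ennreal (pi / 2)"
    by (subst nn_integral_cmult) (auto simp: T_def)
  finally have swap: "(\<integral>\<^sup>+p. indicator A p * ennreal (\<bar>\<phi> (fst p) - \<phi> (snd p)\<bar> * w (fst p) * w (snd p)) \<partial>P)
      \<le> (\<integral>\<^sup>+p. Q p \<partial>P) * ennreal (pi / 2)" .
  have "(\<integral>\<^sup>+p. Q p \<partial>P) = (\<integral>\<^sup>+x. indicator {x. norm x < R2} x * (ennreal (w x) *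
      (\<integral>\<^sup>+y. ennreal (\<bar>inner (G x) y\<bar> * w y) \<partial>M)) \<partial>M)"
    unfolding P_def
  proof (subst nn_integral_fst[OF Q_meas, symmetric], rule nn_integral_cong)
    fix x assume x: "x \<in> S"
    have [measurable]: "G x \<in> S" using x measurable_space[of G M M] by simp
    show "(\<integral>\<^sup>+y. Q (x, y) \<partial>M) = indicator {x. norm x < R2} x * (ennreal (w x) *
      (\<integral>\<^sup>+y. ennreal (\<bar>inner (G x) y\<bar> * w y) \<partial>M))"
      unfolding Q_def fst_conv snd_conv
      by (subst nn_integral_cmult[symmetric], measurable)+
  qed
  also have "\<dots> \<le> (\<integral>\<^sup>+x. indicator {x. norm x < R2} x * (ennreal (w x) *
      ennreal (2 * exp (1 / 2) * Z * norm (G x))) \<partial>M)"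
  proof (intro nn_integral_mono mult_left_mono abs_inner_integral)
    fix x assume "x \<in> S" then show "G x \<in> S" using measurable_space[of G M M] by simp
  qed auto
  also have "\<dots> = (\<integral>\<^sup>+x. ennreal (2 * exp (1 / 2) * Z) * (indicator {x. norm x < R2} x *
      ennreal (norm (G x) * w x)) \<partial>M)"
    using Z_pos by (intro nn_integral_cong) (auto simp: indicator_def mult_ac simp flip: ennreal_mult)
  also have "\<dots> = ennreal (2 * exp (1 / 2) * Z) * (\<integral>\<^sup>+x. indicator {x. norm x < R2} x *
      ennreal (norm (G x) * w x) \<partial>M)"
    by (rule nn_integral_cmult) measurable
  finally have "(\<integral>\<^sup>+p. Q p \<partial>P) * ennreal (pi / 2) \<le> ennreal (2 * exp (1 / 2) * Z) *
      (\<integral>\<^sup>+x. indicator {x. norm x < R2} x * ennreal (norm (G x) * w x) \<partial>M) * ennreal (pi / 2)"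
    by (rule mult_right_mono) simp
  also have "\<dots> = ennreal (2 * exp (1 / 2) * Z) * ennreal (pi / 2) *
      (\<integral>\<^sup>+x. indicator {x. norm x < R2} x * ennreal (norm (G x) * w x) \<partial>M)"
    by (simp add: mult_ac)
  also have "ennreal (2 * exp (1 / 2) * Z) * ennreal (pi / 2) = ennreal (pi * exp (1 / 2) * Z)"
    using Z_pos by (simp flip: ennreal_mult)
  finally show ?thesis
    using swap unfolding P_def A_def by (rule order_trans[rotated])
qed

end

section \<open>Comparing a log-perturbed Gaussian density with the Gaussian\<close>

text \<open>The letters \<open>a\<close>, \<open>p\<close> are the masses of two measures on a ball
  and \<open>t\<close>, \<open>q\<close> their masses outside; the suffix B means the part in a set.
  Dropping the outside changes a normalised mass by at most the relative weight of what is dropped,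
  and the two ball parts are compared after cross-multiplication.\<close>

lemma normalised_difference_bound:
  fixes a b t tB p q pB qB D :: real
  assumes "a > 0" "p > 0" "0 \<le> aB" "aB \<le> a" "0 \<le> tB" "tB \<le> t" "0 \<le> pB" "pB \<le> p" "0 \<le> qB" "qB \<le> q"
    and D: "\<bar>aB * p - a * pB\<bar> \<le> D"
  shows "\<bar>(aB + tB) / (a + t) - (pB + qB) / (p + q)\<bar> \<le> D / (a * p) + t / a + q / p"
proof -
  have aux: "\<bar>(aB + tB) / (a + t) - aB / a\<bar> \<le> t / a"
    if "a > 0" "0 \<le> aB" "aB \<le> a" "0 \<le> tB" "tB \<le> t" for a aB t tB :: real
  proof -
    have "(aB + tB) / (a + t) - aB / a = (tB - (aB / a) * t) / (a + t)"
      using that by (simp add: field_simps)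
    moreover have "\<bar>tB - (aB / a) * t\<bar> \<le> t"
    proof -
      have "0 \<le> (aB / a) * t" using that by simp
      moreover have "(aB / a) * t \<le> 1 * t"
        using that by (intro mult_right_mono) (auto simp: divide_le_eq_1)
      ultimately show ?thesis using that by linarith
    qed
    ultimately have "\<bar>(aB + tB) / (a + t) - aB / a\<bar> \<le> t / (a + t)"
      using that by (simp add: abs_divide divide_right_mono)
    also have "\<dots> \<le> t / a" using that by (intro divide_left_mono) auto
    finally show ?thesis .
  qed
  have "\<bar>aB / a - pB / p\<bar> = \<bar>aB * p - a * pB\<bar> / (a * p)"
    using assms by (simp add: diff_frac_eq abs_divide abs_mult mult.commute)
  also have "\<dots> \<le> D / (a * p)" using assms by (intro divide_right_mono) auto
  finally have "\<bar>aB / a - pB / p\<bar> \<le> D / (a * p)" .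
  moreover have "\<bar>(aB + tB) / (a + t) - aB / a\<bar> \<le> t / a" using assms by (intro aux) auto
  moreover have "\<bar>(pB + qB) / (p + q) - pB / p\<bar> \<le> q / p" using assms by (intro aux) auto
  ultimately show ?thesis by linarith
qed

context translation_invariant_space
begin

section \<open>Tails, volumes and ball masses with explicit dependence on the dimension\<close>

lemma scaled_gaussian_integral:
  assumes "b > 0"
  shows "(\<integral>\<^sup>+x. ennreal (exp (- b * (norm x)\<^sup>2 / 2)) \<partial>M) = ennreal (Z / sqrt b ^ d)"
proof -
  have "(\<integral>\<^sup>+x. ennreal (exp (- b * (norm x)\<^sup>2 / 2)) \<partial>M) = (\<integral>\<^sup>+x. ennreal (w (sqrt b *\<^sub>R x)) \<partial>M)"
    using assms by (intro nn_integral_cong) (simp add: w_def power_mult_distrib)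
  also have "\<dots> = ennreal (1 / sqrt b ^ d) * (\<integral>\<^sup>+x. ennreal (w x) \<partial>M)"
    using assms by (intro scaling) auto
  finally show ?thesis using assms Z_pos by (simp add: integral_w flip: ennreal_mult)
qed

text \<open>Half of the Gaussian exponent is evaluated at the radius \<open>r\<close>; the other
  half remains as a wider Gaussian, whose mass is \<open>sqrt 2 ^ d * Z\<close>.\<close>

lemma gaussian_tail:
  assumes "r \<ge> 0"
  shows "(\<integral>\<^sup>+x. indicator {x. r \<le> norm x} x * ennreal (w x) \<partial>M) \<le> ennreal (exp (- r\<^sup>2 / 4) * sqrt 2 ^ d * Z)"
proof -
  have "(\<integral>\<^sup>+x. indicator {x. r \<le> norm x} x * ennreal (w x) \<partial>M)
    \<le> (\<integral>\<^sup>+x. ennreal (exp (- r\<^sup>2 / 4)) * ennreal (exp (- (1 / 2) * (norm x)\<^sup>2 / 2)) \<partial>M)"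
  proof (rule nn_integral_mono)
    fix x
    show "indicator {x. r \<le> norm x} x * ennreal (w x)
      \<le> ennreal (exp (- r\<^sup>2 / 4)) * ennreal (exp (- (1 / 2) * (norm x)\<^sup>2 / 2))"
    proof (cases "r \<le> norm x")
      case True
      then have "r\<^sup>2 \<le> (norm x)\<^sup>2" using assms by (intro power_mono) auto
      then have "w x \<le> exp (- r\<^sup>2 / 4) * exp (- (1 / 2) * (norm x)\<^sup>2 / 2)"
        by (simp add: w_def flip: exp_add)
      then show ?thesis using True by (simp add: ennreal_leI flip: ennreal_mult)
    qed simp
  qed
  also have "\<dots> = ennreal (exp (- r\<^sup>2 / 4)) * ennreal (Z / sqrt (1 / 2) ^ d)"
    using scaled_gaussian_integral[of "1/2"] by (subst nn_integral_cmult) simp_all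
  also have "\<dots> = ennreal (exp (- r\<^sup>2 / 4) * sqrt 2 ^ d * Z)"
    using Z_pos by (simp add: real_sqrt_divide power_divide mult_ac flip: ennreal_mult)
  finally show ?thesis .
qed

text \<open>On the ball \<open>w\<close> is at least exp (- r^2 / 2), which bounds the volume in
  terms of \<open>Z\<close> without the exact formula.\<close>

lemma ball_volume:
  "(\<integral>\<^sup>+x. indicator {x. norm x < r} x \<partial>M) \<le> ennreal (exp (r\<^sup>2 / 2) * Z)"
proof -
  have "(\<integral>\<^sup>+x. indicator {x. norm x < r} x \<partial>M) \<le> (\<integral>\<^sup>+x. ennreal (exp (r\<^sup>2 / 2)) * ennreal (w x) \<partial>M)"
  proof (rule nn_integral_mono)
    fix x
    show "indicator {x. norm x < r} x \<le> ennreal (exp (r\<^sup>2 / 2)) * ennreal (w x)"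
    proof (cases "norm x < r")
      case True
      then have "(norm x)\<^sup>2 \<le> r\<^sup>2" by (intro power_mono) auto
      then have "1 \<le> exp (r\<^sup>2 / 2) * w x" by (simp add: w_def flip: exp_add)
      then show ?thesis using True by (simp flip: ennreal_mult ennreal_1)
    qed simp
  qed
  also have "\<dots> = ennreal (exp (r\<^sup>2 / 2)) * ennreal Z"
    by (subst nn_integral_cmult) (auto simp: integral_w)
  finally show ?thesis using Z_pos by (simp flip: ennreal_mult)
qed

text \<open>Comparing the integral over a ball with its image under dilation by two gives an inequality
  that the integral can only satisfy if it is small.\<close>

lemma exp_norm_integral:
  assumes b: "b \<ge> 6 / 5 * sqrt d"
  shows "(\<integral>\<^sup>+x. ennreal (exp (- b * norm x)) \<partial>M) \<le> ennreal (3 * 2 ^ d * exp (d / 2) * Z)"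
proof -
  define \<Phi> where "\<Phi> = (\<lambda>x::'a. exp (- b * norm x))"
  have [measurable]: "\<Phi> \<in> borel_measurable M" unfolding \<Phi>_def by measurable
  have b0: "b > 0" by (rule less_le_trans[OF _ b]) (use dim_pos in simp)
  have [measurable]: "Measurable.pred M (\<lambda>x. norm x < r)" for r by measurable
  \<comment> \<open>Integrals over balls are finite by \<open>ball_volume\<close>, so the inequality
    below may be solved for \<open>A R\<close>; the bound obtained does not depend on
    \<open>R\<close>.\<close>
  define A where "A = (\<lambda>R. \<integral>\<^sup>+x. indicator {x. norm x < R} x * ennreal (\<Phi> x) \<partial>M)"
  define K where "K = 3 * 2 ^ d * exp (d / 2) * Z"
  have bd: "A R \<le> ennreal K" for R
  proof (cases "R > 0")
    case True
    have "A R \<le> (\<integral>\<^sup>+x. indicator {x. norm x < R} x \<partial>M)"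
      unfolding A_def using b0 by (intro nn_integral_mono) (auto simp: indicator_def \<Phi>_def)
    also have "\<dots> < \<infinity>" using ball_volume[of R] by (auto simp: le_less_trans)
    finally have fin: "A R < \<infinity>" .
    have "ennreal (1 / 2 ^ d) * A R = (\<integral>\<^sup>+x. indicator {x. norm x < R} (2 *\<^sub>R x) * ennreal (\<Phi> (2 *\<^sub>R x)) \<partial>M)"
      unfolding A_def by (subst scaling) auto
    also have "\<dots> \<le> (\<integral>\<^sup>+x. ennreal (2 / (3 * 2 ^ d)) * (indicator {x. norm x < R} x * ennreal (\<Phi> x))
         + indicator {x. norm x < sqrt d} x \<partial>M)"
    proof (rule nn_integral_mono)
      fix x
      have \<Phi>2: "\<Phi> (2 *\<^sub>R x) = \<Phi> x * exp (- b * norm x)" by (simp add: \<Phi>_def flip: exp_add)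
      have \<Phi>1: "\<Phi> x \<le> 1" using b0 by (simp add: \<Phi>_def)
      show "indicator {x. norm x < R} (2 *\<^sub>R x) * ennreal (\<Phi> (2 *\<^sub>R x))
        \<le> ennreal (2 / (3 * 2 ^ d)) * (indicator {x. norm x < R} x * ennreal (\<Phi> x))
         + indicator {x. norm x < sqrt d} x"
      proof (cases "2 * norm x < R")
        case R: True
        then have R': "norm x < R" using norm_ge_zero[of x] by linarith
        show ?thesis
        proof (cases "norm x < sqrt d")
          case True
          have "\<Phi> (2 *\<^sub>R x) \<le> 1" using b0 by (simp add: \<Phi>_def)
          then show ?thesis using True R by (simp add: add_increasing)
        next
          case False
          \<comment> \<open>Outside the ball of radius \<open>sqrt d\<close> the extra factor exp (-
            b |x|) is at most (1/3)^d, that is, at most 2/3 of the Jacobian factor 1/2^d of the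
            dilation.\<close>
          have "6 / 5 * d = 6 / 5 * sqrt d * sqrt d" by simp
          also have "\<dots> \<le> b * norm x" using False b b0 by (intro mult_mono) auto
          finally have "exp (- b * norm x) \<le> exp (- (6 / 5)) ^ d" by (simp flip: exp_of_nat_mult)
          also have "\<dots> \<le> (1 / 3) ^ d"
          proof (rule power_mono)
            have "(3::real) \<le> (1 + 3/10 + (3/10)\<^sup>2 / 2) ^ 4" by (simp add: power2_eq_square power4_eq_xxxx)
            also have "\<dots> \<le> exp (3 / 10) ^ 4"
              by (intro power_mono exp_lower_Taylor_quadratic) auto
            also have "\<dots> = exp (6 / 5)" by (simp flip: exp_of_nat_mult)
            finally show "exp (- (6 / 5)) \<le> 1 / (3::real)" by (simp add: exp_minus field_simps)
          qed simp
          also have "\<dots> \<le> 2 / (3 * 2 ^ d)"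
          proof -
            have "(1 / 3 :: real) ^ d * 2 ^ d = (2 / 3) ^ d" by (simp flip: power_mult_distrib)
            also have "\<dots> \<le> (2 / 3) ^ 1" using dim_pos by (intro power_decreasing) auto
            finally show ?thesis by (simp add: field_simps)
          qed
          finally have "\<Phi> (2 *\<^sub>R x) \<le> 2 / (3 * 2 ^ d) * \<Phi> x"
            unfolding \<Phi>2 using mult_left_mono[of "exp (- b * norm x)" "2 / (3 * 2 ^ d)" "\<Phi> x"]
            by (simp add: \<Phi>_def mult_ac)
          then have "ennreal (\<Phi> (2 *\<^sub>R x)) \<le> ennreal (2 / (3 * 2 ^ d)) * ennreal (\<Phi> x)"
            by (subst ennreal_mult[symmetric]) (auto simp: \<Phi>_def intro: ennreal_leI)
          then show ?thesis using R R' False by simp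
        qed
      qed simp
    qed
    also have "\<dots> = ennreal (2 / (3 * 2 ^ d)) * A R + (\<integral>\<^sup>+x. indicator {x. norm x < sqrt d} x \<partial>M)"
      unfolding A_def by (subst nn_integral_add, measurable) (subst nn_integral_cmult, auto)
    also have "\<dots> \<le> ennreal (2 / (3 * 2 ^ d)) * A R + ennreal (exp (d / 2) * Z)"
      using ball_volume[of "sqrt d"] by (intro add_left_mono) simp
    finally have *: "ennreal (1 / 2 ^ d) * A R \<le> ennreal (2 / (3 * 2 ^ d)) * A R + ennreal (exp (d / 2) * Z)" .
    obtain r where r: "A R = ennreal r" "r \<ge> 0" using fin by (cases "A R") auto
    have "ennreal (1 / 2 ^ d * r) \<le> ennreal (2 / (3 * 2 ^ d) * r + exp (d / 2) * Z)"
      using * r Z_pos by (simp only: ennreal_mult ennreal_plus mult_nonneg_nonneg exp_ge_zero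
          less_imp_le divide_nonneg_nonneg zero_le_power zero_le_numeral zero_le_one)
    then have "1 / 2 ^ d * r \<le> 2 / (3 * 2 ^ d) * r + exp (d / 2) * Z"
      using r Z_pos by (subst (asm) ennreal_le_iff) auto
    \<comment> \<open>Two thirds of the left side are absorbed, and the remaining third accounts for
      the factor 3 in \<open>K\<close>.\<close>
    then have "r \<le> K" unfolding K_def by (simp add: field_simps)
    then show ?thesis using r by (simp add: ennreal_leI)
  next
    case False
    then have "indicator {x. norm x < R} x = (0 :: ennreal)" for x :: 'a
      using norm_ge_zero[of x] by (auto simp: indicator_def simp del: norm_ge_zero)
    then show ?thesis by (simp add: A_def)
  qed
  have "(\<integral>\<^sup>+x. ennreal (\<Phi> x) \<partial>M) = (\<integral>\<^sup>+x. (SUP i::nat. indicator {x. norm x < real i} x * ennreal (\<Phi> x)) \<partial>M)"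
  proof (intro nn_integral_cong antisym)
    fix x :: 'a
    obtain i :: nat where "norm x < real i" using reals_Archimedean2 by blast
    then show "ennreal (\<Phi> x) \<le> (SUP i::nat. indicator {x. norm x < real i} x * ennreal (\<Phi> x))"
      by (intro SUP_upper2[where i = i]) auto
    show "(SUP i::nat. indicator {x. norm x < real i} x * ennreal (\<Phi> x)) \<le> ennreal (\<Phi> x)"
      by (intro SUP_least) (auto simp: indicator_def)
  qed
  also have "\<dots> = (SUP i::nat. A (real i))"
    unfolding A_def
    by (intro nn_integral_monotone_convergence_SUP)
      (auto simp: incseq_def le_fun_def indicator_def)
  also have "\<dots> \<le> ennreal K" by (intro SUP_least bd)
  finally show ?thesis by (simp add: \<Phi>_def K_def)
qed

lemma sqrt_d: "sqrt d \<ge> 1" "sqrt d > 0" "sqrt d * sqrt d = d" "sqrt d \<le> d"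
proof -
  show 1: "sqrt d \<ge> 1" using dim_pos by simp
  then show "sqrt d > 0" by linarith
  show "sqrt d * sqrt d = d" by simp
  then show "sqrt d \<le> d" using 1 mult_left_mono[OF 1, of "sqrt d"] by simp
qed

text \<open>At radius \<open>2 * sqrt d\<close> the tail bound is the d-th power of
  \<open>sqrt 2 / exp 1\<close>, hence at most 3/4 in every dimension.\<close>

lemma gaussian_ball_mass:
  "ennreal (Z / 4) \<le> (\<integral>\<^sup>+x. indicator {x. norm x < 2 * sqrt d} x * ennreal (w x) \<partial>M)"
proof -
  define r where "r = 2 * sqrt d"
  have "ennreal Z = (\<integral>\<^sup>+x. indicator {x. norm x < r} x * ennreal (w x)
      + indicator {x. r \<le> norm x} x * ennreal (w x) \<partial>M)"
    unfolding integral_w[symmetric] by (intro nn_integral_cong) (auto simp: indicator_def)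
  also have "\<dots> = (\<integral>\<^sup>+x. indicator {x. norm x < r} x * ennreal (w x) \<partial>M)
      + (\<integral>\<^sup>+x. indicator {x. r \<le> norm x} x * ennreal (w x) \<partial>M)"
    by (rule nn_integral_add) measurable
  also have "\<dots> \<le> (\<integral>\<^sup>+x. indicator {x. norm x < r} x * ennreal (w x) \<partial>M) + ennreal (3 / 4 * Z)"
  proof (intro add_left_mono order_trans[OF gaussian_tail] ennreal_leI mult_right_mono)
    have "exp (- r\<^sup>2 / 4) * sqrt 2 ^ d = (sqrt 2 / exp 1) ^ d"
      by (simp add: r_def power_mult_distrib exp_minus power_divide field_simps flip: exp_of_nat_mult)
    also have "\<dots> \<le> (3 / 4) ^ d"
    proof (rule power_mono)
      have "sqrt 2 \<le> 3 / 2" by (rule real_le_lsqrt) (auto simp: power2_eq_square)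
      moreover have "2 \<le> exp (1::real)" using exp_ge_add_one_self[of 1] by simp
      ultimately have "sqrt 2 * 4 \<le> 3 * exp 1" by linarith
      then show "sqrt 2 / exp 1 \<le> 3 / 4" by (simp add: field_simps)
    qed simp
    also have "\<dots> \<le> (3 / 4) ^ 1" using dim_pos by (intro power_decreasing) auto
    finally show "exp (- r\<^sup>2 / 4) * sqrt 2 ^ d \<le> 3 / 4" by simp
  qed (use Z_pos sqrt_d in \<open>auto simp: r_def\<close>)
  finally have *: "ennreal Z \<le> (\<integral>\<^sup>+x. indicator {x. norm x < r} x * ennreal (w x) \<partial>M) + ennreal (3 / 4 * Z)" .
  have "ennreal (Z / 4) = ennreal Z - ennreal (3 / 4 * Z)"
    using Z_pos by (subst ennreal_minus) auto
  also have "\<dots> \<le> (\<integral>\<^sup>+x. indicator {x. norm x < r} x * ennreal (w x) \<partial>M)"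
    using * by (simp add: ennreal_minus_le_iff add.commute)
  finally show ?thesis by (simp add: r_def)
qed

end

text \<open>\<open>h\<close> is a log-density relative to the standard Gaussian and \<open>g\<close>
  its gradient. In the bound on \<open>g\<close> the factor \<open>1 + norm x / sqrt d\<close> is of
  order one at the typical Gaussian radius \<open>sqrt d\<close>; with
  \<open>\<eta> \<le> 1 / 4\<close> its integral along a ray stays below the Gaussian exponent at
  large radii.\<close>

locale log_perturbation = translation_invariant_space M d Z
  for M :: "'a::real_inner measure" and d :: nat and Z :: real +
  fixes h :: "'a \<Rightarrow> real" and g :: "'a \<Rightarrow> 'a" and s \<eta> :: real
  assumes s: "s \<ge> 12" and \<eta>: "0 \<le> \<eta>" "\<eta> \<le> 1 / 4"
    and h_measurable [measurable]: "h \<in> borel_measurable M"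
    and g_measurable [measurable]: "g \<in> M \<rightarrow>\<^sub>M M"
    and h_deriv: "\<And>x. x \<in> space M \<Longrightarrow> norm x < s * sqrt d \<Longrightarrow>
      (h has_derivative (\<lambda>u. inner (g x) u)) (at x within space M)"
    and g_bound: "\<And>x. x \<in> space M \<Longrightarrow> norm x < s * sqrt d \<Longrightarrow> norm (g x) \<le> \<eta> * (1 + norm x / sqrt d)"
    and h_0: "h 0 = 0"
begin

text \<open>The right-hand side is the gradient bound integrated along the ray, with antiderivative
  \<open>e\<close>. It is needed at \<open>c = 0\<close>, for the size of \<open>h\<close>, and at
  \<open>c = 1/2\<close>, for comparing a point with its half.\<close>

lemma h_ray:
  assumes x: "x \<in> S" "norm x < s * sqrt d" and c: "0 \<le> c" "c < 1"
  shows "\<bar>h x - h (c *\<^sub>R x)\<bar> \<le> \<eta> * ((1 - c) * norm x + (1 - c\<^sup>2) * (norm x)\<^sup>2 / (2 * sqrt d))"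
proof -
  define k where "k = (\<lambda>t. h (t *\<^sub>R x))"
  define e where "e = (\<lambda>t. \<eta> * (t * norm x + t\<^sup>2 * (norm x)\<^sup>2 / (2 * sqrt d)))"
  have tx: "t *\<^sub>R x \<in> S" "norm (t *\<^sub>R x) < s * sqrt d" if "t \<in> {c..1}" for t
  proof -
    have "\<bar>t\<bar> * norm x \<le> 1 * norm x" using that c by (intro mult_right_mono) auto
    then show "norm (t *\<^sub>R x) < s * sqrt d" using x by simp
  qed (use x in auto)
  have k: "(k has_vector_derivative inner (g (t *\<^sub>R x)) x) (at t within {c..1})" if t: "t \<in> {c..1}" for t
  proof -
    have "((\<lambda>t. t *\<^sub>R x) has_derivative (\<lambda>u. u *\<^sub>R x)) (at t within {c..1})"
      by (auto intro!: derivative_eq_intros)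
    moreover have "(h has_derivative (\<lambda>u. inner (g (t *\<^sub>R x)) u)) (at (t *\<^sub>R x) within (\<lambda>t. t *\<^sub>R x) ` {c..1})"
      by (rule has_derivative_subset[OF h_deriv]) (use tx t x in auto)
    ultimately show ?thesis
      unfolding k_def has_vector_derivative_def using has_derivative_in_compose by fastforce
  qed
  have kb: "\<bar>inner (g (t *\<^sub>R x)) x\<bar> \<le> \<eta> * (norm x + t * (norm x)\<^sup>2 / sqrt d)" if t: "t \<in> {c..1}" for t
  proof -
    have "\<bar>inner (g (t *\<^sub>R x)) x\<bar> \<le> norm (g (t *\<^sub>R x)) * norm x" by (rule Cauchy_Schwarz_ineq2)
    also have "\<dots> \<le> \<eta> * (1 + norm (t *\<^sub>R x) / sqrt d) * norm x"
      using g_bound[OF tx[OF t]] by (intro mult_right_mono) auto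
    finally show ?thesis using t c by (simp add: power2_eq_square algebra_simps)
  qed
  have e: "(e has_real_derivative \<eta> * (norm x + t * (norm x)\<^sup>2 / sqrt d)) (at t)" for t
    unfolding e_def using sqrt_d by (auto intro!: derivative_eq_intros simp: field_simps power2_eq_square)
  have cont: "continuous_on {c..1} k"
    by (rule continuous_on_vector_derivative) (rule k)
  have econt: "continuous_on {c..1} e" unfolding e_def using sqrt_d by (intro continuous_intros) auto
  have kd: "(k has_real_derivative inner (g (t *\<^sub>R x)) x) (at t)" if "c < t" "t < 1" for t
  proof -
    have "at t within {c..1} = at t" using that by (intro at_within_Icc_at) auto
    then show ?thesis using k[of t] that by (simp add: has_real_derivative_iff_has_vector_derivative)
  qed
  have "k 1 - e 1 \<le> k c - e c"
  proof (rule DERIV_nonpos_imp_decreasing_open[OF less_imp_le[OF c(2)]])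
    fix t assume t: "c < t" "t < 1"
    show "\<exists>y. ((\<lambda>t. k t - e t) has_real_derivative y) (at t) \<and> y \<le> 0"
      using DERIV_diff[OF kd[OF t] e[of t]] kb[of t] t by (intro exI conjI) auto
  qed (intro continuous_intros cont econt)
  moreover have "k c + e c \<le> k 1 + e 1"
  proof (rule DERIV_nonneg_imp_increasing_open[OF less_imp_le[OF c(2)]])
    fix t assume t: "c < t" "t < 1"
    show "\<exists>y. ((\<lambda>t. k t + e t) has_real_derivative y) (at t) \<and> 0 \<le> y"
      using DERIV_add[OF kd[OF t] e[of t]] kb[of t] t by (intro exI conjI) auto
  qed (intro continuous_intros cont econt)
  ultimately have "\<bar>k 1 - k c\<bar> \<le> e 1 - e c" by linarith
  also have "e 1 - e c = \<eta> * ((1 - c) * norm x + (1 - c\<^sup>2) * (norm x)\<^sup>2 / (2 * sqrt d))"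
    by (simp add: e_def algebra_simps diff_divide_distrib)
  finally show ?thesis by (simp add: k_def)
qed

text \<open>The factor 7/10 lies just below \<open>1 / sqrt 2\<close>, so arcs between points of the
  smaller ball stay in the larger one, where \<open>h\<close> is controlled; it lies above 1/2, so
  halving maps the larger ball into the smaller.\<close>

definition R1 :: real where "R1 = 7 / 10 * s * sqrt d"
definition R2 :: real where "R2 = s * sqrt d"

lemma R: "R1 > 0" "R1 \<le> R2" "sqrt 2 * R1 \<le> R2" "R2 / 2 \<le> R1" "4 * sqrt d \<le> R1" "R2 > 0"
proof -
  have "sqrt 2 \<le> 10 / 7" by (rule real_le_lsqrt) (auto simp: power2_eq_square)
  then have "sqrt 2 * (7 / 10 * s * sqrt d) \<le> 10 / 7 * (7 / 10 * s * sqrt d)"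
    using s sqrt_d by (intro mult_right_mono) auto
  then show "sqrt 2 * R1 \<le> R2" by (simp add: R1_def R2_def)
  have p: "s * sqrt d > 0" using s sqrt_d by simp
  have "4 * sqrt d \<le> (7 / 10 * s) * sqrt d" using s sqrt_d by (intro mult_right_mono) auto
  then show "4 * sqrt d \<le> R1" by (simp add: R1_def)
  show "R1 > 0" "R1 \<le> R2" "R2 / 2 \<le> R1" "R2 > 0" using p by (auto simp: R1_def R2_def)
qed

text \<open>Halving the argument changes the Gaussian exponent by 3/8 of the squared norm. The
  perturbation costs at most 1/8 of it, because the norm is at least 4 there and
  \<open>\<eta> \<le> 1 / 4\<close>; what remains is 1/4.\<close>

lemma half_scale:
  assumes x: "x \<in> S" "norm x < R2" "4 * sqrt d \<le> norm x"
  shows "exp (h x) * w x \<le> exp (h ((1/2) *\<^sub>R x)) * w ((1/2) *\<^sub>R x) * exp (- (norm x)\<^sup>2 / 4)"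
proof -
  define r where "r = norm x"
  have r: "r \<ge> 4" using x sqrt_d unfolding r_def by linarith
  have r2: "4 * r \<le> r\<^sup>2" unfolding power2_eq_square using r by (intro mult_right_mono) auto
  have "r\<^sup>2 / (2 * sqrt d) \<le> r\<^sup>2 / 2" using sqrt_d by (intro divide_left_mono) auto
  have "h x - h ((1/2) *\<^sub>R x) \<le> \<eta> * ((1 - 1/2) * r + (1 - (1/2)\<^sup>2) * r\<^sup>2 / (2 * sqrt d))"
    using h_ray[of x "1/2"] x unfolding r_def R2_def by simp
  also have "\<dots> \<le> 1 / 4 * ((1 - 1/2) * r + (1 - (1/2)\<^sup>2) * r\<^sup>2 / (2 * sqrt d))"
    using \<eta> r sqrt_d by (intro mult_right_mono add_nonneg_nonneg) (auto simp: power2_eq_square)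
  also have "\<dots> = r / 8 + 3 / 16 * (r\<^sup>2 / (2 * sqrt d))" by (simp add: power2_eq_square field_simps)
  also have "\<dots> \<le> r / 8 + 3 / 16 * (r\<^sup>2 / 2)"
    using \<open>r\<^sup>2 / (2 * sqrt d) \<le> r\<^sup>2 / 2\<close> by simp
  finally have "h x - r\<^sup>2 / 2 \<le> h ((1/2) *\<^sub>R x) - (r / 2)\<^sup>2 / 2 - r\<^sup>2 / 4"
    using r2 by (simp add: power_divide)
  then show ?thesis
    unfolding w_def by (simp add: r_def[symmetric] flip: exp_add)
qed

text \<open>The weight is at most 5 up to the radius \<open>4 * sqrt d\<close>. Farther out
  \<open>half_scale\<close> compares \<open>x\<close> with its half, and the factor exp (- |x|^2 /
  4) beats both the weight and the Jacobian \<open>2 ^ d\<close> of the dilation, up to the factor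
  27. Hence 32 = 5 + 27. The comparison is with the perturbed mass itself, so the size of
  \<open>exp h\<close> cancels.\<close>

lemma moment_bound:
  "(\<integral>\<^sup>+x. indicator {x. norm x < R2} x * ennreal (exp (h x) * (1 + norm x / sqrt d) * w x) \<partial>M)
   \<le> 32 * (\<integral>\<^sup>+x. indicator {x. norm x < R1} x * ennreal (exp (h x) * w x) \<partial>M)"
proof -
  define \<Phi> where "\<Phi> = (\<lambda>x. exp (h x) * w x)"
  have [measurable]: "\<Phi> \<in> borel_measurable M" unfolding \<Phi>_def by measurable
  have \<Phi>0: "\<Phi> x \<ge> 0" for x by (simp add: \<Phi>_def)
  have [measurable]: "Measurable.pred M (\<lambda>x. norm x < r)" for r by measurable
  define a where "a = (\<integral>\<^sup>+x. indicator {x. norm x < R1} x * ennreal (\<Phi> x) \<partial>M)"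
  define k where "k = (\<lambda>x::'a. indicator {x. norm x < R1} x * ennreal (27 / 2 ^ d * \<Phi> x))"
  have "(\<integral>\<^sup>+x. indicator {x. norm x < R2} x * ennreal (exp (h x) * (1 + norm x / sqrt d) * w x) \<partial>M)
    \<le> (\<integral>\<^sup>+x. 5 * (indicator {x. norm x < R1} x * ennreal (\<Phi> x)) + k ((1/2) *\<^sub>R x) \<partial>M)"
  proof (rule nn_integral_mono)
    fix x assume x: "x \<in> S"
    have eq: "exp (h x) * (1 + norm x / sqrt d) * w x = (1 + norm x / sqrt d) * \<Phi> x"
      by (simp add: \<Phi>_def)
    show "indicator {x. norm x < R2} x * ennreal (exp (h x) * (1 + norm x / sqrt d) * w x)
      \<le> 5 * (indicator {x. norm x < R1} x * ennreal (\<Phi> x)) + k ((1/2) *\<^sub>R x)"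
    proof (cases "norm x < R2")
      case R2: True
      show ?thesis
      proof (cases "norm x < 4 * sqrt d")
        case True
        then have "1 + norm x / sqrt d \<le> 5" using sqrt_d by (simp add: field_simps)
        then have "(1 + norm x / sqrt d) * \<Phi> x \<le> 5 * \<Phi> x" by (intro mult_right_mono \<Phi>0) auto
        then have "ennreal ((1 + norm x / sqrt d) * \<Phi> x) \<le> ennreal (5 * \<Phi> x)" by (rule ennreal_leI)
        also have "\<dots> = 5 * ennreal (\<Phi> x)" using \<Phi>0 by (simp add: ennreal_mult)
        finally have "ennreal ((1 + norm x / sqrt d) * \<Phi> x) \<le> 5 * ennreal (\<Phi> x)" .
        moreover have "norm x < R1" using True R by linarith
        ultimately show ?thesis using R2 unfolding eq by (simp add: add_increasing2)
      next
        case False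
        define \<rho> where "\<rho> = norm x / (2 * sqrt d)"
        have \<rho>: "\<rho> \<ge> 2" using False sqrt_d by (simp add: \<rho>_def field_simps)
        have n: "norm x = 2 * \<rho> * sqrt d" using sqrt_d by (simp add: \<rho>_def)
        have n2: "(norm x)\<^sup>2 / 4 = d * \<rho>\<^sup>2"
          by (simp add: n power_mult_distrib)
        have "exp (- (norm x)\<^sup>2 / 4) * (1 + norm x / sqrt d) \<le> exp (- (d * \<rho>\<^sup>2)) * exp (2 * \<rho>)"
        proof (intro mult_mono)
          have "norm x / sqrt d = 2 * \<rho>" using n sqrt_d by simp
          then show "1 + norm x / sqrt d \<le> exp (2 * \<rho>)" using exp_ge_add_one_self[of "2 * \<rho>"] by simp
        qed (use n2 \<rho> sqrt_d in auto)
        \<comment> \<open>One of the \<open>d\<close> copies of \<rho>^2 absorbs the linear term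
          \<open>2 * \<rho>\<close>; the others, each at least 4, pay for the dimension.\<close>
        also have "\<dots> \<le> exp (3 - real d)"
        proof -
          have "\<rho>\<^sup>2 \<ge> 2\<^sup>2" using \<rho> by (intro power_mono) auto
          then have "(real d - 1) * \<rho>\<^sup>2 \<ge> (real d - 1) * 4" using dim_pos by (intro mult_left_mono) auto
          moreover have "(\<rho> - 1)\<^sup>2 \<ge> 0" by simp
          ultimately have "2 * \<rho> - real d * \<rho>\<^sup>2 \<le> 3 - real d"
            using dim_pos by (simp add: power2_eq_square algebra_simps)
          then show ?thesis by (simp flip: exp_add)
        qed
        also have "\<dots> \<le> 27 / 2 ^ d"
        proof -
          have e3: "exp (3::real) \<le> 27"
          proof -
            have "exp (3::real) = exp 1 ^ 3" by (simp flip: exp_of_nat_mult)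
            also have "\<dots> \<le> 3 ^ 3" using exp_le by (intro power_mono) auto
            finally show ?thesis by simp
          qed
          have "(2::real) ^ d \<le> exp 1 ^ d" using exp_ge_add_one_self[of 1] by (intro power_mono) auto
          also have "\<dots> = exp (real d)" by (simp flip: exp_of_nat_mult)
          finally have "exp 3 * 2 ^ d \<le> 27 * exp (real d)" using e3 by (intro mult_mono) auto
          then show ?thesis by (simp add: exp_diff field_simps)
        qed
        finally have num: "exp (- (norm x)\<^sup>2 / 4) * (1 + norm x / sqrt d) \<le> 27 / 2 ^ d" .
        have "(1 + norm x / sqrt d) * \<Phi> x \<le> (1 + norm x / sqrt d) * (\<Phi> ((1/2) *\<^sub>R x) * exp (- (norm x)\<^sup>2 / 4))"
          using half_scale[OF x R2] False sqrt_d unfolding \<Phi>_def by (intro mult_left_mono) auto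
        also have "\<dots> = (exp (- (norm x)\<^sup>2 / 4) * (1 + norm x / sqrt d)) * \<Phi> ((1/2) *\<^sub>R x)" by simp
        also have "\<dots> \<le> 27 / 2 ^ d * \<Phi> ((1/2) *\<^sub>R x)"
          by (intro mult_right_mono num \<Phi>0)
        finally have "ennreal ((1 + norm x / sqrt d) * \<Phi> x) \<le> ennreal (27 / 2 ^ d * \<Phi> ((1/2) *\<^sub>R x))"
          by (rule ennreal_leI)
        moreover have "norm ((1/2) *\<^sub>R x) < R1" using R2 R by simp
        ultimately show ?thesis using R2 unfolding eq k_def by (simp add: add_increasing)
      qed
    qed simp
  qed
  also have "\<dots> = 5 * a + (\<integral>\<^sup>+x. k ((1/2) *\<^sub>R x) \<partial>M)"
    unfolding a_def k_def by (subst nn_integral_add, measurable) (subst nn_integral_cmult, auto)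
  also have "(\<integral>\<^sup>+x. k ((1/2) *\<^sub>R x) \<partial>M) = ennreal (1 / (1/2) ^ d) * (\<integral>\<^sup>+x. k x \<partial>M)"
    by (rule scaling) (auto simp: k_def)
  also have "(\<integral>\<^sup>+x. k x \<partial>M) = ennreal (27 / 2 ^ d) * a"
    unfolding k_def a_def using \<Phi>0
    by (subst nn_integral_cmult[symmetric]) (auto simp: ennreal_mult indicator_def intro!: nn_integral_cong simp flip: ennreal_mult)
  also have "ennreal (1 / (1/2) ^ d) * (ennreal (27 / 2 ^ d) * a) = 27 * a"
  proof -
    have "ennreal (1 / (1/2) ^ d) * ennreal (27 / 2 ^ d) = 27"
      by (subst ennreal_mult[symmetric]) (auto simp: field_simps power_divide)
    then show ?thesis by (simp add: mult.assoc[symmetric])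
  qed
  also have "5 * a + 27 * a = 32 * a" by (simp flip: distrib_right)
  finally show ?thesis by (simp add: a_def \<Phi>_def)
qed

section \<open>Mass, oscillation and the comparison of normalised measures\<close>

lemma h_bound:
  assumes x: "x \<in> S" "norm x \<le> r" "norm x < R2"
  shows "\<bar>h x\<bar> \<le> \<eta> * (r + r\<^sup>2 / (2 * sqrt d))"
proof -
  have "\<bar>h x\<bar> \<le> \<eta> * (norm x + (norm x)\<^sup>2 / (2 * sqrt d))"
    using h_ray[of x 0] x h_0 by (simp add: R2_def)
  also have "\<dots> \<le> \<eta> * (r + r\<^sup>2 / (2 * sqrt d))"
    using x \<eta> sqrt_d by (intro mult_left_mono add_mono divide_right_mono power_mono) auto
  finally show ?thesis .
qed

text \<open>On the ball of radius \<open>2 * sqrt d\<close>, which carries a quarter of the Gaussian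
  mass, \<open>h\<close> is at least \<open>- sqrt d\<close>.\<close>

lemma mass_lower_bound:
  "ennreal (exp (- sqrt d) / 4 * Z) \<le> (\<integral>\<^sup>+x. indicator {x. norm x < R1} x * ennreal (exp (h x) * w x) \<partial>M)"
proof -
  have "ennreal (exp (- sqrt d) / 4 * Z) = ennreal (exp (- sqrt d)) * ennreal (Z / 4)"
    using Z_pos by (simp flip: ennreal_mult)
  also have "\<dots> \<le> ennreal (exp (- sqrt d)) * (\<integral>\<^sup>+x. indicator {x. norm x < 2 * sqrt d} x * ennreal (w x) \<partial>M)"
    by (intro mult_left_mono gaussian_ball_mass) simp
  also have "\<dots> = (\<integral>\<^sup>+x. ennreal (exp (- sqrt d)) * (indicator {x. norm x < 2 * sqrt d} x * ennreal (w x)) \<partial>M)"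
    by (rule nn_integral_cmult[symmetric]) measurable
  also have "\<dots> \<le> (\<integral>\<^sup>+x. indicator {x. norm x < R1} x * ennreal (exp (h x) * w x) \<partial>M)"
  proof (rule nn_integral_mono)
    fix x assume x: "x \<in> S"
    show "ennreal (exp (- sqrt d)) * (indicator {x. norm x < 2 * sqrt d} x * ennreal (w x))
      \<le> indicator {x. norm x < R1} x * ennreal (exp (h x) * w x)"
    proof (cases "norm x < 2 * sqrt d")
      case True
      then have n: "norm x < R1" "norm x < R2" using R sqrt_d by linarith+
      have "\<bar>h x\<bar> \<le> \<eta> * (2 * sqrt d + (2 * sqrt d)\<^sup>2 / (2 * sqrt d))"
        using True x n by (intro h_bound) auto
      also have "(2 * sqrt d)\<^sup>2 / (2 * sqrt d) = 2 * sqrt d"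
        unfolding power2_eq_square using sqrt_d(2) by (intro nonzero_mult_div_cancel_right) simp
      also have "\<eta> * (2 * sqrt d + 2 * sqrt d) \<le> 1 / 4 * (2 * sqrt d + 2 * sqrt d)"
        using \<eta> by (intro mult_right_mono) auto
      finally have "- sqrt d \<le> h x" by simp
      then have "exp (- sqrt d) * w x \<le> exp (h x) * w x" by (intro mult_right_mono) auto
      then show ?thesis using True n by (simp add: ennreal_leI flip: ennreal_mult)
    qed simp
  qed
  finally show ?thesis .
qed

text \<open>A qualitative bound: it makes \<open>exp h\<close> bounded and integrable on the ball
  and enters no constant.\<close>

definition h_max :: real where "h_max = \<eta> * (R2 + R2\<^sup>2 / (2 * sqrt d))"

lemma h_le_max: "x \<in> S \<Longrightarrow> norm x < R2 \<Longrightarrow> \<bar>h x\<bar> \<le> h_max"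
  unfolding h_max_def by (rule h_bound) auto

text \<open>\<open>maurey_pisier\<close> for \<open>exp h\<close>, whose gradient is at most
  \<open>\<eta> * exp h\<close> times the weight in \<open>moment_bound\<close>. The constant is 256
  = 8 * 32, since \<pi> times the root of e is below 8.\<close>

lemma oscillation_bound:
  "(\<integral>\<^sup>+p. indicator {p. norm (fst p) < R1 \<and> norm (snd p) < R1} p *
      ennreal (\<bar>exp (h (fst p)) - exp (h (snd p))\<bar> * w (fst p) * w (snd p)) \<partial>(M \<Otimes>\<^sub>M M))
    \<le> ennreal (256 * Z * \<eta>) * (\<integral>\<^sup>+x. indicator {x. norm x < R1} x * ennreal (exp (h x) * w x) \<partial>M)"
proof -
  have "(\<integral>\<^sup>+p. indicator {p. norm (fst p) < R1 \<and> norm (snd p) < R1} p *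
      ennreal (\<bar>exp (h (fst p)) - exp (h (snd p))\<bar> * w (fst p) * w (snd p)) \<partial>(M \<Otimes>\<^sub>M M))
    \<le> ennreal (pi * exp (1 / 2) * Z) * (\<integral>\<^sup>+x. indicator {x. norm x < R2} x *
        ennreal (norm (exp (h x) *\<^sub>R g x) * w x) \<partial>M)"
  proof (rule maurey_pisier[where B = "exp h_max * (\<eta> * (1 + R2 / sqrt d))"])
    fix x assume x: "x \<in> S" "norm x < R2"
    have "(h has_derivative (\<lambda>u. inner (g x) u)) (at x within S)"
      using x by (intro h_deriv) (auto simp: R2_def)
    then show "((\<lambda>x. exp (h x)) has_derivative (\<lambda>u. inner (exp (h x) *\<^sub>R g x) u)) (at x within S)"
      by (auto intro!: derivative_eq_intros simp: algebra_simps)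
    have "norm (g x) \<le> \<eta> * (1 + norm x / sqrt d)" using x by (intro g_bound) (auto simp: R2_def)
    also have "\<dots> \<le> \<eta> * (1 + R2 / sqrt d)"
      using \<eta> x sqrt_d by (intro mult_left_mono add_left_mono divide_right_mono) auto
    finally show "norm (exp (h x) *\<^sub>R g x) \<le> exp h_max * (\<eta> * (1 + R2 / sqrt d))"
      using h_le_max[OF x] by (auto intro!: mult_mono)
  qed (use R in auto)
  also have "\<dots> \<le> ennreal (pi * exp (1 / 2) * Z) * (\<integral>\<^sup>+x. ennreal \<eta> * (indicator {x. norm x < R2} x *
        ennreal (exp (h x) * (1 + norm x / sqrt d) * w x)) \<partial>M)"
  proof (intro mult_left_mono nn_integral_mono)
    fix x assume x: "x \<in> S"
    show "indicator {x. norm x < R2} x * ennreal (norm (exp (h x) *\<^sub>R g x) * w x)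
      \<le> ennreal \<eta> * (indicator {x. norm x < R2} x * ennreal (exp (h x) * (1 + norm x / sqrt d) * w x))"
    proof (cases "norm x < R2")
      case True
      then have "norm (g x) \<le> \<eta> * (1 + norm x / sqrt d)" using x by (intro g_bound) (auto simp: R2_def)
      then have "exp (h x) * norm (g x) * w x \<le> exp (h x) * (\<eta> * (1 + norm x / sqrt d)) * w x"
        by (intro mult_right_mono mult_left_mono) auto
      then have "norm (exp (h x) *\<^sub>R g x) * w x \<le> \<eta> * (exp (h x) * (1 + norm x / sqrt d) * w x)"
        by (simp add: mult_ac)
      then show ?thesis using True \<eta> sqrt_d by (simp add: ennreal_leI flip: ennreal_mult)
    qed simp
  qed simp
  also have "\<dots> = ennreal (pi * exp (1 / 2) * Z) * (ennreal \<eta> * (\<integral>\<^sup>+x. indicator {x. norm x < R2} x *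
        ennreal (exp (h x) * (1 + norm x / sqrt d) * w x) \<partial>M))"
    by (subst nn_integral_cmult) measurable
  also have "\<dots> \<le> ennreal (8 * Z) * (ennreal \<eta> * (32 *
      (\<integral>\<^sup>+x. indicator {x. norm x < R1} x * ennreal (exp (h x) * w x) \<partial>M)))"
  proof (intro mult_mono moment_bound ennreal_leI mult_right_mono)
    have "exp (1 / 2 :: real) \<le> 2"
    proof (rule power2_le_imp_le)
      show "(exp (1 / 2 :: real))\<^sup>2 \<le> 2\<^sup>2" using exp_le by (simp flip: exp_double)
    qed simp
    then have "pi * exp (1 / 2) \<le> 4 * 2" using pi_less_4 by (intro mult_mono) auto
    then show "pi * exp (1 / 2) \<le> 8" by simp
  qed (use Z_pos in auto)
  also have "\<dots> = ennreal (8 * Z) * ennreal \<eta> * 32 *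
      (\<integral>\<^sup>+x. indicator {x. norm x < R1} x * ennreal (exp (h x) * w x) \<partial>M)" by (simp add: mult_ac)
  also have "ennreal (8 * Z) * ennreal \<eta> * 32 = ennreal (256 * Z * \<eta>)"
  proof -
    have num: "(32 :: ennreal) = ennreal 32" by simp
    show ?thesis unfolding num using Z_pos \<eta> by (simp add: mult_ac flip: ennreal_mult del: ennreal_numeral)
  qed
  finally show ?thesis .
qed

text \<open>The normalised densities are compared on the ball of radius \<open>R1\<close>; the shell
  between \<open>R1\<close> and \<open>R2\<close> is needed for the arcs, and there
  \<open>f_ball\<close> and \<open>f_tail\<close> both apply. \<open>K\<close> is carried by the
  tail alone, so it appears only with the exponentially small term.\<close>

theorem normalised_comparison:
  fixes f :: "'a \<Rightarrow> real"
  assumes f_measurable [measurable]: "f \<in> borel_measurable M" and f_nonneg: "\<And>x. f x \<ge> 0"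
    and f_ball: "\<And>x. x \<in> S \<Longrightarrow> norm x < R2 \<Longrightarrow> f x = exp (h x) * w x"
    and f_tail: "\<And>x. x \<in> S \<Longrightarrow> R1 \<le> norm x \<Longrightarrow> f x \<le> K * exp (s * sqrt d / 5 * (1 - norm x))"
    and K: "K \<ge> 1"
  shows "integrable M f" "(\<integral>x. f x \<partial>M) > 0" "integrable M w" "(\<integral>x. w x \<partial>M) = Z"
    "\<And>B. B \<in> sets M \<Longrightarrow>
      \<bar>(\<integral>x. indicator B x * f x \<partial>M) / (\<integral>x. f x \<partial>M) - (\<integral>x. indicator B x * w x \<partial>M) / Z\<bar>
      \<le> 1024 * (\<eta> + K * exp (- (d * (s / 12)\<^sup>2)))"
proof -
  define E where "E = exp (- (d * (s / 12)\<^sup>2))"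
  define \<phi> where "\<phi> = (\<lambda>x. exp (h x))"
  have [measurable]: "\<phi> \<in> borel_measurable M" unfolding \<phi>_def by measurable
  define I where "I = (\<lambda>x::'a. indicator {x. norm x < R1} x :: real)"
  define J where "J = (\<lambda>x::'a. indicator {x. R1 \<le> norm x} x :: real)"
  have I [measurable]: "I \<in> borel_measurable M" unfolding I_def by measurable
  have J [measurable]: "J \<in> borel_measurable M" unfolding J_def by measurable
  have IJ: "I x + J x = 1" "0 \<le> I x" "0 \<le> J x" "I x \<le> 1" "J x \<le> 1" for x
    by (auto simp: I_def J_def indicator_def)
  \<comment> \<open>The exponents met below: the decay of \<open>f\<close> beyond \<open>R1\<close>
    against the volume factors and the mass lower bound, and the Gaussian tail at \<open>R1\<close>.
    Both use \<open>s \<ge> 12\<close> to leave a margin of (s/12)^2 per dimension.\<close>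
  have exps: "s * sqrt d / 5 + sqrt d + d + d / 2 - 7 / 100 * s\<^sup>2 * d \<le> - (d * (s / 12)\<^sup>2)"
    "d - 49 / 400 * s\<^sup>2 * d \<le> - (d * (s / 12)\<^sup>2)"
  proof -
    have s1: "12 * s \<le> s\<^sup>2" unfolding power2_eq_square using s by (intro mult_right_mono) auto
    have s2: "144 \<le> s\<^sup>2" using s1 s by linarith
    have "s * sqrt d \<le> s * d" using sqrt_d(4) s by (intro mult_left_mono) auto
    then have "s * sqrt d / 5 + sqrt d + d + d / 2 \<le> s * d / 5 + d + d + d / 2"
      using sqrt_d(4) by linarith
    also have "\<dots> = d * (s / 5 + 5 / 2)" by (simp add: field_simps)
    also have "\<dots> \<le> d * (7 / 100 * s\<^sup>2 - (s / 12)\<^sup>2)"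
      using s1 s2 by (intro mult_left_mono) (auto simp: power_divide)
    finally show "s * sqrt d / 5 + sqrt d + d + d / 2 - 7 / 100 * s\<^sup>2 * d \<le> - (d * (s / 12)\<^sup>2)"
      by (simp add: algebra_simps)
    have "real d * 1 \<le> real d * (49 / 400 * s\<^sup>2 - (s / 12)\<^sup>2)"
      using s2 by (intro mult_left_mono) (auto simp: power_divide)
    then show "d - 49 / 400 * s\<^sup>2 * d \<le> - (d * (s / 12)\<^sup>2)" by (simp add: algebra_simps)
  qed
  have two: "(2::real) ^ d \<le> exp d"
  proof -
    have "(2::real) ^ d \<le> exp 1 ^ d" using exp_ge_add_one_self[of 1] by (intro power_mono) auto
    then show ?thesis by (simp flip: exp_of_nat_mult)
  qed
  show w_int: "integrable M w"
    using integral_w Z_pos by (intro integrableI_nonneg) auto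
  show w_integral: "(\<integral>x. w x \<partial>M) = Z"
    using integral_w Z_pos by (subst integral_eq_nn_integral) auto
  have tail_nn: "(\<integral>\<^sup>+x. ennreal (J x * f x) \<partial>M) \<le> ennreal (3 * K * exp (- sqrt d) * E * Z)"
  proof -
    \<comment> \<open>Half of the decay rate is spent at the radius \<open>R1\<close>, which yields
      7/100 s^2 d; the other half, of rate s/10 sqrt d, is at least 6/5 sqrt d because
      \<open>s \<ge> 12\<close> and is integrated by \<open>exp_norm_integral\<close>.\<close>
    have pw: "J x * f x \<le> K * exp (s * sqrt d / 5 - 7 / 100 * s\<^sup>2 * d) * exp (- (s / 10 * sqrt d) * norm x)"
      if x: "x \<in> S" for x
    proof (cases "R1 \<le> norm x")
      case True
      have "f x \<le> K * exp (s * sqrt d / 5 * (1 - norm x))" by (rule f_tail[OF x True])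
      also have "\<dots> \<le> K * exp ((s * sqrt d / 5 - 7 / 100 * s\<^sup>2 * d) + - (s / 10 * sqrt d) * norm x)"
      proof -
        have "s * sqrt d / 10 * R1 \<le> s * sqrt d / 10 * norm x"
          using True s sqrt_d by (intro mult_left_mono) auto
        moreover have "s * sqrt d / 10 * R1 = 7 / 100 * s\<^sup>2 * (sqrt d * sqrt d)"
          unfolding R1_def power2_eq_square by simp
        moreover have "s * sqrt d / 5 * (1 - norm x) = s * sqrt d / 5 - 2 * (s * sqrt d / 10 * norm x)"
          "- (s / 10 * sqrt d) * norm x = - (s * sqrt d / 10 * norm x)"
          by (simp_all add: field_simps)
        ultimately have "s * sqrt d / 5 * (1 - norm x)
            \<le> (s * sqrt d / 5 - 7 / 100 * s\<^sup>2 * d) + - (s / 10 * sqrt d) * norm x"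
          unfolding sqrt_d(3) by linarith
        then show ?thesis using K by (intro mult_left_mono) auto
      qed
      also have "f x = J x * f x" using True by (simp add: J_def)
      finally show ?thesis by (simp only: exp_add mult.assoc)
    qed (use K in \<open>simp add: J_def\<close>)
    have "(\<integral>\<^sup>+x. ennreal (J x * f x) \<partial>M) \<le> (\<integral>\<^sup>+x. ennreal (K * exp (s * sqrt d / 5 - 7 / 100 * s\<^sup>2 * d)) *
        ennreal (exp (- (s / 10 * sqrt d) * norm x)) \<partial>M)"
      using pw K by (intro nn_integral_mono) (auto intro!: ennreal_leI simp flip: ennreal_mult)
    also have "\<dots> = ennreal (K * exp (s * sqrt d / 5 - 7 / 100 * s\<^sup>2 * d)) *
        (\<integral>\<^sup>+x. ennreal (exp (- (s / 10 * sqrt d) * norm x)) \<partial>M)"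
      by (rule nn_integral_cmult) measurable
    also have "\<dots> \<le> ennreal (K * exp (s * sqrt d / 5 - 7 / 100 * s\<^sup>2 * d)) * ennreal (3 * 2 ^ d * exp (d / 2) * Z)"
      using s sqrt_d by (intro mult_left_mono exp_norm_integral mult_right_mono) auto
    also have "\<dots> = ennreal (3 * K * Z * (exp (s * sqrt d / 5 - 7 / 100 * s\<^sup>2 * d) * 2 ^ d * exp (d / 2)))"
      using K Z_pos by (simp add: mult_ac flip: ennreal_mult)
    also have "\<dots> \<le> ennreal (3 * K * Z * (exp (- sqrt d) * E))"
    proof (intro ennreal_leI mult_left_mono)
      have "exp (s * sqrt d / 5 - 7 / 100 * s\<^sup>2 * d) * 2 ^ d * exp (d / 2)
          \<le> exp (s * sqrt d / 5 - 7 / 100 * s\<^sup>2 * d) * exp d * exp (d / 2)"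
        using two by (intro mult_right_mono mult_left_mono) auto
      also have "\<dots> \<le> exp (- sqrt d) * E"
        using exps(1) unfolding E_def by (simp flip: exp_add)
      finally show "exp (s * sqrt d / 5 - 7 / 100 * s\<^sup>2 * d) * 2 ^ d * exp (d / 2) \<le> exp (- sqrt d) * E" .
    qed (use K Z_pos in auto)
    finally show ?thesis by (simp add: mult_ac)
  qed
  have gtail: "(\<integral>\<^sup>+x. ennreal (J x * w x) \<partial>M) \<le> ennreal (E * Z)"
  proof -
    have "(\<integral>\<^sup>+x. ennreal (J x * w x) \<partial>M) = (\<integral>\<^sup>+x. indicator {x. R1 \<le> norm x} x * ennreal (w x) \<partial>M)"
      by (intro nn_integral_cong) (auto simp: J_def indicator_def)
    also have "\<dots> \<le> ennreal (exp (- R1\<^sup>2 / 4) * sqrt 2 ^ d * Z)"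
      using R by (intro gaussian_tail) auto
    also have "\<dots> \<le> ennreal (E * Z)"
    proof (intro ennreal_leI mult_right_mono)
      have "sqrt 2 ^ d \<le> (2::real) ^ d" by (intro power_mono) (auto simp: real_sqrt_le_iff intro: real_le_lsqrt)
      then have "exp (- R1\<^sup>2 / 4) * sqrt 2 ^ d \<le> exp (- R1\<^sup>2 / 4) * exp d"
        using two by (intro mult_left_mono) auto
      also have "\<dots> \<le> E"
      proof -
        have "R1\<^sup>2 / 4 = 49 / 400 * s\<^sup>2 * d" by (simp add: R1_def power_mult_distrib power_divide)
        then show ?thesis using exps(2) unfolding E_def by (simp flip: exp_add)
      qed
      finally show "exp (- R1\<^sup>2 / 4) * sqrt 2 ^ d \<le> E" .
    qed (use Z_pos in auto)
    finally show ?thesis .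
  qed
  have If: "I x * f x = I x * (\<phi> x * w x)" if "x \<in> S" for x
    using f_ball[OF that] R by (auto simp: I_def \<phi>_def indicator_def)
  have I\<phi>: "I x * \<phi> x \<le> exp h_max" if "x \<in> S" for x
    using h_le_max[OF that] R by (auto simp: I_def \<phi>_def indicator_def)
  have int_If: "integrable M (\<lambda>x. I x * f x)"
  proof (rule Bochner_Integration.integrable_bound[where f = "\<lambda>x. exp h_max * w x"])
    show "AE x in M. norm (I x * f x) \<le> norm (exp h_max * w x)"
    proof (rule AE_I2)
      fix x assume x: "x \<in> S"
      have "I x * f x = (I x * \<phi> x) * w x" using If[OF x] by simp
      also have "\<dots> \<le> exp h_max * w x" by (intro mult_right_mono I\<phi>[OF x]) simp
      finally show "norm (I x * f x) \<le> norm (exp h_max * w x)"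
        using f_nonneg[of x] IJ[of x] by simp
    qed
  qed (use w_int in auto)
  have int_Jf: "integrable M (\<lambda>x. J x * f x)"
    using tail_nn IJ f_nonneg by (intro integrableI_nonneg) (auto simp: le_less_trans)
  have split: "f x = I x * f x + J x * f x" "w x = I x * w x + J x * w x" for x
    using IJ(1)[of x] by (metis distrib_right mult_1)+
  show f_int: "integrable M f"
    by (subst split(1)[abs_def]) (intro Bochner_Integration.integrable_add int_If int_Jf)
  have int_bd: "integrable M (\<lambda>x. b x * u x)"
    if "integrable M u" "b \<in> borel_measurable M" "\<And>x. 0 \<le> b x" "\<And>x. b x \<le> 1" for b u :: "'a \<Rightarrow> real"
    by (rule Bochner_Integration.integrable_bound[OF that(1)])
      (use that in \<open>auto simp: abs_mult intro!: mult_left_le_one_le\<close>)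
  have int_Iw: "integrable M (\<lambda>x. I x * w x)" and int_Jw: "integrable M (\<lambda>x. J x * w x)"
    using IJ by (auto intro!: int_bd[OF w_int])
  define a where "a = (\<integral>x. I x * f x \<partial>M)"
  define t where "t = (\<integral>x. J x * f x \<partial>M)"
  define p where "p = (\<integral>x. I x * w x \<partial>M)"
  define q where "q = (\<integral>x. J x * w x \<partial>M)"
  have a_nn: "ennreal a = (\<integral>\<^sup>+x. indicator {x. norm x < R1} x * ennreal (exp (h x) * w x) \<partial>M)"
  proof -
    have "ennreal a = (\<integral>\<^sup>+x. ennreal (I x * f x) \<partial>M)"
      unfolding a_def using int_If IJ f_nonneg by (intro nn_integral_eq_integral[symmetric]) auto
    also have "\<dots> = (\<integral>\<^sup>+x. indicator {x. norm x < R1} x * ennreal (exp (h x) * w x) \<partial>M)"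
      by (intro nn_integral_cong) (simp add: If, simp add: I_def \<phi>_def indicator_def)
    finally show ?thesis .
  qed
  have a0: "a \<ge> 0" unfolding a_def using IJ f_nonneg by (intro integral_nonneg_AE) auto
  have a_ge: "a \<ge> exp (- sqrt d) / 4 * Z"
    using mass_lower_bound a0 unfolding a_nn[symmetric] by (subst (asm) ennreal_le_iff) auto
  have a_pos: "a > 0" by (rule less_le_trans[OF _ a_ge]) (use Z_pos in simp)
  have p_nn: "ennreal p = (\<integral>\<^sup>+x. indicator {x. norm x < R1} x * ennreal (w x) \<partial>M)"
  proof -
    have "ennreal p = (\<integral>\<^sup>+x. ennreal (I x * w x) \<partial>M)"
      unfolding p_def using int_Iw IJ by (intro nn_integral_eq_integral[symmetric]) auto
    also have "\<dots> = (\<integral>\<^sup>+x. indicator {x. norm x < R1} x * ennreal (w x) \<partial>M)"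
      by (intro nn_integral_cong) (simp add: I_def indicator_def)
    finally show ?thesis .
  qed
  have p0: "p \<ge> 0" unfolding p_def using IJ by (intro integral_nonneg_AE) auto
  have p_ge: "p \<ge> Z / 4"
  proof -
    have "ennreal (Z / 4) \<le> ennreal p"
      unfolding p_nn using R sqrt_d
      by (intro order_trans[OF gaussian_ball_mass] nn_integral_mono mult_right_mono) (auto simp: indicator_def)
    then show ?thesis using p0 by (subst (asm) ennreal_le_iff) auto
  qed
  have p_pos: "p > 0" using p_ge Z_pos by auto
  have t_le: "0 \<le> t" "t \<le> 3 * K * exp (- sqrt d) * E * Z"
  proof -
    show "0 \<le> t" unfolding t_def using IJ f_nonneg by (intro integral_nonneg_AE) auto
    have "ennreal t = (\<integral>\<^sup>+x. ennreal (J x * f x) \<partial>M)"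
      unfolding t_def using int_Jf IJ f_nonneg by (intro nn_integral_eq_integral[symmetric]) auto
    then have "ennreal t \<le> ennreal (3 * K * exp (- sqrt d) * E * Z)" using tail_nn by simp
    then show "t \<le> 3 * K * exp (- sqrt d) * E * Z"
      using K Z_pos by (subst (asm) ennreal_le_iff) (auto simp: E_def)
  qed
  have q_le: "0 \<le> q" "q \<le> E * Z"
  proof -
    show "0 \<le> q" unfolding q_def using IJ by (intro integral_nonneg_AE) auto
    have "ennreal q = (\<integral>\<^sup>+x. ennreal (J x * w x) \<partial>M)"
      unfolding q_def using int_Jw IJ by (intro nn_integral_eq_integral[symmetric]) auto
    then have "ennreal q \<le> ennreal (E * Z)" using gtail by simp
    then show "q \<le> E * Z" using Z_pos by (subst (asm) ennreal_le_iff) (auto simp: E_def)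
  qed
  have f_sum: "(\<integral>x. f x \<partial>M) = a + t"
    unfolding a_def t_def Bochner_Integration.integral_add[OF int_If int_Jf, symmetric] split(1)[symmetric] ..
  have w_sum: "Z = p + q"
    unfolding w_integral[symmetric] p_def q_def
      Bochner_Integration.integral_add[OF int_Iw int_Jw, symmetric] split(2)[symmetric] ..
  show "(\<integral>x. f x \<partial>M) > 0" using f_sum a_pos t_le by simp
  \<comment> \<open>The L1 distance of the two densities on the ball with the denominators
    \<open>a\<close> and \<open>p\<close> cleared; it dominates the difference for every set
    \<open>B\<close> at once.\<close>
  define D where "D = (\<integral>x. I x * w x * \<bar>\<phi> x * p - a\<bar> \<partial>M)"
  have int_D: "integrable M (\<lambda>x. I x * w x * \<bar>\<phi> x * p - a\<bar>)"
  proof (rule Bochner_Integration.integrable_bound[where f = "\<lambda>x. p * (I x * f x) + a * (I x * w x)"])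
    show "AE x in M. norm (I x * w x * \<bar>\<phi> x * p - a\<bar>) \<le> norm (p * (I x * f x) + a * (I x * w x))"
    proof (rule AE_I2)
      fix x assume x: "x \<in> S"
      have "\<bar>\<phi> x * p - a\<bar> \<le> \<phi> x * p + a" using a_pos p_pos by (simp add: \<phi>_def abs_le_iff add_pos_pos less_imp_le)
      then have "I x * w x * \<bar>\<phi> x * p - a\<bar> \<le> I x * w x * (\<phi> x * p + a)"
        using IJ by (intro mult_left_mono) auto
      also have "\<dots> = p * (I x * f x) + a * (I x * w x)" by (simp add: If[OF x] algebra_simps)
      finally show "norm (I x * w x * \<bar>\<phi> x * p - a\<bar>) \<le> norm (p * (I x * f x) + a * (I x * w x))"
        using IJ[of x] f_nonneg[of x] a_pos p_pos by simp
    qed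
  qed (intro Bochner_Integration.integrable_add integrable_mult_right int_If int_Iw, measurable)
  have D_le: "D \<le> 256 * Z * \<eta> * a"
  proof -
    have "ennreal D = (\<integral>\<^sup>+x. ennreal (I x * w x * \<bar>\<phi> x * p - a\<bar>) \<partial>M)"
      unfolding D_def using int_D IJ by (intro nn_integral_eq_integral[symmetric]) auto
    also have "\<dots> \<le> (\<integral>\<^sup>+x. \<integral>\<^sup>+y. ennreal (I x * I y * (\<bar>\<phi> x - \<phi> y\<bar> * w x * w y)) \<partial>M \<partial>M)"
    proof (rule nn_integral_mono)
      fix x assume x: "x \<in> S"
      have int_y: "integrable M (\<lambda>y. \<phi> x * (I y * w y) - I y * f y)"
        by (intro Bochner_Integration.integrable_diff integrable_mult_right int_If int_Iw)
      \<comment> \<open>Both ball masses are integrals over the same variable \<open>y\<close>, so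
        their difference is an average of \<open>\<phi> x - \<phi> y\<close>, and the double
        integral of \<open>oscillation_bound\<close> appears.\<close>
      have "\<phi> x * p - a = (\<integral>y. \<phi> x * (I y * w y) - I y * f y \<partial>M)"
        unfolding p_def a_def using int_If int_Iw by simp
      also have "\<bar>\<dots>\<bar> \<le> (\<integral>y. \<bar>\<phi> x * (I y * w y) - I y * f y\<bar> \<partial>M)" by (rule integral_abs_bound)
      finally have "I x * w x * \<bar>\<phi> x * p - a\<bar> \<le> I x * w x * (\<integral>y. \<bar>\<phi> x * (I y * w y) - I y * f y\<bar> \<partial>M)"
        using IJ by (intro mult_left_mono) auto
      then have "ennreal (I x * w x * \<bar>\<phi> x * p - a\<bar>)
        \<le> ennreal (I x * w x) * ennreal (\<integral>y. \<bar>\<phi> x * (I y * w y) - I y * f y\<bar> \<partial>M)"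
        using IJ by (subst ennreal_mult[symmetric]) (auto intro: ennreal_leI)
      also have "ennreal (\<integral>y. \<bar>\<phi> x * (I y * w y) - I y * f y\<bar> \<partial>M) = (\<integral>\<^sup>+y. ennreal \<bar>\<phi> x * (I y * w y) - I y * f y\<bar> \<partial>M)"
        using int_y by (intro nn_integral_eq_integral[symmetric]) auto
      also have "ennreal (I x * w x) * \<dots> = (\<integral>\<^sup>+y. ennreal (I x * w x) * ennreal \<bar>\<phi> x * (I y * w y) - I y * f y\<bar> \<partial>M)"
        by (rule nn_integral_cmult[symmetric]) measurable
      also have "\<dots> = (\<integral>\<^sup>+y. ennreal (I x * I y * (\<bar>\<phi> x - \<phi> y\<bar> * w x * w y)) \<partial>M)"
      proof (rule nn_integral_cong)
        fix y assume y: "y \<in> S"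
        have "\<phi> x * (I y * w y) - I y * f y = (I y * w y) * (\<phi> x - \<phi> y)"
          by (simp add: If[OF y] algebra_simps)
        then have "\<bar>\<phi> x * (I y * w y) - I y * f y\<bar> = I y * w y * \<bar>\<phi> x - \<phi> y\<bar>"
          using IJ[of y] by (simp add: abs_mult)
        then show "ennreal (I x * w x) * ennreal \<bar>\<phi> x * (I y * w y) - I y * f y\<bar>
            = ennreal (I x * I y * (\<bar>\<phi> x - \<phi> y\<bar> * w x * w y))"
          using IJ by (simp add: mult_ac flip: ennreal_mult)
      qed
      finally show "ennreal (I x * w x * \<bar>\<phi> x * p - a\<bar>)
        \<le> (\<integral>\<^sup>+y. ennreal (I x * I y * (\<bar>\<phi> x - \<phi> y\<bar> * w x * w y)) \<partial>M)" .
    qed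
    also have "\<dots> = (\<integral>\<^sup>+z. ennreal (I (fst z) * I (snd z) * (\<bar>\<phi> (fst z) - \<phi> (snd z)\<bar> * w (fst z) * w (snd z))) \<partial>(M \<Otimes>\<^sub>M M))"
      by (subst nn_integral_fst[symmetric]) auto
    also have "\<dots> = (\<integral>\<^sup>+p. indicator {p. norm (fst p) < R1 \<and> norm (snd p) < R1} p *
      ennreal (\<bar>exp (h (fst p)) - exp (h (snd p))\<bar> * w (fst p) * w (snd p)) \<partial>(M \<Otimes>\<^sub>M M))"
      by (intro nn_integral_cong) (auto simp: I_def \<phi>_def indicator_def)
    also have "\<dots> \<le> ennreal (256 * Z * \<eta>) * ennreal a" unfolding a_nn by (rule oscillation_bound)
    also have "\<dots> = ennreal (256 * Z * \<eta> * a)" using Z_pos \<eta> a0 by (simp flip: ennreal_mult)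
    finally show ?thesis using Z_pos \<eta> a0 by (subst (asm) ennreal_le_iff) auto
  qed
  fix B assume B [measurable]: "B \<in> sets M"
  define b where "b = (\<lambda>x. indicator B x :: real)"
  have b: "b \<in> borel_measurable M" "0 \<le> b x" "b x \<le> 1" for x unfolding b_def by auto
  note [measurable] = b(1)
  define aB where "aB = (\<integral>x. b x * (I x * f x) \<partial>M)"
  define tB where "tB = (\<integral>x. b x * (J x * f x) \<partial>M)"
  define pB where "pB = (\<integral>x. b x * (I x * w x) \<partial>M)"
  define qB where "qB = (\<integral>x. b x * (J x * w x) \<partial>M)"
  note bint = int_bd[OF int_If b] int_bd[OF int_Jf b] int_bd[OF int_Iw b] int_bd[OF int_Jw b]
  have main: "\<bar>(aB + tB) / (a + t) - (pB + qB) / (p + q)\<bar> \<le> D / (a * p) + t / a + q / p"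
  proof (rule normalised_difference_bound[OF a_pos p_pos])
    show "0 \<le> aB" "0 \<le> tB" "0 \<le> pB" "0 \<le> qB"
      unfolding aB_def tB_def pB_def qB_def using b IJ f_nonneg by (auto intro!: integral_nonneg_AE)
    show "aB \<le> a" "tB \<le> t" "pB \<le> p" "qB \<le> q"
      unfolding aB_def tB_def pB_def qB_def a_def t_def p_def q_def
      using b IJ f_nonneg int_If int_Jf int_Iw int_Jw bint
      by (auto intro!: integral_mono mult_left_le_one_le)
    have diff: "aB * p - a * pB = (\<integral>x. b x * (I x * f x) * p - a * (b x * (I x * w x)) \<partial>M)"
      unfolding aB_def pB_def using bint by simp
    have "\<bar>aB * p - a * pB\<bar> \<le> (\<integral>x. \<bar>b x * (I x * f x) * p - a * (b x * (I x * w x))\<bar> \<partial>M)"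
      unfolding diff by (rule integral_abs_bound)
    also have "\<dots> \<le> D"
      unfolding D_def
    proof (rule integral_mono[OF _ int_D])
      show "integrable M (\<lambda>x. \<bar>b x * (I x * f x) * p - a * (b x * (I x * w x))\<bar>)"
        by (intro integrable_abs Bochner_Integration.integrable_diff integrable_mult_right
            integrable_mult_left bint)
    next
      fix x assume x: "x \<in> S"
      have "b x * (I x * f x) * p - a * (b x * (I x * w x)) = b x * (I x * w x * (\<phi> x * p - a))"
        by (simp add: If[OF x] algebra_simps)
      then have "\<bar>b x * (I x * f x) * p - a * (b x * (I x * w x))\<bar> = b x * (I x * w x * \<bar>\<phi> x * p - a\<bar>)"
        using b IJ by (simp add: abs_mult)
      also have "\<dots> \<le> I x * w x * \<bar>\<phi> x * p - a\<bar>" using b IJ by (intro mult_left_le_one_le) auto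
      finally show "\<bar>b x * (I x * f x) * p - a * (b x * (I x * w x))\<bar> \<le> I x * w x * \<bar>\<phi> x * p - a\<bar>" .
    qed
    finally show "\<bar>aB * p - a * pB\<bar> \<le> D" .
  qed
  \<comment> \<open>1024 = 4 * 256: the factor \<open>Z\<close> of the oscillation bound is at most
    \<open>4 * p\<close>.\<close>
  have 1: "D / (a * p) \<le> 1024 * \<eta>"
  proof -
    have "D \<le> 256 * (4 * p) * \<eta> * a" 
      using D_le p_ge \<eta> a0 mult_right_mono[of Z "4 * p" "256 * \<eta> * a"] by (simp add: mult_ac)
    then show ?thesis using a_pos p_pos by (simp add: field_simps)
  qed
  \<comment> \<open>The factor \<open>exp (- sqrt d)\<close> kept in the tail bound cancels the one
    in the lower bound for \<open>a\<close>.\<close>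
  have 2: "t / a \<le> 12 * K * E"
  proof -
    have "t \<le> 12 * K * E * (exp (- sqrt d) / 4 * Z)" using t_le by (simp add: mult_ac)
    also have "\<dots> \<le> 12 * K * E * a" using a_ge K by (intro mult_left_mono) (auto simp: E_def)
    finally show ?thesis using a_pos by (simp add: field_simps)
  qed
  have 3: "q / p \<le> 4 * E"
  proof -
    have "E * Z \<le> E * (4 * p)" using p_ge by (intro mult_left_mono) (auto simp: E_def)
    then have "q \<le> E * (4 * p)" using q_le by linarith
    then show ?thesis using p_pos by (simp add: field_simps)
  qed
  have 4: "1024 * \<eta> + 12 * K * E + 4 * E \<le> 1024 * (\<eta> + K * E)"
  proof -
    have "1 * E \<le> K * E" using K by (intro mult_right_mono) (auto simp: E_def)
    moreover have "0 \<le> K * E" using K by (simp add: E_def)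
    ultimately show ?thesis by (simp add: algebra_simps)
  qed
  have "aB + tB = (\<integral>x. b x * (I x * f x) + b x * (J x * f x) \<partial>M)"
    unfolding aB_def tB_def using bint by simp
  also have "\<dots> = (\<integral>x. indicator B x * f x \<partial>M)"
    unfolding b_def by (rule Bochner_Integration.integral_cong[OF refl]) (metis distrib_left split(1))
  finally have 5: "aB + tB = (\<integral>x. indicator B x * f x \<partial>M)" .
  have "pB + qB = (\<integral>x. b x * (I x * w x) + b x * (J x * w x) \<partial>M)"
    unfolding pB_def qB_def using bint by simp
  also have "\<dots> = (\<integral>x. indicator B x * w x \<partial>M)"
    unfolding b_def by (rule Bochner_Integration.integral_cong[OF refl]) (metis distrib_left split(2))
  finally have 6: "pB + qB = (\<integral>x. indicator B x * w x \<partial>M)" .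
  show "\<bar>(\<integral>x. indicator B x * f x \<partial>M) / (\<integral>x. f x \<partial>M) - (\<integral>x. indicator B x * w x \<partial>M) / Z\<bar>
      \<le> 1024 * (\<eta> + K * exp (- (d * (s / 12)\<^sup>2)))"
    using main 1 2 3 4 unfolding 5 6 f_sum[symmetric] w_sum[symmetric] E_def by linarith
qed

end

section \<open>Lebesgue measure and triangular changes of variables\<close>

abbreviation lborel_fun :: "nat \<Rightarrow> (nat \<Rightarrow> real) measure" where
  "lborel_fun d \<equiv> (\<Pi>\<^sub>M i\<in>{..<d}. lborel)"

interpretation lborel_product: product_sigma_finite "\<lambda>_::nat. lborel :: real measure" ..

text \<open>Lower triangular affine maps: enough for translations, dilations, reflections and the
  Cholesky factor. The restriction makes the value extensional, as points of the product space
  are.\<close>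

definition triangular :: "nat \<Rightarrow> (nat \<Rightarrow> nat \<Rightarrow> real) \<Rightarrow> (nat \<Rightarrow> real) \<Rightarrow> (nat \<Rightarrow> real) \<Rightarrow> nat \<Rightarrow> real" where
  "triangular d T c x = (\<lambda>i\<in>{..<d}. c i + (\<Sum>j\<le>i. T i j * x j))"

lemma triangular_measurable [measurable]: "triangular d T c \<in> lborel_fun d \<rightarrow>\<^sub>M lborel_fun d"
  unfolding triangular_def
  by (intro measurable_restrict) (auto intro!: borel_measurable_add borel_measurable_sum borel_measurable_times measurable_component_singleton)

text \<open>Induction on the dimension: with the first \<open>d\<close> coordinates fixed the last
  one undergoes an affine substitution on the line, whose shift depends on the others but whose
  factor does not.\<close>

lemma nn_integral_triangular:
  assumes "\<And>i. i < d \<Longrightarrow> T i i \<noteq> 0" and "f \<in> borel_measurable (lborel_fun d)"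
  shows "(\<integral>\<^sup>+x. f (triangular d T c x) \<partial>lborel_fun d)
    = ennreal (\<Prod>i<d. 1 / \<bar>T i i\<bar>) * (\<integral>\<^sup>+x. f x \<partial>lborel_fun d)"
  using assms
proof (induction d arbitrary: f)
  case 0
  have "triangular 0 T c x = x" if "x \<in> space (lborel_fun 0)" for x
    using that by (auto simp: triangular_def space_PiM restrict_def fun_eq_iff)
  then have "(\<integral>\<^sup>+x. f (triangular 0 T c x) \<partial>lborel_fun 0) = (\<integral>\<^sup>+x. f x \<partial>lborel_fun 0)"
    by (intro nn_integral_cong) simp
  then show ?case by simp
next
  case (Suc d)
  note f [measurable] = Suc.prems(2)
  have ins: "{..<Suc d} = insert d {..<d}" by auto
  have f' [measurable]: "f \<in> borel_measurable (PiM (insert d {..<d}) (\<lambda>_. lborel))"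
    using f by (simp add: ins)
  have tm: "(\<lambda>x. f (triangular (Suc d) T c x)) \<in> borel_measurable (PiM (insert d {..<d}) (\<lambda>_. lborel))"
    using measurable_compose[OF triangular_measurable f] by (simp add: ins)
  define g where "g = (\<lambda>x. \<integral>\<^sup>+y. f (x(d := y)) \<partial>lborel)"
  have g [measurable]: "g \<in> borel_measurable (lborel_fun d)" unfolding g_def by measurable
  have "(\<integral>\<^sup>+x. f (triangular (Suc d) T c x) \<partial>lborel_fun (Suc d))
      = (\<integral>\<^sup>+x. \<integral>\<^sup>+y. f (triangular (Suc d) T c (x(d := y))) \<partial>lborel \<partial>lborel_fun d)"
    unfolding ins by (rule lborel_product.product_nn_integral_insert) (use tm in auto)
  also have "\<dots> = (\<integral>\<^sup>+x. ennreal (1 / \<bar>T d d\<bar>) * g (triangular d T c x) \<partial>lborel_fun d)"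
  proof (rule nn_integral_cong)
    fix x assume x: "x \<in> space (lborel_fun d)"
    define t where "t = c d + (\<Sum>j<d. T d j * x j)"
    define x' where "x' = triangular d T c x"
    have x': "x' \<in> space (lborel_fun d)" unfolding x'_def by (rule measurable_space[OF triangular_measurable x])
    have [measurable]: "(\<lambda>y. f (x'(d := y))) \<in> borel_measurable borel"
      using x' by measurable
    have eq: "triangular (Suc d) T c (x(d := y)) = x'(d := t + T d d * y)" for y
    proof
      fix i
      have "(\<Sum>j\<le>i. T i j * (x(d := y)) j) = (\<Sum>j\<le>i. T i j * x j)" if "i < d"
        using that by (intro sum.cong) auto
      moreover have "(\<Sum>j\<le>d. T d j * (x(d := y)) j) = (\<Sum>j<d. T d j * x j) + T d d * y"
        by (simp flip: lessThan_Suc_atMost)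
      ultimately show "triangular (Suc d) T c (x(d := y)) i = (x'(d := t + T d d * y)) i"
        by (auto simp: triangular_def x'_def t_def less_Suc_eq)
    qed
    have Td: "T d d \<noteq> 0" using Suc.prems(1) by simp
    have "g x' = ennreal \<bar>T d d\<bar> * (\<integral>\<^sup>+y. f (x'(d := t + T d d * y)) \<partial>lborel)"
      unfolding g_def by (rule nn_integral_real_affine) (use Td in auto)
    then have "ennreal (1 / \<bar>T d d\<bar>) * g x' = (\<integral>\<^sup>+y. f (x'(d := t + T d d * y)) \<partial>lborel)"
      using Td by (simp add: mult.assoc[symmetric] flip: ennreal_mult)
    then show "(\<integral>\<^sup>+y. f (triangular (Suc d) T c (x(d := y))) \<partial>lborel)
        = ennreal (1 / \<bar>T d d\<bar>) * g (triangular d T c x)"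
      by (simp add: eq x'_def)
  qed
  also have "\<dots> = ennreal (1 / \<bar>T d d\<bar>) * (\<integral>\<^sup>+x. g (triangular d T c x) \<partial>lborel_fun d)"
    by (rule nn_integral_cmult) measurable
  also have "(\<integral>\<^sup>+x. g (triangular d T c x) \<partial>lborel_fun d)
      = ennreal (\<Prod>i<d. 1 / \<bar>T i i\<bar>) * (\<integral>\<^sup>+x. g x \<partial>lborel_fun d)"
    by (rule Suc.IH[OF _ g]) (use Suc.prems(1) in auto)
  also have "(\<integral>\<^sup>+x. g x \<partial>lborel_fun d) = (\<integral>\<^sup>+x. f x \<partial>lborel_fun (Suc d))"
    unfolding ins g_def by (rule lborel_product.product_nn_integral_insert[symmetric]) auto
  finally show ?case
    by (simp add: mult.assoc[symmetric] mult.commute prod_nonneg flip: ennreal_mult)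
qed

section \<open>Finitely supported sequences\<close>

text \<open>A single inner product space that contains a copy of every finite-dimensional one.\<close>

typedef fseq = "{f :: nat \<Rightarrow> real. finite {i. f i \<noteq> 0}}"
  morphisms coord Abs_fseq by (rule exI[of _ "\<lambda>_. 0"]) simp

setup_lifting type_definition_fseq

lemma finite_coord: "finite {i. coord x i \<noteq> 0}"
  using coord by blast

lemma fseq_eqI: "(\<And>i. coord x i = coord y i) \<Longrightarrow> x = y"
  by (metis coord_inject ext)

instantiation fseq :: real_vector
begin

lift_definition zero_fseq :: fseq is "\<lambda>_. 0" by simp
lift_definition plus_fseq :: "fseq \<Rightarrow> fseq \<Rightarrow> fseq" is "\<lambda>f g i. f i + g i"
  subgoal for f g by (rule finite_subset[of _ "{i. f i \<noteq> 0} \<union> {i. g i \<noteq> 0}"]) auto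
  done
lift_definition uminus_fseq :: "fseq \<Rightarrow> fseq" is "\<lambda>f i. - f i" by simp
lift_definition minus_fseq :: "fseq \<Rightarrow> fseq \<Rightarrow> fseq" is "\<lambda>f g i. f i - g i"
  subgoal for f g by (rule finite_subset[of _ "{i. f i \<noteq> 0} \<union> {i. g i \<noteq> 0}"]) auto
  done
lift_definition scaleR_fseq :: "real \<Rightarrow> fseq \<Rightarrow> fseq" is "\<lambda>c f i. c * f i"
  by (rule finite_subset) auto

instance
  by standard (transfer, force simp: algebra_simps)+

end

lemmas coord_simps [simp] = zero_fseq.rep_eq plus_fseq.rep_eq uminus_fseq.rep_eq
  minus_fseq.rep_eq scaleR_fseq.rep_eq

definition fseq_support :: "fseq \<Rightarrow> nat set" where "fseq_support x = {i. coord x i \<noteq> 0}"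

definition fseq_inner :: "fseq \<Rightarrow> fseq \<Rightarrow> real" where
  "fseq_inner x y = (\<Sum>i\<in>fseq_support x. coord x i * coord y i)"

text \<open>The definition sums over the support of the first argument only. With this any finite
  set that covers the product may be used, so that all axioms can be checked on one common
  set.\<close>

lemma fseq_inner_eq:
  assumes "finite A" "\<And>i. i \<notin> A \<Longrightarrow> coord x i = 0 \<or> coord y i = 0"
  shows "fseq_inner x y = (\<Sum>i\<in>A. coord x i * coord y i)"
proof -
  have fin: "finite (fseq_support x)" using finite_coord by (simp add: fseq_support_def)
  have "fseq_inner x y = (\<Sum>i\<in>A \<union> fseq_support x. coord x i * coord y i)"
    unfolding fseq_inner_def using assms fin
    by (intro sum.mono_neutral_left) (auto simp: fseq_support_def)
  also have "\<dots> = (\<Sum>i\<in>A. coord x i * coord y i)"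
    using assms fin by (intro sum.mono_neutral_right) force+
  finally show ?thesis .
qed

instantiation fseq :: real_inner
begin

definition inner_fseq :: "fseq \<Rightarrow> fseq \<Rightarrow> real" where "inner_fseq = fseq_inner"
definition norm_fseq :: "fseq \<Rightarrow> real" where "norm_fseq x = sqrt (inner x x)"
definition dist_fseq :: "fseq \<Rightarrow> fseq \<Rightarrow> real" where "dist_fseq x y = norm (x - y)"
definition sgn_fseq :: "fseq \<Rightarrow> fseq" where "sgn_fseq x = inverse (norm x) *\<^sub>R x"
definition uniformity_fseq :: "(fseq \<times> fseq) filter" where
  "uniformity_fseq = (INF e\<in>{0 <..}. principal {(x, y). dist x y < e})"
definition open_fseq :: "fseq set \<Rightarrow> bool" where
  "open_fseq U \<longleftrightarrow> (\<forall>x\<in>U. eventually (\<lambda>(x', y). x' = x \<longrightarrow> y \<in> U) uniformity)"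

instance
proof
  fix x y z :: fseq and r :: real
  define A where "A = fseq_support x \<union> fseq_support y \<union> fseq_support z"
  have A: "finite A" using finite_coord by (simp add: A_def fseq_support_def)
  have out: "coord x i = 0" "coord y i = 0" "coord z i = 0" if "i \<notin> A" for i
    using that by (auto simp: A_def fseq_support_def)
  note eq = fseq_inner_eq[OF A]
  show "dist x y = norm (x - y)" by (rule dist_fseq_def)
  show "sgn x = inverse (norm x) *\<^sub>R x" by (rule sgn_fseq_def)
  show "(uniformity :: (fseq \<times> fseq) filter) = (INF e\<in>{0 <..}. principal {(x, y). dist x y < e})"
    by (rule uniformity_fseq_def)
  show "open U = (\<forall>x\<in>U. \<forall>\<^sub>F (x', y) in uniformity. x' = x \<longrightarrow> y \<in> U)" for U :: "fseq set"
    by (rule open_fseq_def)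
  show "inner x y = inner y x"
    unfolding inner_fseq_def using out by (subst (1 2) eq) (auto simp: mult.commute)
  show "inner (x + y) z = inner x z + inner y z"
    unfolding inner_fseq_def using out
    by (subst (1 2 3) eq) (auto simp: distrib_right sum.distrib)
  show "inner (r *\<^sub>R x) y = r * inner x y"
    unfolding inner_fseq_def using out
    by (subst (1 2) eq) (auto simp: sum_distrib_left mult_ac)
  show "0 \<le> inner x x" unfolding inner_fseq_def fseq_inner_def by (auto intro: sum_nonneg)
  show "(inner x x = 0) = (x = 0)"
  proof
    assume "inner x x = 0"
    then have "\<forall>i\<in>fseq_support x. coord x i * coord x i = 0"
      unfolding inner_fseq_def fseq_inner_def
      using finite_coord[of x] by (subst (asm) sum_nonneg_eq_0_iff) (auto simp: fseq_support_def)
    then show "x = 0" by (intro fseq_eqI) (auto simp: fseq_support_def)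
  qed (simp add: inner_fseq_def fseq_inner_def fseq_support_def)
  show "norm x = sqrt (inner x x)" by (rule norm_fseq_def)
qed

end

section \<open>Coordinate subspaces and their Lebesgue measure\<close>

definition seqs :: "nat \<Rightarrow> fseq set" where "seqs d = {x. \<forall>i\<ge>d. coord x i = 0}"

definition fseq_of :: "nat \<Rightarrow> (nat \<Rightarrow> real) \<Rightarrow> fseq" where
  "fseq_of d f = Abs_fseq (\<lambda>i. if i < d then f i else 0)"

lemma coord_fseq_of [simp]: "coord (fseq_of d f) i = (if i < d then f i else 0)"
proof -
  have "finite {i. (if i < d then f i else 0) \<noteq> 0}" by (rule finite_subset[of _ "{..<d}"]) auto
  then show ?thesis by (simp add: fseq_of_def Abs_fseq_inverse)
qed

lemma fseq_of_in [simp]: "fseq_of d f \<in> seqs d"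
  by (simp add: seqs_def)

lemma inner_seqs: "x \<in> seqs d \<Longrightarrow> inner x y = (\<Sum>i<d. coord x i * coord y i)"
  unfolding inner_fseq_def by (intro fseq_inner_eq) (auto simp: seqs_def)

definition lborel_fseq :: "nat \<Rightarrow> fseq measure" where
  "lborel_fseq d = embed_measure (lborel_fun d) (fseq_of d)"

lemma inj_fseq_of: "inj_on (fseq_of d) (space (lborel_fun d))"
proof (rule inj_onI)
  fix x y assume *: "x \<in> space (lborel_fun d)" "y \<in> space (lborel_fun d)" "fseq_of d x = fseq_of d y"
  show "x = y"
  proof (rule PiE_ext[of _ "{..<d}" "\<lambda>_. UNIV"])
    show "x i = y i" if "i \<in> {..<d}" for i
      using arg_cong[OF *(3), of "\<lambda>z. coord z i"] that by simp
  qed (use * in \<open>auto simp: space_PiM\<close>)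
qed

lemma space_lborel_fseq: "space (lborel_fseq d) = seqs d"
proof -
  have "x \<in> fseq_of d ` space (lborel_fun d)" if "x \<in> seqs d" for x
  proof (rule image_eqI[where x = "\<lambda>i\<in>{..<d}. coord x i"])
    show "x = fseq_of d (\<lambda>i\<in>{..<d}. coord x i)"
      using that by (intro fseq_eqI) (auto simp: seqs_def)
  qed (auto simp: space_PiM)
  then show ?thesis by (auto simp: lborel_fseq_def space_embed_measure)
qed

lemma coord_measurable [measurable]: "(\<lambda>x. coord x i) \<in> borel_measurable (lborel_fseq d)"
  unfolding lborel_fseq_def
  by (rule measurable_embed_measure1, cases "i < d") (auto intro!: measurable_component_singleton)

text \<open>The map factors through the product space of its first \<open>d\<close> coordinates,
  where measurability is coordinatewise.\<close>

lemma measurable_into_lborel_fseq: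
  assumes "\<And>i. i < d \<Longrightarrow> (\<lambda>x. coord (g x) i) \<in> borel_measurable N"
    and "\<And>x. x \<in> space N \<Longrightarrow> g x \<in> seqs d"
  shows "g \<in> N \<rightarrow>\<^sub>M lborel_fseq d"
proof -
  have 1: "(\<lambda>x. \<lambda>i\<in>{..<d}. coord (g x) i) \<in> N \<rightarrow>\<^sub>M lborel_fun d"
    using assms(1) by (intro measurable_restrict) auto
  have 2: "fseq_of d \<in> lborel_fun d \<rightarrow>\<^sub>M lborel_fseq d"
    unfolding lborel_fseq_def by (rule measurable_embed_measure2'[OF inj_fseq_of])
  have "(\<lambda>x. fseq_of d (\<lambda>i\<in>{..<d}. coord (g x) i)) \<in> N \<rightarrow>\<^sub>M lborel_fseq d"
    by (rule measurable_compose[OF 1 2])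
  moreover have "fseq_of d (\<lambda>i\<in>{..<d}. coord (g x) i) = g x" if "x \<in> space N" for x
    using assms(2)[OF that] by (intro fseq_eqI) (auto simp: seqs_def)
  ultimately show ?thesis by (simp cong: measurable_cong)
qed

lemma fseq_of_measurable [measurable]: "fseq_of d \<in> lborel_fun d \<rightarrow>\<^sub>M lborel_fseq d"
  unfolding lborel_fseq_def by (rule measurable_embed_measure2'[OF inj_fseq_of])

lemma nn_integral_lborel_fseq:
  "f \<in> borel_measurable (lborel_fseq d) \<Longrightarrow> (\<integral>\<^sup>+x. f x \<partial>lborel_fseq d) = (\<integral>\<^sup>+x. f (fseq_of d x) \<partial>lborel_fun d)"
  unfolding lborel_fseq_def by (rule nn_integral_embed_measure'[OF inj_fseq_of])

lemma subspace_seqs: "Real_Vector_Spaces.subspace (seqs d)"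
  by (auto simp: Real_Vector_Spaces.subspace_def seqs_def)

lemma inner_measurable_fseq:
  assumes [measurable]: "f \<in> N \<rightarrow>\<^sub>M lborel_fseq d" "g \<in> N \<rightarrow>\<^sub>M lborel_fseq d"
  shows "(\<lambda>x. inner (f x) (g x)) \<in> borel_measurable N"
proof -
  have "(\<lambda>x. \<Sum>i<d. coord (f x) i * coord (g x) i) \<in> borel_measurable N" by measurable
  moreover have "inner (f x) (g x) = (\<Sum>i<d. coord (f x) i * coord (g x) i)" if "x \<in> space N" for x
    using measurable_space[OF assms(1) that] by (intro inner_seqs) (simp add: space_lborel_fseq)
  ultimately show ?thesis by (simp cong: measurable_cong)
qed

lemma norm_measurable_fseq:
  "f \<in> N \<rightarrow>\<^sub>M lborel_fseq d \<Longrightarrow> (\<lambda>x. norm (f x)) \<in> borel_measurable N"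
  unfolding norm_eq_sqrt_inner using inner_measurable_fseq[of f N d f] by measurable

lemma gaussian_integral_real: "(\<integral>\<^sup>+x. ennreal (exp (- x\<^sup>2 / 2)) \<partial>lborel) = ennreal (sqrt (2 * pi))"
proof -
  interpret prob_space "density lborel (\<lambda>x. ennreal (normal_density 0 1 x))"
    by (rule prob_space_normal_density) simp
  have one: "(\<integral>\<^sup>+x. ennreal (normal_density 0 1 x) \<partial>lborel) = 1"
    using emeasure_space_1 by (simp add: emeasure_density)
  have "(\<integral>\<^sup>+x. ennreal (exp (- x\<^sup>2 / 2)) \<partial>lborel)
      = (\<integral>\<^sup>+x. ennreal (sqrt (2 * pi)) * ennreal (normal_density 0 1 x) \<partial>lborel)"
    by (intro nn_integral_cong) (simp add: normal_density_def flip: ennreal_mult)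
  also have "\<dots> = ennreal (sqrt (2 * pi))"
    by (subst nn_integral_cmult) (simp_all add: one)
  finally show ?thesis .
qed

lemma gaussian_integral_fseq:
  "(\<integral>\<^sup>+x. ennreal (exp (- (norm x)\<^sup>2 / 2)) \<partial>lborel_fseq d) = ennreal (sqrt (2 * pi) ^ d)"
proof -
  have [measurable]: "norm \<in> borel_measurable (lborel_fseq d)"
    using norm_measurable_fseq[of "\<lambda>x. x"] by simp
  have eq: "(norm (fseq_of d x))\<^sup>2 = (\<Sum>i<d. (x i)\<^sup>2)" for x
    unfolding power2_norm_eq_inner by (subst inner_seqs[of _ d]) (auto simp: power2_eq_square)
  have "(\<integral>\<^sup>+x. ennreal (exp (- (norm x)\<^sup>2 / 2)) \<partial>lborel_fseq d)
      = (\<integral>\<^sup>+x. ennreal (exp (- (norm (fseq_of d x))\<^sup>2 / 2)) \<partial>lborel_fun d)"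
    by (rule nn_integral_lborel_fseq) measurable
  also have "\<dots> = (\<integral>\<^sup>+x. (\<Prod>i<d. ennreal (exp (- (x i)\<^sup>2 / 2))) \<partial>lborel_fun d)"
    unfolding eq by (simp add: sum_divide_distrib prod_ennreal exp_sum flip: sum_negf)
  also have "\<dots> = (\<Prod>i<d. \<integral>\<^sup>+x. ennreal (exp (- x\<^sup>2 / 2)) \<partial>lborel)"
    by (rule lborel_product.product_nn_integral_prod) auto
  also have "\<dots> = ennreal (sqrt (2 * pi) ^ d)"
    by (subst gaussian_integral_real) (simp add: ennreal_power)
  finally show ?thesis .
qed

lemma nn_integral_fseq_triangular:
  assumes f [measurable]: "f \<in> borel_measurable (lborel_fseq d)" and "\<And>i. i < d \<Longrightarrow> T i i \<noteq> 0"
    and eq: "\<And>x. x \<in> seqs d \<Longrightarrow> g x = fseq_of d (triangular d T c (coord x))"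
  shows "(\<integral>\<^sup>+x. f (g x) \<partial>lborel_fseq d) = ennreal (\<Prod>i<d. 1 / \<bar>T i i\<bar>) * (\<integral>\<^sup>+x. f x \<partial>lborel_fseq d)"
proof -
  have tri: "triangular d T c (coord (fseq_of d x)) = triangular d T c x" for x
    unfolding triangular_def by (rule restrict_ext) (auto intro!: sum.cong)
  have "g \<in> lborel_fseq d \<rightarrow>\<^sub>M lborel_fseq d"
  proof (rule measurable_into_lborel_fseq)
    fix i assume i: "i < d"
    have "(\<lambda>x. c i + (\<Sum>j\<le>i. T i j * coord x j)) \<in> borel_measurable (lborel_fseq d)" by measurable
    moreover have "coord (g x) i = c i + (\<Sum>j\<le>i. T i j * coord x j)" if "x \<in> space (lborel_fseq d)" for x
      using that i by (simp add: space_lborel_fseq eq triangular_def)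
    ultimately show "(\<lambda>x. coord (g x) i) \<in> borel_measurable (lborel_fseq d)" by (simp cong: measurable_cong)
  qed (simp add: space_lborel_fseq eq)
  then have "(\<integral>\<^sup>+x. f (g x) \<partial>lborel_fseq d) = (\<integral>\<^sup>+x. f (g (fseq_of d x)) \<partial>lborel_fun d)"
    by (intro nn_integral_lborel_fseq) measurable
  also have "\<dots> = (\<integral>\<^sup>+x. f (fseq_of d (triangular d T c x)) \<partial>lborel_fun d)"
    by (simp add: eq tri)
  also have "\<dots> = ennreal (\<Prod>i<d. 1 / \<bar>T i i\<bar>) * (\<integral>\<^sup>+x. f (fseq_of d x) \<partial>lborel_fun d)"
    by (rule nn_integral_triangular) (use assms in measurable)
  also have "(\<integral>\<^sup>+x. f (fseq_of d x) \<partial>lborel_fun d) = (\<integral>\<^sup>+x. f x \<partial>lborel_fseq d)"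
    by (rule nn_integral_lborel_fseq[symmetric]) measurable
  finally show ?thesis .
qed

text \<open>Translation, dilation and reflection are instances of
  \<open>nn_integral_fseq_triangular\<close> with a diagonal matrix.\<close>

lemma translation_invariant_space_fseq:
  assumes "d \<ge> 1"
  shows "translation_invariant_space (lborel_fseq d) d (sqrt (2 * pi) ^ d)"
proof
  have [measurable]: "norm \<in> borel_measurable (lborel_fseq d)"
    using norm_measurable_fseq[of "\<lambda>x. x"] by simp
  have ball: "{x \<in> space (lborel_fseq d). norm x < real n} \<in> sets (lborel_fseq d)" for n :: nat
    by measurable
  note ball' = ball[unfolded space_lborel_fseq]
  note space_lborel_fseq [simp]
  show "\<exists>A. countable A \<and> A \<subseteq> sets (lborel_fseq d) \<and> \<Union> A = space (lborel_fseq d)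
      \<and> (\<forall>a\<in>A. emeasure (lborel_fseq d) a \<noteq> \<infinity>)"
  proof (intro exI[of _ "range (\<lambda>n::nat. {x \<in> space (lborel_fseq d). norm x < n})"] conjI ballI)
    have "\<exists>n::nat. norm x < n" for x :: fseq by (rule reals_Archimedean2)
    then show "\<Union> (range (\<lambda>n::nat. {x \<in> space (lborel_fseq d). norm x < n})) = space (lborel_fseq d)"
      by auto
    fix a assume "a \<in> range (\<lambda>n::nat. {x \<in> space (lborel_fseq d). norm x < n})"
    then obtain n :: nat where a: "a = {x \<in> space (lborel_fseq d). norm x < n}" by auto
    \<comment> \<open>On the ball of radius \<open>n\<close> the indicator is at most a multiple of
      the Gaussian, which has finite integral; so the balls witness sigma-finiteness.\<close>
    have "emeasure (lborel_fseq d) a = (\<integral>\<^sup>+x. indicator a x \<partial>lborel_fseq d)"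
      unfolding a using ball by (subst nn_integral_indicator) auto
    also have "\<dots> \<le> (\<integral>\<^sup>+x. ennreal (exp (n\<^sup>2 / 2)) * ennreal (exp (- (norm x)\<^sup>2 / 2)) \<partial>lborel_fseq d)"
    proof (rule nn_integral_mono)
      fix x
      show "indicator a x \<le> ennreal (exp (n\<^sup>2 / 2)) * ennreal (exp (- (norm x)\<^sup>2 / 2))"
      proof (cases "x \<in> a")
        case True
        then have "(norm x)\<^sup>2 \<le> n\<^sup>2" unfolding a by (auto intro: power_mono)
        then have "1 \<le> exp (n\<^sup>2 / 2) * exp (- (norm x)\<^sup>2 / 2)" by (simp flip: exp_add)
        then show ?thesis using True by (simp flip: ennreal_mult ennreal_1)
      qed simp
    qed
    also have "\<dots> = ennreal (exp (n\<^sup>2 / 2)) * ennreal (sqrt (2 * pi) ^ d)"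
      using gaussian_integral_fseq by (subst nn_integral_cmult) simp_all
    also have "\<dots> < \<infinity>" by (simp add: ennreal_mult_less_top)
    finally show "emeasure (lborel_fseq d) a \<noteq> \<infinity>" by simp
  qed (use ball' in auto)
  show "Real_Vector_Spaces.subspace (space (lborel_fseq d))" by (simp add: subspace_seqs)
  show "(\<lambda>(x, y). x + y) \<in> lborel_fseq d \<Otimes>\<^sub>M lborel_fseq d \<rightarrow>\<^sub>M lborel_fseq d"
    by (rule measurable_into_lborel_fseq) (auto simp: split_beta space_pair_measure seqs_def)
  show "(\<lambda>(c, x). c *\<^sub>R x) \<in> borel \<Otimes>\<^sub>M lborel_fseq d \<rightarrow>\<^sub>M lborel_fseq d"
    by (rule measurable_into_lborel_fseq) (auto simp: split_beta space_pair_measure seqs_def)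
  show "(\<lambda>(x, y). inner x y) \<in> borel_measurable (lborel_fseq d \<Otimes>\<^sub>M lborel_fseq d)"
    unfolding split_beta by (rule inner_measurable_fseq) measurable
  show "(\<integral>\<^sup>+x. f (x + a) \<partial>lborel_fseq d) = (\<integral>\<^sup>+x. f x \<partial>lborel_fseq d)"
    if "f \<in> borel_measurable (lborel_fseq d)" "a \<in> space (lborel_fseq d)" for f a
  proof -
    \<comment> \<open>The test \<open>i = i\<close> keeps the product literally of the form
      \<open>T i i\<close> for the chosen \<open>T\<close>.\<close>
    have "(\<integral>\<^sup>+x. f (x + a) \<partial>lborel_fseq d)
        = ennreal (\<Prod>i<d. 1 / \<bar>if i = i then 1 else 0\<bar>) * (\<integral>\<^sup>+x. f x \<partial>lborel_fseq d)"
      by (rule nn_integral_fseq_triangular[where T = "\<lambda>i j. if i = j then 1 else 0" and c = "coord a"])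
        (use that in \<open>auto intro!: fseq_eqI simp: triangular_def seqs_def if_distrib[of "\<lambda>u. u * _"] cong: if_cong\<close>)
    then show ?thesis by simp
  qed
  show "(\<integral>\<^sup>+x. f (c *\<^sub>R x) \<partial>lborel_fseq d) = ennreal (1 / c ^ d) * (\<integral>\<^sup>+x. f x \<partial>lborel_fseq d)"
    if "f \<in> borel_measurable (lborel_fseq d)" "c > 0" for f c
  proof -
    have "(\<integral>\<^sup>+x. f (c *\<^sub>R x) \<partial>lborel_fseq d)
        = ennreal (\<Prod>i<d. 1 / \<bar>if i = i then c else 0\<bar>) * (\<integral>\<^sup>+x. f x \<partial>lborel_fseq d)"
      by (rule nn_integral_fseq_triangular[where T = "\<lambda>i j. if i = j then c else 0" and c = "\<lambda>_. 0"])
        (use that in \<open>auto intro!: fseq_eqI simp: triangular_def seqs_def if_distrib[of "\<lambda>u. u * _"] cong: if_cong\<close>)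
    then show ?thesis using that by (simp add: power_divide)
  qed
  show "(\<integral>\<^sup>+x. f (- x) \<partial>lborel_fseq d) = (\<integral>\<^sup>+x. f x \<partial>lborel_fseq d)"
    if "f \<in> borel_measurable (lborel_fseq d)" for f
  proof -
    have "(\<integral>\<^sup>+x. f (- x) \<partial>lborel_fseq d)
        = ennreal (\<Prod>i<d. 1 / \<bar>if i = i then - 1 else 0\<bar>) * (\<integral>\<^sup>+x. f x \<partial>lborel_fseq d)"
      by (rule nn_integral_fseq_triangular[where T = "\<lambda>i j. if i = j then - 1 else 0" and c = "\<lambda>_. 0"])
        (use that in \<open>auto intro!: fseq_eqI simp: triangular_def seqs_def if_distrib[of "\<lambda>u. u * _"] cong: if_cong\<close>)
    then show ?thesis by simp
  qed
qed (use assms gaussian_integral_fseq in auto)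

section \<open>Whitening of Lebesgue measure on vectors\<close>

definition vec_of :: "nat \<Rightarrow> fseq \<Rightarrow> real Matrix.vec" where
  "vec_of d z = Matrix.vec d (coord z)"

lemma vec_of_carrier [simp]: "vec_of d z \<in> carrier_vec d" "dim_vec (vec_of d z) = d"
  by (auto simp: vec_of_def)

lemma vec_of_index [simp]: "i < d \<Longrightarrow> vec_of d z $ i = coord z i"
  by (simp add: vec_of_def)

lemma vec_of_linear:
  "vec_of d (x + y) = vec_of d x + vec_of d y" "vec_of d (c *\<^sub>R x) = c \<cdot>\<^sub>v vec_of d x"
  "vec_of d (x - y) = vec_of d x - vec_of d y" "vec_of d 0 = 0\<^sub>v d"
  by (auto intro!: eq_vecI)

lemma vec_of_inner: "x \<in> seqs d \<Longrightarrow> vec_of d x \<bullet> vec_of d y = inner x y"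
  by (simp add: scalar_prod_def inner_seqs lessThan_atLeast0)

lemma inj_vec: "inj_on (Matrix.vec d) (space (lborel_fun d))"
proof (rule inj_onI)
  fix x y :: "nat \<Rightarrow> real" assume *: "x \<in> space (lborel_fun d)" "y \<in> space (lborel_fun d)" "Matrix.vec d x = Matrix.vec d y"
  show "x = y"
  proof (rule PiE_ext[of _ "{..<d}" "\<lambda>_. UNIV"])
    show "x i = y i" if "i \<in> {..<d}" for i
      using arg_cong[OF *(3), of "\<lambda>z. z $ i"] that by simp
  qed (use * in \<open>auto simp: space_PiM\<close>)
qed

lemma vec_index_measurable: "i < d \<Longrightarrow> (\<lambda>v. v $ i) \<in> borel_measurable (lborel_vec d)"
  unfolding lborel_vec_def
  by (rule measurable_embed_measure1)
    (auto intro!: measurable_component_singleton simp: cong: measurable_cong)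

lemma measurable_into_lborel_vec:
  assumes "\<And>i. i < d \<Longrightarrow> (\<lambda>x. g x $ i) \<in> borel_measurable N"
    and "\<And>x. x \<in> space N \<Longrightarrow> g x \<in> carrier_vec d"
  shows "g \<in> N \<rightarrow>\<^sub>M lborel_vec d"
proof -
  have 1: "(\<lambda>x. \<lambda>i\<in>{..<d}. g x $ i) \<in> N \<rightarrow>\<^sub>M lborel_fun d"
    using assms(1) by (intro measurable_restrict) auto
  have 2: "Matrix.vec d \<in> lborel_fun d \<rightarrow>\<^sub>M lborel_vec d"
    unfolding lborel_vec_def by (rule measurable_embed_measure2'[OF inj_vec])
  have "(\<lambda>x. Matrix.vec d (\<lambda>i\<in>{..<d}. g x $ i)) \<in> N \<rightarrow>\<^sub>M lborel_vec d"
    by (rule measurable_compose[OF 1 2])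
  moreover have "Matrix.vec d (\<lambda>i\<in>{..<d}. g x $ i) = g x" if "x \<in> space N" for x
    using assms(2)[OF that] by (intro eq_vecI) auto
  ultimately show ?thesis by (simp cong: measurable_cong)
qed

lemma nn_integral_lborel_vec:
  "f \<in> borel_measurable (lborel_vec d) \<Longrightarrow> (\<integral>\<^sup>+x. f x \<partial>lborel_vec d) = (\<integral>\<^sup>+x. f (Matrix.vec d x) \<partial>lborel_fun d)"
  unfolding lborel_vec_def by (rule nn_integral_embed_measure'[OF inj_vec])

text \<open>The triangular substitution is made with \<open>T\<close>, not with its inverse
  \<open>A\<close>: inserted into the whitened integrand it produces T (x - \<theta>), which
  \<open>A\<close> and the shift undo. So it is \<open>T\<close> that has to be triangular.\<close>

lemma nn_integral_whitening:
  assumes T: "T \<in> carrier_mat d d" "\<And>i j. i < d \<Longrightarrow> j < d \<Longrightarrow> i < j \<Longrightarrow> T $$ (i, j) = 0"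
      "\<And>i. i < d \<Longrightarrow> T $$ (i, i) > 0"
    and A: "A \<in> carrier_mat d d" "A * T = 1\<^sub>m d"
    and \<theta>: "\<theta> \<in> carrier_vec d"
    and f [measurable]: "f \<in> borel_measurable (lborel_vec d)"
  shows "(\<integral>\<^sup>+x. f x \<partial>lborel_vec d)
    = ennreal (\<Prod>i<d. 1 / T $$ (i, i)) * (\<integral>\<^sup>+z. f (\<theta> + A *\<^sub>v vec_of d z) \<partial>lborel_fseq d)"
    "(\<lambda>z. \<theta> + A *\<^sub>v vec_of d z) \<in> lborel_fseq d \<rightarrow>\<^sub>M lborel_vec d"
proof -
  define c where "c = (\<lambda>i. - (T *\<^sub>v \<theta>) $ i)"
  define T' where "T' = (\<lambda>i j. T $$ (i, j))"
  show meas [measurable]: "(\<lambda>z. \<theta> + A *\<^sub>v vec_of d z) \<in> lborel_fseq d \<rightarrow>\<^sub>M lborel_vec d"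
  proof (rule measurable_into_lborel_vec)
    fix i assume i: "i < d"
    have "(\<theta> + A *\<^sub>v vec_of d z) $ i = \<theta> $ i + (\<Sum>j<d. A $$ (i, j) * coord z j)" for z
      using i A(1) \<theta> by (auto simp: scalar_prod_def lessThan_atLeast0 intro!: sum.cong)
    then show "(\<lambda>z. (\<theta> + A *\<^sub>v vec_of d z) $ i) \<in> borel_measurable (lborel_fseq d)" by simp
  qed (use A \<theta> in auto)
  have inv: "\<theta> + A *\<^sub>v vec_of d (fseq_of d (triangular d T' c x)) = Matrix.vec d x" for x
  proof -
    define v where "v = Matrix.vec d x"
    have v: "v \<in> carrier_vec d" by (simp add: v_def)
    have "vec_of d (fseq_of d (triangular d T' c x)) = T *\<^sub>v (v - \<theta>)"
    proof (rule eq_vecI)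
      fix i assume "i < dim_vec (T *\<^sub>v (v - \<theta>))"
      then have i: "i < d" using T(1) by simp
      have "(T *\<^sub>v v) $ i = (\<Sum>j<d. T $$ (i, j) * x j)"
        using i T(1) by (auto simp: scalar_prod_def v_def lessThan_atLeast0 intro!: sum.cong)
      also have "\<dots> = (\<Sum>j\<le>i. T $$ (i, j) * x j)"
        using i T(2) by (intro sum.mono_neutral_right) auto
      finally have "(T *\<^sub>v v) $ i = (\<Sum>j\<le>i. T $$ (i, j) * x j)" .
      moreover have "T *\<^sub>v (v - \<theta>) = T *\<^sub>v v - T *\<^sub>v \<theta>"
        by (rule mult_minus_distrib_mat_vec[OF T(1) v \<theta>])
      ultimately show "vec_of d (fseq_of d (triangular d T' c x)) $ i = (T *\<^sub>v (v - \<theta>)) $ i"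
        using i T(1) \<theta> v by (simp add: triangular_def c_def T'_def)
    qed (use T in auto)
    then have "A *\<^sub>v vec_of d (fseq_of d (triangular d T' c x)) = (A * T) *\<^sub>v (v - \<theta>)"
      by (simp only: assoc_mult_mat_vec[OF A(1) T(1) minus_carrier_vec[OF v \<theta>]])
    also have "\<dots> = v - \<theta>" using A \<theta> v by simp
    finally show ?thesis using \<theta> v by (auto simp: v_def intro!: eq_vecI)
  qed
  have tri: "(\<integral>\<^sup>+x. f (\<theta> + A *\<^sub>v vec_of d (fseq_of d (triangular d T' c x))) \<partial>lborel_fun d)
      = ennreal (\<Prod>i<d. 1 / \<bar>T' i i\<bar>) * (\<integral>\<^sup>+x. f (\<theta> + A *\<^sub>v vec_of d (fseq_of d x)) \<partial>lborel_fun d)"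
  proof (rule nn_integral_triangular)
    show "T' i i \<noteq> 0" if "i < d" for i using T(3)[OF that] by (simp add: T'_def)
  qed measurable
  have "(\<integral>\<^sup>+x. f x \<partial>lborel_vec d) = (\<integral>\<^sup>+x. f (Matrix.vec d x) \<partial>lborel_fun d)"
    by (rule nn_integral_lborel_vec[OF f])
  also have "\<dots> = ennreal (\<Prod>i<d. 1 / \<bar>T' i i\<bar>) * (\<integral>\<^sup>+x. f (\<theta> + A *\<^sub>v vec_of d (fseq_of d x)) \<partial>lborel_fun d)"
    using tri unfolding inv .
  also have "(\<integral>\<^sup>+x. f (\<theta> + A *\<^sub>v vec_of d (fseq_of d x)) \<partial>lborel_fun d)
      = (\<integral>\<^sup>+z. f (\<theta> + A *\<^sub>v vec_of d z) \<partial>lborel_fseq d)"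
    by (rule nn_integral_lborel_fseq[symmetric]) measurable
  also have "(\<Prod>i<d. 1 / \<bar>T' i i\<bar>) = (\<Prod>i<d. 1 / T $$ (i, i))"
    using T(3) by (intro prod.cong) (auto simp: T'_def abs_of_pos)
  finally show "(\<integral>\<^sup>+x. f x \<partial>lborel_vec d)
    = ennreal (\<Prod>i<d. 1 / T $$ (i, i)) * (\<integral>\<^sup>+z. f (\<theta> + A *\<^sub>v vec_of d z) \<partial>lborel_fseq d)" .
qed

section \<open>Positive definite matrices\<close>

definition of_vec :: "nat \<Rightarrow> real Matrix.vec \<Rightarrow> fseq" where
  "of_vec d u = fseq_of d (\<lambda>i. u $ i)"

lemma of_vec_in [simp]: "of_vec d u \<in> seqs d"
  by (simp add: of_vec_def)

lemma vec_of_of_vec [simp]: "u \<in> carrier_vec d \<Longrightarrow> vec_of d (of_vec d u) = u"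
  by (auto simp: of_vec_def intro!: eq_vecI)

lemma of_vec_vec_of [simp]: "z \<in> seqs d \<Longrightarrow> of_vec d (vec_of d z) = z"
  by (intro fseq_eqI) (auto simp: of_vec_def seqs_def)

lemma scalar_prod_eq_inner:
  "u \<in> carrier_vec d \<Longrightarrow> v \<in> carrier_vec d \<Longrightarrow> u \<bullet> v = inner (of_vec d u) (of_vec d v)"
  using vec_of_inner[of "of_vec d u" d "of_vec d v"] by simp

lemma scalar_prod_self_nonneg: "(u :: real Matrix.vec) \<bullet> u \<ge> 0"
  by (auto simp: scalar_prod_def intro: sum_nonneg)

lemma vnorm_eq_norm: "u \<in> carrier_vec d \<Longrightarrow> vnorm u = norm (of_vec d u)"
  by (simp add: vnorm_def norm_eq_sqrt_inner scalar_prod_eq_inner)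

lemma vnorm_nonneg [simp]: "vnorm u \<ge> 0"
  by (simp add: vnorm_def scalar_prod_self_nonneg)

lemma vnorm_square: "(vnorm u)\<^sup>2 = u \<bullet> u"
  by (simp add: vnorm_def scalar_prod_self_nonneg)

text \<open>Transported from \<open>fseq\<close>: vectors of all dimensions share one type, which is
  not itself an inner product space.\<close>

lemma scalar_prod_Cauchy_Schwarz:
  "u \<in> carrier_vec d \<Longrightarrow> v \<in> carrier_vec d \<Longrightarrow> \<bar>u \<bullet> v\<bar> \<le> vnorm u * vnorm v"
  using Cauchy_Schwarz_ineq2[of "of_vec d u" "of_vec d v"]
  by (simp add: scalar_prod_eq_inner vnorm_eq_norm)

lemma scalar_prod_self_eq_0: "u \<in> carrier_vec d \<Longrightarrow> (u :: real Matrix.vec) \<bullet> u = 0 \<longleftrightarrow> u = 0\<^sub>v d"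
proof
  assume u: "u \<in> carrier_vec d" and "u \<bullet> u = 0"
  then have "of_vec d u = 0" by (simp add: scalar_prod_eq_inner)
  then have "vec_of d (of_vec d u) = 0\<^sub>v d" by (simp add: vec_of_linear)
  then show "u = 0\<^sub>v d" using u by simp
qed simp

lemma smult_mat_mult_vec:
  "A \<in> carrier_mat m n \<Longrightarrow> u \<in> carrier_vec n \<Longrightarrow> (c \<cdot>\<^sub>m A) *\<^sub>v u = c \<cdot>\<^sub>v (A *\<^sub>v (u :: real Matrix.vec))"
  by (rule eq_vecI) (auto simp: scalar_prod_def sum_distrib_left mult_ac)

lemma smult_mat_transpose: "transpose_mat (c \<cdot>\<^sub>m A) = c \<cdot>\<^sub>m transpose_mat (A :: real mat)"
  by (rule eq_matI) auto

lemma smult_smult_mat: "a \<cdot>\<^sub>m (b \<cdot>\<^sub>m A) = (a * b) \<cdot>\<^sub>m (A :: real mat)"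
  by (rule eq_matI) auto

lemma mat_mult_unit_vec:
  "A \<in> carrier_mat m n \<Longrightarrow> i < m \<Longrightarrow> j < n \<Longrightarrow> (A *\<^sub>v unit_vec n j) $ i = (A :: real mat) $$ (i, j)"
  by simp

lemma mat_mult_entry:
  "A \<in> carrier_mat m n \<Longrightarrow> B \<in> carrier_mat n p \<Longrightarrow> i < m \<Longrightarrow> j < p \<Longrightarrow>
    (A * B) $$ (i, j) = (\<Sum>l<n. A $$ (i, l) * (B :: real mat) $$ (l, j))"
  by (auto simp: scalar_prod_def lessThan_atLeast0)

lemma mat_inv_inverse:
  assumes A: "A \<in> carrier_mat d d" and det: "Determinant.det A \<noteq> (0::real)"
  shows "mat_inv A \<in> carrier_mat d d" "A * mat_inv A = 1\<^sub>m d" "mat_inv A * A = 1\<^sub>m d"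
proof -
  obtain B where "mat_inverse A = Some B"
    using mat_inverse(1)[OF A, of "()"] det_non_zero_imp_unit[OF A det, of "()"] by (cases "mat_inverse A") auto
  then show "mat_inv A \<in> carrier_mat d d" "A * mat_inv A = 1\<^sub>m d" "mat_inv A * A = 1\<^sub>m d"
    using mat_inverse(2)[OF A] by (auto simp: mat_inv_def)
qed

lemma mat_inv_unique:
  assumes A: "A \<in> carrier_mat d d" and B: "B \<in> carrier_mat d d" "A * B = 1\<^sub>m d"
  shows "mat_inv A = (B :: real mat)"
proof -
  have "Determinant.det A * Determinant.det B = 1"
    using det_mult[OF A B(1)] B(2) by simp
  then have det: "Determinant.det A \<noteq> 0" by auto
  note inv = mat_inv_inverse[OF A det]
  have "mat_inv A = mat_inv A * (A * B)" using B inv(1) by simp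
  also have "\<dots> = (mat_inv A * A) * B" by (rule assoc_mult_mat[OF inv(1) A B(1), symmetric])
  also have "\<dots> = B" using B inv(3) by simp
  finally show ?thesis .
qed

lemma pos_def_mat_det:
  assumes "pos_def_mat d A"
  shows "Determinant.det A \<noteq> 0"
proof
  assume "Determinant.det A = 0"
  moreover have A: "A \<in> carrier_mat d d" using assms by (simp add: pos_def_mat_def)
  ultimately obtain v where v: "v \<in> carrier_vec d" "v \<noteq> 0\<^sub>v d" "A *\<^sub>v v = 0\<^sub>v d"
    using det_0_iff_vec_prod_zero_field[OF A] by auto
  from v(1,2) have "v \<bullet> (A *\<^sub>v v) > 0" using assms by (simp add: pos_def_mat_def)
  then show False using v by simp
qed

lemma symmetric_mat_form:
  assumes "A \<in> carrier_mat d d" "transpose_mat A = A" "u \<in> carrier_vec d" "v \<in> carrier_vec d"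
  shows "(A *\<^sub>v u) \<bullet> v = u \<bullet> (A *\<^sub>v (v :: real Matrix.vec))"
  using transpose_vec_mult_scalar[OF assms(1,4,3)] assms(2) by simp

text \<open>The values \<open>s = c\<close>, \<open>t = - b\<close> give c (a c - b^2) \<ge> 0,
  which settles the case of nonzero \<open>c\<close>. The form is only semidefinite, so
  \<open>c\<close> may vanish; then it is affine in \<open>t\<close> and its slope must be
  0.\<close>

lemma psd_Cauchy_Schwarz:
  assumes A: "A \<in> carrier_mat d d" "transpose_mat A = A"
    and psd: "\<And>u. u \<in> carrier_vec d \<Longrightarrow> u \<bullet> (A *\<^sub>v u) \<ge> 0"
    and uv: "u \<in> carrier_vec d" "v \<in> carrier_vec d"
  shows "(u \<bullet> (A *\<^sub>v v))\<^sup>2 \<le> (u \<bullet> (A *\<^sub>v u)) * (v \<bullet> (A *\<^sub>v (v :: real Matrix.vec)))"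
proof -
  define a b c where "a = u \<bullet> (A *\<^sub>v u)" and "b = u \<bullet> (A *\<^sub>v v)" and "c = v \<bullet> (A *\<^sub>v v)"
  have sym: "v \<bullet> (A *\<^sub>v u) = b"
    using symmetric_mat_form[OF A uv] uv A(1) by (simp add: b_def comm_scalar_prod[of _ d])
  have q: "a * s\<^sup>2 + 2 * b * s * t + c * t\<^sup>2 \<ge> 0" for s t :: real
  proof -
    have "(s \<cdot>\<^sub>v u + t \<cdot>\<^sub>v v) \<bullet> (A *\<^sub>v (s \<cdot>\<^sub>v u + t \<cdot>\<^sub>v v)) = a * s\<^sup>2 + 2 * b * s * t + c * t\<^sup>2"
    proof -
      have c: "A *\<^sub>v u \<in> carrier_vec d" "A *\<^sub>v v \<in> carrier_vec d" using A uv by auto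
      have "A *\<^sub>v (s \<cdot>\<^sub>v u + t \<cdot>\<^sub>v v) = s \<cdot>\<^sub>v (A *\<^sub>v u) + t \<cdot>\<^sub>v (A *\<^sub>v v)"
        using A uv by (simp add: mult_add_distrib_mat_vec[of _ d d] mult_mat_vec[of _ d d])
      then show ?thesis
        using c uv sym
        by (simp add: add_scalar_prod_distrib[of _ d] scalar_prod_add_distrib[of _ d]
            a_def b_def c_def algebra_simps power2_eq_square)
    qed
    then show ?thesis using psd[of "s \<cdot>\<^sub>v u + t \<cdot>\<^sub>v v"] uv by simp
  qed
  have a0: "a \<ge> 0" "c \<ge> 0" using psd uv by (auto simp: a_def c_def)
  have "b\<^sup>2 \<le> a * c"
  proof (cases "c = 0")
    case False
    have "a * c\<^sup>2 - b\<^sup>2 * c \<ge> 0" using q[of c "- b"] by (simp add: power2_eq_square algebra_simps)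
    then have "c * (a * c - b\<^sup>2) \<ge> 0" by (simp add: power2_eq_square algebra_simps)
    then show ?thesis using False a0 by (simp add: zero_le_mult_iff)
  next
    case True
    show ?thesis
    proof (rule ccontr)
      assume "\<not> ?thesis"
      then have b: "b \<noteq> 0" using True by auto
      \<comment> \<open>This value of \<open>t\<close> makes the expression equal to - 1.\<close>
      have "a + 2 * b * (- (a + 1) / (2 * b)) \<ge> 0" using q[of 1 "- (a + 1) / (2 * b)"] True by simp
      then show False using b by simp
    qed
  qed
  then show ?thesis by (simp add: a_def b_def c_def)
qed

subsection \<open>The square root\<close>

definition mat_tr :: "nat \<Rightarrow> real mat \<Rightarrow> real" where "mat_tr d A = (\<Sum>i<d. A $$ (i, i))"

lemma mat_tr_commute:
  assumes "A \<in> carrier_mat d d" "B \<in> carrier_mat d d"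
  shows "mat_tr d (A * B) = mat_tr d (B * A)"
proof -
  have eq: "mat_tr d (A * B) = (\<Sum>i<d. \<Sum>j<d. A $$ (i, j) * B $$ (j, i))"
    if "A \<in> carrier_mat d d" "B \<in> carrier_mat d d" for A B
    unfolding mat_tr_def using that
    by (intro sum.cong) (auto simp: scalar_prod_def lessThan_atLeast0)
  show ?thesis unfolding eq[OF assms] eq[OF assms(2,1)]
    by (subst sum.swap) (simp add: mult.commute)
qed

text \<open>With \<open>D = B - C\<close> the hypothesis reads \<open>B * D = - (D * C)\<close>, so
  the traces of D B D and D C D are opposite. Both are sums of values of positive definite forms at
  the columns of \<open>D\<close>, hence zero, and \<open>D\<close> vanishes.\<close>

lemma psd_sqrt_unique:
  assumes B: "pos_def_mat d B" and C: "pos_def_mat d C" and eq: "B * B = C * C"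
  shows "B = C"
proof -
  have Bc: "B \<in> carrier_mat d d" "transpose_mat B = B" and Cc: "C \<in> carrier_mat d d" "transpose_mat C = C"
    using B C by (auto simp: pos_def_mat_def)
  define D where "D = B - C"
  have Dc: "D \<in> carrier_mat d d" using Bc Cc by (auto simp: D_def)
  have Dt: "D $$ (i, j) = D $$ (j, i)" if "i < d" "j < d" for i j
  proof -
    have "B $$ (i, j) = B $$ (j, i)" "C $$ (i, j) = C $$ (j, i)"
      using that Bc Cc index_transpose_mat(1)[of j B i] index_transpose_mat(1)[of j C i] by auto
    then show ?thesis using that Bc Cc by (simp add: D_def)
  qed
  have "B * D = B * B - B * C" unfolding D_def by (rule mult_minus_distrib_mat[OF Bc(1) Bc(1) Cc(1)])
  moreover have "D * C = B * C - C * C" unfolding D_def by (rule minus_mult_distrib_mat[OF Bc(1) Cc(1) Cc(1)])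
  moreover have "B * B \<in> carrier_mat d d" "C * C \<in> carrier_mat d d" "B * C \<in> carrier_mat d d"
    using Bc Cc by auto
  ultimately have zero: "B * D = - (D * C)"
    unfolding eq by (auto intro!: eq_matI simp del: index_mult_mat)
  have tr_nonneg: "mat_tr d (D * (E * D)) \<ge> 0" and tr_pos: "mat_tr d (D * (E * D)) = 0 \<Longrightarrow> D = 0\<^sub>m d d"
    if E: "pos_def_mat d E" for E
  proof -
    have Ec: "E \<in> carrier_mat d d" using E by (simp add: pos_def_mat_def)
    have tr: "mat_tr d (D * (E * D)) = (\<Sum>i<d. col D i \<bullet> (E *\<^sub>v col D i))"
      unfolding mat_tr_def
    proof (rule sum.cong[OF refl])
      fix i assume i: "i \<in> {..<d}"
      have "row D i = col D i" using i Dc Dt by (intro eq_vecI) auto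
      moreover have "col (E * D) i = E *\<^sub>v col D i" using i Ec Dc by (intro col_mult2) auto
      ultimately show "(D * (E * D)) $$ (i, i) = col D i \<bullet> (E *\<^sub>v col D i)"
        using i Ec Dc by simp
    qed
    have nn: "col D i \<bullet> (E *\<^sub>v col D i) \<ge> 0" if "i \<in> {..<d}" for i
    proof (cases "col D i = 0\<^sub>v d")
      case False
      then show ?thesis using E Dc that unfolding pos_def_mat_def by (simp add: less_imp_le)
    next
      case True
      then show ?thesis using Ec by simp
    qed
    show "mat_tr d (D * (E * D)) \<ge> 0" unfolding tr by (rule sum_nonneg[OF nn])
    assume "mat_tr d (D * (E * D)) = 0"
    then have z: "\<And>i. i \<in> {..<d} \<Longrightarrow> col D i \<bullet> (E *\<^sub>v col D i) = 0"
      unfolding tr using nn by (subst (asm) sum_nonneg_eq_0_iff) auto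
    have "D $$ (j, i) = 0" if "i < d" "j < d" for i j
    proof -
      have ci: "col D i \<in> carrier_vec d" using that Dc by simp
      have "col D i = 0\<^sub>v d"
      proof (rule ccontr)
        assume "col D i \<noteq> 0\<^sub>v d"
        then have "col D i \<bullet> (E *\<^sub>v col D i) > 0" using E ci unfolding pos_def_mat_def by blast
        then show False using z[of i] that by simp
      qed
      then have "col D i $ j = 0" using that by simp
      then show ?thesis using that Dc by simp
    qed
    then show "D = 0\<^sub>m d d" using Dc by (intro eq_matI) auto
  qed
  have "mat_tr d (D * (B * D)) = - mat_tr d (D * (D * C))"
    unfolding zero mat_tr_def using Dc Cc by (simp add: sum_negf)
  also have "mat_tr d (D * (D * C)) = mat_tr d (D * C * D)"
    using Dc Cc by (intro mat_tr_commute) auto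
  also have "D * C * D = D * (C * D)" by (rule assoc_mult_mat[OF Dc Cc(1) Dc])
  finally have "mat_tr d (D * (B * D)) = - mat_tr d (D * (C * D))" .
  then have "mat_tr d (D * (B * D)) = 0" using tr_nonneg[OF B] tr_nonneg[OF C] by linarith
  then have "D = 0\<^sub>m d d" by (rule tr_pos[OF B])
  show ?thesis
  proof (rule eq_matI)
    fix i j assume "i < dim_row C" "j < dim_col C"
    then have "(B - C) $$ (i, j) = 0" using \<open>D = 0\<^sub>m d d\<close> Cc unfolding D_def by simp
    then show "B $$ (i, j) = C $$ (i, j)" using \<open>i < dim_row C\<close> \<open>j < dim_col C\<close> by simp
  qed (use Bc Cc in auto)
qed

text \<open>The square root is a value at the exponent one half of the binomial series
  of (1 - X) to the power a, which is multiplicative in the exponent.\<close>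

locale contraction_mat =
  fixes d :: nat and X :: "real mat" and q :: real
  assumes X: "X \<in> carrier_mat d d" "transpose_mat X = X"
    and q: "0 \<le> q" "q < 1"
    and contraction: "\<And>u. u \<in> carrier_vec d \<Longrightarrow> vnorm (X *\<^sub>v u) \<le> q * vnorm u"
begin

lemma power_bound: "u \<in> carrier_vec d \<Longrightarrow> vnorm ((X ^\<^sub>m k) *\<^sub>v u) \<le> q ^ k * vnorm u"
proof (induction k arbitrary: u)
  case (Suc k)
  have "(X ^\<^sub>m Suc k) *\<^sub>v u = (X ^\<^sub>m k) *\<^sub>v (X *\<^sub>v u)"
    using X Suc.prems by (simp add: assoc_mult_mat_vec[of _ d d _ d])
  then have "vnorm ((X ^\<^sub>m Suc k) *\<^sub>v u) \<le> q ^ k * vnorm (X *\<^sub>v u)"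
    using Suc.IH[of "X *\<^sub>v u"] X Suc.prems by simp
  also have "\<dots> \<le> q ^ k * (q * vnorm u)"
    using q by (intro mult_left_mono contraction Suc.prems) auto
  finally show ?case by (simp add: mult_ac)
qed (use X in simp)

lemma entry_bound:
  assumes "i < d" "j < d"
  shows "\<bar>(X ^\<^sub>m k) $$ (i, j)\<bar> \<le> q ^ k"
proof -
  have e: "vnorm (unit_vec d i) = 1" if "i < d" for i using that by (simp add: vnorm_def)
  have P: "X ^\<^sub>m k \<in> carrier_mat d d" using X by simp
  have "(X ^\<^sub>m k) $$ (i, j) = unit_vec d i \<bullet> ((X ^\<^sub>m k) *\<^sub>v unit_vec d j)"
    using mat_mult_unit_vec[OF P assms] assms P by simp
  also have "\<bar>\<dots>\<bar> \<le> vnorm (unit_vec d i) * vnorm ((X ^\<^sub>m k) *\<^sub>v unit_vec d j)"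
    using P by (intro scalar_prod_Cauchy_Schwarz[of _ d]) auto
  also have "\<dots> \<le> q ^ k" using power_bound[of "unit_vec d j" k] assms by (simp add: e)
  finally show ?thesis .
qed

definition coeff :: "real \<Rightarrow> nat \<Rightarrow> real" where "coeff a k = (a gchoose k) * (- 1) ^ k"

text \<open>The series is summed entry by entry, so its convergence is that of real series dominated
  through \<open>entry_bound\<close>.\<close>

definition P :: "real \<Rightarrow> real mat" where
  "P a = Matrix.mat d d (\<lambda>(i, j). \<Sum>k. coeff a k * (X ^\<^sub>m k) $$ (i, j))"

lemma P_carrier [simp]: "P a \<in> carrier_mat d d" by (simp add: P_def)

text \<open>The binomial series converges up to radius 1; a point \<open>r\<close> strictly between
  \<open>q\<close> and 1 makes the convergence at \<open>q\<close> absolute.\<close>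

lemma coeff_summable: "summable (\<lambda>k. \<bar>coeff a k\<bar> * q ^ k)"
proof -
  define r where "r = (1 + q) / 2"
  have r: "norm r < 1" "norm q < norm r" using q by (auto simp: r_def)
  have "summable (\<lambda>n. (a gchoose n) * r ^ n)"
    using gen_binomial_real[of r a] r by (auto simp: sums_iff)
  from powser_insidea[OF this r(2)] show ?thesis
    using q by (simp add: coeff_def abs_mult power_abs)
qed

lemma entry_summable:
  assumes "i < d" "j < d"
  shows "summable (\<lambda>k. norm (coeff a k * (X ^\<^sub>m k) $$ (i, j)))"
  by (rule summable_comparison_test'[OF coeff_summable[of a]])
    (use entry_bound[OF assms] in \<open>auto simp: abs_mult intro!: mult_left_mono\<close>)

lemma pow_add: "X ^\<^sub>m (m + n) = X ^\<^sub>m m * X ^\<^sub>m n"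
proof (induction n)
  case (Suc n)
  show ?case using X Suc by (simp add: assoc_mult_mat[of _ d d _ d _ d])
qed (use X in simp)

lemma coeff_Vandermonde: "(\<Sum>k\<le>n. coeff a k * coeff b (n - k)) = coeff (a + b) n"
proof -
  have "coeff a k * coeff b (n - k) = (- 1) ^ n * ((a gchoose k) * (b gchoose (n - k)))" if "k \<le> n" for k
    using that by (simp add: coeff_def mult_ac flip: power_add)
  then have "(\<Sum>k\<le>n. coeff a k * coeff b (n - k)) = (- 1) ^ n * (\<Sum>k\<le>n. (a gchoose k) * (b gchoose (n - k)))"
    by (simp add: sum_distrib_left)
  then show ?thesis
    by (simp add: gbinomial_Vandermonde coeff_def atLeast0AtMost[symmetric])
qed

text \<open>Cauchy product of the entry series: Vandermonde's identity collects the coefficients,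
  and the sum over the inner index \<open>l\<close> reassembles powers of \<open>X\<close>.\<close>

lemma P_mult: "P a * P b = P (a + b)"
proof (rule eq_matI)
  fix i j assume "i < dim_row (P (a + b))" "j < dim_col (P (a + b))"
  then have ij: "i < d" "j < d" by (auto simp: P_def)
  have "(P a * P b) $$ (i, j) = (\<Sum>l<d. P a $$ (i, l) * P b $$ (l, j))"
    using ij P_carrier[of a] P_carrier[of b] by (simp add: scalar_prod_def lessThan_atLeast0 del: P_carrier)
  also have "\<dots> = (\<Sum>l<d. (\<Sum>k. coeff a k * (X ^\<^sub>m k) $$ (i, l)) * (\<Sum>k. coeff b k * (X ^\<^sub>m k) $$ (l, j)))"
    using ij by (intro sum.cong) (auto simp: P_def)
  finally have 1: "(P a * P b) $$ (i, j) = \<dots>" .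
  have "(\<lambda>n. \<Sum>l<d. \<Sum>k\<le>n. (coeff a k * (X ^\<^sub>m k) $$ (i, l)) * (coeff b (n - k) * (X ^\<^sub>m (n - k)) $$ (l, j)))
    sums (P a * P b) $$ (i, j)"
    unfolding 1 using ij by (intro sums_sum Cauchy_product_sums entry_summable) auto
  moreover have "(\<Sum>l<d. \<Sum>k\<le>n. (coeff a k * (X ^\<^sub>m k) $$ (i, l)) * (coeff b (n - k) * (X ^\<^sub>m (n - k)) $$ (l, j)))
      = coeff (a + b) n * (X ^\<^sub>m n) $$ (i, j)" for n
  proof -
    have "(\<Sum>l<d. \<Sum>k\<le>n. (coeff a k * (X ^\<^sub>m k) $$ (i, l)) * (coeff b (n - k) * (X ^\<^sub>m (n - k)) $$ (l, j)))
        = (\<Sum>k\<le>n. coeff a k * coeff b (n - k) * (\<Sum>l<d. (X ^\<^sub>m k) $$ (i, l) * (X ^\<^sub>m (n - k)) $$ (l, j)))"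
      by (subst sum.swap) (simp add: sum_distrib_left mult_ac)
    also have "\<dots> = (\<Sum>k\<le>n. coeff a k * coeff b (n - k) * (X ^\<^sub>m n) $$ (i, j))"
    proof (rule sum.cong[OF refl])
      fix k assume k: "k \<in> {..n}"
      have c: "X ^\<^sub>m k \<in> carrier_mat d d" "X ^\<^sub>m (n - k) \<in> carrier_mat d d" using X by auto
      have "X ^\<^sub>m n = X ^\<^sub>m k * X ^\<^sub>m (n - k)" using k pow_add[of k "n - k"] by simp
      then have "(X ^\<^sub>m n) $$ (i, j) = (\<Sum>l<d. (X ^\<^sub>m k) $$ (i, l) * (X ^\<^sub>m (n - k)) $$ (l, j))"
        using mat_mult_entry[OF c ij] by simp
      then show "coeff a k * coeff b (n - k) * (\<Sum>l<d. (X ^\<^sub>m k) $$ (i, l) * (X ^\<^sub>m (n - k)) $$ (l, j))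
        = coeff a k * coeff b (n - k) * (X ^\<^sub>m n) $$ (i, j)" by simp
    qed
    finally show ?thesis by (simp add: coeff_Vandermonde flip: sum_distrib_right)
  qed
  ultimately show "(P a * P b) $$ (i, j) = P (a + b) $$ (i, j)"
    using ij by (simp add: P_def sums_iff)
qed (use P_carrier in \<open>auto simp: P_def\<close>)

lemma P_1: "P 1 = 1\<^sub>m d - X"
proof (rule eq_matI)
  fix i j assume "i < dim_row (1\<^sub>m d - X)" "j < dim_col (1\<^sub>m d - X)"
  then have ij: "i < d" "j < d" using X by auto
  have "coeff 1 k = 0" if "k \<notin> {0, 1}" for k
  proof -
    have "(1::real) gchoose k = real (1 choose k)" by (simp add: binomial_gbinomial)
    also have "1 choose k = 0" using that by (intro binomial_eq_0) auto
    finally show ?thesis by (simp add: coeff_def)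
  qed
  then have "(\<Sum>k. coeff 1 k * (X ^\<^sub>m k) $$ (i, j)) = (\<Sum>k\<in>{0, 1}. coeff 1 k * (X ^\<^sub>m k) $$ (i, j))"
    by (intro suminf_finite) auto
  also have "\<dots> = (1\<^sub>m d - X) $$ (i, j)" using ij X by (simp add: coeff_def)
  finally show "P 1 $$ (i, j) = (1\<^sub>m d - X) $$ (i, j)" using ij by (simp add: P_def)
qed (use X in \<open>auto simp: P_def\<close>)

lemma P_symmetric: "transpose_mat (P a) = P a"
proof (rule eq_matI)
  fix i j assume "i < dim_row (P a)" "j < dim_col (P a)"
  then have ij: "i < d" "j < d" by (auto simp: P_def)
  have "transpose_mat (X ^\<^sub>m k) = X ^\<^sub>m k" for k
  proof (induction k)
    case (Suc k)
    have "transpose_mat (X ^\<^sub>m Suc k) = transpose_mat X * transpose_mat (X ^\<^sub>m k)"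
      using X transpose_mult[of "X ^\<^sub>m k" d d X d] by simp
    also have "\<dots> = X ^\<^sub>m 1 * X ^\<^sub>m k" using X Suc by simp
    also have "\<dots> = X ^\<^sub>m (1 + k)" by (rule pow_add[symmetric])
    finally show ?case by simp
  qed (use X in simp)
  then have "(X ^\<^sub>m k) $$ (i, j) = (X ^\<^sub>m k) $$ (j, i)" for k
    using ij X index_transpose_mat(1)[of j "X ^\<^sub>m k" i] by (simp del: index_transpose_mat)
  then show "transpose_mat (P a) $$ (i, j) = P a $$ (i, j)" using ij by (simp add: P_def)
qed (auto simp: P_def)

text \<open>Positivity also comes from multiplicativity: \<open>P (1/2)\<close> is the square of the
  symmetric \<open>P (1/4)\<close>, so its form is a squared norm, and \<open>P (1/4)\<close> is
  injective because \<open>P (3/4)\<close> times it is 1 - X.\<close>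

lemma pos_def_P_half:
  assumes inj: "\<And>u :: real Matrix.vec. u \<in> carrier_vec d \<Longrightarrow> (1\<^sub>m d - X) *\<^sub>v u = 0\<^sub>v d \<Longrightarrow> u = 0\<^sub>v d"
  shows "pos_def_mat d (P (1/2))" "P (1/2) * P (1/2) = 1\<^sub>m d - X"
proof -
  show "P (1/2) * P (1/2) = 1\<^sub>m d - X" by (simp add: P_mult P_1)
  show "pos_def_mat d (P (1/2))"
    unfolding pos_def_mat_def
  proof (intro conjI ballI impI)
    fix u :: "real Matrix.vec" assume u: "u \<in> carrier_vec d" "u \<noteq> 0\<^sub>v d"
    have c: "P (1/4) *\<^sub>v u \<in> carrier_vec d" using u P_carrier[of "1/4"] by (intro mult_mat_vec_carrier)
    have "P (1/2) *\<^sub>v u = P (1/4) *\<^sub>v (P (1/4) *\<^sub>v u)"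
      using assoc_mult_mat_vec[OF P_carrier P_carrier u(1), of "1/4" "1/4"] by (simp add: P_mult)
    then have eq: "u \<bullet> (P (1/2) *\<^sub>v u) = (P (1/4) *\<^sub>v u) \<bullet> (P (1/4) *\<^sub>v u)"
      using symmetric_mat_form[OF P_carrier P_symmetric u(1) c] by simp
    have "P (1/4) *\<^sub>v u \<noteq> 0\<^sub>v d"
    proof
      assume z: "P (1/4) *\<^sub>v u = 0\<^sub>v d"
      have "(1\<^sub>m d - X) *\<^sub>v u = (P (3/4) * P (1/4)) *\<^sub>v u" by (simp add: P_mult P_1)
      also have "\<dots> = P (3/4) *\<^sub>v (P (1/4) *\<^sub>v u)" by (rule assoc_mult_mat_vec[OF P_carrier P_carrier u(1)])
      also have "\<dots> = 0\<^sub>v d" unfolding z by (auto simp: P_def intro!: eq_vecI)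
      finally show False using inj u by blast
    qed
    then show "u \<bullet> (P (1/2) *\<^sub>v u) > 0"
      unfolding eq using scalar_prod_self_eq_0[OF c] scalar_prod_self_nonneg[of "P (1/4) *\<^sub>v u"] by linarith
  qed (auto simp: P_symmetric)
qed

end

lemma form_bound:
  assumes "A \<in> carrier_mat d d"
  obtains K where "K > 0" "\<And>u :: real Matrix.vec. u \<in> carrier_vec d \<Longrightarrow> \<bar>u \<bullet> (A *\<^sub>v u)\<bar> \<le> K * (u \<bullet> u)"
proof -
  define K where "K = 1 + (\<Sum>i<d. \<Sum>j<d. \<bar>A $$ (i, j)\<bar>)"
  have K: "K > 0" unfolding K_def by (intro add_pos_nonneg sum_nonneg) auto
  moreover have "\<bar>u \<bullet> (A *\<^sub>v u)\<bar> \<le> K * (u \<bullet> u)" if u: "u \<in> carrier_vec d" for u :: "real Matrix.vec"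
  proof -
    have comp: "\<bar>u $ i\<bar> \<le> vnorm u" if "i < d" for i
    proof -
      have "(u $ i)\<^sup>2 \<le> (\<Sum>i<d. (u $ i)\<^sup>2)" using that by (intro member_le_sum) auto
      also have "\<dots> = u \<bullet> u" using u by (simp add: scalar_prod_def lessThan_atLeast0 power2_eq_square)
      finally show ?thesis by (simp add: vnorm_def real_le_rsqrt)
    qed
    have "u \<bullet> (A *\<^sub>v u) = (\<Sum>i<d. \<Sum>j<d. A $$ (i, j) * (u $ i * u $ j))"
      using u assms by (auto simp: scalar_prod_def lessThan_atLeast0 sum_distrib_left mult_ac intro!: sum.cong)
    also have "\<bar>\<dots>\<bar> \<le> (\<Sum>i<d. \<Sum>j<d. \<bar>A $$ (i, j) * (u $ i * u $ j)\<bar>)"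
      by (intro order_trans[OF sum_abs] sum_mono sum_abs)
    also have "\<dots> \<le> (\<Sum>i<d. \<Sum>j<d. \<bar>A $$ (i, j)\<bar> * (u \<bullet> u))"
    proof (intro sum_mono)
      fix i j assume "i \<in> {..<d}" "j \<in> {..<d}"
      then have "\<bar>u $ i\<bar> * \<bar>u $ j\<bar> \<le> vnorm u * vnorm u" by (intro mult_mono comp) auto
      then show "\<bar>A $$ (i, j) * (u $ i * u $ j)\<bar> \<le> \<bar>A $$ (i, j)\<bar> * (u \<bullet> u)"
        unfolding abs_mult by (intro mult_left_mono) (auto simp flip: vnorm_square simp: power2_eq_square)
    qed
    also have "\<dots> = (K - 1) * (u \<bullet> u)" by (simp add: K_def sum_distrib_right)
    also have "\<dots> \<le> K * (u \<bullet> u)" using scalar_prod_self_nonneg[of u] by (intro mult_right_mono) auto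
    finally show ?thesis .
  qed
  ultimately show ?thesis using that by blast
qed

lemma pos_def_mat_nonneg:
  assumes "pos_def_mat d A" "u \<in> carrier_vec d"
  shows "u \<bullet> (A *\<^sub>v u) \<ge> 0"
proof (cases "u = 0\<^sub>v d")
  case True
  then show ?thesis using assms by (auto simp: pos_def_mat_def)
qed (use assms in \<open>auto simp: pos_def_mat_def less_imp_le\<close>)

text \<open>Compactness and eigenvalues are avoided: Cauchy-Schwarz for the form of
  \<open>A\<close>, applied to \<open>u\<close> and to its image under the inverse of
  \<open>A\<close>, bounds the square of u . u by u . A u times the form of the inverse, which
  \<open>form_bound\<close> controls.\<close>

lemma pos_def_mat_coercive:
  assumes A: "pos_def_mat d A"
  obtains m where "m > 0" "\<And>u. u \<in> carrier_vec d \<Longrightarrow> m * (u \<bullet> u) \<le> u \<bullet> (A *\<^sub>v u)"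
proof -
  have Ac: "A \<in> carrier_mat d d" "transpose_mat A = A" using A by (auto simp: pos_def_mat_def)
  note inv = mat_inv_inverse[OF Ac(1) pos_def_mat_det[OF A]]
  obtain K where K: "K > 0" "\<And>u. u \<in> carrier_vec d \<Longrightarrow> \<bar>u \<bullet> (mat_inv A *\<^sub>v u)\<bar> \<le> K * (u \<bullet> u)"
    using form_bound[OF inv(1)] by blast
  have "1 / K * (u \<bullet> u) \<le> u \<bullet> (A *\<^sub>v u)" if u: "u \<in> carrier_vec d" for u
  proof (cases "u \<bullet> u = 0")
    case False
    define v where "v = mat_inv A *\<^sub>v u"
    have v: "v \<in> carrier_vec d" using inv u by (simp add: v_def)
    have Av: "A *\<^sub>v v = u" unfolding v_def using assoc_mult_mat_vec[OF Ac(1) inv(1) u] inv u by simp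
    have "(u \<bullet> u)\<^sup>2 \<le> (u \<bullet> (A *\<^sub>v u)) * (v \<bullet> u)"
      using psd_Cauchy_Schwarz[OF Ac pos_def_mat_nonneg[OF A] u v] by (simp add: Av)
    also have "v \<bullet> u \<le> K * (u \<bullet> u)" using K(2)[OF u] comm_scalar_prod[OF v u] by (simp add: v_def)
    then have "(u \<bullet> (A *\<^sub>v u)) * (v \<bullet> u) \<le> (u \<bullet> (A *\<^sub>v u)) * (K * (u \<bullet> u))"
      using pos_def_mat_nonneg[OF A u] by (intro mult_left_mono)
    finally have "(u \<bullet> u) * (u \<bullet> u) \<le> (K * (u \<bullet> (A *\<^sub>v u))) * (u \<bullet> u)"
      by (simp add: power2_eq_square mult_ac)
    then have "u \<bullet> u \<le> K * (u \<bullet> (A *\<^sub>v u))"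
      using False scalar_prod_self_nonneg[of u] by (simp add: mult_le_cancel_right)
    then show ?thesis using K(1) by (simp add: field_simps)
  qed (use pos_def_mat_nonneg[OF A u] in simp)
  then show ?thesis using K(1) that[of "1 / K"] by simp
qed

text \<open>Dividing \<open>A\<close> by a large \<open>c\<close> puts the form of
  \<open>X = 1 - A / c\<close> between 0 and \<open>q = 1 - m / c < 1\<close> times the squared
  norm. So \<open>X\<close> is a contraction, and the binomial series for the root of 1 - X
  applies.\<close>

lemma pos_def_sqrt_exists:
  assumes A: "pos_def_mat d A"
  shows "\<exists>B. pos_def_mat d B \<and> B * B = A"
proof -
  have Ac: "A \<in> carrier_mat d d" "transpose_mat A = A" using A by (auto simp: pos_def_mat_def)
  obtain m where m: "m > 0" "\<And>u. u \<in> carrier_vec d \<Longrightarrow> m * (u \<bullet> u) \<le> u \<bullet> (A *\<^sub>v u)"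
    using pos_def_mat_coercive[OF A] by blast
  obtain K where K: "K > 0" "\<And>u :: real Matrix.vec. u \<in> carrier_vec d \<Longrightarrow> \<bar>u \<bullet> (A *\<^sub>v u)\<bar> \<le> K * (u \<bullet> u)"
    using form_bound[OF Ac(1)] by blast
  define c where "c = max K m"
  have c: "c > 0" "K \<le> c" "m \<le> c" using K by (auto simp: c_def)
  define X where "X = 1\<^sub>m d - (1 / c) \<cdot>\<^sub>m A"
  define q where "q = 1 - m / c"
  have q: "0 \<le> q" "q < 1" using m c by (auto simp: q_def)
  have Xc: "X \<in> carrier_mat d d" using Ac by (auto simp: X_def)
  have Xt: "transpose_mat X = X"
  proof (rule eq_matI)
    fix i j assume "i < dim_row X" "j < dim_col X"
    then have ij: "i < d" "j < d" using Xc by auto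
    have "A $$ (j, i) = transpose_mat A $$ (i, j)" using ij Ac(1) by simp
    then show "transpose_mat X $$ (i, j) = X $$ (i, j)" using ij Ac by (simp add: X_def eq_commute)
  qed (use Xc in auto)
  have Xv: "X *\<^sub>v u = u - (1 / c) \<cdot>\<^sub>v (A *\<^sub>v u)" if "u \<in> carrier_vec d" for u
    using that Ac by (simp add: X_def minus_mult_distrib_mat_vec[of _ d d] smult_mat_mult_vec[of _ d d])
  have Xu: "u \<bullet> (X *\<^sub>v u) = u \<bullet> u - (u \<bullet> (A *\<^sub>v u)) / c" if u: "u \<in> carrier_vec d" for u
    using u Ac by (simp add: Xv scalar_prod_minus_distrib[of _ d])
  have X_nonneg: "u \<bullet> (X *\<^sub>v u) \<ge> 0" if u: "u \<in> carrier_vec d" for u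
  proof -
    have "u \<bullet> (A *\<^sub>v u) \<le> K * (u \<bullet> u)" using K(2)[OF u] by simp
    also have "\<dots> \<le> c * (u \<bullet> u)" using c scalar_prod_self_nonneg[of u] by (intro mult_right_mono)
    finally show ?thesis unfolding Xu[OF u] using c by (simp add: field_simps)
  qed
  have X_le: "u \<bullet> (X *\<^sub>v u) \<le> q * (u \<bullet> u)" if u: "u \<in> carrier_vec d" for u
    unfolding Xu[OF u] using m(2)[OF u] c by (simp add: q_def field_simps)
  interpret contraction_mat d X q
  proof
    fix u :: "real Matrix.vec" assume u: "u \<in> carrier_vec d"
    have v: "X *\<^sub>v u \<in> carrier_vec d" using Xc u by simp
    \<comment> \<open>A bound on the form gives a bound on the operator: Cauchy-Schwarz for the form
      of \<open>X\<close> at X u and u has a right side of at most q^2 |X u|^2 |u|^2.\<close>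
    have "((X *\<^sub>v u) \<bullet> (X *\<^sub>v u))\<^sup>2 \<le> ((X *\<^sub>v u) \<bullet> (X *\<^sub>v (X *\<^sub>v u))) * (u \<bullet> (X *\<^sub>v u))"
      by (rule psd_Cauchy_Schwarz[OF Xc Xt X_nonneg v u])
    also have "\<dots> \<le> (q * ((X *\<^sub>v u) \<bullet> (X *\<^sub>v u))) * (q * (u \<bullet> u))"
      using X_le[OF u] X_le[OF v] X_nonneg[OF u] q scalar_prod_self_nonneg by (intro mult_mono) auto
    finally have *: "(vnorm (X *\<^sub>v u))\<^sup>2 * (vnorm (X *\<^sub>v u))\<^sup>2 \<le> (q * vnorm u)\<^sup>2 * (vnorm (X *\<^sub>v u))\<^sup>2"
      by (simp add: vnorm_square power_mult_distrib) (simp add: power2_eq_square mult_ac)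
    show "vnorm (X *\<^sub>v u) \<le> q * vnorm u"
    proof (cases "vnorm (X *\<^sub>v u) = 0")
      case False
      have "(vnorm (X *\<^sub>v u))\<^sup>2 \<le> (q * vnorm u)\<^sup>2"
        by (rule mult_right_le_imp_le[OF *]) (use False in simp)
      then show ?thesis by (rule power2_le_imp_le) (use q in simp)
    qed (use q in simp)
  qed (use Xc Xt q in auto)
  have e1: "1\<^sub>m d - X = (1 / c) \<cdot>\<^sub>m A" using Ac by (auto simp: X_def intro!: eq_matI)
  have inj: "u = 0\<^sub>v d" if u: "u \<in> carrier_vec d" "(1\<^sub>m d - X) *\<^sub>v u = 0\<^sub>v d" for u
  proof (rule ccontr)
    assume "u \<noteq> 0\<^sub>v d"
    then have "u \<bullet> (A *\<^sub>v u) > 0" using A u by (simp add: pos_def_mat_def)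
    moreover have "u \<bullet> (((1 / c) \<cdot>\<^sub>m A) *\<^sub>v u) = (1 / c) * (u \<bullet> (A *\<^sub>v u))"
      using u Ac by (simp add: smult_mat_mult_vec[of _ d d])
    ultimately show False using u c unfolding e1 by simp
  qed
  note P = pos_def_P_half[OF inj]
  define Q where "Q = P (1/2)"
  define B where "B = sqrt c \<cdot>\<^sub>m Q"
  have Qc: "Q \<in> carrier_mat d d" by (simp add: Q_def)
  have "pos_def_mat d B"
    unfolding pos_def_mat_def
  proof (intro conjI ballI impI)
    show "B \<in> carrier_mat d d" using Qc by (simp add: B_def)
    show "transpose_mat B = B" using P_symmetric[of "1/2"] by (simp add: B_def Q_def smult_mat_transpose)
    fix u :: "real Matrix.vec" assume u: "u \<in> carrier_vec d" "u \<noteq> 0\<^sub>v d"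
    have "u \<bullet> (B *\<^sub>v u) = sqrt c * (u \<bullet> (Q *\<^sub>v u))"
      using u Qc by (simp add: B_def smult_mat_mult_vec[of _ d d])
    then show "u \<bullet> (B *\<^sub>v u) > 0" using P(1) u c by (simp add: pos_def_mat_def Q_def)
  qed
  moreover have "B * B = A"
  proof -
    have "B * B = (sqrt c * sqrt c) \<cdot>\<^sub>m (Q * Q)"
      unfolding B_def using Qc by (simp add: mult_smult_assoc_mat[of _ d d _ d] mult_smult_distrib[of _ d d _ d] smult_smult_mat)
    also have "Q * Q = (1 / c) \<cdot>\<^sub>m A" using P(2) by (simp add: Q_def e1)
    finally show ?thesis using c by (auto simp: smult_smult_mat intro!: eq_matI)
  qed
  ultimately show ?thesis by blast
qed

lemma mat_sqrt:
  assumes A: "pos_def_mat d A"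
  shows "pos_def_mat d (mat_sqrt A)" "mat_sqrt A * mat_sqrt A = A"
proof -
  have dim: "dim_row A = d" using A by (auto simp: pos_def_mat_def)
  obtain B where B: "pos_def_mat d B \<and> B * B = A" using pos_def_sqrt_exists[OF A] by blast
  have "pos_def_mat d (mat_sqrt A) \<and> mat_sqrt A * mat_sqrt A = A"
    unfolding mat_sqrt_def dim
    by (rule theI[of _ B]) (use B psd_sqrt_unique in auto)
  then show "pos_def_mat d (mat_sqrt A)" "mat_sqrt A * mat_sqrt A = A" by auto
qed

lemma norm_wrt_eq:
  assumes A: "pos_def_mat d A" and u: "u \<in> carrier_vec d"
  shows "norm_wrt A u = sqrt (u \<bullet> (A *\<^sub>v u))"
proof -
  define B where "B = mat_sqrt A"
  have B: "B \<in> carrier_mat d d" "transpose_mat B = B" "B * B = A"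
    using mat_sqrt[OF A] by (auto simp: B_def pos_def_mat_def)
  have "(B *\<^sub>v u) \<bullet> (B *\<^sub>v u) = u \<bullet> (B *\<^sub>v (B *\<^sub>v u))"
    using u B by (intro symmetric_mat_form) auto
  also have "B *\<^sub>v (B *\<^sub>v u) = A *\<^sub>v u" using assoc_mult_mat_vec[OF B(1) B(1) u] B by simp
  finally show ?thesis by (simp add: norm_wrt_def vnorm_def B_def)
qed

text \<open>Inserting the root of \<open>A\<close> and its inverse splits the product: the inverse
  root acts on \<open>g\<close> and the root on \<open>u\<close>, and the Euclidean Cauchy-Schwarz
  inequality remains.\<close>

lemma dual_norm_wrt_bound:
  assumes A: "pos_def_mat d A" and g: "g \<in> carrier_vec d" and u: "u \<in> carrier_vec d"
  shows "\<bar>g \<bullet> u\<bar> \<le> dual_norm_wrt A g * norm_wrt A u"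
proof -
  define B where "B = mat_sqrt A"
  have B: "B \<in> carrier_mat d d" "transpose_mat B = B" "Determinant.det B \<noteq> 0"
    using mat_sqrt[OF A] pos_def_mat_det[of d B] by (auto simp: B_def pos_def_mat_def)
  note inv = mat_inv_inverse[OF B(1,3)]
  have v: "mat_inv B *\<^sub>v g \<in> carrier_vec d" using inv g by simp
  have "g = B *\<^sub>v (mat_inv B *\<^sub>v g)"
    using assoc_mult_mat_vec[OF B(1) inv(1) g] inv g by simp
  then have "g \<bullet> u = (mat_inv B *\<^sub>v g) \<bullet> (B *\<^sub>v u)"
    using symmetric_mat_form[OF B(1,2) v u] by simp
  also have "\<bar>\<dots>\<bar> \<le> vnorm (mat_inv B *\<^sub>v g) * vnorm (B *\<^sub>v u)"
    using v B u by (intro scalar_prod_Cauchy_Schwarz) auto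
  finally show ?thesis by (simp add: dual_norm_wrt_def norm_wrt_def B_def)
qed

subsection \<open>Cholesky decomposition\<close>

text \<open>Elimination starts from the last variable, so that the lower triangular factor stands to
  the right of its transpose; whitened coordinates are then a lower triangular function of the
  original ones, as \<open>triangular\<close> requires. \<open>S\<close> is the Schur complement of
  the last diagonal entry.\<close>

lemma Cholesky_fun:
  fixes H :: "nat \<Rightarrow> nat \<Rightarrow> real"
  assumes "\<And>i j. i < d \<Longrightarrow> j < d \<Longrightarrow> H i j = H j i"
    and "\<And>x. (\<exists>i<d. x i \<noteq> 0) \<Longrightarrow> (\<Sum>i<d. \<Sum>j<d. x i * H i j * x j) > 0"
  shows "\<exists>T :: nat \<Rightarrow> nat \<Rightarrow> real. (\<forall>i<d. T i i > 0) \<and> (\<forall>i j. i < j \<longrightarrow> T i j = 0) \<and>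
    (\<forall>i<d. \<forall>j<d. (\<Sum>k<d. T k i * T k j) = H i j)"
  using assms
proof (induction d arbitrary: H)
  case (Suc d)
  define c where "c = H d d"
  have c: "c > 0"
  proof -
    define x :: "nat \<Rightarrow> real" where "x = (\<lambda>i. if i = d then 1 else 0)"
    have "\<exists>i<Suc d. x i \<noteq> 0" by (auto simp: x_def)
    from Suc.prems(2)[OF this] show ?thesis by (simp add: x_def c_def)
  qed
  define S where "S = (\<lambda>i j. H i j - H d i * H d j / c)"
  have "\<exists>T :: nat \<Rightarrow> nat \<Rightarrow> real. (\<forall>i<d. T i i > 0) \<and> (\<forall>i j. i < j \<longrightarrow> T i j = 0) \<and>
    (\<forall>i<d. \<forall>j<d. (\<Sum>k<d. T k i * T k j) = S i j)"
  proof (rule Suc.IH)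
    show "S i j = S j i" if "i < d" "j < d" for i j
      using Suc.prems(1)[of i j] that by (simp add: S_def mult.commute)
    fix x :: "nat \<Rightarrow> real" assume x: "\<exists>i<d. x i \<noteq> 0"
    have eq: "x i * S i j * x j = x i * H i j * x j - x i * (H d i * H d j / c) * x j" for i j
      by (simp add: S_def algebra_simps)
    define h where "h = (\<Sum>i<d. H d i * x i)"
    \<comment> \<open>This last coordinate minimises the form for given \<open>x\<close>; the
      minimum is the form of the Schur complement.\<close>
    define y where "y = x(d := - h / c)"
    have "\<exists>i<Suc d. y i \<noteq> 0" using x by (auto simp: y_def)
    from Suc.prems(2)[OF this] have "0 < (\<Sum>i<Suc d. \<Sum>j<Suc d. y i * H i j * y j)" .
    also have "\<dots> = (\<Sum>i<d. (\<Sum>j<d. x i * H i j * x j) + x i * H i d * (- h / c))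
        + ((\<Sum>j<d. (- h / c) * H d j * x j) + (- h / c) * c * (- h / c))"
      by (simp add: y_def c_def)
    also have "(\<Sum>i<d. (\<Sum>j<d. x i * H i j * x j) + x i * H i d * (- h / c))
        = (\<Sum>i<d. \<Sum>j<d. x i * H i j * x j) + h * (- h / c)"
    proof -
      have "(\<Sum>i<d. x i * H i d * (- h / c)) = (\<Sum>i<d. H d i * x i) * (- h / c)"
        unfolding sum_distrib_right using Suc.prems(1)[of _ d] by (intro sum.cong) auto
      then show ?thesis unfolding sum.distrib h_def by simp
    qed
    also have "(\<Sum>j<d. (- h / c) * H d j * x j) = (- h / c) * h"
    proof -
      have "(\<Sum>j<d. e * H d j * x j) = e * h" for e by (simp add: h_def sum_distrib_left mult_ac)
      then show ?thesis .
    qed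
    also have "(\<Sum>i<d. \<Sum>j<d. x i * H i j * x j) + h * (- h / c) + ((- h / c) * h + (- h / c) * c * (- h / c))
        = (\<Sum>i<d. \<Sum>j<d. x i * H i j * x j) - h * h / c"
      using c by simp
    also have "h * h / c = (\<Sum>i<d. \<Sum>j<d. x i * (H d i * H d j / c) * x j)"
      by (simp add: h_def sum_product sum_divide_distrib mult_ac)
    finally show "(\<Sum>i<d. \<Sum>j<d. x i * S i j * x j) > 0"
      using eq by (simp only: sum_subtractf)
  qed
  then obtain T where T: "\<forall>i<d. T i i > 0" "\<forall>i j. i < j \<longrightarrow> T i j = 0"
    "\<forall>i<d. \<forall>j<d. (\<Sum>k<d. T k i * T k j) = S i j" by blast
  define T' where "T' = (\<lambda>i j. if i = d then (if j \<le> d then H d j / sqrt c else 0) else T i j)"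
  show ?case
  proof (intro exI[of _ T'] conjI allI impI)
    show "0 < T' i i" if "i < Suc d" for i
      using that T(1) c by (auto simp: T'_def less_Suc_eq c_def[symmetric])
    show "T' i j = 0" if "i < j" for i j using that T(2) by (auto simp: T'_def)
    fix i j assume ij: "i < Suc d" "j < Suc d"
    have sum: "(\<Sum>k<Suc d. T' k i * T' k j) = (\<Sum>k<d. T k i * T k j) + H d i * H d j / c"
      using ij c by (simp add: T'_def)
    have col: "(\<Sum>k<d. T k i * T k j) = 0" if "i = d \<or> j = d"
      using that T(2) by (intro sum.neutral) auto
    show "(\<Sum>k<Suc d. T' k i * T' k j) = H i j"
    proof (cases "i < d \<and> j < d")
      case True
      then show ?thesis using T(3) unfolding sum by (simp add: S_def)
    next
      case False
      then have "i = d \<or> j = d" using ij by auto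
      then show ?thesis
        unfolding sum using col c Suc.prems(1)[of i d] ij by (auto simp: c_def[symmetric])
    qed
  qed
qed (auto intro!: exI[of _ "\<lambda>_ _. 0"])

lemma Cholesky:
  assumes H: "pos_def_mat d H"
  obtains T A where "T \<in> carrier_mat d d" "\<And>i j. i < d \<Longrightarrow> j < d \<Longrightarrow> i < j \<Longrightarrow> T $$ (i, j) = 0"
    "\<And>i. i < d \<Longrightarrow> T $$ (i, i) > 0" "transpose_mat T * T = H"
    "A \<in> carrier_mat d d" "A * T = 1\<^sub>m d" "T * A = 1\<^sub>m d"
    "Determinant.det H = (\<Prod>i<d. T $$ (i, i))\<^sup>2"
    "\<And>u v. u \<in> carrier_vec d \<Longrightarrow> v \<in> carrier_vec d \<Longrightarrow> u \<bullet> (H *\<^sub>v v) = (T *\<^sub>v u) \<bullet> (T *\<^sub>v v)"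
proof -
  have Hc: "H \<in> carrier_mat d d" "transpose_mat H = H" using H by (auto simp: pos_def_mat_def)
  have "\<exists>T :: nat \<Rightarrow> nat \<Rightarrow> real. (\<forall>i<d. T i i > 0) \<and> (\<forall>i j. i < j \<longrightarrow> T i j = 0) \<and>
    (\<forall>i<d. \<forall>j<d. (\<Sum>k<d. T k i * T k j) = H $$ (i, j))"
  proof (rule Cholesky_fun)
    show "H $$ (i, j) = H $$ (j, i)" if "i < d" "j < d" for i j
      using that Hc index_transpose_mat(1)[of i H j] by simp
    fix x :: "nat \<Rightarrow> real" assume x: "\<exists>i<d. x i \<noteq> 0"
    define u where "u = Matrix.vec d x"
    have "u \<noteq> 0\<^sub>v d"
    proof
      assume "u = 0\<^sub>v d"
      then have "u $ i = 0" if "i < d" for i using that by simp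
      then show False using x by (auto simp: u_def)
    qed
    then have "u \<bullet> (H *\<^sub>v u) > 0" using H by (simp add: pos_def_mat_def u_def)
    also have "u \<bullet> (H *\<^sub>v u) = (\<Sum>i<d. \<Sum>j<d. x i * H $$ (i, j) * x j)"
      using Hc by (auto simp: u_def scalar_prod_def lessThan_atLeast0 sum_distrib_left mult_ac intro!: sum.cong)
    finally show "0 < (\<Sum>i<d. \<Sum>j<d. x i * H $$ (i, j) * x j)" .
  qed
  then obtain T' where T': "\<forall>i<d. T' i i > 0" "\<forall>i j. i < j \<longrightarrow> T' i j = 0"
    "\<forall>i<d. \<forall>j<d. (\<Sum>k<d. T' k i * T' k j) = H $$ (i, j)" by blast
  define T where "T = Matrix.mat d d (\<lambda>(i, j). T' i j)"
  have T: "T \<in> carrier_mat d d" "\<And>i j. i < d \<Longrightarrow> j < d \<Longrightarrow> i < j \<Longrightarrow> T $$ (i, j) = 0"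
    "\<And>i. i < d \<Longrightarrow> T $$ (i, i) > 0"
    using T' by (auto simp: T_def)
  have TT: "transpose_mat T * T = H"
    using Hc T'(3) by (intro eq_matI) (auto simp: T_def scalar_prod_def lessThan_atLeast0)
  have "Determinant.det T = prod_list (diag_mat T)"
    by (rule det_lower_triangular[OF _ T(1)]) (use T(2) in auto)
  also have "\<dots> = (\<Prod>i<d. T $$ (i, i))"
    using T(1) by (simp add: prod_list_diag_prod lessThan_atLeast0)
  finally have det: "Determinant.det T = (\<Prod>i<d. T $$ (i, i))" .
  have "(\<Prod>i<d. T $$ (i, i)) > 0" by (rule prod_pos) (use T(3) in auto)
  then have "Determinant.det T \<noteq> 0" unfolding det by linarith
  note inv = mat_inv_inverse[OF T(1) this]
  have detH: "Determinant.det H = (\<Prod>i<d. T $$ (i, i))\<^sup>2"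
    using det_mult[of "transpose_mat T" d T] T(1) det_transpose[OF T(1)] det
    by (simp add: TT power2_eq_square)
  have form: "u \<bullet> (H *\<^sub>v v) = (T *\<^sub>v u) \<bullet> (T *\<^sub>v v)" if uv: "u \<in> carrier_vec d" "v \<in> carrier_vec d" for u v
  proof -
    have Tv: "T *\<^sub>v v \<in> carrier_vec d" "T *\<^sub>v u \<in> carrier_vec d" using T uv by auto
    have "H *\<^sub>v v = transpose_mat T *\<^sub>v (T *\<^sub>v v)"
      unfolding TT[symmetric] using T uv by (intro assoc_mult_mat_vec[of _ d d _ d]) auto
    then have "u \<bullet> (H *\<^sub>v v) = (transpose_mat T *\<^sub>v (T *\<^sub>v v)) \<bullet> u"
      using T uv Tv by (simp add: comm_scalar_prod[of _ d])
    also have "\<dots> = (T *\<^sub>v v) \<bullet> (T *\<^sub>v u)" by (rule transpose_vec_mult_scalar[OF T(1) uv(1) Tv(1)])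
    finally show ?thesis using Tv by (simp add: comm_scalar_prod[of _ d])
  qed
  show ?thesis by (rule that[OF T TT inv(1,3,2) detH form])
qed

section \<open>Derivatives of the log partition function\<close>

text \<open>Used for differentiation under the integral: a quadratic remainder with an integrable
  constant takes the place of dominated convergence.\<close>

lemma has_derivative_quadratic_remainder:
  fixes f :: "real \<Rightarrow> real"
  assumes "r > 0" "\<And>h. \<bar>h\<bar> < r \<Longrightarrow> \<bar>f (x + h) - f x - h * D\<bar> \<le> C * h\<^sup>2"
  shows "(f has_real_derivative D) (at x)"
proof -
  have "((\<lambda>h. (f (x + h) - f x) / h - D) \<longlongrightarrow> 0) (at 0)"
  proof (rule Lim_null_comparison)
    show "\<forall>\<^sub>F h in at 0. norm ((f (x + h) - f x) / h - D) \<le> \<bar>C\<bar> * \<bar>h\<bar>"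
      unfolding eventually_at
    proof (intro exI[of _ r] conjI ballI impI)
      fix h :: real assume h: "h \<noteq> 0 \<and> dist h 0 < r"
      then have "\<bar>f (x + h) - f x - h * D\<bar> \<le> C * h\<^sup>2" using assms(2)[of h] by simp
      also have "\<dots> \<le> \<bar>C\<bar> * h\<^sup>2" by (intro mult_right_mono) auto
      finally have le: "\<bar>f (x + h) - f x - h * D\<bar> \<le> \<bar>C\<bar> * h\<^sup>2" .
      have "norm ((f (x + h) - f x) / h - D) = \<bar>f (x + h) - f x - h * D\<bar> / \<bar>h\<bar>"
        using h by (simp add: diff_divide_distrib flip: abs_divide)
      also have "\<dots> \<le> (\<bar>C\<bar> * h\<^sup>2) / \<bar>h\<bar>" by (intro divide_right_mono le) simp
      also have "h\<^sup>2 = \<bar>h\<bar> * \<bar>h\<bar>" by (simp add: power2_eq_square)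
      also have "\<bar>C\<bar> * (\<bar>h\<bar> * \<bar>h\<bar>) / \<bar>h\<bar> = \<bar>C\<bar> * \<bar>h\<bar>" using h by (simp del: abs_mult_self_eq)
      finally show "norm ((f (x + h) - f x) / h - D) \<le> \<bar>C\<bar> * \<bar>h\<bar>" .
    qed (use assms in simp)
    show "((\<lambda>h. \<bar>C\<bar> * \<bar>h\<bar>) \<longlongrightarrow> 0) (at 0)"
      by (auto intro!: tendsto_eq_intros)
  qed
  then have "((\<lambda>h. (f (x + h) - f x) / h) \<longlongrightarrow> D) (at 0)" by (simp add: LIM_zero_iff)
  then show ?thesis by (simp add: DERIV_def)
qed

text \<open>Both exponentials appear on the right because they become tilts of the density in two
  opposite directions, which are integrable when the steps are short.\<close>

lemma exp_remainder: "\<bar>exp x - 1 - x\<bar> \<le> x\<^sup>2 * (exp x + exp (- x :: real))"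
proof -
  obtain t where t: "\<bar>t\<bar> \<le> \<bar>x\<bar>" "exp x = (\<Sum>m<2. x ^ m / fact m) + exp t / fact 2 * x\<^sup>2"
    using Maclaurin_exp_le[of x 2] by blast
  have "exp t \<le> exp \<bar>x\<bar>" using t by simp
  also have "\<dots> \<le> exp x + exp (- x)" by (cases "x \<ge> 0") auto
  finally have "exp t / 2 * x\<^sup>2 \<le> x\<^sup>2 * (exp x + exp (- x))"
    using mult_right_mono[of "exp t / 2" "exp x + exp (- x)" "x\<^sup>2"] exp_gt_zero[of t] by (simp add: mult.commute)
  moreover have "exp x - 1 - x = exp t / 2 * x\<^sup>2"
    using t(2) by (simp add: numeral_2_eq_2)
  moreover have "exp t / 2 * x\<^sup>2 \<ge> 0" by simp
  ultimately show ?thesis by linarith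
qed

lemma line_shift:
  "\<omega> \<in> carrier_vec k \<Longrightarrow> v \<in> carrier_vec k \<Longrightarrow> (\<omega> + t \<cdot>\<^sub>v v) + s \<cdot>\<^sub>v v = \<omega> + (s + t) \<cdot>\<^sub>v (v :: real Matrix.vec)"
  by (auto intro!: eq_vecI simp: algebra_simps)

lemma DERIV_line:
  assumes "\<omega> \<in> carrier_vec k" "v \<in> carrier_vec k"
    and "((\<lambda>s. f ((\<omega> + t \<cdot>\<^sub>v v) + s \<cdot>\<^sub>v v)) has_real_derivative D) (at 0)"
  shows "((\<lambda>s. f (\<omega> + s \<cdot>\<^sub>v v)) has_real_derivative D) (at t)"
proof -
  have "(\<lambda>s. f ((\<omega> + t \<cdot>\<^sub>v v) + s \<cdot>\<^sub>v v)) = (\<lambda>s. f (\<omega> + (s + t) \<cdot>\<^sub>v v))"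
    by (intro ext arg_cong[of _ _ f] line_shift[of _ k] assms)
  then show ?thesis using DERIV_shift[of "\<lambda>s. f (\<omega> + s \<cdot>\<^sub>v v)" D 0 t] assms(3) by simp
qed

locale exp_family =
  fixes k :: nat and YY :: "real Matrix.vec set" and \<mu> :: "real Matrix.vec measure"
  assumes regular: "regular_minimal_family k YY \<mu>" and nonempty: "natural_params k \<mu> \<noteq> {}"
begin

abbreviation \<Omega> :: "real Matrix.vec set" where "\<Omega> \<equiv> natural_params k \<mu>"

section \<open>The natural parameter space\<close>

lemma space_mu: "space \<mu> = YY" "YY \<subseteq> carrier_vec k"
proof -
  have s: "sets \<mu> = sets (restrict_space (lborel_vec k) YY)" and Y: "YY \<subseteq> carrier_vec k"
    using regular by (auto simp: regular_minimal_family_def)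
  show "space \<mu> = YY" using sets_eq_imp_space_eq[OF s] Y by (auto simp: space_restrict_space space_lborel_vec)
  show "YY \<subseteq> carrier_vec k" by (rule Y)
qed

lemma measurable_muI: "f \<in> lborel_vec k \<rightarrow>\<^sub>M N \<Longrightarrow> f \<in> \<mu> \<rightarrow>\<^sub>M N"
proof -
  assume "f \<in> lborel_vec k \<rightarrow>\<^sub>M N"
  then have "f \<in> restrict_space (lborel_vec k) YY \<rightarrow>\<^sub>M N" by (rule measurable_restrict_space1)
  moreover have "sets \<mu> = sets (restrict_space (lborel_vec k) YY)"
    using regular by (auto simp: regular_minimal_family_def)
  ultimately show ?thesis using measurable_cong_sets by blast
qed

lemma space_mu_carrier: "y \<in> space \<mu> \<Longrightarrow> y \<in> carrier_vec k"
  using space_mu by auto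

lemma scalar_prod_measurable: "u \<in> carrier_vec k \<Longrightarrow> (\<lambda>y. u \<bullet> y) \<in> borel_measurable \<mu>"
proof -
  assume u: "u \<in> carrier_vec k"
  have "(\<lambda>y. \<Sum>i<k. u $ i * y $ i) \<in> borel_measurable \<mu>"
    by (intro borel_measurable_sum borel_measurable_times borel_measurable_const
        measurable_muI vec_index_measurable) auto
  moreover have "u \<bullet> y = (\<Sum>i<k. u $ i * y $ i)" if "y \<in> space \<mu>" for y
    using space_mu_carrier[OF that] by (simp add: scalar_prod_def lessThan_atLeast0)
  ultimately show ?thesis by (simp cong: measurable_cong)
qed

lemma natural_params_open:
  assumes "\<omega> \<in> \<Omega>"
  obtains r where "r > 0" "\<And>v. v \<in> carrier_vec k \<Longrightarrow> vnorm v < r \<Longrightarrow> \<omega> + v \<in> \<Omega>"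
proof -
  interpret V: Metric_space "carrier_vec k" "vdist k" by (rule Metric_space_vdist)
  have "openin V.mtopology \<Omega>"
    using regular by (simp add: regular_minimal_family_def vec_topology_def)
  then obtain r where r: "r > 0" "V.mball \<omega> r \<subseteq> \<Omega>"
    using assms unfolding V.openin_mtopology by blast
  have \<omega>: "\<omega> \<in> carrier_vec k" using assms by (simp add: natural_params_def)
  have "\<omega> + v \<in> \<Omega>" if v: "v \<in> carrier_vec k" "vnorm v < r" for v
  proof -
    have "vdist k \<omega> (\<omega> + v) = vnorm v"
      using \<omega> v by (simp add: vdist_def vnorm_def L2_set_def scalar_prod_def power2_eq_square lessThan_atLeast0)
    then have "\<omega> + v \<in> V.mball \<omega> r" using \<omega> v by (simp add: V.in_mball)
    then show ?thesis using r by blast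
  qed
  then show ?thesis using that r by blast
qed

lemma \<Omega>_carrier: "\<omega> \<in> \<Omega> \<Longrightarrow> \<omega> \<in> carrier_vec k"
  by (simp add: natural_params_def)

lemma natural_params_line:
  assumes \<omega>: "\<omega> \<in> \<Omega>" and v: "v \<in> carrier_vec k"
  obtains r where "r > 0" "\<And>t. \<bar>t\<bar> < r \<Longrightarrow> \<omega> + t \<cdot>\<^sub>v v \<in> \<Omega>"
proof -
  obtain r where r: "r > 0" "\<And>v. v \<in> carrier_vec k \<Longrightarrow> vnorm v < r \<Longrightarrow> \<omega> + v \<in> \<Omega>"
    using natural_params_open[OF \<omega>] by blast
  have n: "vnorm (t \<cdot>\<^sub>v v) = \<bar>t\<bar> * vnorm v" for t
    using v by (simp add: vnorm_def real_sqrt_mult mult.assoc[symmetric])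
  show ?thesis
  proof (rule that[of "r / (1 + vnorm v)"])
    fix t assume t: "\<bar>t\<bar> < r / (1 + vnorm v)"
    have p: "1 + vnorm v > 0" using vnorm_nonneg[of v] by linarith
    have "\<bar>t\<bar> * vnorm v \<le> \<bar>t\<bar> * (1 + vnorm v)" by (intro mult_left_mono) auto
    also have "\<dots> < r" using t p by (simp add: field_simps)
    finally show "\<omega> + t \<cdot>\<^sub>v v \<in> \<Omega>" using v by (intro r) (auto simp: n)
  qed (use r vnorm_nonneg[of v] in \<open>simp add: add_pos_nonneg\<close>)
qed

text \<open>Convexity without Holder's inequality: the exponent at an intermediate point is at most
  the larger of the two end values, so the integrand is at most their sum.\<close>

lemma natural_params_segment:
  assumes a: "a \<in> \<Omega>" and b: "b \<in> \<Omega>" and t: "0 \<le> t" "t \<le> 1"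
  shows "a + t \<cdot>\<^sub>v (b - a) \<in> \<Omega>"
proof -
  note c = \<Omega>_carrier[OF a] \<Omega>_carrier[OF b]
  have "(\<integral>\<^sup>+y. ennreal (exp ((a + t \<cdot>\<^sub>v (b - a)) \<bullet> y)) \<partial>\<mu>)
      \<le> (\<integral>\<^sup>+y. ennreal (exp (a \<bullet> y)) + ennreal (exp (b \<bullet> y)) \<partial>\<mu>)"
  proof (rule nn_integral_mono)
    fix y assume "y \<in> space \<mu>"
    then have y: "y \<in> carrier_vec k" by (rule space_mu_carrier)
    have "(a + t \<cdot>\<^sub>v (b - a)) \<bullet> y = (1 - t) * (a \<bullet> y) + t * (b \<bullet> y)"
      using c y by (simp add: add_scalar_prod_distrib[of _ k] minus_scalar_prod_distrib[of _ k] algebra_simps)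
    also have "\<dots> \<le> max (a \<bullet> y) (b \<bullet> y)"
    proof -
      have "(1 - t) * (a \<bullet> y) + t * (b \<bullet> y) \<le> (1 - t) * max (a \<bullet> y) (b \<bullet> y) + t * max (a \<bullet> y) (b \<bullet> y)"
        using t by (intro add_mono mult_left_mono) auto
      then show ?thesis by (simp add: algebra_simps)
    qed
    finally have "exp ((a + t \<cdot>\<^sub>v (b - a)) \<bullet> y) \<le> exp (max (a \<bullet> y) (b \<bullet> y))" by simp
    also have "\<dots> \<le> exp (a \<bullet> y) + exp (b \<bullet> y)" by (simp add: max_def)
    finally show "ennreal (exp ((a + t \<cdot>\<^sub>v (b - a)) \<bullet> y)) \<le> ennreal (exp (a \<bullet> y)) + ennreal (exp (b \<bullet> y))"
      by (simp flip: ennreal_plus add: ennreal_leI)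
  qed
  also have "\<dots> = (\<integral>\<^sup>+y. ennreal (exp (a \<bullet> y)) \<partial>\<mu>) + (\<integral>\<^sup>+y. ennreal (exp (b \<bullet> y)) \<partial>\<mu>)"
  proof (rule nn_integral_add)
    note [measurable] = scalar_prod_measurable[OF c(1)] scalar_prod_measurable[OF c(2)]
    show "(\<lambda>y. ennreal (exp (a \<bullet> y))) \<in> borel_measurable \<mu>" by measurable
    show "(\<lambda>y. ennreal (exp (b \<bullet> y))) \<in> borel_measurable \<mu>" by measurable
  qed
  also have "\<dots> < \<infinity>" using a b by (simp add: natural_params_def)
  finally show ?thesis using c by (simp add: natural_params_def)
qed

section \<open>Moments of tilted densities and differentiation under the integral\<close>

definition tilted_integrable :: "(real Matrix.vec \<Rightarrow> real) \<Rightarrow> bool" where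
  "tilted_integrable g \<longleftrightarrow> (\<forall>\<omega>\<in>\<Omega>. integrable \<mu> (\<lambda>y. g y * exp (\<omega> \<bullet> y)))"

lemma tilted_integrable_const: "tilted_integrable (\<lambda>_. 1)"
  unfolding tilted_integrable_def
proof
  fix \<omega> assume \<omega>: "\<omega> \<in> \<Omega>"
  note [measurable] = scalar_prod_measurable[OF \<Omega>_carrier[OF \<omega>]]
  have "integrable \<mu> (\<lambda>y. exp (\<omega> \<bullet> y))"
    by (rule integrableI_nonneg) (use \<omega> in \<open>auto simp: natural_params_def\<close>)
  then show "integrable \<mu> (\<lambda>y. 1 * exp (\<omega> \<bullet> y))" by simp
qed

lemma tilt_eq:
  assumes "\<omega> \<in> carrier_vec k" "v \<in> carrier_vec k" "y \<in> space \<mu>"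
  shows "(\<omega> + t \<cdot>\<^sub>v v) \<bullet> y = \<omega> \<bullet> y + t * (v \<bullet> y)"
  using assms space_mu_carrier[of y] by (simp add: add_scalar_prod_distrib[of _ k])

text \<open>Since the parameter space is open, it contains points on both sides of
  \<open>\<omega>\<close> along \<open>u\<close>; as |b| is at most exp b + exp (- b), the two tilts
  there dominate the extra linear factor. Iteration gives all moments.\<close>

lemma tilted_integrable_mult:
  assumes g: "tilted_integrable g" and u: "u \<in> carrier_vec k"
  shows "tilted_integrable (\<lambda>y. (u \<bullet> y) * g y)"
  unfolding tilted_integrable_def
proof
  fix \<omega> assume \<omega>: "\<omega> \<in> \<Omega>"
  note \<omega>c = \<Omega>_carrier[OF \<omega>]
  obtain r where r: "r > 0" "\<And>t. \<bar>t\<bar> < r \<Longrightarrow> \<omega> + t \<cdot>\<^sub>v u \<in> \<Omega>"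
    using natural_params_line[OF \<omega> u] by blast
  define t where "t = r / 2"
  have t: "t > 0" "\<omega> + t \<cdot>\<^sub>v u \<in> \<Omega>" "\<omega> + (- t) \<cdot>\<^sub>v u \<in> \<Omega>" using r by (auto simp: t_def)
  define F where "F = (\<lambda>y. (1 / t) * (\<bar>g y * exp ((\<omega> + t \<cdot>\<^sub>v u) \<bullet> y)\<bar> + \<bar>g y * exp ((\<omega> + (- t) \<cdot>\<^sub>v u) \<bullet> y)\<bar>))"
  have F: "integrable \<mu> F"
    unfolding F_def using g t
    by (intro integrable_mult_right Bochner_Integration.integrable_add integrable_abs)
      (auto simp: tilted_integrable_def)
  have "integrable \<mu> (\<lambda>y. g y * exp (\<omega> \<bullet> y))" using g \<omega> by (simp add: tilted_integrable_def)
  then have m: "(\<lambda>y. g y * exp (\<omega> \<bullet> y)) \<in> borel_measurable \<mu>" by (rule borel_measurable_integrable)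
  show "integrable \<mu> (\<lambda>y. (u \<bullet> y) * g y * exp (\<omega> \<bullet> y))"
  proof (rule Bochner_Integration.integrable_bound[OF F])
    show "(\<lambda>y. (u \<bullet> y) * g y * exp (\<omega> \<bullet> y)) \<in> borel_measurable \<mu>"
      using borel_measurable_times[OF scalar_prod_measurable[OF u] m] by (simp add: mult.assoc)
    show "AE y in \<mu>. norm ((u \<bullet> y) * g y * exp (\<omega> \<bullet> y)) \<le> norm (F y)"
    proof (rule AE_I2)
      fix y assume y: "y \<in> space \<mu>"
      define b where "b = t * (u \<bullet> y)"
      have "\<bar>b\<bar> \<le> exp b + exp (- b)"
        using exp_ge_add_one_self[of b] exp_ge_add_one_self[of "- b"] exp_gt_zero[of b] exp_gt_zero[of "- b"]
        by linarith
      then have "\<bar>b\<bar> * (\<bar>g y\<bar> * exp (\<omega> \<bullet> y)) \<le> (exp b + exp (- b)) * (\<bar>g y\<bar> * exp (\<omega> \<bullet> y))"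
        by (intro mult_right_mono) auto
      also have "\<dots> = t * F y"
      proof -
        have "exp ((\<omega> + t \<cdot>\<^sub>v u) \<bullet> y) = exp (\<omega> \<bullet> y) * exp b"
          "exp ((\<omega> + (- t) \<cdot>\<^sub>v u) \<bullet> y) = exp (\<omega> \<bullet> y) * exp (- b)"
          unfolding tilt_eq[OF \<omega>c u y] exp_add[symmetric] by (simp_all add: b_def)
        then show ?thesis using t by (simp add: F_def abs_mult algebra_simps)
      qed
      also have "\<bar>b\<bar> * (\<bar>g y\<bar> * exp (\<omega> \<bullet> y)) = t * norm ((u \<bullet> y) * g y * exp (\<omega> \<bullet> y))"
        using t by (simp add: b_def abs_mult)
      finally have "norm ((u \<bullet> y) * g y * exp (\<omega> \<bullet> y)) \<le> F y" using t by simp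
      then show "norm ((u \<bullet> y) * g y * exp (\<omega> \<bullet> y)) \<le> norm (F y)" by simp
    qed
  qed
qed

text \<open>The Taylor remainder of the exponential is at most h^2 times second-moment integrands at
  two parameters on either side of \<open>\<omega>\<close>, which are integrable by
  \<open>tilted_integrable_mult\<close>.\<close>

lemma tilted_derivative:
  assumes g: "tilted_integrable g" and \<omega>: "\<omega> \<in> \<Omega>" and v: "v \<in> carrier_vec k"
  shows "((\<lambda>t. \<integral>y. g y * exp ((\<omega> + t \<cdot>\<^sub>v v) \<bullet> y) \<partial>\<mu>) has_real_derivative
    (\<integral>y. (v \<bullet> y) * g y * exp (\<omega> \<bullet> y) \<partial>\<mu>)) (at 0)"
proof -
  note \<omega>c = \<Omega>_carrier[OF \<omega>]
  obtain r where r: "r > 0" "\<And>t. \<bar>t\<bar> < r \<Longrightarrow> \<omega> + t \<cdot>\<^sub>v v \<in> \<Omega>"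
    using natural_params_line[OF \<omega> v] by blast
  define t where "t = r / 2"
  have t: "t > 0" "\<omega> + t \<cdot>\<^sub>v v \<in> \<Omega>" "\<omega> + (- t) \<cdot>\<^sub>v v \<in> \<Omega>" using r by (auto simp: t_def)
  have g2: "tilted_integrable (\<lambda>y. (v \<bullet> y) * ((v \<bullet> y) * g y))"
    by (intro tilted_integrable_mult g v)
  \<comment> \<open>The factor 2 arises because exp (h b) and exp (- h b) are each bounded by the
    sum of the two tilts.\<close>
  define F where "F = (\<lambda>y. 2 * (\<bar>(v \<bullet> y) * ((v \<bullet> y) * g y) * exp ((\<omega> + t \<cdot>\<^sub>v v) \<bullet> y)\<bar>
      + \<bar>(v \<bullet> y) * ((v \<bullet> y) * g y) * exp ((\<omega> + (- t) \<cdot>\<^sub>v v) \<bullet> y)\<bar>))"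
  have F: "integrable \<mu> F"
    unfolding F_def using g2 t
    by (intro integrable_mult_right Bochner_Integration.integrable_add integrable_abs)
      (auto simp: tilted_integrable_def)
  have i0: "integrable \<mu> (\<lambda>y. g y * exp (\<omega> \<bullet> y))" using g \<omega> by (simp add: tilted_integrable_def)
  have i1: "integrable \<mu> (\<lambda>y. (v \<bullet> y) * g y * exp (\<omega> \<bullet> y))"
    using tilted_integrable_mult[OF g v] \<omega> by (simp add: tilted_integrable_def)
  show ?thesis
  proof (rule has_derivative_quadratic_remainder[where r = t and C = "\<integral>y. F y \<partial>\<mu>"])
    fix h assume h: "\<bar>h\<bar> < t"
    then have ih: "integrable \<mu> (\<lambda>y. g y * exp ((\<omega> + h \<cdot>\<^sub>v v) \<bullet> y))"
      using g r by (auto simp: tilted_integrable_def t_def)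
    have z: "\<omega> + 0 \<cdot>\<^sub>v v = \<omega>" using \<omega>c v by (auto intro!: eq_vecI)
    have "(\<integral>y. g y * exp ((\<omega> + (0 + h) \<cdot>\<^sub>v v) \<bullet> y) \<partial>\<mu>) - (\<integral>y. g y * exp ((\<omega> + 0 \<cdot>\<^sub>v v) \<bullet> y) \<partial>\<mu>)
        - h * (\<integral>y. (v \<bullet> y) * g y * exp (\<omega> \<bullet> y) \<partial>\<mu>)
      = (\<integral>y. g y * exp ((\<omega> + h \<cdot>\<^sub>v v) \<bullet> y) - g y * exp (\<omega> \<bullet> y) - h * ((v \<bullet> y) * g y * exp (\<omega> \<bullet> y)) \<partial>\<mu>)"
      unfolding z using ih i0 i1 by simp
    also have "\<bar>\<dots>\<bar> \<le> (\<integral>y. h\<^sup>2 * F y \<partial>\<mu>)"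
    proof (rule integral_abs_bound[THEN order_trans], rule integral_mono)
      show "integrable \<mu> (\<lambda>y. \<bar>g y * exp ((\<omega> + h \<cdot>\<^sub>v v) \<bullet> y) - g y * exp (\<omega> \<bullet> y) - h * ((v \<bullet> y) * g y * exp (\<omega> \<bullet> y))\<bar>)"
        using ih i0 i1 by (intro integrable_abs Bochner_Integration.integrable_diff integrable_mult_right)
      show "integrable \<mu> (\<lambda>y. h\<^sup>2 * F y)" using F by simp
      fix y assume y: "y \<in> space \<mu>"
      define b where "b = v \<bullet> y"
      have eb: "exp (h * b) \<le> exp (t * b) + exp (- (t * b))" if "\<bar>h\<bar> < t" for h
      proof -
        have "h * b \<le> \<bar>h\<bar> * \<bar>b\<bar>" by (metis abs_ge_self abs_mult)
        also have "\<dots> \<le> t * \<bar>b\<bar>" using that by (intro mult_right_mono) auto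
        finally have "exp (h * b) \<le> exp (t * \<bar>b\<bar>)" by simp
        also have "\<dots> \<le> exp (t * b) + exp (- (t * b))" by (cases "b \<ge> 0") auto
        finally show ?thesis .
      qed
      have "g y * exp ((\<omega> + h \<cdot>\<^sub>v v) \<bullet> y) - g y * exp (\<omega> \<bullet> y) - h * (b * g y * exp (\<omega> \<bullet> y))
        = (g y * exp (\<omega> \<bullet> y)) * (exp (h * b) - 1 - h * b)"
        by (simp add: tilt_eq[OF \<omega>c v y] b_def exp_add algebra_simps)
      then have "\<bar>g y * exp ((\<omega> + h \<cdot>\<^sub>v v) \<bullet> y) - g y * exp (\<omega> \<bullet> y) - h * (b * g y * exp (\<omega> \<bullet> y))\<bar>
        = (\<bar>g y\<bar> * exp (\<omega> \<bullet> y)) * \<bar>exp (h * b) - 1 - h * b\<bar>"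
        by (simp add: abs_mult)
      also have "\<dots> \<le> (\<bar>g y\<bar> * exp (\<omega> \<bullet> y)) * ((h * b)\<^sup>2 * (2 * (exp (t * b) + exp (- (t * b)))))"
      proof (rule mult_left_mono)
        have "\<bar>exp (h * b) - 1 - h * b\<bar> \<le> (h * b)\<^sup>2 * (exp (h * b) + exp (- (h * b)))" by (rule exp_remainder)
        also have "\<dots> \<le> (h * b)\<^sup>2 * (2 * (exp (t * b) + exp (- (t * b))))"
          using eb[of h] eb[of "- h"] h by (intro mult_left_mono) auto
        finally show "\<bar>exp (h * b) - 1 - h * b\<bar> \<le> (h * b)\<^sup>2 * (2 * (exp (t * b) + exp (- (t * b))))" .
      qed simp
      also have "\<dots> = h\<^sup>2 * F y"
      proof -
        have "exp ((\<omega> + t \<cdot>\<^sub>v v) \<bullet> y) = exp (\<omega> \<bullet> y) * exp (t * b)"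
          "exp ((\<omega> + (- t) \<cdot>\<^sub>v v) \<bullet> y) = exp (\<omega> \<bullet> y) * exp (- (t * b))"
          unfolding tilt_eq[OF \<omega>c v y] exp_add[symmetric] by (simp_all add: b_def)
        moreover have "\<bar>b * (b * g y) * (E * E')\<bar> = b\<^sup>2 * (\<bar>g y\<bar> * (E * E'))" if "E > 0" "E' > 0" for E E'
          using that by (simp add: abs_mult power2_eq_square mult.assoc[symmetric])
        ultimately have "F y = 2 * (b\<^sup>2 * (\<bar>g y\<bar> * (exp (\<omega> \<bullet> y) * exp (t * b)))
            + b\<^sup>2 * (\<bar>g y\<bar> * (exp (\<omega> \<bullet> y) * exp (- (t * b)))))"
          unfolding F_def b_def by (simp only: exp_gt_zero)
        then show ?thesis by (simp add: power_mult_distrib algebra_simps)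
      qed
      finally show "\<bar>g y * exp ((\<omega> + h \<cdot>\<^sub>v v) \<bullet> y) - g y * exp (\<omega> \<bullet> y) - h * ((v \<bullet> y) * g y * exp (\<omega> \<bullet> y))\<bar>
        \<le> h\<^sup>2 * F y" by (simp add: b_def)
    qed
    also have "\<dots> = (\<integral>y. F y \<partial>\<mu>) * h\<^sup>2" by simp
    finally show "\<bar>(\<integral>y. g y * exp ((\<omega> + (0 + h) \<cdot>\<^sub>v v) \<bullet> y) \<partial>\<mu>) - (\<integral>y. g y * exp ((\<omega> + 0 \<cdot>\<^sub>v v) \<bullet> y) \<partial>\<mu>)
        - h * (\<integral>y. (v \<bullet> y) * g y * exp (\<omega> \<bullet> y) \<partial>\<mu>)\<bar> \<le> (\<integral>y. F y \<partial>\<mu>) * h\<^sup>2" .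
  qed (rule t)
qed

text \<open>Unnormalised moments. Keeping the directions in a list makes differentiation along
  \<open>v\<close> the same as consing \<open>v\<close>.\<close>

definition mom :: "real Matrix.vec list \<Rightarrow> real Matrix.vec \<Rightarrow> real" where
  "mom us \<omega> = (\<integral>y. prod_list (map (\<lambda>u. u \<bullet> y) us) * exp (\<omega> \<bullet> y) \<partial>\<mu>)"

lemma tilted_integrable_list:
  "set us \<subseteq> carrier_vec k \<Longrightarrow> tilted_integrable (\<lambda>y. prod_list (map (\<lambda>u. u \<bullet> y) us))"
  by (induction us) (auto intro: tilted_integrable_const tilted_integrable_mult)

lemma mom_integrable:
  "set us \<subseteq> carrier_vec k \<Longrightarrow> \<omega> \<in> \<Omega> \<Longrightarrow> integrable \<mu> (\<lambda>y. prod_list (map (\<lambda>u. u \<bullet> y) us) * exp (\<omega> \<bullet> y))"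
  using tilted_integrable_list[of us] by (simp add: tilted_integrable_def)

lemma mom_derivative:
  assumes "set us \<subseteq> carrier_vec k" "\<omega> \<in> carrier_vec k" "v \<in> carrier_vec k" "\<omega> + t \<cdot>\<^sub>v v \<in> \<Omega>"
  shows "((\<lambda>t. mom us (\<omega> + t \<cdot>\<^sub>v v)) has_real_derivative mom (v # us) (\<omega> + t \<cdot>\<^sub>v v)) (at t)"
  by (rule DERIV_line[OF assms(2,3)])
    (use tilted_derivative[OF tilted_integrable_list[OF assms(1)] assms(4,3)] in \<open>simp add: mom_def\<close>)

lemma mom_add:
  assumes "set us \<subseteq> carrier_vec k" "u \<in> carrier_vec k" "v \<in> carrier_vec k" "\<omega> \<in> \<Omega>"
  shows "mom ((u + v) # us) \<omega> = mom (u # us) \<omega> + mom (v # us) \<omega>"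
proof -
  have "mom ((u + v) # us) \<omega> = (\<integral>y. prod_list (map (\<lambda>u. u \<bullet> y) (u # us)) * exp (\<omega> \<bullet> y)
      + prod_list (map (\<lambda>u. u \<bullet> y) (v # us)) * exp (\<omega> \<bullet> y) \<partial>\<mu>)"
    unfolding mom_def
    using assms space_mu_carrier
    by (intro Bochner_Integration.integral_cong) (auto simp: add_scalar_prod_distrib[of _ k] algebra_simps)
  also have "\<dots> = mom (u # us) \<omega> + mom (v # us) \<omega>"
    unfolding mom_def using assms by (intro Bochner_Integration.integral_add mom_integrable) auto
  finally show ?thesis .
qed

lemma mom_smult:
  assumes "u \<in> carrier_vec k"
  shows "mom ((c \<cdot>\<^sub>v u) # us) \<omega> = c * mom (u # us) \<omega>"
proof -
  have "mom ((c \<cdot>\<^sub>v u) # us) \<omega> = (\<integral>y. c * (prod_list (map (\<lambda>u. u \<bullet> y) (u # us)) * exp (\<omega> \<bullet> y)) \<partial>\<mu>)"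
    unfolding mom_def
    using assms space_mu_carrier
    by (intro Bochner_Integration.integral_cong) (auto simp: algebra_simps)
  then show ?thesis by (simp add: mom_def)
qed

lemma mom_sum:
  assumes "finite I" "set us \<subseteq> carrier_vec k" "u \<in> carrier_vec k" "\<And>i. i \<in> I \<Longrightarrow> b i \<in> carrier_vec k" "\<omega> \<in> \<Omega>"
    and eq: "\<And>y. y \<in> carrier_vec k \<Longrightarrow> u \<bullet> y = (\<Sum>i\<in>I. c i * (b i \<bullet> y))"
  shows "mom (u # us) \<omega> = (\<Sum>i\<in>I. c i * mom (b i # us) \<omega>)"
proof -
  have "mom (u # us) \<omega> = (\<integral>y. (\<Sum>i\<in>I. c i * (prod_list (map (\<lambda>u. u \<bullet> y) (b i # us)) * exp (\<omega> \<bullet> y))) \<partial>\<mu>)"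
    unfolding mom_def
    using eq space_mu_carrier
    by (intro Bochner_Integration.integral_cong) (auto simp: sum_distrib_right sum_distrib_left mult_ac)
  also have "\<dots> = (\<Sum>i\<in>I. c i * mom (b i # us) \<omega>)"
    unfolding mom_def using assms
    by (subst Bochner_Integration.integral_sum) (auto intro!: integrable_mult_right mom_integrable[of "_ # _", simplified])
  finally show ?thesis .
qed

lemma mom_perm: "mset us = mset vs \<Longrightarrow> mom us \<omega> = mom vs \<omega>"
proof -
  assume "mset us = mset vs"
  then have "prod_mset (image_mset (\<lambda>u. u \<bullet> y) (mset us)) = prod_mset (image_mset (\<lambda>u. u \<bullet> y) (mset vs))" for y
    by simp
  then have "prod_list (map (\<lambda>u. u \<bullet> y) us) = prod_list (map (\<lambda>u. u \<bullet> y) vs)" for y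
    unfolding mset_map[symmetric] prod_mset_prod_list .
  then show ?thesis by (simp add: mom_def)
qed

lemma not_AE_affine: "affine_vec k A \<Longrightarrow> A \<noteq> carrier_vec k \<Longrightarrow> \<not> (AE y in \<mu>. y \<in> A)"
  using regular by (auto simp: regular_minimal_family_def)

text \<open>The empty set is affine and proper, so minimality also says that \<mu> is not the null
  measure.\<close>

lemma not_AE_False: "\<not> (AE y in \<mu>. False)"
proof -
  have "affine_vec k {}" by (simp add: affine_vec_def)
  moreover have "{} \<noteq> (carrier_vec k :: real Matrix.vec set)" using zero_carrier_vec by blast
  ultimately show ?thesis using not_AE_affine[of "{}"] by simp
qed

lemma mom_0_pos: "\<omega> \<in> \<Omega> \<Longrightarrow> mom [] \<omega> > 0"
proof -
  assume \<omega>: "\<omega> \<in> \<Omega>"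
  have i: "integrable \<mu> (\<lambda>y. exp (\<omega> \<bullet> y))" using mom_integrable[of "[]" \<omega>] \<omega> by simp
  have "mom [] \<omega> \<ge> 0" by (simp add: mom_def)
  moreover have "mom [] \<omega> \<noteq> 0"
  proof
    assume "mom [] \<omega> = 0"
    then have "AE y in \<mu>. exp (\<omega> \<bullet> y) = 0"
      using integral_nonneg_eq_0_iff_AE[OF i] by (simp add: mom_def)
    then show False using not_AE_False by simp
  qed
  ultimately show ?thesis by simp
qed

abbreviation \<psi> :: "real Matrix.vec \<Rightarrow> real" where "\<psi> \<equiv> log_partition \<mu>"

section \<open>Cumulants as derivatives of the log partition function\<close>

lemma psi_eq: "\<psi> \<omega> = ln (mom [] \<omega>)"
  by (simp add: log_partition_def mom_def)

text \<open>\<open>\<kappa>1\<close>, \<open>\<kappa>2\<close> and \<open>\<kappa>3\<close> are the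
  joint cumulants of orders one to three of the tilted law, written with unnormalised moments. Each
  is the derivative of the preceding one along its new first argument.\<close>

definition \<kappa>1 :: "real Matrix.vec \<Rightarrow> real Matrix.vec \<Rightarrow> real" where
  "\<kappa>1 \<omega> u = mom [u] \<omega> / mom [] \<omega>"

definition \<kappa>2 :: "real Matrix.vec \<Rightarrow> real Matrix.vec \<Rightarrow> real Matrix.vec \<Rightarrow> real" where
  "\<kappa>2 \<omega> u v = mom [u, v] \<omega> / mom [] \<omega> - mom [u] \<omega> * mom [v] \<omega> / (mom [] \<omega>)\<^sup>2"

definition \<kappa>3 :: "real Matrix.vec \<Rightarrow> real Matrix.vec \<Rightarrow> real Matrix.vec \<Rightarrow> real Matrix.vec \<Rightarrow> real" where
  "\<kappa>3 \<omega> u v w = mom [u, v, w] \<omega> / mom [] \<omega>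
    - (mom [u, v] \<omega> * mom [w] \<omega> + mom [u, w] \<omega> * mom [v] \<omega> + mom [v, w] \<omega> * mom [u] \<omega>) / (mom [] \<omega>)\<^sup>2
    + 2 * mom [u] \<omega> * mom [v] \<omega> * mom [w] \<omega> / (mom [] \<omega>) ^ 3"

context
  fixes \<omega> v t
  assumes \<omega>: "\<omega> \<in> carrier_vec k" and v: "v \<in> carrier_vec k" and in\<Omega>: "\<omega> + t \<cdot>\<^sub>v v \<in> \<Omega>"
begin

lemma m0: "mom [] (\<omega> + t \<cdot>\<^sub>v v) \<noteq> 0"
  using mom_0_pos[OF in\<Omega>] by simp

lemma psi_derivative: "((\<lambda>t. \<psi> (\<omega> + t \<cdot>\<^sub>v v)) has_real_derivative \<kappa>1 (\<omega> + t \<cdot>\<^sub>v v) v) (at t)"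
  unfolding psi_eq \<kappa>1_def
  by (rule derivative_eq_intros mom_derivative \<omega> v in\<Omega> mom_0_pos refl | simp)+

lemma kappa1_derivative:
  assumes u: "u \<in> carrier_vec k"
  shows "((\<lambda>t. \<kappa>1 (\<omega> + t \<cdot>\<^sub>v v) u) has_real_derivative \<kappa>2 (\<omega> + t \<cdot>\<^sub>v v) v u) (at t)"
proof -
  note d = mom_derivative[OF _ \<omega> v in\<Omega>]
  show ?thesis
    unfolding \<kappa>1_def
    by (rule DERIV_cong[OF DERIV_divide[OF d d m0]])
      (use u m0 in \<open>auto simp: \<kappa>2_def divide_simps power2_eq_square\<close>)
qed

lemma kappa2_derivative:
  assumes u: "u \<in> carrier_vec k" "u' \<in> carrier_vec k"
  shows "((\<lambda>t. \<kappa>2 (\<omega> + t \<cdot>\<^sub>v v) u u') has_real_derivative \<kappa>3 (\<omega> + t \<cdot>\<^sub>v v) v u u') (at t)"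
proof -
  note d = mom_derivative[OF _ \<omega> v in\<Omega>]
  have m02: "(mom [] (\<omega> + t \<cdot>\<^sub>v v))\<^sup>2 \<noteq> 0" using m0 by simp
  show ?thesis
    unfolding \<kappa>2_def
    by (rule DERIV_cong[OF DERIV_diff[OF DERIV_divide[OF d d m0]
          DERIV_divide[OF DERIV_mult[OF d d] DERIV_power[OF d] m02]]])
      (use u m0 in \<open>auto simp: \<kappa>3_def field_simps power2_eq_square power3_eq_cube\<close>)
qed

end

text \<open>A lower partial derivative has a formula only on the parameter space, while
  \<open>partial\<close> refers to the function on all vectors; openness makes the two agree near
  the point, so that it can be differentiated again.\<close>

lemma partial_on_open:
  assumes f: "\<And>\<omega>. \<omega> \<in> \<Omega> \<Longrightarrow> f \<omega> = g \<omega>" and \<omega>: "\<omega> \<in> \<Omega>" and j: "j < k"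
    and g: "((\<lambda>t. g (\<omega> + t \<cdot>\<^sub>v unit_vec k j)) has_real_derivative D) (at 0)"
  shows "partial j f \<omega> = D"
proof -
  have e: "unit_vec k j \<in> carrier_vec k" by simp
  obtain r where r: "r > 0" "\<And>t. \<bar>t\<bar> < r \<Longrightarrow> \<omega> + t \<cdot>\<^sub>v unit_vec k j \<in> \<Omega>"
    using natural_params_line[OF \<omega> e] by blast
  have "((\<lambda>t. f (\<omega> + t \<cdot>\<^sub>v unit_vec k j)) has_real_derivative D) (at 0)"
    by (rule has_field_derivative_transform_within[OF g r(1)]) (use f r in auto)
  moreover have "dim_vec \<omega> = k" using \<Omega>_carrier[OF \<omega>] by simp
  ultimately show ?thesis by (simp add: partial_def DERIV_imp_deriv)
qed

lemma partial_psi: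
  assumes \<omega>: "\<omega> \<in> \<Omega>" and j: "j < k"
  shows "partial j \<psi> \<omega> = \<kappa>1 \<omega> (unit_vec k j)"
proof (rule partial_on_open[OF refl \<omega> j])
  have z: "\<omega> + 0 \<cdot>\<^sub>v unit_vec k j = \<omega>" using \<Omega>_carrier[OF \<omega>] by (auto intro!: eq_vecI)
  show "((\<lambda>t. \<psi> (\<omega> + t \<cdot>\<^sub>v unit_vec k j)) has_real_derivative \<kappa>1 \<omega> (unit_vec k j)) (at 0)"
    using psi_derivative[of \<omega> "unit_vec k j" 0] \<omega> \<Omega>_carrier[OF \<omega>] by (simp add: z)
qed

lemma partial2_psi:
  assumes \<omega>: "\<omega> \<in> \<Omega>" and j: "j < k" "i < k"
  shows "partial i (partial j \<psi>) \<omega> = \<kappa>2 \<omega> (unit_vec k i) (unit_vec k j)"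
proof (rule partial_on_open[OF partial_psi[OF _ j(1)] \<omega> j(2)])
  have z: "\<omega> + 0 \<cdot>\<^sub>v unit_vec k i = \<omega>" using \<Omega>_carrier[OF \<omega>] by (auto intro!: eq_vecI)
  show "((\<lambda>t. \<kappa>1 (\<omega> + t \<cdot>\<^sub>v unit_vec k i) (unit_vec k j)) has_real_derivative
      \<kappa>2 \<omega> (unit_vec k i) (unit_vec k j)) (at 0)"
    using kappa1_derivative[of \<omega> "unit_vec k i" 0 "unit_vec k j"] \<omega> \<Omega>_carrier[OF \<omega>] by (simp add: z)
qed

lemma partial3_psi:
  assumes \<omega>: "\<omega> \<in> \<Omega>" and j: "j < k" "i < k" "l < k"
  shows "partial l (partial i (partial j \<psi>)) \<omega> = \<kappa>3 \<omega> (unit_vec k l) (unit_vec k i) (unit_vec k j)"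
proof (rule partial_on_open[OF partial2_psi[OF _ j(1,2)] \<omega> j(3)])
  have z: "\<omega> + 0 \<cdot>\<^sub>v unit_vec k l = \<omega>" using \<Omega>_carrier[OF \<omega>] by (auto intro!: eq_vecI)
  show "((\<lambda>t. \<kappa>2 (\<omega> + t \<cdot>\<^sub>v unit_vec k l) (unit_vec k i) (unit_vec k j)) has_real_derivative
      \<kappa>3 \<omega> (unit_vec k l) (unit_vec k i) (unit_vec k j)) (at 0)"
    using kappa2_derivative[of \<omega> "unit_vec k l" 0 "unit_vec k i" "unit_vec k j"] \<omega> \<Omega>_carrier[OF \<omega>] by (simp add: z)
qed

lemma mom_unit_vec_sum:
  assumes "set us \<subseteq> carrier_vec k" "u \<in> carrier_vec k" "\<omega> \<in> \<Omega>"
  shows "mom (u # us) \<omega> = (\<Sum>i<k. u $ i * mom (unit_vec k i # us) \<omega>)"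
proof (rule mom_sum)
  show "u \<bullet> y = (\<Sum>i<k. u $ i * (unit_vec k i \<bullet> y))" if y: "y \<in> carrier_vec k" for y
  proof -
    have "(\<Sum>i<k. u $ i * (unit_vec k i \<bullet> y)) = (\<Sum>i<k. u $ i * y $ i)"
      using y by (intro sum.cong) auto
    then show ?thesis using y by (simp add: scalar_prod_def[of u] lessThan_atLeast0)
  qed
qed (use assms in auto)

section \<open>Symmetry, multilinearity and positivity of the cumulants\<close>

lemma mom_swap: "mom (u # v # us) \<omega> = mom (v # u # us) \<omega>"
  by (rule mom_perm) simp

lemma kappa2_sym: "\<kappa>2 \<omega> u v = \<kappa>2 \<omega> v u"
  by (simp add: \<kappa>2_def mom_swap[of u v] mult.commute)

lemma kappa3_sym: "\<kappa>3 \<omega> u v w = \<kappa>3 \<omega> v u w" "\<kappa>3 \<omega> u v w = \<kappa>3 \<omega> u w v"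
proof -
  have "mom [u, v, w] \<omega> = mom [v, u, w] \<omega>" "mom [u, v, w] \<omega> = mom [u, w, v] \<omega>"
    by (rule mom_perm; simp)+
  moreover have "mom [u, v] \<omega> = mom [v, u] \<omega>" "mom [v, w] \<omega> = mom [w, v] \<omega>" by (rule mom_swap)+
  ultimately show "\<kappa>3 \<omega> u v w = \<kappa>3 \<omega> v u w" "\<kappa>3 \<omega> u v w = \<kappa>3 \<omega> u w v"
    unfolding \<kappa>3_def by (simp_all add: algebra_simps)
qed

context
  fixes \<omega> assumes \<omega>: "\<omega> \<in> \<Omega>"
begin

lemma kappa1_linear:
  assumes "u \<in> carrier_vec k" "v \<in> carrier_vec k"
  shows "\<kappa>1 \<omega> (u + v) = \<kappa>1 \<omega> u + \<kappa>1 \<omega> v" "\<kappa>1 \<omega> (c \<cdot>\<^sub>v u) = c * \<kappa>1 \<omega> u"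
  using assms \<omega> by (simp_all add: \<kappa>1_def mom_add mom_smult add_divide_distrib)

lemma kappa2_linear:
  assumes "u \<in> carrier_vec k" "v \<in> carrier_vec k" "x \<in> carrier_vec k"
  shows "\<kappa>2 \<omega> (u + v) x = \<kappa>2 \<omega> u x + \<kappa>2 \<omega> v x" "\<kappa>2 \<omega> (c \<cdot>\<^sub>v u) x = c * \<kappa>2 \<omega> u x"
  using assms \<omega> mom_0_pos[OF \<omega>] by (simp_all add: \<kappa>2_def mom_add mom_smult field_simps)

lemma kappa3_linear:
  assumes "u \<in> carrier_vec k" "v \<in> carrier_vec k" "x \<in> carrier_vec k" "z \<in> carrier_vec k"
  shows "\<kappa>3 \<omega> (u + v) x z = \<kappa>3 \<omega> u x z + \<kappa>3 \<omega> v x z" "\<kappa>3 \<omega> (c \<cdot>\<^sub>v u) x z = c * \<kappa>3 \<omega> u x z"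
  using assms \<omega> mom_0_pos[OF \<omega>] by (simp_all add: \<kappa>3_def mom_add mom_smult field_simps)

lemma kappa_unit_vec_sum:
  assumes "u \<in> carrier_vec k" "v \<in> carrier_vec k" "x \<in> carrier_vec k"
  shows "\<kappa>1 \<omega> u = (\<Sum>i<k. u $ i * \<kappa>1 \<omega> (unit_vec k i))"
    "\<kappa>2 \<omega> u v = (\<Sum>i<k. u $ i * \<kappa>2 \<omega> (unit_vec k i) v)"
    "\<kappa>3 \<omega> u v x = (\<Sum>i<k. u $ i * \<kappa>3 \<omega> (unit_vec k i) v x)"
proof -
  have m: "mom (u # us) \<omega> = (\<Sum>i<k. u $ i * mom (unit_vec k i # us) \<omega>)" if "set us \<subseteq> carrier_vec k" for us
    using that assms \<omega> by (intro mom_unit_vec_sum) auto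
  show "\<kappa>1 \<omega> u = (\<Sum>i<k. u $ i * \<kappa>1 \<omega> (unit_vec k i))"
    unfolding \<kappa>1_def by (subst m) (auto simp: sum_divide_distrib)
  have "\<kappa>2 \<omega> u v = (\<Sum>i<k. u $ i * mom [unit_vec k i, v] \<omega>) / mom [] \<omega>
      - (\<Sum>i<k. u $ i * mom [unit_vec k i] \<omega>) * mom [v] \<omega> / (mom [] \<omega>)\<^sup>2"
    unfolding \<kappa>2_def using m[of "[v]"] m[of "[]"] assms by simp
  also have "\<dots> = (\<Sum>i<k. u $ i * mom [unit_vec k i, v] \<omega> / mom [] \<omega>
      - u $ i * mom [unit_vec k i] \<omega> * mom [v] \<omega> / (mom [] \<omega>)\<^sup>2)"
    by (simp add: sum_divide_distrib sum_distrib_right sum_subtractf)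
  finally show "\<kappa>2 \<omega> u v = (\<Sum>i<k. u $ i * \<kappa>2 \<omega> (unit_vec k i) v)"
    by (simp add: \<kappa>2_def algebra_simps)
  have "\<kappa>3 \<omega> u v x = (\<Sum>i<k. u $ i * mom [unit_vec k i, v, x] \<omega>) / mom [] \<omega>
    - ((\<Sum>i<k. u $ i * mom [unit_vec k i, v] \<omega>) * mom [x] \<omega>
       + (\<Sum>i<k. u $ i * mom [unit_vec k i, x] \<omega>) * mom [v] \<omega>
       + mom [v, x] \<omega> * (\<Sum>i<k. u $ i * mom [unit_vec k i] \<omega>)) / (mom [] \<omega>)\<^sup>2
    + 2 * (\<Sum>i<k. u $ i * mom [unit_vec k i] \<omega>) * mom [v] \<omega> * mom [x] \<omega> / (mom [] \<omega>) ^ 3"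
    unfolding \<kappa>3_def using m[of "[v, x]"] m[of "[v]"] m[of "[x]"] m[of "[]"] assms by simp
  also have "\<dots> = (\<Sum>i<k. u $ i * mom [unit_vec k i, v, x] \<omega> / mom [] \<omega>
    - (u $ i * mom [unit_vec k i, v] \<omega> * mom [x] \<omega> + u $ i * mom [unit_vec k i, x] \<omega> * mom [v] \<omega>
       + mom [v, x] \<omega> * (u $ i * mom [unit_vec k i] \<omega>)) / (mom [] \<omega>)\<^sup>2
    + 2 * (u $ i * mom [unit_vec k i] \<omega>) * mom [v] \<omega> * mom [x] \<omega> / (mom [] \<omega>) ^ 3)"
    by (simp add: sum_divide_distrib sum_distrib_left sum_distrib_right sum_subtractf sum.distrib add_divide_distrib)
  also have "\<dots> = (\<Sum>i<k. u $ i * \<kappa>3 \<omega> (unit_vec k i) v x)"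
    by (intro sum.cong) (simp_all add: \<kappa>3_def algebra_simps add_divide_distrib)
  finally show "\<kappa>3 \<omega> u v x = (\<Sum>i<k. u $ i * \<kappa>3 \<omega> (unit_vec k i) v x)" .
qed

lemma hessian_form_psi:
  assumes v: "v \<in> carrier_vec k"
  shows "hessian_form \<psi> \<omega> v = \<kappa>2 \<omega> v v"
proof -
  have dim: "dim_vec \<omega> = k" using \<Omega>_carrier[OF \<omega>] by simp
  have "\<kappa>2 \<omega> v v = (\<Sum>a<k. v $ a * \<kappa>2 \<omega> v (unit_vec k a))"
    by (subst kappa_unit_vec_sum(2)[OF v v v]) (simp add: kappa2_sym)
  also have "\<dots> = (\<Sum>a<k. \<Sum>b<k. v $ a * (v $ b * \<kappa>2 \<omega> (unit_vec k b) (unit_vec k a)))"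
    by (intro sum.cong refl) (subst kappa_unit_vec_sum(2), use v in \<open>auto simp: sum_distrib_left\<close>)
  also have "\<dots> = hessian_form \<psi> \<omega> v"
    unfolding hessian_form_def dim
    by (intro sum.cong refl) (simp add: partial2_psi[OF \<omega>] kappa2_sym)
  finally show ?thesis by simp
qed

lemma third_form_psi:
  assumes v: "v \<in> carrier_vec k"
  shows "third_form \<psi> \<omega> v = \<kappa>3 \<omega> v v v"
proof -
  have dim: "dim_vec \<omega> = k" using \<Omega>_carrier[OF \<omega>] by simp
  have "third_form \<psi> \<omega> v = (\<Sum>a<k. v $ a * (\<Sum>b<k. v $ b * (\<Sum>c<k. v $ c *
      \<kappa>3 \<omega> (unit_vec k c) (unit_vec k b) (unit_vec k a))))"
    unfolding third_form_def dim
    by (intro sum.cong refl) (simp add: partial3_psi[OF \<omega>] sum_distrib_left kappa3_sym mult_ac)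
  also have "\<dots> = (\<Sum>a<k. v $ a * (\<Sum>b<k. v $ b * \<kappa>3 \<omega> v (unit_vec k b) (unit_vec k a)))"
    using kappa_unit_vec_sum(3)[OF v] by simp
  also have "\<dots> = (\<Sum>a<k. v $ a * (\<Sum>b<k. v $ b * \<kappa>3 \<omega> (unit_vec k b) v (unit_vec k a)))"
    by (simp only: kappa3_sym(1)[of \<omega> v])
  also have "\<dots> = (\<Sum>a<k. v $ a * \<kappa>3 \<omega> v v (unit_vec k a))"
    using kappa_unit_vec_sum(3)[OF v v] by simp
  also have "\<dots> = (\<Sum>a<k. v $ a * \<kappa>3 \<omega> (unit_vec k a) v v)"
    by (simp add: kappa3_sym(2)[of \<omega> v v] kappa3_sym(1)[of \<omega> v "unit_vec k _"])
  also have "\<dots> = \<kappa>3 \<omega> v v v" using kappa_unit_vec_sum(3)[OF v v v] by simp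
  finally show ?thesis .
qed

lemma kappa2_variance:
  assumes v: "v \<in> carrier_vec k"
  shows "mom [] \<omega> * \<kappa>2 \<omega> v v = (\<integral>y. (v \<bullet> y - \<kappa>1 \<omega> v)\<^sup>2 * exp (\<omega> \<bullet> y) \<partial>\<mu>)"
    "integrable \<mu> (\<lambda>y. (v \<bullet> y - \<kappa>1 \<omega> v)\<^sup>2 * exp (\<omega> \<bullet> y))"
proof -
  define c where "c = \<kappa>1 \<omega> v"
  have i: "integrable \<mu> (\<lambda>y. (v \<bullet> y) * (v \<bullet> y) * exp (\<omega> \<bullet> y))" "integrable \<mu> (\<lambda>y. (v \<bullet> y) * exp (\<omega> \<bullet> y))"
    "integrable \<mu> (\<lambda>y. exp (\<omega> \<bullet> y))"
    using mom_integrable[of "[v, v]" \<omega>] mom_integrable[of "[v]" \<omega>] mom_integrable[of "[]" \<omega>] v \<omega> by (auto simp: mult.assoc)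
  have eq: "(v \<bullet> y - c)\<^sup>2 * exp (\<omega> \<bullet> y) = (v \<bullet> y) * (v \<bullet> y) * exp (\<omega> \<bullet> y)
      - 2 * c * ((v \<bullet> y) * exp (\<omega> \<bullet> y)) + c\<^sup>2 * exp (\<omega> \<bullet> y)" for y
    by (simp add: power2_eq_square algebra_simps)
  show "integrable \<mu> (\<lambda>y. (v \<bullet> y - \<kappa>1 \<omega> v)\<^sup>2 * exp (\<omega> \<bullet> y))"
    unfolding c_def[symmetric] eq using i by simp
  have "(\<integral>y. (v \<bullet> y - c)\<^sup>2 * exp (\<omega> \<bullet> y) \<partial>\<mu>) = mom [v, v] \<omega> - 2 * c * mom [v] \<omega> + c\<^sup>2 * mom [] \<omega>"
    unfolding eq using i by (simp add: mom_def mult.assoc)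
  also have "\<dots> = mom [] \<omega> * \<kappa>2 \<omega> v v"
    using mom_0_pos[OF \<omega>] by (simp add: c_def \<kappa>1_def \<kappa>2_def field_simps power2_eq_square)
  finally show "mom [] \<omega> * \<kappa>2 \<omega> v v = (\<integral>y. (v \<bullet> y - \<kappa>1 \<omega> v)\<^sup>2 * exp (\<omega> \<bullet> y) \<partial>\<mu>)"
    by (simp add: c_def)
qed

lemma kappa2_nonneg:
  assumes v: "v \<in> carrier_vec k"
  shows "\<kappa>2 \<omega> v v \<ge> 0"
proof -
  have "mom [] \<omega> * \<kappa>2 \<omega> v v \<ge> 0" unfolding kappa2_variance[OF v] by simp
  then show ?thesis using mom_0_pos[OF \<omega>] by (simp add: zero_le_mult_iff)
qed

text \<open>\<open>\<kappa>2\<close> is a variance, so its vanishing confines \<mu> to a hyperplane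
  orthogonal to \<open>v\<close>, which minimality excludes for nonzero \<open>v\<close>.\<close>

lemma kappa2_eq_0:
  assumes v: "v \<in> carrier_vec k" and 0: "\<kappa>2 \<omega> v v = 0"
  shows "v = 0\<^sub>v k"
proof (rule ccontr)
  assume v0: "v \<noteq> 0\<^sub>v k"
  define c where "c = \<kappa>1 \<omega> v"
  define A where "A = {y \<in> carrier_vec k. v \<bullet> y = c}"
  have "AE y in \<mu>. (v \<bullet> y - c)\<^sup>2 * exp (\<omega> \<bullet> y) = 0"
    using kappa2_variance[OF v] 0 integral_nonneg_eq_0_iff_AE[OF kappa2_variance(2)[OF v]]
    by (simp add: c_def)
  then have "AE y in \<mu>. y \<in> A"
    by (rule AE_mp) (auto intro!: AE_I2 simp: A_def space_mu_carrier)
  moreover have "affine_vec k A"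
    unfolding affine_vec_def
  proof (intro conjI ballI allI impI)
    fix x y and a b :: real assume xy: "x \<in> A" "y \<in> A" and ab: "a + b = 1"
    have "v \<bullet> (a \<cdot>\<^sub>v x + b \<cdot>\<^sub>v y) = a * c + b * c"
      using xy v by (simp add: A_def scalar_prod_add_distrib[of _ k])
    also have "\<dots> = c" using ab by (simp flip: distrib_right)
    finally show "a \<cdot>\<^sub>v x + b \<cdot>\<^sub>v y \<in> A" using xy by (simp add: A_def)
  qed (auto simp: A_def)
  moreover have "A \<noteq> carrier_vec k"
  proof
    assume A: "A = carrier_vec k"
    have "0\<^sub>v k \<in> A" "v \<in> A" using v by (auto simp: A)
    then have "v \<bullet> v = 0" using v by (simp add: A_def)
    then show False using v v0 scalar_prod_self_eq_0 by blast
  qed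
  ultimately show False using not_AE_affine by blast
qed

lemma expfam_mgf:
  assumes v: "\<omega> + v \<in> \<Omega>" "v \<in> carrier_vec k"
  shows "(\<integral>\<^sup>+y. ennreal (exp (v \<bullet> y)) \<partial>expfam \<mu> \<omega>) = ennreal (exp (\<psi> (\<omega> + v) - \<psi> \<omega>))"
proof -
  note c = \<Omega>_carrier[OF \<omega>]
  note [measurable] = scalar_prod_measurable[OF c] scalar_prod_measurable[OF v(2)]
  have "(\<integral>\<^sup>+y. ennreal (exp (v \<bullet> y)) \<partial>expfam \<mu> \<omega>)
      = (\<integral>\<^sup>+y. ennreal (exp (\<omega> \<bullet> y - \<psi> \<omega>)) * ennreal (exp (v \<bullet> y)) \<partial>\<mu>)"
    unfolding expfam_def by (rule nn_integral_density) measurable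
  also have "\<dots> = (\<integral>\<^sup>+y. ennreal (exp (- \<psi> \<omega>) * exp ((\<omega> + v) \<bullet> y)) \<partial>\<mu>)"
    using space_mu_carrier c v
    by (intro nn_integral_cong)
      (simp add: add_scalar_prod_distrib[of _ k] algebra_simps flip: ennreal_mult exp_add)
  also have "\<dots> = ennreal (exp (- \<psi> \<omega>) * mom [] (\<omega> + v))"
    using mom_integrable[of "[]", OF _ v(1)]
    by (subst nn_integral_eq_integral) (auto simp: mom_def)
  also have "mom [] (\<omega> + v) = exp (\<psi> (\<omega> + v))" using mom_0_pos[OF v(1)] by (simp add: psi_eq)
  finally show ?thesis by (simp add: exp_diff exp_minus field_simps)
qed

lemma prob_space_expfam: "prob_space (expfam \<mu> \<omega>)"
proof
  note c = \<Omega>_carrier[OF \<omega>]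
  have z: "\<omega> + 0\<^sub>v k = \<omega>" using c by simp
  have "emeasure (expfam \<mu> \<omega>) (space (expfam \<mu> \<omega>)) = (\<integral>\<^sup>+y. 1 \<partial>expfam \<mu> \<omega>)" by simp
  also have "\<dots> = (\<integral>\<^sup>+y. ennreal (exp (0\<^sub>v k \<bullet> y)) \<partial>expfam \<mu> \<omega>)"
    using space_mu_carrier by (intro nn_integral_cong) (auto simp: expfam_def)
  also have "\<dots> = 1" using expfam_mgf[of "0\<^sub>v k"] \<omega> by (simp add: z)
  finally show "emeasure (expfam \<mu> \<omega>) (space (expfam \<mu> \<omega>)) = 1" .
qed

end

end

section \<open>The Laplace approximation of a convex potential\<close>

lemma DERIV_compare:
  fixes f g :: "real \<Rightarrow> real"
  assumes "a \<le> b"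
    and "\<And>t. a \<le> t \<Longrightarrow> t \<le> b \<Longrightarrow> (f has_real_derivative f' t) (at t)"
    and "\<And>t. a \<le> t \<Longrightarrow> t \<le> b \<Longrightarrow> (g has_real_derivative g' t) (at t)"
    and "\<And>t. a \<le> t \<Longrightarrow> t \<le> b \<Longrightarrow> g' t \<le> f' t"
  shows "g b - g a \<le> f b - f a"
proof -
  have "f a - g a \<le> f b - g b"
  proof (rule DERIV_nonneg_imp_nondecreasing[where f = "\<lambda>t. f t - g t", OF assms(1)])
    fix t assume t: "a \<le> t" "t \<le> b"
    show "\<exists>y. ((\<lambda>t. f t - g t) has_real_derivative y) (at t) \<and> 0 \<le> y"
      using DERIV_diff[OF assms(2)[OF t] assms(3)[OF t]] assms(4)[OF t]
      by (intro exI[of _ "f' t - g' t"]) simp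
  qed
  then show ?thesis by linarith
qed

text \<open>The space of all finitely supported sequences is not complete, but these
  finite-dimensional subspaces are; the fixed point argument needs it.\<close>

lemma complete_seqs: "uniform_space_class.complete (seqs d)"
proof (rule completeI)
  fix f :: "nat \<Rightarrow> fseq" assume f: "\<forall>n. f n \<in> seqs d" "Cauchy f"
  have comp: "\<bar>coord x i\<bar> \<le> norm x" if x: "x \<in> seqs d" for x i
  proof (cases "i < d")
    case True
    have "(coord x i)\<^sup>2 \<le> (\<Sum>i<d. (coord x i)\<^sup>2)" using True by (intro member_le_sum) auto
    also have "\<dots> = (norm x)\<^sup>2" by (simp only: power2_norm_eq_inner[of x] inner_seqs[OF x]) (simp add: power2_eq_square)
    finally show ?thesis by (simp add: abs_le_square_iff[symmetric])
  qed (use x in \<open>simp add: seqs_def\<close>)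
  have "Cauchy (\<lambda>n. coord (f n) i)" for i
  proof (rule metric_CauchyI)
    fix e :: real assume "e > 0"
    then obtain N where N: "\<And>m n. m \<ge> N \<Longrightarrow> n \<ge> N \<Longrightarrow> dist (f m) (f n) < e"
      using metric_CauchyD[OF f(2)] by blast
    have "dist (coord (f m) i) (coord (f n) i) < e" if "m \<ge> N" "n \<ge> N" for m n
    proof -
      have "f m - f n \<in> seqs d" using f(1) by (auto simp: seqs_def)
      from comp[OF this, of i] have "dist (coord (f m) i) (coord (f n) i) \<le> dist (f m) (f n)"
        by (simp add: dist_norm)
      then show ?thesis using N[OF that] by linarith
    qed
    then show "\<exists>N. \<forall>m\<ge>N. \<forall>n\<ge>N. dist (coord (f m) i) (coord (f n) i) < e" by blast
  qed
  then have "\<exists>l. (\<lambda>n. coord (f n) i) \<longlonglongrightarrow> l" for i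
    using Cauchy_convergent_iff convergent_def by blast
  then obtain l where l: "\<And>i. (\<lambda>n. coord (f n) i) \<longlonglongrightarrow> l i" by metis
  define L where "L = fseq_of d l"
  have "(\<lambda>n. sqrt (\<Sum>i<d. (coord (f n) i - l i)\<^sup>2)) \<longlonglongrightarrow> sqrt (\<Sum>i<d. (l i - l i)\<^sup>2)"
    by (intro tendsto_intros l)
  then have lim: "(\<lambda>n. sqrt (\<Sum>i<d. (coord (f n) i - l i)\<^sup>2)) \<longlonglongrightarrow> 0" by simp
  have dist: "dist (f n) L = sqrt (\<Sum>i<d. (coord (f n) i - l i)\<^sup>2)" for n
  proof -
    have "f n - L \<in> seqs d" using f(1) by (auto simp: L_def seqs_def)
    then show ?thesis
      unfolding dist_norm norm_eq_sqrt_inner using inner_seqs[of "f n - L" d "f n - L"]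
      by (simp add: power2_eq_square) (simp add: L_def)
  qed
  have "(\<lambda>n. dist (f n) L) \<longlonglongrightarrow> 0" unfolding dist by (rule lim)
  then have "f \<longlonglongrightarrow> L" by (rule tendsto_dist_iff[THEN iffD2])
  moreover have "L \<in> seqs d" by (simp add: L_def)
  ultimately show "\<exists>l\<in>seqs d. f \<longlonglongrightarrow> l" by blast
qed

text \<open>The whitened potential, described by derivatives along lines: \<open>Q\<close> and
  \<open>T\<close> are its second and third derivative as forms. As in the definition of
  \<open>delta3\<close>, \<open>T\<close> is bounded on the diagonal only, and only on the ball;
  elsewhere the convexity of \<open>\<Theta>\<close> and of \<open>V\<close> is all that is
  available.\<close>

locale potential =
  fixes d :: nat and s \<delta> :: real and \<Theta> :: "fseq set" and V :: "fseq \<Rightarrow> real"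
    and grad :: "fseq \<Rightarrow> fseq" and Q :: "fseq \<Rightarrow> fseq \<Rightarrow> fseq \<Rightarrow> real"
    and T :: "fseq \<Rightarrow> fseq \<Rightarrow> fseq \<Rightarrow> fseq \<Rightarrow> real"
  assumes d: "d \<ge> 1" and s: "s \<ge> 12" and \<delta>: "\<delta> \<ge> 0" "2 * s * \<delta> * sqrt d \<le> 1 / 4"
    and \<Theta>_sub: "\<Theta> \<subseteq> seqs d"
    and \<Theta>_ball: "\<And>z. z \<in> seqs d \<Longrightarrow> norm z \<le> 2 * s * sqrt d \<Longrightarrow> z \<in> \<Theta>"
    and \<Theta>_segment: "\<And>z z' t. z \<in> \<Theta> \<Longrightarrow> z' \<in> \<Theta> \<Longrightarrow> 0 \<le> t \<Longrightarrow> t \<le> 1 \<Longrightarrow> z + t *\<^sub>R (z' - z) \<in> \<Theta>"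
    and grad_in: "\<And>z. grad z \<in> seqs d"
    and V_deriv: "\<And>z u t. z \<in> seqs d \<Longrightarrow> u \<in> seqs d \<Longrightarrow> z + t *\<^sub>R u \<in> \<Theta> \<Longrightarrow>
      ((\<lambda>t. V (z + t *\<^sub>R u)) has_real_derivative inner (grad (z + t *\<^sub>R u)) u) (at t)"
    and grad_deriv: "\<And>z u v t. z \<in> seqs d \<Longrightarrow> u \<in> seqs d \<Longrightarrow> v \<in> seqs d \<Longrightarrow> z + t *\<^sub>R u \<in> \<Theta> \<Longrightarrow>
      ((\<lambda>t. inner (grad (z + t *\<^sub>R u)) v) has_real_derivative Q (z + t *\<^sub>R u) u v) (at t)"
    and Q_deriv: "\<And>z u v v' t. z \<in> seqs d \<Longrightarrow> u \<in> seqs d \<Longrightarrow> v \<in> seqs d \<Longrightarrow> v' \<in> seqs d \<Longrightarrow> z + t *\<^sub>R u \<in> \<Theta> \<Longrightarrow>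
      ((\<lambda>t. Q (z + t *\<^sub>R u) v v') has_real_derivative T (z + t *\<^sub>R u) u v v') (at t)"
    and Q_sym: "\<And>z u v. Q z u v = Q z v u"
    and T_sym: "\<And>z u v x. T z u v x = T z v u x" "\<And>z u v x. T z u v x = T z u x v"
    and Q_linear: "\<And>z u v x. z \<in> \<Theta> \<Longrightarrow> u \<in> seqs d \<Longrightarrow> v \<in> seqs d \<Longrightarrow> x \<in> seqs d \<Longrightarrow> Q z (u + v) x = Q z u x + Q z v x"
      "\<And>z u x c. z \<in> \<Theta> \<Longrightarrow> u \<in> seqs d \<Longrightarrow> x \<in> seqs d \<Longrightarrow> Q z (c *\<^sub>R u) x = c * Q z u x"
    and T_linear: "\<And>z u v x y. z \<in> \<Theta> \<Longrightarrow> u \<in> seqs d \<Longrightarrow> v \<in> seqs d \<Longrightarrow> x \<in> seqs d \<Longrightarrow> y \<in> seqs d \<Longrightarrow>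
        T z (u + v) x y = T z u x y + T z v x y"
      "\<And>z u x y c. z \<in> \<Theta> \<Longrightarrow> u \<in> seqs d \<Longrightarrow> x \<in> seqs d \<Longrightarrow> y \<in> seqs d \<Longrightarrow> T z (c *\<^sub>R u) x y = c * T z u x y"
    and Q_nonneg: "\<And>z u. z \<in> \<Theta> \<Longrightarrow> u \<in> seqs d \<Longrightarrow> Q z u u \<ge> 0"
    and Q_0: "\<And>u. u \<in> seqs d \<Longrightarrow> Q 0 u u = (norm u)\<^sup>2"
    and T_bound: "\<And>z u. z \<in> seqs d \<Longrightarrow> norm z \<le> 2 * s * sqrt d \<Longrightarrow> u \<in> seqs d \<Longrightarrow> \<bar>T z u u u\<bar> \<le> \<delta> * norm u ^ 3"
begin

abbreviation "S \<equiv> seqs d"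

lemma S_intros [simp, intro]:
  "0 \<in> S" "x \<in> S \<Longrightarrow> y \<in> S \<Longrightarrow> x + y \<in> S" "x \<in> S \<Longrightarrow> y \<in> S \<Longrightarrow> x - y \<in> S"
  "x \<in> S \<Longrightarrow> c *\<^sub>R x \<in> S" "x \<in> S \<Longrightarrow> - x \<in> S"
  by (auto simp: seqs_def)

section \<open>Hessian and gradient near the origin\<close>

definition R :: real where "R = 2 * s * sqrt d"

lemma R_pos: "R > 0" using d s by (simp add: R_def)

lemma \<delta>R: "\<delta> * R \<le> 1 / 4" using \<delta> by (simp add: R_def mult_ac)

text \<open>Polarisation: a symmetric trilinear form is controlled by its diagonal.\<close>

lemma T_polarized_unit:
  assumes z: "z \<in> S" "norm z \<le> R" and u: "u \<in> S" "norm u = 1" and v: "v \<in> S" "norm v = 1"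
  shows "\<bar>T z u u v\<bar> \<le> 5 / 3 * \<delta>"
proof -
  have z\<Theta>: "z \<in> \<Theta>" using z by (intro \<Theta>_ball) (auto simp: R_def)
  note lin = T_linear[OF z\<Theta>]
  have lin2: "T z a (b + c) e = T z a b e + T z a c e" "T z a e (b + c) = T z a e b + T z a e c"
    if "a \<in> S" "b \<in> S" "c \<in> S" "e \<in> S" for a b c e
  proof -
    show "T z a (b + c) e = T z a b e + T z a c e"
      using lin(1)[of b c a e] that by (simp add: T_sym(1)[of z a])
    have "T z a e x = T z x a e" for x using T_sym(2)[of z a e x] T_sym(1)[of z a x e] by simp
    then show "T z a e (b + c) = T z a e b + T z a e c" using lin(1)[of b c a e] that by simp
  qed
  have neg: "T z (- a) b e = - T z a b e" if "a \<in> S" "b \<in> S" "e \<in> S" for a b e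
    using lin(2)[of a b e "- 1"] that by simp
  have neg2: "T z a (- b) e = - T z a b e" "T z a e (- b) = - T z a e b" if "a \<in> S" "b \<in> S" "e \<in> S" for a b e
  proof -
    show "T z a (- b) e = - T z a b e" using neg[of b a e] that by (simp add: T_sym(1)[of z a])
    have "T z a e x = T z x a e" for x using T_sym(2)[of z a e x] T_sym(1)[of z a x e] by simp
    then show "T z a e (- b) = - T z a e b" using neg[of b a e] that by simp
  qed
  have plus: "T z (u + x) (u + x) (u + x) = T z u u u + 3 * T z u u x + 3 * T z u x x + T z x x x"
    if x: "x \<in> S" for x
  proof -
    have perm: "T z u x u = T z u u x" "T z x u u = T z u u x" "T z x u x = T z u x x" "T z x x u = T z u x x"
      using T_sym(2)[of z u x u] T_sym(1)[of z x u u] T_sym(1)[of z x u x] T_sym(2)[of z x x u] by simp_all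
    show ?thesis using u x by (simp add: lin(1) lin2 perm)
  qed
  define v' where "v' = - v"
  have v': "v' \<in> S" using v by (auto simp: v'_def)
  have minus: "T z u u v' = - T z u u v" "T z u v' v' = T z u v v" "T z v' v' v' = - T z v v v"
    using u v by (simp_all add: v'_def neg neg2)
  \<comment> \<open>The values at u + v and u - v differ by the terms odd in v, which are 6 T(u,u,v)
    + 2 T(v,v,v).\<close>
  have "6 * T z u u v = T z (u + v) (u + v) (u + v) - T z (u + v') (u + v') (u + v') - 2 * T z v v v"
    unfolding plus[OF v(1)] plus[OF v'] minus by simp
  then have le: "6 * \<bar>T z u u v\<bar> \<le> \<bar>T z (u + v) (u + v) (u + v)\<bar> + \<bar>T z (u + v') (u + v') (u + v')\<bar> + 2 * \<bar>T z v v v\<bar>"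
    by linarith
  have b: "\<bar>T z x x x\<bar> \<le> \<delta> * norm x ^ 3" if "x \<in> S" for x
    using T_bound z that by (auto simp: R_def)
  define p q where "p = norm (u + v)" and "q = norm (u + v')"
  have pq: "p\<^sup>2 + q\<^sup>2 = 4"
    unfolding p_def q_def power2_norm_eq_inner using u v
    by (simp add: v'_def inner_diff_left inner_diff_right inner_add_left inner_add_right inner_commute norm_eq_1)
  have p2: "0 \<le> p" "p \<le> 2" "0 \<le> q" "q \<le> 2"
  proof -
    show "0 \<le> p" "0 \<le> q" by (auto simp: p_def q_def)
    have "p\<^sup>2 \<le> 4" "q\<^sup>2 \<le> 4" using pq zero_le_power2[of p] zero_le_power2[of q] by linarith+
    then show "p \<le> 2" "q \<le> 2" using power2_le_imp_le[of p 2] power2_le_imp_le[of q 2] by simp_all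
  qed
  \<comment> \<open>By the parallelogram law the squares of \<open>p\<close> and \<open>q\<close>
    add up to 4 and neither number exceeds 2, so their cubes add up to at most 8. This makes the
    constant 5/3 = (8 + 2) / 6.\<close>
  have "p ^ 3 + q ^ 3 \<le> 2 * p\<^sup>2 + 2 * q\<^sup>2"
    unfolding power3_eq_cube power2_eq_square using p2
    by (intro add_mono) (auto intro!: mult_right_mono simp: mult.assoc[symmetric])
  then have pq3: "p ^ 3 + q ^ 3 \<le> 8" using pq by simp
  have "6 * \<bar>T z u u v\<bar> \<le> \<delta> * p ^ 3 + \<delta> * q ^ 3 + 2 * (\<delta> * norm v ^ 3)"
    using le b[of "u + v"] b[of "u + v'"] b[of v] u v v' by (simp add: p_def q_def)
  also have "\<dots> = \<delta> * (p ^ 3 + q ^ 3) + 2 * \<delta>" using v by (simp add: algebra_simps)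
  also have "\<dots> \<le> \<delta> * 8 + 2 * \<delta>" using pq3 \<delta> by (intro add_mono mult_left_mono) auto
  finally show ?thesis by simp
qed

lemma T_polarized:
  assumes z: "z \<in> S" "norm z \<le> R" and u: "u \<in> S" and v: "v \<in> S"
  shows "\<bar>T z v u u\<bar> \<le> 5 / 3 * \<delta> * norm v * (norm u)\<^sup>2"
proof -
  have z\<Theta>: "z \<in> \<Theta>" using z by (intro \<Theta>_ball) (auto simp: R_def)
  have sc: "T z (a *\<^sub>R v) (b *\<^sub>R u) (b *\<^sub>R u) = a * b * b * T z v u u" if "u \<in> S" "v \<in> S" for a b u v
  proof -
    have "T z (a *\<^sub>R v) (b *\<^sub>R u) (b *\<^sub>R u) = a * T z v (b *\<^sub>R u) (b *\<^sub>R u)"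
      using that by (intro T_linear z\<Theta>) auto
    also have "T z v (b *\<^sub>R u) (b *\<^sub>R u) = T z (b *\<^sub>R u) v (b *\<^sub>R u)" by (rule T_sym)
    also have "\<dots> = b * T z u v (b *\<^sub>R u)" using that by (intro T_linear z\<Theta>) auto
    also have "T z u v (b *\<^sub>R u) = T z (b *\<^sub>R u) u v" by (simp only: T_sym(2)[of z u v] T_sym(1)[of z u "b *\<^sub>R u"])
    also have "\<dots> = b * T z u u v" using that by (intro T_linear z\<Theta>) auto
    also have "T z u u v = T z v u u" by (simp only: T_sym(2)[of z u u v] T_sym(1)[of z u v])
    finally show ?thesis by simp
  qed
  show ?thesis
  proof (cases "u = 0 \<or> v = 0")
    case True
    have "T z v u u = 0" using sc[OF u v, of 1 0] sc[OF u v, of 0 1] True by auto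
    then show ?thesis using True by auto
  next
    case False
    define u' v' where "u' = (1 / norm u) *\<^sub>R u" and "v' = (1 / norm v) *\<^sub>R v"
    have uv': "u' \<in> S" "norm u' = 1" "v' \<in> S" "norm v' = 1" using False u v by (auto simp: u'_def v'_def)
    have "T z v u u = T z (norm v *\<^sub>R v') (norm u *\<^sub>R u') (norm u *\<^sub>R u')" using False by (simp add: u'_def v'_def)
    also have "\<dots> = norm v * (norm u)\<^sup>2 * T z v' u' u'" by (simp add: sc uv' power2_eq_square)
    also have "T z v' u' u' = T z u' u' v'" by (simp only: T_sym(2)[of z u' u' v'] T_sym(1)[of z u' v'])
    finally have "\<bar>T z v u u\<bar> = norm v * (norm u)\<^sup>2 * \<bar>T z u' u' v'\<bar>" by (simp add: abs_mult)
    also have "\<dots> \<le> norm v * (norm u)\<^sup>2 * (5 / 3 * \<delta>)"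
      using z uv' by (intro mult_left_mono T_polarized_unit) auto
    finally show ?thesis by (simp add: mult_ac)
  qed
qed

text \<open>Mean value theorem along the ray from the origin, where \<open>Q\<close> is the
  identity; \<open>T_polarized\<close> bounds the derivative.\<close>

lemma Q_near_identity:
  assumes z: "z \<in> S" "norm z \<le> R" and u: "u \<in> S"
  shows "\<bar>Q z u u - (norm u)\<^sup>2\<bar> \<le> 5 / 3 * \<delta> * norm z * (norm u)\<^sup>2"
proof -
  have in\<Theta>: "0 + t *\<^sub>R z \<in> \<Theta>" and le: "norm (t *\<^sub>R z) \<le> R" if t: "0 \<le> t" "t \<le> 1" for t
  proof -
    have "t * norm z \<le> 1 * norm z" using t by (intro mult_right_mono) auto
    then show "norm (t *\<^sub>R z) \<le> R" using t z by simp
    then show "0 + t *\<^sub>R z \<in> \<Theta>" using z by (auto intro!: \<Theta>_ball simp: R_def)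
  qed
  obtain t where t: "0 < t" "t < 1"
    "Q (0 + 1 *\<^sub>R z) u u - Q (0 + 0 *\<^sub>R z) u u = (1 - 0) * T (0 + t *\<^sub>R z) z u u"
    using MVT2[of 0 1 "\<lambda>t. Q (0 + t *\<^sub>R z) u u" "\<lambda>t. T (0 + t *\<^sub>R z) z u u"]
      Q_deriv[OF S_intros(1) z(1) u u] in\<Theta> by auto
  then have "\<bar>Q z u u - (norm u)\<^sup>2\<bar> = \<bar>T (t *\<^sub>R z) z u u\<bar>" using Q_0[OF u] by simp
  also have "\<dots> \<le> 5 / 3 * \<delta> * norm z * (norm u)\<^sup>2" using z u t le by (intro T_polarized) auto
  finally show ?thesis .
qed

text \<open>Polarisation of the quadratic bound. Unlike the cubic case it costs no constant, because
  of the parallelogram law.\<close>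

lemma Q_near_inner:
  assumes z: "z \<in> S" "norm z \<le> r" "r \<le> R" and u: "u \<in> S" and v: "v \<in> S"
  shows "\<bar>Q z u v - inner u v\<bar> \<le> 5 / 3 * \<delta> * r * norm u * norm v"
proof -
  define c where "c = 5 / 3 * \<delta> * r"
  have c: "c \<ge> 0" using \<delta> z norm_ge_zero[of z] unfolding c_def by (intro mult_nonneg_nonneg) linarith+
  have z\<Theta>: "z \<in> \<Theta>" using z by (intro \<Theta>_ball) (auto simp: R_def)
  define B where "B = (\<lambda>u v. Q z u v - inner u v)"
  have diag: "\<bar>B u u\<bar> \<le> c * (norm u)\<^sup>2" if "u \<in> S" for u
  proof -
    have "\<bar>B u u\<bar> \<le> 5 / 3 * \<delta> * norm z * (norm u)\<^sup>2"
      using Q_near_identity[of z u] z that by (simp add: B_def power2_norm_eq_inner)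
    also have "\<dots> \<le> c * (norm u)\<^sup>2" unfolding c_def using z \<delta> by (intro mult_right_mono mult_left_mono) auto
    finally show ?thesis .
  qed
  have Bsym: "B u v = B v u" for u v by (simp add: B_def Q_sym inner_commute)
  have Badd: "B (u + v) x = B u x + B v x" if "u \<in> S" "v \<in> S" "x \<in> S" for u v x
    using that by (simp add: B_def Q_linear[OF z\<Theta>] inner_add_left)
  have Bsc: "B (a *\<^sub>R u) x = a * B u x" if "u \<in> S" "x \<in> S" for a u x
    using that by (simp add: B_def Q_linear[OF z\<Theta>] algebra_simps)
  have unit: "\<bar>B u v\<bar> \<le> c" if uv: "u \<in> S" "v \<in> S" "norm u = 1" "norm v = 1" for u v
  proof -
    define v' where "v' = - v"
    have v': "v' \<in> S" using uv by (auto simp: v'_def)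
    have Badd2: "B x (a + b) = B x a + B x b" if "x \<in> S" "a \<in> S" "b \<in> S" for x a b
      using Badd[of a b x] that by (simp only: Bsym[of x])
    have exp: "B (u + x) (u + x) = B u u + 2 * B u x + B x x" if "x \<in> S" for x
      using uv that by (simp add: Badd Badd2 Bsym[of x u])
    have "B u v' = - B u v" "B v' v' = B v v"
      using Bsc[of v u "- 1"] Bsc[of v "v'" "- 1"] Bsc[of v v "- 1"] uv v'
      by (simp_all add: v'_def Bsym[of u] Bsym[of v "- v"])
    then have "4 * B u v = B (u + v) (u + v) - B (u + v') (u + v')"
      unfolding exp[OF uv(2)] exp[OF v'] by simp
    then have "4 * \<bar>B u v\<bar> \<le> c * (norm (u + v))\<^sup>2 + c * (norm (u + v'))\<^sup>2"
      using diag[of "u + v"] diag[of "u + v'"] uv v' by auto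
    also have "\<dots> = c * ((norm (u + v))\<^sup>2 + (norm (u + v'))\<^sup>2)" by (simp add: distrib_left)
    also have "(norm (u + v))\<^sup>2 + (norm (u + v'))\<^sup>2 = 4"
      unfolding power2_norm_eq_inner v'_def using uv
      by (simp add: inner_diff_left inner_diff_right inner_add_left inner_add_right inner_commute norm_eq_1)
    finally show ?thesis by simp
  qed
  have "\<bar>B u v\<bar> \<le> c * norm u * norm v"
  proof (cases "u = 0 \<or> v = 0")
    case True
    have "B u v = 0" using True Bsc[of u v 0] Bsc[of v u 0] u v Bsym[of u v] by auto
    then show ?thesis using True by auto
  next
    case False
    define u' v' where "u' = (1 / norm u) *\<^sub>R u" and "v' = (1 / norm v) *\<^sub>R v"
    have uv': "u' \<in> S" "norm u' = 1" "v' \<in> S" "norm v' = 1" using False u v by (auto simp: u'_def v'_def)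
    have "B u v = B (norm u *\<^sub>R u') (norm v *\<^sub>R v')" using False by (simp add: u'_def v'_def)
    also have "\<dots> = norm u * norm v * B u' v'" using uv' by (simp add: Bsc Bsym[of _ "norm v *\<^sub>R v'"] Bsym[of v'])
    finally have "\<bar>B u v\<bar> = norm u * norm v * \<bar>B u' v'\<bar>" by (simp add: abs_mult)
    also have "\<dots> \<le> norm u * norm v * c" using uv' by (intro mult_left_mono unit) auto
    finally show ?thesis by (simp add: mult_ac)
  qed
  then show ?thesis by (simp add: B_def c_def)
qed

lemma segment_in:
  assumes "z \<in> S" "u \<in> S" "norm z \<le> r" "norm (z + u) \<le> r" "0 \<le> t" "t \<le> 1"
  shows "z + t *\<^sub>R u \<in> S" "norm (z + t *\<^sub>R u) \<le> r"
proof -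
  have "norm (z + t *\<^sub>R u) = norm ((1 - t) *\<^sub>R z + t *\<^sub>R (z + u))" by (simp add: algebra_simps)
  also have "\<dots> \<le> norm ((1 - t) *\<^sub>R z) + norm (t *\<^sub>R (z + u))" by (rule norm_triangle_ineq)
  also have "\<dots> = (1 - t) * norm z + t * norm (z + u)" using assms by simp
  also have "\<dots> \<le> (1 - t) * r + t * r" using assms by (intro add_mono mult_left_mono) auto
  finally show "norm (z + t *\<^sub>R u) \<le> r" by (simp add: algebra_simps)
qed (use assms in auto)

lemma ball_in_\<Theta>: "z \<in> S \<Longrightarrow> norm z \<le> R \<Longrightarrow> z \<in> \<Theta>"
  by (auto intro: \<Theta>_ball simp: R_def)

text \<open>The vector increment is tested against itself, which reduces the claim to the scalar
  mean value theorem and \<open>Q_near_inner\<close>.\<close>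

lemma grad_near_identity:
  assumes z: "z \<in> S" "u \<in> S" "norm z \<le> r" "norm (z + u) \<le> r" "r \<le> R"
  shows "norm (grad (z + u) - grad z - u) \<le> 5 / 3 * \<delta> * r * norm u"
proof -
  define v where "v = grad (z + u) - grad z - u"
  have v: "v \<in> S" using z grad_in by (auto simp: v_def)
  have seg: "z + t *\<^sub>R u \<in> S" "norm (z + t *\<^sub>R u) \<le> r" "z + t *\<^sub>R u \<in> \<Theta>" if "0 \<le> t" "t \<le> 1" for t
    using segment_in[OF z(1,2,3,4) that] ball_in_\<Theta> z(5) by auto
  obtain t where t: "0 < t" "t < 1"
    "inner (grad (z + 1 *\<^sub>R u)) v - inner (grad (z + 0 *\<^sub>R u)) v = (1 - 0) * Q (z + t *\<^sub>R u) u v"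
    using MVT2[of 0 1 "\<lambda>t. inner (grad (z + t *\<^sub>R u)) v" "\<lambda>t. Q (z + t *\<^sub>R u) u v"]
      grad_deriv[OF z(1,2) v] seg by auto
  have "(norm v)\<^sup>2 = inner (grad (z + u) - grad z) v - inner u v"
    unfolding power2_norm_eq_inner by (subst (1) v_def) (simp add: inner_diff_left)
  also have "\<dots> = Q (z + t *\<^sub>R u) u v - inner u v" using t by (simp add: inner_diff_left)
  also have "\<dots> \<le> \<bar>Q (z + t *\<^sub>R u) u v - inner u v\<bar>" by simp
  also have "\<dots> \<le> 5 / 3 * \<delta> * r * norm u * norm v"
    using seg[of t] t z v by (intro Q_near_inner) auto
  finally have "norm v * norm v \<le> (5 / 3 * \<delta> * r * norm u) * norm v" by (simp add: power2_eq_square)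
  moreover have "0 \<le> 5 / 3 * \<delta> * r * norm u"
  proof -
    have "0 \<le> r" using z norm_ge_zero[of z] by linarith
    then show ?thesis using \<delta> by simp
  qed
  ultimately have "norm v \<le> 5 / 3 * \<delta> * r * norm u"
    by (cases "v = 0") (auto simp: mult_le_cancel_right)
  then show ?thesis by (simp add: v_def)
qed

text \<open>The locale provides derivatives along lines only. The Lipschitz bound for
  \<open>grad\<close> makes the first-order remainder quadratic, uniformly in the direction.\<close>

lemma V_frechet:
  assumes z: "z \<in> S" "norm z < R"
  shows "(V has_derivative (\<lambda>u. inner (grad z) u)) (at z within S)"
proof (rule has_derivativeI)
  show "bounded_linear (inner (grad z))" by (rule bounded_linear_inner_right)
  have le: "norm ((V y - V z - inner (grad z) (y - z)) /\<^sub>R norm (y - z)) \<le> 2 * norm (y - z)"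
    if y: "y \<in> S" "norm y \<le> R" for y
  proof (cases "y = z")
    case False
    define u where "u = y - z"
    have u: "u \<in> S" "norm (z + u) \<le> R" "u \<noteq> 0" using y z False by (auto simp: u_def)
    have seg: "z + t *\<^sub>R u \<in> S" "norm (z + t *\<^sub>R u) \<le> R" "z + t *\<^sub>R u \<in> \<Theta>" if "0 \<le> t" "t \<le> 1" for t
      using segment_in[OF z(1) u(1) _ u(2) that] ball_in_\<Theta> z(2) by auto
    obtain t where t: "0 < t" "t < 1"
      "V (z + 1 *\<^sub>R u) - V (z + 0 *\<^sub>R u) = (1 - 0) * inner (grad (z + t *\<^sub>R u)) u"
      using MVT2[of 0 1 "\<lambda>t. V (z + t *\<^sub>R u)" "\<lambda>t. inner (grad (z + t *\<^sub>R u)) u"] V_deriv[OF z(1) u(1)] seg by auto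
    have "V y - V z - inner (grad z) u = inner (grad (z + t *\<^sub>R u) - grad z - t *\<^sub>R u) u + t * (norm u)\<^sup>2"
      using t by (simp add: u_def inner_diff_left power2_norm_eq_inner)
    moreover have "\<bar>inner (grad (z + t *\<^sub>R u) - grad z - t *\<^sub>R u) u\<bar> \<le> (5 / 3 * \<delta> * R * norm (t *\<^sub>R u)) * norm u"
      by (rule order_trans[OF Cauchy_Schwarz_ineq2])
        (intro mult_right_mono grad_near_identity; use z u t seg[of t] in auto)
    moreover have "5 / 3 * \<delta> * R * norm (t *\<^sub>R u) * norm u \<le> 1 * (norm u)\<^sup>2"
    proof -
      have "5 / 3 * \<delta> * R * norm (t *\<^sub>R u) * norm u = (5 / 3 * (\<delta> * R) * t) * (norm u)\<^sup>2"
        using t by (simp add: power2_eq_square)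
      also have "\<dots> \<le> 1 * (norm u)\<^sup>2"
      proof (rule mult_right_mono)
        have "(\<delta> * R) * t \<le> 1 / 4 * 1" using \<delta>R t by (intro mult_mono) auto
        then show "5 / 3 * (\<delta> * R) * t \<le> 1" by simp
      qed simp
      finally show ?thesis .
    qed
    moreover have "t * (norm u)\<^sup>2 \<le> 1 * (norm u)\<^sup>2" using t by (intro mult_right_mono) auto
    moreover have "0 \<le> t * (norm u)\<^sup>2" using t by simp
    ultimately have "\<bar>V y - V z - inner (grad z) u\<bar> \<le> 2 * (norm u)\<^sup>2" by linarith
    then have "\<bar>V y - V z - inner (grad z) u\<bar> / norm u \<le> 2 * (norm u)\<^sup>2 / norm u" by (rule divide_right_mono) simp
    also have "2 * (norm u)\<^sup>2 / norm u = 2 * norm u" using u(3) by (simp add: power2_eq_square)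
    finally show ?thesis by (simp add: u_def divide_inverse mult.commute abs_mult)
  qed simp
  show "((\<lambda>y. (V y - V z - inner (grad z) (y - z)) /\<^sub>R norm (y - z)) \<longlongrightarrow> 0) (at z within S)"
  proof (rule Lim_null_comparison)
    have "\<forall>\<^sub>F y in at z within S. y \<in> S" by (simp add: eventually_at_filter)
    moreover have "\<forall>\<^sub>F y in at z within S. norm y < R"
      using order_tendstoD(2)[OF tendsto_norm[OF tendsto_ident_at] z(2)] .
    ultimately show "\<forall>\<^sub>F y in at z within S. norm ((V y - V z - inner (grad z) (y - z)) /\<^sub>R norm (y - z)) \<le> 2 * norm (y - z)"
      by eventually_elim (use le in auto)
    have "((\<lambda>y. 2 * norm (y - z)) \<longlongrightarrow> 2 * norm (z - z)) (at z within S)" by (intro tendsto_intros)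
    then show "((\<lambda>y. 2 * norm (y - z)) \<longlongrightarrow> 0) (at z within S)" by simp
  qed
qed

end

locale potential_score = potential +
  assumes score: "norm (grad 0) \<le> 7 / 10 * s * sqrt d"
begin

text \<open>A zero of the gradient is a fixed point of a gradient step, which is a contraction.\<close>

lemma stationary_exists:
  "\<exists>z\<in>S. norm z \<le> 4 / 5 * s * sqrt d \<and> grad z = 0"
proof -
  \<comment> \<open>This radius is 3/5 of \<open>R\<close>, so
    \<open>\<delta> * r \<le> 3 / 20\<close> and the contraction factor is 5/3 * 3/20 = 1/4. The
    step maps the ball to itself since 1/4 * 6/5 + 7/10 \<le> 6/5.\<close>
  define r where "r = 6 / 5 * s * sqrt d"
  have r: "0 < r" "r \<le> R" using s d by (auto simp: r_def R_def)
  have \<delta>r: "\<delta> * r \<le> 3 / 20" using \<delta>R by (simp add: r_def R_def algebra_simps)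
  define F where "F = (\<lambda>z. z - grad z)"
  define A where "A = S \<inter> cball 0 r"
  have contr: "norm (F z' - F z) \<le> 1 / 4 * norm (z' - z)" if "z \<in> A" "z' \<in> A" for z z'
  proof -
    have "norm (F z' - F z) = norm (grad (z + (z' - z)) - grad z - (z' - z))"
      unfolding F_def by (simp add: norm_minus_commute algebra_simps)
    also have "\<dots> \<le> 5 / 3 * \<delta> * r * norm (z' - z)"
      using that r by (intro grad_near_identity) (auto simp: A_def)
    also have "\<dots> = 5 / 3 * (\<delta> * r) * norm (z' - z)" by simp
    also have "\<dots> \<le> 1 / 4 * norm (z' - z)" using \<delta>r by (intro mult_right_mono) auto
    finally show ?thesis .
  qed
  have "\<exists>!z\<in>A. F z = z"
  proof (rule Banach_fix[where c = "1 / 4"])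
    show "uniform_space_class.complete A" unfolding A_def by (intro complete_Int_closed complete_seqs closed_cball)
    have A0: "0 \<in> A" using r by (auto simp: A_def)
    then show "A \<noteq> {}" by auto
    show "F ` A \<subseteq> A"
    proof safe
      fix z assume z: "z \<in> A"
      have "norm (F z) \<le> norm (F z - F 0) + norm (F 0)" using norm_triangle_ineq[of "F z - F 0" "F 0"] by simp
      also have "\<dots> \<le> 1 / 4 * norm (z - 0) + 7 / 10 * s * sqrt d"
        using contr[OF A0 z] score by (intro add_mono) (auto simp: F_def)
      also have "\<dots> \<le> r" using z r by (auto simp: A_def r_def)
      finally show "F z \<in> A" using z grad_in by (auto simp: A_def F_def)
    qed
    show "dist (F x) (F y) \<le> 1 / 4 * dist x y" if "x \<in> A" "y \<in> A" for x y
      using contr[OF that(2,1)] by (simp add: dist_norm)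
  qed auto
  then obtain z where z: "z \<in> S" "norm z \<le> r" "grad z = 0" by (auto simp: A_def F_def)
  \<comment> \<open>The fixed point theorem gives only 6/5 s sqrt d. Integrating the lower Hessian
    bound along the ray to \<open>z\<close> gives 7/8 |z| \<le> 7/10 s sqrt d, hence 4/5, so that a
    ball of radius s sqrt d around \<open>z\<close> still fits into the ball of radius
    \<open>R\<close>.\<close>
  have "norm z \<le> 4 / 5 * s * sqrt d"
  proof (cases "z = 0")
    case False
    define e where "e = (\<lambda>t. t * (norm z)\<^sup>2 - 5 / 6 * \<delta> * t\<^sup>2 * norm z ^ 3)"
    have seg: "0 + t *\<^sub>R z \<in> \<Theta>" "norm (t *\<^sub>R z) \<le> t * norm z" "norm (t *\<^sub>R z) \<le> R" if "0 \<le> t" "t \<le> 1" for t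
    proof -
      have "t * norm z \<le> 1 * norm z" using that by (intro mult_right_mono) auto
      then show 1: "norm (t *\<^sub>R z) \<le> R" using that z r by simp
      show "norm (t *\<^sub>R z) \<le> t * norm z" using that by simp
      show "0 + t *\<^sub>R z \<in> \<Theta>" using ball_in_\<Theta>[of "t *\<^sub>R z"] 1 z by simp
    qed
    have "e 1 - e 0 \<le> inner (grad (0 + 1 *\<^sub>R z)) z - inner (grad (0 + 0 *\<^sub>R z)) z"
    proof (rule DERIV_compare[where f = "\<lambda>t. inner (grad (0 + t *\<^sub>R z)) z"])
      fix t :: real assume t: "0 \<le> t" "t \<le> 1"
      show "(e has_real_derivative (norm z)\<^sup>2 - 5 / 3 * \<delta> * t * norm z ^ 3) (at t)"
        unfolding e_def by (auto intro!: derivative_eq_intros)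
      show "((\<lambda>t. inner (grad (0 + t *\<^sub>R z)) z) has_real_derivative Q (0 + t *\<^sub>R z) z z) (at t)"
        by (rule grad_deriv[OF S_intros(1) z(1) z(1) seg(1)[OF t]])
      have "\<bar>Q (t *\<^sub>R z) z z - (norm z)\<^sup>2\<bar> \<le> 5 / 3 * \<delta> * norm (t *\<^sub>R z) * (norm z)\<^sup>2"
        using z seg[OF t] by (intro Q_near_identity) auto
      also have "\<dots> = 5 / 3 * \<delta> * t * norm z ^ 3" using t by (simp add: power2_eq_square power3_eq_cube)
      finally have "(norm z)\<^sup>2 - 5 / 3 * \<delta> * t * norm z ^ 3 \<le> Q (t *\<^sub>R z) z z"
        using abs_ge_minus_self[of "Q (t *\<^sub>R z) z z - (norm z)\<^sup>2"] by linarith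
      then show "(norm z)\<^sup>2 - 5 / 3 * \<delta> * t * norm z ^ 3 \<le> Q (0 + t *\<^sub>R z) z z" by simp
    qed simp
    then have "(norm z)\<^sup>2 - 5 / 6 * \<delta> * norm z ^ 3 \<le> - inner (grad 0) z" by (simp add: e_def z(3))
    also have "\<dots> \<le> norm (grad 0) * norm z" using Cauchy_Schwarz_ineq2[of "grad 0" z] by linarith
    also have "\<dots> \<le> 7 / 10 * s * sqrt d * norm z" by (intro mult_right_mono score) simp
    finally have "(norm z - 5 / 6 * \<delta> * (norm z)\<^sup>2) * norm z \<le> 7 / 10 * s * sqrt d * norm z"
      by (simp add: power2_eq_square power3_eq_cube algebra_simps)
    then have 1: "norm z - 5 / 6 * \<delta> * (norm z)\<^sup>2 \<le> 7 / 10 * s * sqrt d"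
      using False by (simp add: mult_le_cancel_right)
    have "\<delta> * norm z \<le> \<delta> * r" using z \<delta> by (intro mult_left_mono) auto
    then have "\<delta> * norm z * norm z \<le> 3 / 20 * norm z" using \<delta>r by (intro mult_right_mono) auto
    then have "5 / 6 * \<delta> * (norm z)\<^sup>2 \<le> 1 / 8 * norm z" by (simp add: power2_eq_square)
    then show ?thesis using 1 by simp
  qed (use s in simp)
  then show ?thesis using z by blast
qed

definition zh :: fseq where "zh = (SOME z. z \<in> S \<and> norm z \<le> 4 / 5 * s * sqrt d \<and> grad z = 0)"

lemma zh: "zh \<in> S" "norm zh \<le> 4 / 5 * s * sqrt d" "grad zh = 0"
  using someI_ex[of "\<lambda>z. z \<in> S \<and> norm z \<le> 4 / 5 * s * sqrt d \<and> grad z = 0"] stationary_exists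
  unfolding zh_def by blast+

lemma sd_pos: "s * sqrt d > 0" using s d by simp

section \<open>Convexity and growth around the minimiser\<close>

lemma zh_in_\<Theta>: "zh \<in> \<Theta>"
  using zh sd_pos by (intro ball_in_\<Theta>) (auto simp: R_def)

context
  fixes x assumes x: "x \<in> S" "zh + x \<in> \<Theta>"
begin

lemma ray_in: "0 \<le> t \<Longrightarrow> t \<le> 1 \<Longrightarrow> zh + t *\<^sub>R x \<in> \<Theta>"
  using \<Theta>_segment[OF zh_in_\<Theta> x(2), of t] by simp

lemma ray_slope_mono:
  assumes "0 \<le> a" "a \<le> b" "b \<le> 1"
  shows "inner (grad (zh + a *\<^sub>R x)) x \<le> inner (grad (zh + b *\<^sub>R x)) x"
proof -
  have "(\<lambda>_. 0) b - (\<lambda>_. 0) a \<le> inner (grad (zh + b *\<^sub>R x)) x - inner (grad (zh + a *\<^sub>R x)) x"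
    by (rule DERIV_compare[where f = "\<lambda>t. inner (grad (zh + t *\<^sub>R x)) x" and g' = "\<lambda>_. 0", OF assms(2)
          grad_deriv[OF zh(1) x(1) x(1) ray_in]])
      (use assms Q_nonneg x(1) ray_in in auto)
  then show ?thesis by simp
qed

lemma ray_slope_nonneg: "0 \<le> t \<Longrightarrow> t \<le> 1 \<Longrightarrow> 0 \<le> inner (grad (zh + t *\<^sub>R x)) x"
  using ray_slope_mono[of 0 t] zh(3) by simp

lemma V_zh_min: "V zh \<le> V (zh + x)"
proof -
  have "(\<lambda>_. 0) 1 - (\<lambda>_. 0) 0 \<le> V (zh + 1 *\<^sub>R x) - V (zh + 0 *\<^sub>R x)"
    by (rule DERIV_compare[where f = "\<lambda>t. V (zh + t *\<^sub>R x)" and g' = "\<lambda>_. 0", OF zero_le_one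
          V_deriv[OF zh(1) x(1) ray_in]])
      (use ray_slope_nonneg in auto)
  then show ?thesis by simp
qed

text \<open>\<open>c\<close> marks how far along the ray the Hessian is under control. Up to there
  it is at least 7/12 of the identity, as 5/3 * 1/4 = 5/12; beyond, convexity keeps the slope
  already gained. Hence the growth is linear rather than quadratic far away.\<close>

lemma V_growth:
  assumes c: "0 < c" "c \<le> 1" "c * norm x \<le> 7 / 10 * s * sqrt d"
  shows "V (zh + x) - V zh \<ge> 7 / 24 * c * (norm x)\<^sup>2"
proof -
  have Q: "7 / 12 * (norm x)\<^sup>2 \<le> Q (zh + t *\<^sub>R x) x x" if t: "0 \<le> t" "t \<le> c" for t
  proof -
    have "norm (zh + t *\<^sub>R x) \<le> norm zh + norm (t *\<^sub>R x)" by (rule norm_triangle_ineq)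
    also have "\<dots> \<le> norm zh + c * norm x" using t by (auto intro: mult_right_mono)
    also have "\<dots> \<le> R" using zh(2) c sd_pos by (simp add: R_def)
    finally have n: "norm (zh + t *\<^sub>R x) \<le> R" .
    have "\<bar>Q (zh + t *\<^sub>R x) x x - (norm x)\<^sup>2\<bar> \<le> 5 / 3 * \<delta> * norm (zh + t *\<^sub>R x) * (norm x)\<^sup>2"
      using x zh n by (intro Q_near_identity) auto
    also have "\<dots> \<le> 5 / 12 * (norm x)\<^sup>2"
    proof (rule mult_right_mono)
      have "\<delta> * norm (zh + t *\<^sub>R x) \<le> \<delta> * R" using n \<delta> by (intro mult_left_mono) auto
      then show "5 / 3 * \<delta> * norm (zh + t *\<^sub>R x) \<le> 5 / 12" using \<delta>R by simp
    qed simp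
    finally show ?thesis
      using abs_ge_minus_self[of "Q (zh + t *\<^sub>R x) x x - (norm x)\<^sup>2"] by linarith
  qed
  have slope: "7 / 12 * (norm x)\<^sup>2 * t \<le> inner (grad (zh + t *\<^sub>R x)) x" if t: "0 \<le> t" "t \<le> c" for t
  proof -
    have "7 / 12 * (norm x)\<^sup>2 * t - 7 / 12 * (norm x)\<^sup>2 * 0
        \<le> inner (grad (zh + t *\<^sub>R x)) x - inner (grad (zh + 0 *\<^sub>R x)) x"
      by (rule DERIV_compare[where f = "\<lambda>t. inner (grad (zh + t *\<^sub>R x)) x" and g = "\<lambda>t. 7 / 12 * (norm x)\<^sup>2 * t"
            and g' = "\<lambda>_. 7 / 12 * (norm x)\<^sup>2", OF t(1) grad_deriv[OF zh(1) x(1) x(1) ray_in]])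
        (use t c Q in \<open>auto intro!: derivative_eq_intros\<close>)
    then show ?thesis using zh(3) by simp
  qed
  have 1: "V (zh + c *\<^sub>R x) - V zh \<ge> 7 / 24 * (norm x)\<^sup>2 * c\<^sup>2"
  proof -
    have "7 / 24 * (norm x)\<^sup>2 * c\<^sup>2 - 7 / 24 * (norm x)\<^sup>2 * 0\<^sup>2 \<le> V (zh + c *\<^sub>R x) - V (zh + 0 *\<^sub>R x)"
      by (rule DERIV_compare[where f = "\<lambda>t. V (zh + t *\<^sub>R x)" and g = "\<lambda>t. 7 / 24 * (norm x)\<^sup>2 * t\<^sup>2"
            and g' = "\<lambda>t. 7 / 12 * (norm x)\<^sup>2 * t", OF less_imp_le[OF c(1)] V_deriv[OF zh(1) x(1) ray_in]])
        (use c slope in \<open>auto intro!: derivative_eq_intros\<close>)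
    then show ?thesis by simp
  qed
  have 2: "V (zh + x) - V (zh + c *\<^sub>R x) \<ge> 7 / 12 * (norm x)\<^sup>2 * c * (1 - c)"
  proof -
    have sl: "7 / 12 * (norm x)\<^sup>2 * c \<le> inner (grad (zh + t *\<^sub>R x)) x" if "c \<le> t" "t \<le> 1" for t
      using slope[of c] ray_slope_mono[of c t] c that by linarith
    have "7 / 12 * (norm x)\<^sup>2 * c * 1 - 7 / 12 * (norm x)\<^sup>2 * c * c \<le> V (zh + 1 *\<^sub>R x) - V (zh + c *\<^sub>R x)"
      by (rule DERIV_compare[where f = "\<lambda>t. V (zh + t *\<^sub>R x)" and g = "\<lambda>t. 7 / 12 * (norm x)\<^sup>2 * c * t"
            and g' = "\<lambda>t. 7 / 12 * (norm x)\<^sup>2 * c", OF c(2) V_deriv[OF zh(1) x(1) ray_in]])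
        (use c sl in \<open>auto intro!: derivative_eq_intros\<close>)
    then show ?thesis by (simp add: right_diff_distrib)
  qed
  have "7 / 24 * c * (norm x)\<^sup>2 = 7 / 24 * (norm x)\<^sup>2 * c\<^sup>2 + 7 / 24 * (norm x)\<^sup>2 * c * (1 - c)"
    by (simp add: power2_eq_square field_simps)
  also have "\<dots> \<le> 7 / 24 * (norm x)\<^sup>2 * c\<^sup>2 + 7 / 12 * (norm x)\<^sup>2 * c * (1 - c)"
    using c by (intro add_left_mono mult_right_mono) auto
  finally show ?thesis using 1 2 by linarith
qed

lemma V_zh_strict_min: "x \<noteq> 0 \<Longrightarrow> V zh < V (zh + x)"
proof -
  assume x0: "x \<noteq> 0"
  \<comment> \<open>The largest fraction of the ray that \<open>V_growth\<close> admits.\<close>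
  define c where "c = min 1 (7 / 10 * s * sqrt d / norm x)"
  have c: "0 < c" "c \<le> 1" using x0 sd_pos by (auto simp: c_def)
  have "c * norm x \<le> 7 / 10 * s * sqrt d / norm x * norm x" by (intro mult_right_mono) (auto simp: c_def)
  then have "c * norm x \<le> 7 / 10 * s * sqrt d" using x0 by simp
  from V_growth[OF c this] have "V (zh + x) - V zh \<ge> 7 / 24 * c * (norm x)\<^sup>2" .
  moreover have "7 / 24 * c * (norm x)\<^sup>2 > 0" using c x0 by simp
  ultimately show ?thesis by linarith
qed

text \<open>\<open>V_growth\<close> with \<open>c * norm x\<close> equal to 7/10 s sqrt d; its
  constant 7/24 * 7/10 = 49/240 just exceeds 1/5.\<close>

lemma V_tail:
  assumes "7 / 10 * s * sqrt d \<le> norm x"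
  shows "V (zh + x) - V zh \<ge> s * sqrt d * norm x / 5"
proof -
  define c where "c = 7 / 10 * s * sqrt d / norm x"
  have "7 / 10 * s * sqrt d > 0" using sd_pos by simp
  then have nx: "norm x > 0" using assms by linarith
  have c: "0 < c" "c \<le> 1" "c * norm x = 7 / 10 * s * sqrt d" using nx sd_pos assms by (auto simp: c_def)
  have "V (zh + x) - V zh \<ge> 7 / 24 * c * (norm x)\<^sup>2" using V_growth[of c] c by simp
  also have "7 / 24 * c * (norm x)\<^sup>2 = 7 / 24 * (c * norm x) * norm x" by (simp add: power2_eq_square)
  also have "\<dots> = 49 / 240 * (s * sqrt d * norm x)" by (simp add: c)
  finally have "49 / 240 * (s * sqrt d * norm x) \<le> V (zh + x) - V zh" .
  moreover have "0 \<le> s * sqrt d * norm x" using sd_pos by simp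
  ultimately show ?thesis by linarith
qed

end

lemma minimizer_unique:
  assumes "z \<in> \<Theta>"
  shows "V zh \<le> V z" "z \<noteq> zh \<Longrightarrow> V zh < V z"
proof -
  have "z - zh \<in> S" "zh + (z - zh) \<in> \<Theta>" using assms zh \<Theta>_sub by auto
  then show "V zh \<le> V z" "z \<noteq> zh \<Longrightarrow> V zh < V z"
    using V_zh_min[of "z - zh"] V_zh_strict_min[of "z - zh"] by auto
qed

end

text \<open>Each coordinate of the gradient is a pointwise limit of difference quotients, which are
  measurable along with \<open>h\<close>.\<close>

lemma gradient_measurable_fseq:
  assumes h: "h \<in> borel_measurable (lborel_fseq d)"
    and deriv: "\<And>x. x \<in> seqs d \<Longrightarrow> norm x < r \<Longrightarrow> (h has_derivative (\<lambda>u. inner (g x) u)) (at x within seqs d)"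
    and g: "\<And>x. x \<in> seqs d \<Longrightarrow> norm x < r \<Longrightarrow> g x \<in> seqs d"
  shows "(\<lambda>x. if norm x < r then g x else 0) \<in> lborel_fseq d \<rightarrow>\<^sub>M lborel_fseq d"
proof (rule measurable_into_lborel_fseq)
  fix i assume i: "i < d"
  define e where "e = fseq_of d (\<lambda>j. if j = i then 1 else 0)"
  have e: "e \<in> seqs d" by (simp add: e_def)
  have [measurable]: "norm \<in> borel_measurable (lborel_fseq d)" using norm_measurable_fseq[of "\<lambda>x. x"] by simp
  note [measurable] = h
  define F where "F = (\<lambda>(n::nat) x. if norm x < r then real (Suc n) * (h (x + inverse (Suc n) *\<^sub>R e) - h x) else 0)"
  have meas: "F n \<in> borel_measurable (lborel_fseq d)" for n
  proof -
    have [measurable]: "(\<lambda>x. x + inverse (real (Suc n)) *\<^sub>R e) \<in> lborel_fseq d \<rightarrow>\<^sub>M lborel_fseq d"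
      using e by (intro measurable_into_lborel_fseq) (auto simp: space_lborel_fseq seqs_def)
    show ?thesis unfolding F_def by measurable
  qed
  show "(\<lambda>x. coord (if norm x < r then g x else 0) i) \<in> borel_measurable (lborel_fseq d)"
  proof (rule borel_measurable_LIMSEQ_real[OF _ meas])
    fix x assume "x \<in> space (lborel_fseq d)"
    then have x: "x \<in> seqs d" by (simp add: space_lborel_fseq)
    show "(\<lambda>n. F n x) \<longlonglongrightarrow> coord (if norm x < r then g x else 0) i"
    proof (cases "norm x < r")
      case True
      have "((\<lambda>t. x + t *\<^sub>R e) has_derivative (\<lambda>t. t *\<^sub>R e)) (at 0)" by (auto intro!: derivative_eq_intros)
      moreover have "(h has_derivative inner (g x)) (at (x + 0 *\<^sub>R e) within range (\<lambda>t. x + t *\<^sub>R e))"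
      proof -
        have z: "x + 0 *\<^sub>R e = x" by simp
        show ?thesis unfolding z by (rule has_derivative_subset[OF deriv[OF x True]]) (use x e in \<open>auto simp: seqs_def\<close>)
      qed
      ultimately have "((\<lambda>t. h (x + t *\<^sub>R e)) has_derivative (\<lambda>t. inner (g x) (t *\<^sub>R e))) (at 0)"
        by (rule has_derivative_in_compose)
      then have "((\<lambda>t. h (x + t *\<^sub>R e)) has_real_derivative inner (g x) e) (at 0)"
      proof -
        have "(*) (inner (g x) e) = (\<lambda>t. t * inner (g x) e)" by (rule ext) (rule mult.commute)
        then show "((\<lambda>t. h (x + t *\<^sub>R e)) has_derivative (\<lambda>t. inner (g x) (t *\<^sub>R e))) (at 0) \<Longrightarrow> ?thesis"
          by (simp add: has_field_derivative_def)
      qed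
      then have "((\<lambda>t. (h (x + t *\<^sub>R e) - h x) / t) \<longlongrightarrow> inner (g x) e) (at 0)"
        by (simp add: DERIV_def)
      moreover have "filterlim (\<lambda>n. inverse (real (Suc n))) (at 0) sequentially"
        using LIMSEQ_inverse_real_of_nat by (auto simp: filterlim_at)
      ultimately have "(\<lambda>n. (h (x + inverse (real (Suc n)) *\<^sub>R e) - h x) / inverse (real (Suc n))) \<longlonglongrightarrow> inner (g x) e"
        by (rule filterlim_compose)
      moreover have "inner (g x) e = coord (g x) i"
        using g[OF x True] i by (simp add: inner_seqs e_def if_distrib[of "\<lambda>u. _ * u"] cong: if_cong)
      ultimately show ?thesis using True by (simp add: F_def divide_inverse mult.commute)
    qed (simp add: F_def)
  qed
qed (use g in \<open>auto simp: space_lborel_fseq seqs_def\<close>)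

text \<open>\<open>p\<close> is the prior in whitened coordinates, \<open>\<eta>1\<close> bounds the
  gradient of its logarithm and \<open>K\<close> its values relative to that at the true parameter.
  The bound 1/4 costs nothing in the end, because total variation never exceeds 1.\<close>

locale potential_prior = potential_score +
  fixes p :: "fseq \<Rightarrow> real" and glp :: "fseq \<Rightarrow> fseq" and \<eta>1 K :: real
  assumes V_measurable: "V \<in> borel_measurable (lborel_fseq d)"
    and \<Theta>_measurable: "\<Theta> \<in> sets (lborel_fseq d)"
    and p_measurable: "p \<in> borel_measurable (lborel_fseq d)"
    and p_pos: "\<And>z. z \<in> \<Theta> \<Longrightarrow> p z > 0"
    and p_le: "\<And>z. z \<in> \<Theta> \<Longrightarrow> p z \<le> K * p 0"
    and lp_deriv: "\<And>z. z \<in> seqs d \<Longrightarrow> norm z < R \<Longrightarrow>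
      ((\<lambda>z. ln (p z)) has_derivative (\<lambda>u. inner (glp z) u)) (at z within seqs d)"
    and glp_in: "\<And>z. z \<in> seqs d \<Longrightarrow> glp z \<in> seqs d"
    and glp_bound: "\<And>z. z \<in> seqs d \<Longrightarrow> norm z < R \<Longrightarrow> norm (glp z) \<le> \<eta>1"
    and \<eta>1: "\<eta>1 \<ge> 0" "\<eta>1 + 3 * s * \<delta> * d \<le> 1 / 4"
begin

section \<open>The posterior as a perturbed Gaussian around the minimiser\<close>

definition \<eta> :: real where "\<eta> = \<eta>1 + 3 * s * \<delta> * d"

lemma \<eta>: "0 \<le> \<eta>" "\<eta> \<le> 1 / 4" "\<eta>1 \<le> \<eta>"
proof -
  have "0 \<le> 3 * s * \<delta> * d" using s \<delta> by simp
  then show "0 \<le> \<eta>" "\<eta> \<le> 1 / 4" "\<eta>1 \<le> \<eta>" using \<eta>1 by (auto simp: \<eta>_def)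
qed

lemma zero_in_\<Theta>: "0 \<in> \<Theta>" using R_pos by (intro ball_in_\<Theta>) auto

lemma K_ge_1: "K \<ge> 1"
  using p_le[OF zero_in_\<Theta>] p_pos[OF zero_in_\<Theta>] by simp

lemma near_zh:
  assumes "x \<in> S" "norm x < s * sqrt d"
  shows "zh + x \<in> S" "norm (zh + x) \<le> 9 / 5 * s * sqrt d" "norm (zh + x) < R" "zh + x \<in> \<Theta>"
proof -
  have "norm (zh + x) \<le> norm zh + norm x" by (rule norm_triangle_ineq)
  then show 1: "norm (zh + x) \<le> 9 / 5 * s * sqrt d" using assms zh(2) by linarith
  show 2: "norm (zh + x) < R" using 1 sd_pos by (simp add: R_def)
  show 3: "zh + x \<in> S" using zh assms by auto
  show "zh + x \<in> \<Theta>" using 2 3 by (intro ball_in_\<Theta>) auto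
qed

text \<open>\<open>K\<close> compares the prior with its value at 0, while the posterior is
  normalised at \<open>zh\<close>. Integrating the gradient bound over the way from 0 to
  \<open>zh\<close> costs 1/4 * 4/5 = 1/5 in units of s sqrt d.\<close>

lemma prior_at_zh: "p 0 / p zh \<le> exp (s * sqrt d / 5)"
proof -
  have in_ball: "norm (t *\<^sub>R zh) < R" if "0 \<le> t" "t \<le> 1" for t
  proof -
    have "t * norm zh \<le> 1 * norm zh" using that by (intro mult_right_mono) auto
    also have "\<dots> < R" using zh(2) sd_pos by (simp add: R_def)
    finally show ?thesis using that by simp
  qed
  define k where "k = (\<lambda>t. ln (p (t *\<^sub>R zh)))"
  have k: "(k has_vector_derivative inner (glp (t *\<^sub>R zh)) zh) (at t within {0..1})" if t: "t \<in> {0..1}" for t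
  proof -
    have "((\<lambda>t. t *\<^sub>R zh) has_derivative (\<lambda>u. u *\<^sub>R zh)) (at t within {0..1})"
      by (auto intro!: derivative_eq_intros)
    moreover have "((\<lambda>z. ln (p z)) has_derivative inner (glp (t *\<^sub>R zh))) (at (t *\<^sub>R zh) within (\<lambda>t. t *\<^sub>R zh) ` {0..1})"
      by (rule has_derivative_subset[OF lp_deriv]) (use in_ball t zh in auto)
    ultimately have "(k has_derivative (\<lambda>u. inner (glp (t *\<^sub>R zh)) (u *\<^sub>R zh))) (at t within {0..1})"
      unfolding k_def by (rule has_derivative_in_compose)
    then show ?thesis by (simp add: has_vector_derivative_def)
  qed
  have "norm (k 1 - k 0) \<le> (\<eta>1 * norm zh) * norm (1 - 0 :: real)"
  proof (rule differentiable_bound[where S = "{0..1}"])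
    fix t :: real assume t: "t \<in> {0..1}"
    show "(k has_derivative (\<lambda>u. u *\<^sub>R inner (glp (t *\<^sub>R zh)) zh)) (at t within {0..1})"
      using k[OF t] by (simp add: has_vector_derivative_def)
    have "\<bar>inner (glp (t *\<^sub>R zh)) zh\<bar> \<le> \<eta>1 * norm zh"
      using order_trans[OF Cauchy_Schwarz_ineq2 mult_right_mono[OF glp_bound]] in_ball t zh by auto
    then show "onorm (\<lambda>u. u *\<^sub>R inner (glp (t *\<^sub>R zh)) zh) \<le> \<eta>1 * norm zh"
      by (intro onorm_bound) (auto simp: abs_mult mult.commute mult_left_mono \<eta>1)
  qed auto
  then have "\<bar>ln (p zh) - ln (p 0)\<bar> \<le> \<eta>1 * norm zh" by (simp add: k_def)
  also have "\<dots> \<le> 1 / 4 * (4 / 5 * s * sqrt d)"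
    using zh(2) \<eta> \<eta>1 by (intro mult_mono) auto
  also have "1 / 4 * (4 / 5 * s * sqrt d) = s * sqrt d / 5" by simp
  finally have "ln (p 0) - ln (p zh) \<le> s * sqrt d / 5" by linarith
  then have "ln (p 0 / p zh) \<le> s * sqrt d / 5"
    using p_pos[OF zero_in_\<Theta>] p_pos[OF zh_in_\<Theta>] by (simp add: ln_div)
  then have "exp (ln (p 0 / p zh)) \<le> exp (s * sqrt d / 5)" by simp
  then show ?thesis using p_pos[OF zero_in_\<Theta>] p_pos[OF zh_in_\<Theta>] by simp
qed

text \<open>The logarithm of the posterior density relative to the standard Gaussian centred at
  \<open>zh\<close>, normalised to 0 there. It is cut off because farther out \<open>zh + x\<close>
  may leave \<open>\<Theta>\<close>.\<close>

definition lap_h :: "fseq \<Rightarrow> real" where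
  "lap_h x = (if norm x < s * sqrt d
     then ln (p (zh + x)) - ln (p zh) - (V (zh + x) - V zh) + (norm x)\<^sup>2 / 2 else 0)"

definition lap_g :: "fseq \<Rightarrow> fseq" where
  "lap_g x = (if norm x < s * sqrt d then glp (zh + x) - grad (zh + x) + x else 0)"

lemma norm_measurable [measurable]: "norm \<in> borel_measurable (lborel_fseq d)"
  using norm_measurable_fseq[of "\<lambda>x. x"] by simp

lemma shift_measurable [measurable]:
  assumes "a \<in> S"
  shows "(\<lambda>x. a + x) \<in> lborel_fseq d \<rightarrow>\<^sub>M lborel_fseq d" "(\<lambda>x. x + a) \<in> lborel_fseq d \<rightarrow>\<^sub>M lborel_fseq d"
    "(\<lambda>x. x - a) \<in> lborel_fseq d \<rightarrow>\<^sub>M lborel_fseq d"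
  using assms by (auto intro!: measurable_into_lborel_fseq simp: space_lborel_fseq)

lemma lap_h_deriv:
  assumes x: "x \<in> S" "norm x < s * sqrt d"
  shows "(lap_h has_derivative (\<lambda>u. inner (lap_g x) u)) (at x within S)"
proof -
  have shift: "((\<lambda>x. zh + x) has_derivative (\<lambda>u. u)) (at x within S)"
    by (auto intro!: derivative_eq_intros)
  have sub: "(\<lambda>x. zh + x) ` S \<subseteq> S" using zh by auto
  have 1: "((\<lambda>x. ln (p (zh + x))) has_derivative (\<lambda>u. inner (glp (zh + x)) u)) (at x within S)"
    by (rule has_derivative_in_compose[OF shift has_derivative_subset[OF lp_deriv sub]])
      (use near_zh[OF x] in auto)
  have 2: "((\<lambda>x. V (zh + x)) has_derivative (\<lambda>u. inner (grad (zh + x)) u)) (at x within S)"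
    by (rule has_derivative_in_compose[OF shift has_derivative_subset[OF V_frechet sub]])
      (use near_zh[OF x] in auto)
  have 3: "((\<lambda>x. (norm x)\<^sup>2 / 2) has_derivative (\<lambda>u. inner x u)) (at x within S)"
    unfolding power2_norm_eq_inner
    by (auto intro!: derivative_eq_intros simp: inner_commute)
  have "((\<lambda>x. ln (p (zh + x)) - ln (p zh) - (V (zh + x) - V zh) + (norm x)\<^sup>2 / 2) has_derivative
      (\<lambda>u. inner (glp (zh + x)) u - 0 - (inner (grad (zh + x)) u - 0) + inner x u)) (at x within S)"
    by (intro has_derivative_add has_derivative_diff has_derivative_const 1 2 3)
  moreover have "(\<lambda>u. inner (glp (zh + x)) u - 0 - (inner (grad (zh + x)) u - 0) + inner x u) = (\<lambda>u. inner (lap_g x) u)"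
    using x by (simp add: lap_g_def inner_add_left inner_diff_left)
  ultimately have "((\<lambda>x. ln (p (zh + x)) - ln (p zh) - (V (zh + x) - V zh) + (norm x)\<^sup>2 / 2) has_derivative
      (\<lambda>u. inner (lap_g x) u)) (at x within S)" by simp
  then show ?thesis
  proof (rule has_derivative_transform_within)
    show "0 < s * sqrt d - norm x" using x by simp
    fix y assume y: "y \<in> S" "dist y x < s * sqrt d - norm x"
    have "norm y \<le> norm x + dist y x" by (metis dist_norm norm_triangle_sub)
    then show "ln (p (zh + y)) - ln (p zh) - (V (zh + y) - V zh) + (norm y)\<^sup>2 / 2 = lap_h y"
      using y by (simp add: lap_h_def)
  qed (rule x)
qed

lemma lap_g_in: "x \<in> S \<Longrightarrow> lap_g x \<in> S"
  using zh glp_in grad_in by (auto simp: lap_g_def)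

lemma lap_h_measurable: "lap_h \<in> borel_measurable (lborel_fseq d)"
proof -
  note [measurable] = V_measurable p_measurable zh(1)
  show ?thesis unfolding lap_h_def by measurable
qed

lemma lap_g_measurable: "lap_g \<in> lborel_fseq d \<rightarrow>\<^sub>M lborel_fseq d"
proof -
  have "(\<lambda>x. if norm x < s * sqrt d then lap_g x else 0) \<in> lborel_fseq d \<rightarrow>\<^sub>M lborel_fseq d"
    by (rule gradient_measurable_fseq[OF lap_h_measurable lap_h_deriv lap_g_in])
  also have "(\<lambda>x. if norm x < s * sqrt d then lap_g x else 0) = lap_g" by (auto simp: lap_g_def)
  finally show ?thesis .
qed

text \<open>Since \<open>grad zh = 0\<close>, the likelihood part is an increment of
  \<open>grad\<close> minus the identity on the ball of radius 9/5 s sqrt d, and 5/3 * 9/5 = 3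
  explains the constant in \<open>\<eta>\<close>.\<close>

lemma lap_g_bound:
  assumes x: "x \<in> S" "norm x < s * sqrt d"
  shows "norm (lap_g x) \<le> \<eta> * (1 + norm x / sqrt d)"
proof -
  have "lap_g x = glp (zh + x) - (grad (zh + x) - grad zh - x)" using x zh by (simp add: lap_g_def)
  then have "norm (lap_g x) \<le> norm (glp (zh + x)) + norm (grad (zh + x) - grad zh - x)"
    using norm_triangle_ineq4 by simp
  also have "\<dots> \<le> \<eta>1 + 5 / 3 * \<delta> * (9 / 5 * s * sqrt d) * norm x"
  proof (intro add_mono glp_bound grad_near_identity)
    show "norm zh \<le> 9 / 5 * s * sqrt d" using zh(2) sd_pos by simp
  qed (use near_zh[OF x] zh x sd_pos in \<open>auto simp: R_def\<close>)
  also have "5 / 3 * \<delta> * (9 / 5 * s * sqrt d) * norm x = (3 * s * \<delta> * d) * (norm x / sqrt d)"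
  proof -
    have "sqrt d * sqrt d = d" "sqrt d > 0" using d by auto
    then have "real d / sqrt d = sqrt d" by (simp add: field_simps)
    moreover have "(3 * s * \<delta> * d) * (norm x / sqrt d) = 3 * s * \<delta> * norm x * (real d / sqrt d)" by simp
    ultimately show ?thesis by simp
  qed
  also have "\<eta>1 + (3 * s * \<delta> * d) * (norm x / sqrt d) \<le> \<eta> * (1 + norm x / sqrt d)"
  proof -
    have "0 \<le> \<eta>1 * (norm x / sqrt d) + 3 * s * \<delta> * d" using \<eta>1 s \<delta> by simp
    then show ?thesis by (simp add: \<eta>_def algebra_simps)
  qed
  finally show ?thesis .
qed

definition weight :: "fseq \<Rightarrow> real" where "weight z = indicator \<Theta> z * (exp (- V z) * p z)"

lemma weight_nonneg: "weight z \<ge> 0"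
  using p_pos[of z] by (auto simp: weight_def indicator_def)

lemma weight_measurable: "weight \<in> borel_measurable (lborel_fseq d)"
proof -
  note [measurable] = V_measurable p_measurable \<Theta>_measurable
  show ?thesis unfolding weight_def by measurable
qed

theorem posterior_comparison:
  shows "(\<integral>\<^sup>+z. ennreal (weight z) \<partial>lborel_fseq d) > 0" "(\<integral>\<^sup>+z. ennreal (weight z) \<partial>lborel_fseq d) < \<infinity>"
    "\<And>B. B \<in> sets (lborel_fseq d) \<Longrightarrow>
      \<bar>enn2real (\<integral>\<^sup>+z. indicator B z * ennreal (weight z) \<partial>lborel_fseq d) / enn2real (\<integral>\<^sup>+z. ennreal (weight z) \<partial>lborel_fseq d)
       - enn2real (\<integral>\<^sup>+z. indicator B z * ennreal (exp (- (norm (z - zh))\<^sup>2 / 2)) \<partial>lborel_fseq d) / sqrt (2 * pi) ^ d\<bar>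
      \<le> 1024 * (\<eta> + K * exp (- (d * (s / 12)\<^sup>2)))"
proof -
  interpret TI: translation_invariant_space "lborel_fseq d" d "sqrt (2 * pi) ^ d"
    by (rule translation_invariant_space_fseq[OF d])
  interpret LP: log_perturbation "lborel_fseq d" d "sqrt (2 * pi) ^ d" lap_h lap_g s \<eta>
    by unfold_locales
      (use s \<eta> lap_h_measurable lap_g_measurable lap_h_deriv lap_g_bound sd_pos in
        \<open>auto simp: space_lborel_fseq lap_h_def\<close>)
  note [measurable] = weight_measurable
  \<comment> \<open>Division by the value at \<open>zh\<close> makes \<open>f\<close> equal to 1 at
    the origin, matching the normalisation of \<open>lap_h\<close> and \<open>w\<close>.\<close>
  define c where "c = exp (- V zh) * p zh"
  have c: "c > 0" using p_pos[OF zh_in_\<Theta>] by (simp add: c_def)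
  define f where "f = (\<lambda>x. weight (x + zh) / c)"
  have shift [measurable]: "(\<lambda>x. x + zh) \<in> lborel_fseq d \<rightarrow>\<^sub>M lborel_fseq d" by (rule shift_measurable[OF zh(1)])
  have f_meas [measurable]: "f \<in> borel_measurable (lborel_fseq d)" unfolding f_def by measurable
  have f0: "f x \<ge> 0" for x using weight_nonneg c by (simp add: f_def)
  have f_eq: "f x = p (zh + x) / p zh * exp (- (V (zh + x) - V zh))" if "zh + x \<in> \<Theta>" for x
  proof -
    have "exp (- (V (zh + x) - V zh)) = exp (- V (zh + x)) / exp (- V zh)" by (simp flip: exp_diff)
    then show ?thesis using that by (simp add: f_def weight_def c_def add.commute[of x] mult.commute)
  qed
  have f_out: "f x = 0" if "zh + x \<notin> \<Theta>" for x
    using that by (simp add: f_def weight_def add.commute[of x])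
  have f_ball: "f x = exp (lap_h x) * TI.w x" if x: "x \<in> space (lborel_fseq d)" "norm x < LP.R2" for x
  proof -
    have x': "x \<in> S" "norm x < s * sqrt d" using x by (auto simp: space_lborel_fseq LP.R2_def)
    have "p (zh + x) / p zh = exp (ln (p (zh + x)) - ln (p zh))"
      using p_pos[OF zh_in_\<Theta>] p_pos[OF near_zh(4)[OF x']] by (simp add: exp_diff)
    then have "f x = exp (ln (p (zh + x)) - ln (p zh)) * exp (- (V (zh + x) - V zh))"
      using f_eq[OF near_zh(4)[OF x']] by simp
    also have "\<dots> = exp (lap_h x) * TI.w x"
      using x' by (simp add: lap_h_def TI.w_def flip: exp_add)
    finally show ?thesis .
  qed
  \<comment> \<open>The growth of \<open>V\<close> gives the decay in |x|, and the change from
    \<open>p zh\<close> to \<open>p 0\<close> gives the 1 in \<open>1 - norm x\<close>; both come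
    with the same rate s sqrt d / 5.\<close>
  have f_tail: "f x \<le> K * exp (s * sqrt d / 5 * (1 - norm x))"
    if x: "x \<in> space (lborel_fseq d)" "LP.R1 \<le> norm x" for x
  proof (cases "zh + x \<in> \<Theta>")
    case True
    have x': "x \<in> S" "7 / 10 * s * sqrt d \<le> norm x" using x by (auto simp: space_lborel_fseq LP.R1_def)
    have "p (zh + x) / p zh \<le> K * (p 0 / p zh)"
      using p_le[OF True] p_pos[OF zh_in_\<Theta>] by (simp add: divide_right_mono)
    also have "\<dots> \<le> K * exp (s * sqrt d / 5)" using K_ge_1 by (intro mult_left_mono prior_at_zh) auto
    finally have 1: "p (zh + x) / p zh \<le> K * exp (s * sqrt d / 5)" .
    have 2: "exp (- (V (zh + x) - V zh)) \<le> exp (- (s * sqrt d * norm x / 5))"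
      using V_tail[OF x'(1) True x'(2)] by simp
    have "f x \<le> (K * exp (s * sqrt d / 5)) * exp (- (s * sqrt d * norm x / 5))"
      unfolding f_eq[OF True] using K_ge_1 by (intro mult_mono 1 2) auto
    also have "\<dots> = K * exp (s * sqrt d / 5 * (1 - norm x))"
      by (simp add: right_diff_distrib flip: exp_add)
    finally show ?thesis .
  qed (use f_out K_ge_1 in simp)
  have comp1: "integrable (lborel_fseq d) f"
    by (rule LP.normalised_comparison(1)[OF f_meas f0 f_ball f_tail K_ge_1])
  have comp2: "(\<integral>x. f x \<partial>lborel_fseq d) > 0"
    by (rule LP.normalised_comparison(2)[OF f_meas f0 f_ball f_tail K_ge_1])
  have comp3: "integrable (lborel_fseq d) TI.w"
    by (rule LP.normalised_comparison(3)[OF f_meas f0 f_ball f_tail K_ge_1])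
  have comp_set: "\<bar>(\<integral>x. indicator B x * f x \<partial>lborel_fseq d) / (\<integral>x. f x \<partial>lborel_fseq d)
        - (\<integral>x. indicator B x * TI.w x \<partial>lborel_fseq d) / sqrt (2 * pi) ^ d\<bar>
      \<le> 1024 * (\<eta> + K * exp (- (d * (s / 12)\<^sup>2)))" if "B \<in> sets (lborel_fseq d)" for B
    by (rule LP.normalised_comparison(5)[OF f_meas f0 f_ball f_tail K_ge_1 that])
  have w_nn: "(\<integral>\<^sup>+z. g z * ennreal (weight z) \<partial>lborel_fseq d) = ennreal c * (\<integral>\<^sup>+x. g (x + zh) * ennreal (f x) \<partial>lborel_fseq d)"
    if [measurable]: "g \<in> borel_measurable (lborel_fseq d)" for g :: "fseq \<Rightarrow> ennreal"
  proof -
    have "(\<integral>\<^sup>+z. g z * ennreal (weight z) \<partial>lborel_fseq d) = (\<integral>\<^sup>+x. g (x + zh) * ennreal (weight (x + zh)) \<partial>lborel_fseq d)"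
      using zh(1) by (intro TI.translation[symmetric]) (auto simp: space_lborel_fseq)
    also have "\<dots> = (\<integral>\<^sup>+x. ennreal c * (g (x + zh) * ennreal (f x)) \<partial>lborel_fseq d)"
    proof (rule nn_integral_cong)
      fix x
      have "weight (x + zh) = c * f x" using c by (simp add: f_def)
      then show "g (x + zh) * ennreal (weight (x + zh)) = ennreal c * (g (x + zh) * ennreal (f x))"
        using c f0 by (simp add: ennreal_mult mult_ac)
    qed
    finally show ?thesis by (subst (asm) nn_integral_cmult) auto
  qed
  have f_nn: "(\<integral>\<^sup>+x. ennreal (f x) \<partial>lborel_fseq d) = ennreal (\<integral>x. f x \<partial>lborel_fseq d)"
    by (intro nn_integral_eq_integral comp1) (use f0 in auto)
  have tot: "(\<integral>\<^sup>+z. ennreal (weight z) \<partial>lborel_fseq d) = ennreal (c * (\<integral>x. f x \<partial>lborel_fseq d))"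
    using w_nn[of "\<lambda>_. 1"] c comp2 by (simp add: f_nn ennreal_mult)
  show "(\<integral>\<^sup>+z. ennreal (weight z) \<partial>lborel_fseq d) > 0" "(\<integral>\<^sup>+z. ennreal (weight z) \<partial>lborel_fseq d) < \<infinity>"
    unfolding tot using c comp2 by auto
  fix B assume B [measurable]: "B \<in> sets (lborel_fseq d)"
  define B' where "B' = {x \<in> space (lborel_fseq d). x + zh \<in> B}"
  have B' [measurable]: "B' \<in> sets (lborel_fseq d)" unfolding B'_def by measurable
  have int_ind: "(\<integral>\<^sup>+x. indicator B (x + zh) * ennreal (u x) \<partial>lborel_fseq d) = ennreal (\<integral>x. indicator B' x * u x \<partial>lborel_fseq d)"
    if u: "integrable (lborel_fseq d) u" "\<And>x. u x \<ge> 0" for u :: "fseq \<Rightarrow> real"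
  proof -
    have "(\<integral>\<^sup>+x. indicator B (x + zh) * ennreal (u x) \<partial>lborel_fseq d) = (\<integral>\<^sup>+x. ennreal (indicator B' x * u x) \<partial>lborel_fseq d)"
      by (intro nn_integral_cong) (auto simp: B'_def indicator_def)
    also have "\<dots> = ennreal (\<integral>x. indicator B' x * u x \<partial>lborel_fseq d)"
      using u integrable_mult_indicator[OF B' u(1)] by (intro nn_integral_eq_integral) auto
    finally show ?thesis .
  qed
  have wB: "(\<integral>\<^sup>+z. indicator B z * ennreal (weight z) \<partial>lborel_fseq d) = ennreal (c * (\<integral>x. indicator B' x * f x \<partial>lborel_fseq d))"
    using w_nn[of "indicator B"] int_ind[OF comp1 f0] c f0 by (simp add: ennreal_mult)
  have gB: "(\<integral>\<^sup>+z. indicator B z * ennreal (exp (- (norm (z - zh))\<^sup>2 / 2)) \<partial>lborel_fseq d)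
      = ennreal (\<integral>x. indicator B' x * TI.w x \<partial>lborel_fseq d)"
  proof -
    have [measurable]: "(\<lambda>x. x - zh) \<in> lborel_fseq d \<rightarrow>\<^sub>M lborel_fseq d" by (rule shift_measurable[OF zh(1)])
    have "(\<integral>\<^sup>+z. indicator B z * ennreal (exp (- (norm (z - zh))\<^sup>2 / 2)) \<partial>lborel_fseq d)
        = (\<integral>\<^sup>+x. indicator B (x + zh) * ennreal (exp (- (norm ((x + zh) - zh))\<^sup>2 / 2)) \<partial>lborel_fseq d)"
      using zh(1) by (intro TI.translation[symmetric]) (auto simp: space_lborel_fseq)
    also have "\<dots> = (\<integral>\<^sup>+x. indicator B (x + zh) * ennreal (TI.w x) \<partial>lborel_fseq d)" by (simp add: TI.w_def)
    also have "\<dots> = ennreal (\<integral>x. indicator B' x * TI.w x \<partial>lborel_fseq d)" by (rule int_ind[OF comp3]) (simp add: TI.w_def)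
    finally show ?thesis .
  qed
  have nn: "(\<integral>x. indicator B' x * f x \<partial>lborel_fseq d) \<ge> 0" "(\<integral>x. indicator B' x * TI.w x \<partial>lborel_fseq d) \<ge> 0"
    using f0 by (auto intro!: integral_nonneg_AE)
  show "\<bar>enn2real (\<integral>\<^sup>+z. indicator B z * ennreal (weight z) \<partial>lborel_fseq d) / enn2real (\<integral>\<^sup>+z. ennreal (weight z) \<partial>lborel_fseq d)
       - enn2real (\<integral>\<^sup>+z. indicator B z * ennreal (exp (- (norm (z - zh))\<^sup>2 / 2)) \<partial>lborel_fseq d) / sqrt (2 * pi) ^ d\<bar>
      \<le> 1024 * (\<eta> + K * exp (- (d * (s / 12)\<^sup>2)))"
    unfolding tot wB gB using comp_set[OF B'] comp2 c nn by simp
qed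

end

section \<open>Concentration of the score\<close>

text \<open>Chernoff's bound with the exponential tilt averaged over a Gaussian truncated to a ball.\<close>

lemma (in translation_invariant_space) gaussian_mixture_lower_bound:
  assumes \<xi>: "\<xi> \<in> S" "norm \<xi> \<ge> \<tau>" and \<tau>: "\<tau> > 0" and b: "b > 0" and r: "r \<ge> 0"
  shows "ennreal (exp (\<tau>\<^sup>2 / (2 * b))) * (\<integral>\<^sup>+v. indicator {v. norm v < r} v * ennreal (exp (- b * (norm v)\<^sup>2 / 2)) \<partial>M)
    \<le> (\<integral>\<^sup>+v. indicator {v. norm v < \<tau> / b + r} v * ennreal (exp (inner \<xi> v - b * (norm v)\<^sup>2 / 2)) \<partial>M)"
proof -
  have n\<xi>: "norm \<xi> > 0" using \<xi> \<tau> by linarith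
  \<comment> \<open>With this factor \<open>v0\<close> has norm \<tau> / b. It would maximise the
    exponent if \<xi> had norm exactly \<tau>; shifting the Gaussian there recovers the optimal
    Chernoff exponent.\<close>
  define a where "a = \<tau> / (b * norm \<xi>)"
  define v0 where "v0 = a *\<^sub>R \<xi>"
  have v0: "v0 \<in> S" "norm v0 = \<tau> / b" using \<xi> n\<xi> \<tau> b by (auto simp: v0_def a_def)
  have [measurable]: "v0 \<in> S" "\<xi> \<in> S" by (rule v0 \<xi>)+
  define e where "e = (\<lambda>v :: 'a. indicator {v. norm v < r} v * ennreal (exp (- b * (norm v)\<^sup>2 / 2)))"
  define E where "E = (\<lambda>v. indicator {v. norm v < \<tau> / b + r} v * ennreal (exp (inner \<xi> v - b * (norm v)\<^sup>2 / 2)))"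
  have [measurable]: "Measurable.pred M (\<lambda>x. norm x < r)" for r by measurable
  have e_meas [measurable]: "e \<in> borel_measurable M" unfolding e_def by measurable
  have E_meas [measurable]: "E \<in> borel_measurable M" unfolding E_def by measurable
  \<comment> \<open>Averaging over \<open>v\<close> and \<open>- v\<close> removes the term linear
    in \<open>v\<close>, because exp k + exp (- k) \<ge> 2; so a lower bound on |\<xi>| suffices in
    place of equality.\<close>
  have key: "2 * exp (\<tau>\<^sup>2 / (2 * b)) * exp (- b * (norm v)\<^sup>2 / 2)
      \<le> exp (inner \<xi> (v + v0) - b * (norm (v + v0))\<^sup>2 / 2) + exp (inner \<xi> (- v + v0) - b * (norm (- v + v0))\<^sup>2 / 2)" for v
  proof -
    define k where "k = inner \<xi> v - b * inner v v0"
    define c where "c = inner \<xi> v0 - b * (norm v0)\<^sup>2 / 2"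
    have sq: "(norm (v + v0))\<^sup>2 = (norm v)\<^sup>2 + 2 * inner v v0 + (norm v0)\<^sup>2"
      "(norm (- v + v0))\<^sup>2 = (norm v)\<^sup>2 - 2 * inner v v0 + (norm v0)\<^sup>2"
      unfolding power2_norm_eq_inner
      by (simp_all add: inner_add_left inner_add_right inner_diff_left inner_diff_right inner_commute)
    have "2 \<le> exp k + exp (- k)"
      using exp_ge_add_one_self[of k] exp_ge_add_one_self[of "- k"] by linarith
    then have "2 * (exp c * exp (- b * (norm v)\<^sup>2 / 2)) \<le> (exp k + exp (- k)) * (exp c * exp (- b * (norm v)\<^sup>2 / 2))"
      by (intro mult_right_mono) auto
    also have "\<dots> = exp (inner \<xi> (v + v0) - b * (norm (v + v0))\<^sup>2 / 2) + exp (inner \<xi> (- v + v0) - b * (norm (- v + v0))\<^sup>2 / 2)"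
    proof -
      have "inner \<xi> (v + v0) - b * (norm (v + v0))\<^sup>2 / 2 = k + (c + - b * (norm v)\<^sup>2 / 2)"
        unfolding sq by (simp add: k_def c_def inner_add_right field_simps)
      moreover have "inner \<xi> (- v + v0) - b * (norm (- v + v0))\<^sup>2 / 2 = - k + (c + - b * (norm v)\<^sup>2 / 2)"
        unfolding sq by (simp add: k_def c_def inner_diff_right field_simps)
      ultimately show ?thesis by (simp only: exp_add distrib_right)
    qed
    finally have "2 * (exp c * exp (- b * (norm v)\<^sup>2 / 2)) \<le> \<dots>" .
    moreover have "exp (\<tau>\<^sup>2 / (2 * b)) \<le> exp c"
    proof -
      have "inner \<xi> v0 = \<tau> / b * norm \<xi>"
        using n\<xi> b by (simp add: v0_def a_def power2_norm_eq_inner[symmetric] power2_eq_square)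
      then have "c = \<tau> / b * norm \<xi> - \<tau>\<^sup>2 / (2 * b)" unfolding c_def v0(2) using b by (simp add: power2_eq_square)
      moreover have "\<tau> / b * norm \<xi> \<ge> \<tau> / b * \<tau>" using \<xi> \<tau> b by (intro mult_left_mono) auto
      moreover have "\<tau> / b * \<tau> = \<tau>\<^sup>2 / (2 * b) + \<tau>\<^sup>2 / (2 * b)" using b by (simp add: power2_eq_square)
      ultimately have "\<tau>\<^sup>2 / (2 * b) \<le> c" by linarith
      then show ?thesis by simp
    qed
    then have "2 * (exp (\<tau>\<^sup>2 / (2 * b)) * exp (- b * (norm v)\<^sup>2 / 2)) \<le> 2 * (exp c * exp (- b * (norm v)\<^sup>2 / 2))"
      by (intro mult_left_mono mult_right_mono) auto
    ultimately show ?thesis by linarith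
  qed
  have le: "ennreal (2 * exp (\<tau>\<^sup>2 / (2 * b))) * e v \<le> E (v + v0) + E (- v + v0)" for v
  proof (cases "norm v < r")
    case True
    have "norm (v + v0) < \<tau> / b + r" "norm (- v + v0) < \<tau> / b + r"
      using True norm_triangle_ineq[of v v0] norm_triangle_ineq[of "- v" v0] v0 by auto
    then show ?thesis using True ennreal_leI[OF key[of v]]
      by (simp add: e_def E_def ennreal_mult ennreal_plus)
  qed (simp add: e_def)
  have "ennreal (2 * exp (\<tau>\<^sup>2 / (2 * b))) * (\<integral>\<^sup>+v. e v \<partial>M) = (\<integral>\<^sup>+v. ennreal (2 * exp (\<tau>\<^sup>2 / (2 * b))) * e v \<partial>M)"
    by (rule nn_integral_cmult[symmetric]) measurable
  also have "\<dots> \<le> (\<integral>\<^sup>+v. E (v + v0) + E (- v + v0) \<partial>M)" by (intro nn_integral_mono le)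
  also have "\<dots> = (\<integral>\<^sup>+v. E (v + v0) \<partial>M) + (\<integral>\<^sup>+v. E (- v + v0) \<partial>M)"
  proof (rule nn_integral_add)
    have "(\<lambda>v. E ((- 1) *\<^sub>R v + v0)) \<in> borel_measurable M" by measurable
    then show "(\<lambda>v. E (- v + v0)) \<in> borel_measurable M" by simp
  qed measurable
  also have "(\<integral>\<^sup>+v. E (- v + v0) \<partial>M) = (\<integral>\<^sup>+v. E (v + v0) \<partial>M)"
    by (rule reflection[where f = "\<lambda>v. E (v + v0)"]) measurable
  also have "(\<integral>\<^sup>+v. E (v + v0) \<partial>M) = (\<integral>\<^sup>+v. E v \<partial>M)" by (rule translation) (use v0 in auto)
  finally have le2: "ennreal (2 * exp (\<tau>\<^sup>2 / (2 * b))) * (\<integral>\<^sup>+v. e v \<partial>M) \<le> (\<integral>\<^sup>+v. E v \<partial>M) + (\<integral>\<^sup>+v. E v \<partial>M)" .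
  have "ennreal (2 * exp (\<tau>\<^sup>2 / (2 * b))) = 2 * ennreal (exp (\<tau>\<^sup>2 / (2 * b)))"
    by (subst ennreal_mult) auto
  then have "2 * (ennreal (exp (\<tau>\<^sup>2 / (2 * b))) * (\<integral>\<^sup>+v. e v \<partial>M)) \<le> 2 * (\<integral>\<^sup>+v. E v \<partial>M)"
    using le2 by (simp only: mult.assoc mult_2[of "integral\<^sup>N M E"])
  then have "ennreal (exp (\<tau>\<^sup>2 / (2 * b))) * (\<integral>\<^sup>+v. e v \<partial>M) \<le> (\<integral>\<^sup>+v. E v \<partial>M)"
    by (subst (asm) ennreal_mult_le_mult_iff) auto
  then show ?thesis by (simp add: e_def E_def)
qed

text \<open>Third-order Taylor expansion along the ray. Only the diagonal value of \<open>T\<close>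
  in the direction \<open>v\<close> occurs, so no polarisation constant enters: 1/2 + 1/6 * 1/4 =
  13/24.\<close>

lemma (in potential) V_upper:
  assumes v: "v \<in> S" "norm v \<le> R"
  shows "V v - V 0 - inner (grad 0) v \<le> 13 / 24 * (norm v)\<^sup>2"
proof -
  have seg: "0 + t *\<^sub>R v \<in> \<Theta>" "norm (t *\<^sub>R v) \<le> R" if "0 \<le> t" "t \<le> 1" for t
  proof -
    have "t * norm v \<le> 1 * norm v" using that by (intro mult_right_mono) auto
    then show 1: "norm (t *\<^sub>R v) \<le> R" using that v by simp
    show "0 + t *\<^sub>R v \<in> \<Theta>" using ball_in_\<Theta>[of "t *\<^sub>R v"] 1 v by simp
  qed
  have Q: "Q (0 + t *\<^sub>R v) v v \<le> (norm v)\<^sup>2 + \<delta> * norm v ^ 3 * t" if t: "0 \<le> t" "t \<le> 1" for t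
  proof -
    have "Q (0 + t *\<^sub>R v) v v - Q (0 + 0 *\<^sub>R v) v v \<le> \<delta> * norm v ^ 3 * t - \<delta> * norm v ^ 3 * 0"
    proof (rule DERIV_compare[OF t(1)])
      fix a assume a: "0 \<le> a" "a \<le> t"
      show "((\<lambda>t. Q (0 + t *\<^sub>R v) v v) has_real_derivative T (0 + a *\<^sub>R v) v v v) (at a)"
        using a t v by (intro Q_deriv seg) auto
      show "((\<lambda>t. \<delta> * norm v ^ 3 * t) has_real_derivative \<delta> * norm v ^ 3) (at a)"
        by (auto intro!: derivative_eq_intros)
      have "\<bar>T (a *\<^sub>R v) v v v\<bar> \<le> \<delta> * norm v ^ 3"
        using a t v seg[of a] by (intro T_bound) (auto simp: R_def)
      then show "T (0 + a *\<^sub>R v) v v v \<le> \<delta> * norm v ^ 3" by simp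
    qed
    then show ?thesis using Q_0[OF v(1)] by simp
  qed
  have G: "inner (grad (0 + t *\<^sub>R v)) v - inner (grad 0) v \<le> (norm v)\<^sup>2 * t + \<delta> * norm v ^ 3 * t\<^sup>2 / 2"
    if t: "0 \<le> t" "t \<le> 1" for t
  proof -
    have "inner (grad (0 + t *\<^sub>R v)) v - inner (grad (0 + 0 *\<^sub>R v)) v
        \<le> ((norm v)\<^sup>2 * t + \<delta> * norm v ^ 3 * t\<^sup>2 / 2) - ((norm v)\<^sup>2 * 0 + \<delta> * norm v ^ 3 * 0\<^sup>2 / 2)"
    proof (rule DERIV_compare[OF t(1)])
      fix a assume a: "0 \<le> a" "a \<le> t"
      show "((\<lambda>t. inner (grad (0 + t *\<^sub>R v)) v) has_real_derivative Q (0 + a *\<^sub>R v) v v) (at a)"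
        using a t v by (intro grad_deriv seg) auto
      show "((\<lambda>t. (norm v)\<^sup>2 * t + \<delta> * norm v ^ 3 * t\<^sup>2 / 2) has_real_derivative (norm v)\<^sup>2 + \<delta> * norm v ^ 3 * a) (at a)"
        by (auto intro!: derivative_eq_intros)
      show "Q (0 + a *\<^sub>R v) v v \<le> (norm v)\<^sup>2 + \<delta> * norm v ^ 3 * a" using Q[of a] a t by simp
    qed
    then show ?thesis by simp
  qed
  have "V (0 + 1 *\<^sub>R v) - V (0 + 0 *\<^sub>R v)
      \<le> (inner (grad 0) v * 1 + (norm v)\<^sup>2 * 1\<^sup>2 / 2 + \<delta> * norm v ^ 3 * 1 ^ 3 / 6)
        - (inner (grad 0) v * 0 + (norm v)\<^sup>2 * 0\<^sup>2 / 2 + \<delta> * norm v ^ 3 * 0 ^ 3 / 6)"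
  proof (rule DERIV_compare[OF zero_le_one])
    fix a :: real assume a: "0 \<le> a" "a \<le> 1"
    show "((\<lambda>t. V (0 + t *\<^sub>R v)) has_real_derivative inner (grad (0 + a *\<^sub>R v)) v) (at a)"
      using a v by (intro V_deriv seg) auto
    show "((\<lambda>t. inner (grad 0) v * t + (norm v)\<^sup>2 * t\<^sup>2 / 2 + \<delta> * norm v ^ 3 * t ^ 3 / 6) has_real_derivative
        inner (grad 0) v + (norm v)\<^sup>2 * a + \<delta> * norm v ^ 3 * a\<^sup>2 / 2) (at a)"
      by (auto intro!: derivative_eq_intros)
    show "inner (grad (0 + a *\<^sub>R v)) v \<le> inner (grad 0) v + (norm v)\<^sup>2 * a + \<delta> * norm v ^ 3 * a\<^sup>2 / 2"
      using G[OF a] by linarith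
  qed
  then have "V v - V 0 - inner (grad 0) v \<le> (norm v)\<^sup>2 / 2 + \<delta> * norm v ^ 3 / 6" by simp
  also have "\<dots> \<le> 13 / 24 * (norm v)\<^sup>2"
  proof -
    have "\<delta> * norm v \<le> \<delta> * R" using v \<delta> by (intro mult_left_mono) auto
    then have "\<delta> * norm v * (norm v)\<^sup>2 \<le> 1 / 4 * (norm v)\<^sup>2" using \<delta>R by (intro mult_right_mono) auto
    then show ?thesis by (simp add: power2_eq_square power3_eq_cube mult.assoc)
  qed
  finally show ?thesis .
qed

text \<open>The exponent 3/13 * 49/100 = 147/1300 exceeds 1/10 by 17/1300, and times s^2 \<ge> 144
  this surplus is at least 1.88 per dimension, enough for the prefactor, as 4 sqrt 2 < 6 < exp
  1.88.\<close>

lemma score_tail_numeric: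
  assumes "d \<ge> 1" "s \<ge> 12"
  shows "4 * sqrt 2 ^ d * exp (- (3 / 13 * (7 / 10 * s * sqrt d)\<^sup>2)) \<le> exp (- (d * s\<^sup>2 / 10))"
proof -
  have s2: "144 \<le> s\<^sup>2" using power_mono[OF assms(2), of 2] by simp
  have sq2: "sqrt 2 \<le> 3 / 2" by (rule real_le_lsqrt) (auto simp: power2_eq_square)
  have "4 * sqrt 2 ^ d \<le> (4 * sqrt 2) ^ d"
  proof -
    have "(4::real) ^ 1 \<le> 4 ^ d" using assms by (intro power_increasing) auto
    then show ?thesis by (simp add: power_mult_distrib mult_right_mono)
  qed
  also have "\<dots> \<le> exp (188 / 100) ^ d"
  proof (rule power_mono)
    have "4 * sqrt 2 \<le> (6::real)" using sq2 by simp
    also have "(6::real) \<le> (1 + 47 / 100 + (47 / 100)\<^sup>2 / 2) ^ 4" by (simp add: power2_eq_square power4_eq_xxxx)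
    also have "\<dots> \<le> exp (47 / 100) ^ 4" by (intro power_mono exp_lower_Taylor_quadratic) auto
    also have "\<dots> = exp (188 / 100)" by (simp flip: exp_of_nat_mult)
    finally show "4 * sqrt 2 \<le> exp (188 / 100)" by simp
  qed simp
  also have "\<dots> = exp (d * (188 / 100))" by (simp flip: exp_of_nat_mult)
  also have "\<dots> \<le> exp (d * (147 / 1300 * s\<^sup>2 - s\<^sup>2 / 10))"
    using s2 by (intro exp_le_cancel_iff[THEN iffD2] mult_left_mono) auto
  finally have "4 * sqrt 2 ^ d * exp (- (3 / 13 * (7 / 10 * s * sqrt d)\<^sup>2))
      \<le> exp (d * (147 / 1300 * s\<^sup>2 - s\<^sup>2 / 10)) * exp (- (3 / 13 * (7 / 10 * s * sqrt d)\<^sup>2))"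
    by (intro mult_right_mono) auto
  also have "\<dots> = exp (- (d * s\<^sup>2 / 10))"
    by (simp add: power_mult_distrib power_divide algebra_simps flip: exp_add)
  finally show ?thesis .
qed

lemma score_tail:
  fixes P :: "'b measure" and \<xi> :: "'b \<Rightarrow> fseq"
  assumes P: "prob_space P" and d: "d \<ge> 1" and s: "s \<ge> 12"
    and \<xi> [measurable]: "\<xi> \<in> P \<rightarrow>\<^sub>M lborel_fseq d"
    and mgf: "\<And>v. v \<in> seqs d \<Longrightarrow> norm v \<le> 2 * s * sqrt d \<Longrightarrow>
      (\<integral>\<^sup>+Y. ennreal (exp (inner (\<xi> Y) v)) \<partial>P) \<le> ennreal (exp (13 / 24 * (norm v)\<^sup>2))"
  shows "measure P {Y \<in> space P. norm (\<xi> Y) \<le> 7 / 10 * s * sqrt d} \<ge> 1 - exp (- (d * s\<^sup>2 / 10))"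
proof -
  interpret P: prob_space P by (rule P)
  interpret TI: translation_invariant_space "lborel_fseq d" d "sqrt (2 * pi) ^ d"
    by (rule translation_invariant_space_fseq[OF d])
  interpret PM: pair_sigma_finite P "lborel_fseq d" ..
  define \<tau> where "\<tau> = 7 / 10 * s * sqrt d"
  \<comment> \<open>Twice 13/12: half of the Gaussian tilt absorbs the moment generating function,
    the other half keeps the mixture integrable. The exponent becomes \<tau>^2 / (2 b) = 3/13
    \<tau>^2, and the ratio of the two widths is \<open>sqrt 2\<close> per dimension.\<close>
  define b where "b = (13 / 6 :: real)"
  define Z where "Z = sqrt (2 * pi) ^ d"
  define r where "r = s * sqrt d"
  have sd: "s * sqrt d > 0" using s d by simp
  have \<tau>: "\<tau> > 0" using sd by (simp add: \<tau>_def)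
  have Z: "Z > 0" by (simp add: Z_def)
  \<comment> \<open>The moment generating function is bounded only on this ball, so the tilts of the
    mixture must not leave it.\<close>
  have rad: "\<tau> / b + r \<le> 2 * s * sqrt d" using sd by (simp add: \<tau>_def b_def r_def)
  define I where "I = (\<integral>\<^sup>+v. indicator {v. norm v < r} v * ennreal (exp (- b * (norm v)\<^sup>2 / 2)) \<partial>lborel_fseq d)"
  define J where "J = (\<lambda>Y. \<integral>\<^sup>+v. indicator {v. norm v < \<tau> / b + r} v * ennreal (exp (inner (\<xi> Y) v - b * (norm v)\<^sup>2 / 2)) \<partial>lborel_fseq d)"
  have [measurable]: "norm \<in> borel_measurable (lborel_fseq d)" using norm_measurable_fseq[of "\<lambda>x. x"] by simp
  have [measurable]: "Measurable.pred (lborel_fseq d) (\<lambda>v. norm v < a)" for a by measurable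
  have I_ge: "ennreal (Z / (4 * sqrt b ^ d)) \<le> I"
  proof -
    have "ennreal (Z / (4 * sqrt b ^ d)) = ennreal (1 / sqrt b ^ d) * ennreal (Z / 4)"
      using Z by (simp add: b_def flip: ennreal_mult)
    also have "\<dots> \<le> ennreal (1 / sqrt b ^ d) * (\<integral>\<^sup>+x. indicator {x. norm x < 2 * sqrt d} x * ennreal (TI.w x) \<partial>lborel_fseq d)"
      using TI.gaussian_ball_mass by (intro mult_left_mono) (auto simp: Z_def)
    also have "\<dots> = (\<integral>\<^sup>+x. indicator {x. norm x < 2 * sqrt d} (sqrt b *\<^sub>R x) * ennreal (TI.w (sqrt b *\<^sub>R x)) \<partial>lborel_fseq d)"
      by (rule TI.scaling[symmetric]) (auto simp: b_def)
    also have "\<dots> \<le> I"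
      unfolding I_def
    proof (rule nn_integral_mono)
      fix x :: fseq
      have sb: "1 \<le> sqrt b" by (simp add: b_def)
      have "norm x < r" if "sqrt b * norm x < 2 * sqrt d"
      proof -
        have "1 * norm x \<le> sqrt b * norm x" using sb by (intro mult_right_mono) auto
        also have "\<dots> < 2 * sqrt d" by (rule that)
        also have "\<dots> \<le> r" unfolding r_def using s by (intro mult_right_mono) auto
        finally show ?thesis by simp
      qed
      moreover have "TI.w (sqrt b *\<^sub>R x) = exp (- b * (norm x)\<^sup>2 / 2)"
        by (simp add: TI.w_def power_mult_distrib b_def)
      ultimately show "indicator {x. norm x < 2 * sqrt d} (sqrt b *\<^sub>R x) * ennreal (TI.w (sqrt b *\<^sub>R x))
        \<le> indicator {v. norm v < r} x * ennreal (exp (- b * (norm x)\<^sup>2 / 2))"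
        using sb by (auto simp: indicator_def)
    qed
    finally show ?thesis .
  qed
  have jm: "(\<lambda>(Y, v). indicator {v. norm v < \<tau> / b + r} v * ennreal (exp (inner (\<xi> Y) v - b * (norm v)\<^sup>2 / 2)))
      \<in> borel_measurable (P \<Otimes>\<^sub>M lborel_fseq d)"
  proof -
    have [measurable]: "(\<lambda>q. inner (\<xi> (fst q)) (snd q)) \<in> borel_measurable (P \<Otimes>\<^sub>M lborel_fseq d)"
      by (rule inner_measurable_fseq) measurable
    show ?thesis unfolding split_beta by measurable
  qed
  have "(\<integral>\<^sup>+Y. J Y \<partial>P) = (\<integral>\<^sup>+v. \<integral>\<^sup>+Y. indicator {v. norm v < \<tau> / b + r} v * ennreal (exp (inner (\<xi> Y) v - b * (norm v)\<^sup>2 / 2)) \<partial>P \<partial>lborel_fseq d)"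
    unfolding J_def using PM.Fubini'[OF jm] by simp
  also have "\<dots> \<le> (\<integral>\<^sup>+v. ennreal (exp (- (13 / 12) * (norm v)\<^sup>2 / 2)) \<partial>lborel_fseq d)"
  proof (rule nn_integral_mono)
    fix v assume "v \<in> space (lborel_fseq d)"
    then have v: "v \<in> seqs d" by (simp add: space_lborel_fseq)
    have [measurable]: "(\<lambda>Y. inner (\<xi> Y) v) \<in> borel_measurable P"
      by (rule inner_measurable_fseq[OF \<xi>]) (use v in \<open>simp add: space_lborel_fseq\<close>)
    show "(\<integral>\<^sup>+Y. indicator {v. norm v < \<tau> / b + r} v * ennreal (exp (inner (\<xi> Y) v - b * (norm v)\<^sup>2 / 2)) \<partial>P)
        \<le> ennreal (exp (- (13 / 12) * (norm v)\<^sup>2 / 2))"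
    proof (cases "norm v < \<tau> / b + r")
      case True
      have "(\<integral>\<^sup>+Y. indicator {v. norm v < \<tau> / b + r} v * ennreal (exp (inner (\<xi> Y) v - b * (norm v)\<^sup>2 / 2)) \<partial>P)
          = (\<integral>\<^sup>+Y. ennreal (exp (- b * (norm v)\<^sup>2 / 2)) * ennreal (exp (inner (\<xi> Y) v)) \<partial>P)"
        using True by (intro nn_integral_cong) (simp flip: ennreal_mult exp_add)
      also have "\<dots> = ennreal (exp (- b * (norm v)\<^sup>2 / 2)) * (\<integral>\<^sup>+Y. ennreal (exp (inner (\<xi> Y) v)) \<partial>P)"
        by (rule nn_integral_cmult) measurable
      also have "\<dots> \<le> ennreal (exp (- b * (norm v)\<^sup>2 / 2)) * ennreal (exp (13 / 24 * (norm v)\<^sup>2))"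
        using True rad v by (intro mult_left_mono mgf) auto
      also have "\<dots> = ennreal (exp (- (13 / 12) * (norm v)\<^sup>2 / 2))"
        by (simp add: b_def flip: ennreal_mult exp_add)
      finally show ?thesis .
    qed simp
  qed
  also have "\<dots> = ennreal (Z / sqrt (13 / 12) ^ d)"
    unfolding Z_def by (rule TI.scaled_gaussian_integral) simp
  finally have J_le: "(\<integral>\<^sup>+Y. J Y \<partial>P) \<le> ennreal (Z / sqrt (13 / 12) ^ d)" .
  define A where "A = {Y \<in> space P. \<tau> < norm (\<xi> Y)}"
  have [measurable]: "(\<lambda>Y. norm (\<xi> Y)) \<in> borel_measurable P" by (rule norm_measurable_fseq[OF \<xi>])
  have A [measurable]: "A \<in> sets P" unfolding A_def by measurable
  define c where "c = exp (\<tau>\<^sup>2 / (2 * b)) * (Z / (4 * sqrt b ^ d))"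
  have c: "c > 0" using Z by (simp add: c_def b_def)
  have "ennreal c * emeasure P A = (\<integral>\<^sup>+Y. ennreal c * indicator A Y \<partial>P)"
    by (subst nn_integral_cmult_indicator) auto
  also have "\<dots> \<le> (\<integral>\<^sup>+Y. J Y \<partial>P)"
  proof (rule nn_integral_mono)
    fix Y assume Y: "Y \<in> space P"
    show "ennreal c * indicator A Y \<le> J Y"
    proof (cases "Y \<in> A")
      case True
      have \<xi>Y: "\<xi> Y \<in> space (lborel_fseq d)" using measurable_space[OF \<xi> Y] .
      have "ennreal c = ennreal (exp (\<tau>\<^sup>2 / (2 * b))) * ennreal (Z / (4 * sqrt b ^ d))"
        unfolding c_def using Z by (intro ennreal_mult) (auto simp: b_def)
      also have "\<dots> \<le> ennreal (exp (\<tau>\<^sup>2 / (2 * b))) * I" by (intro mult_left_mono I_ge) simp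
      also have "\<dots> \<le> J Y"
        unfolding I_def J_def using True \<xi>Y \<tau> sd
        by (intro TI.gaussian_mixture_lower_bound) (auto simp: A_def b_def r_def)
      finally show ?thesis using True by simp
    qed simp
  qed
  also note J_le
  finally have "ennreal c * ennreal (measure P A) \<le> ennreal (Z / sqrt (13 / 12) ^ d)"
    by (simp add: P.emeasure_eq_measure)
  then have "c * measure P A \<le> Z / sqrt (13 / 12) ^ d"
    using c Z by (simp add: ennreal_le_iff flip: ennreal_mult)
  then have "measure P A \<le> (Z / sqrt (13 / 12) ^ d) / c" using c by (simp add: field_simps)
  also have "\<dots> = 4 * sqrt 2 ^ d * exp (- (3 / 13 * \<tau>\<^sup>2))"
  proof -
    have "sqrt b = sqrt 2 * sqrt (13 / 12)" by (simp add: b_def flip: real_sqrt_mult)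
    then have "sqrt b ^ d = sqrt 2 ^ d * sqrt (13 / 12) ^ d" by (simp add: power_mult_distrib)
    moreover have "exp (- (3 / 13 * \<tau>\<^sup>2)) = 1 / exp (\<tau>\<^sup>2 / (2 * b))" by (simp add: b_def exp_minus field_simps)
    moreover have "sqrt (13 / 12) ^ d \<noteq> (0::real)" by simp
    ultimately show ?thesis using Z by (simp add: c_def)
  qed
  also have "\<dots> \<le> exp (- (d * s\<^sup>2 / 10))" unfolding \<tau>_def by (rule score_tail_numeric[OF d s])
  finally have "measure P A \<le> exp (- (d * s\<^sup>2 / 10))" .
  moreover have "measure P {Y \<in> space P. norm (\<xi> Y) \<le> 7 / 10 * s * sqrt d} = 1 - measure P A"
  proof -
    have "{Y \<in> space P. norm (\<xi> Y) \<le> 7 / 10 * s * sqrt d} = space P - A" by (auto simp: A_def \<tau>_def)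
    then show ?thesis using P.prob_compl[OF A] by simp
  qed
  ultimately show ?thesis by simp
qed

section \<open>Differentiability of the prior\<close>

lemma increment_bound:
  fixes g :: "real \<Rightarrow> real"
  assumes "\<And>t. t \<in> closed_segment a b \<Longrightarrow> (g has_real_derivative g' t) (at t)"
    and "\<And>t. t \<in> closed_segment a b \<Longrightarrow> \<bar>g' t - c\<bar> \<le> e"
  shows "\<bar>g b - g a - (b - a) * c\<bar> \<le> e * \<bar>b - a\<bar>"
proof -
  have "norm ((\<lambda>t. g t - c * t) b - (\<lambda>t. g t - c * t) a) \<le> e * norm (b - a)"
  proof (rule field_differentiable_bound[where S = "closed_segment a b" and f' = "\<lambda>t. g' t - c"])
    fix t assume t: "t \<in> closed_segment a b"
    have "((\<lambda>t. g t - c * t) has_real_derivative g' t - c) (at t)"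
      by (auto intro!: derivative_eq_intros assms(1)[OF t])
    then show "((\<lambda>t. g t - c * t) has_field_derivative g' t - c) (at t within closed_segment a b)"
      by (rule has_field_derivative_at_within)
    show "norm (g' t - c) \<le> e" using assms(2)[OF t] by simp
  qed auto
  then show ?thesis by (simp add: algebra_simps)
qed

lemma vec_entry_le_vnorm: "u \<in> carrier_vec d \<Longrightarrow> i < d \<Longrightarrow> \<bar>u $ i\<bar> \<le> vnorm u"
proof -
  assume u: "u \<in> carrier_vec d" and i: "i < d"
  have "(u $ i)\<^sup>2 \<le> (\<Sum>i<d. (u $ i)\<^sup>2)" using i by (intro member_le_sum) auto
  also have "\<dots> = u \<bullet> u" using u by (simp add: scalar_prod_def lessThan_atLeast0 power2_eq_square)
  finally show ?thesis by (simp add: vnorm_def real_le_rsqrt)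
qed

lemma vnorm_mono:
  assumes "u \<in> carrier_vec d" "v \<in> carrier_vec d" "\<And>i. i < d \<Longrightarrow> \<bar>u $ i\<bar> \<le> \<bar>v $ i\<bar>"
  shows "vnorm u \<le> vnorm v"
proof -
  have "u \<bullet> u = (\<Sum>i<d. (u $ i)\<^sup>2)" "v \<bullet> v = (\<Sum>i<d. (v $ i)\<^sup>2)"
    using assms(1,2) by (simp_all add: scalar_prod_def lessThan_atLeast0 power2_eq_square)
  moreover have "(\<Sum>i<d. (u $ i)\<^sup>2) \<le> (\<Sum>i<d. (v $ i)\<^sup>2)"
    using assms(3) by (intro sum_mono) (simp add: abs_le_square_iff)
  ultimately show ?thesis by (simp add: vnorm_def)
qed

lemma continuous_vec_topologyD:
  assumes cont: "continuous_map (subtopology (vec_topology d) U) euclideanreal g"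
    and U: "U \<subseteq> carrier_vec d" and x: "x \<in> U" and e: "e > 0"
  obtains \<rho> where "\<rho> > 0" "\<And>u. u \<in> carrier_vec d \<Longrightarrow> vnorm u < \<rho> \<Longrightarrow> x + u \<in> U \<Longrightarrow> \<bar>g (x + u) - g x\<bar> \<le> e"
proof -
  interpret V: Metric_space "carrier_vec d" "vdist d" by (rule Metric_space_vdist)
  have top: "topspace (subtopology (vec_topology d) U) = U"
    using U by (auto simp: vec_topology_def)
  have "open {y. \<bar>y - g x\<bar> < e}"
  proof -
    have "{y. \<bar>y - g x\<bar> < e} = ball (g x) e" by (auto simp: dist_real_def abs_minus_commute)
    then show ?thesis by simp
  qed
  then have "openin euclideanreal {y. \<bar>y - g x\<bar> < e}" by simp
  from openin_continuous_map_preimage[OF cont this]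
  have "openin (subtopology (vec_topology d) U) {y \<in> U. g y \<in> {y. \<bar>y - g x\<bar> < e}}"
    unfolding top .
  then obtain W where W: "openin V.mtopology W" "{y \<in> U. g y \<in> {y. \<bar>y - g x\<bar> < e}} = W \<inter> U"
    unfolding openin_subtopology vec_topology_def by (elim exE conjE)
  have "x \<in> {y \<in> U. g y \<in> {y. \<bar>y - g x\<bar> < e}}" using x e by simp
  then have "x \<in> W" unfolding W(2) by (rule IntD1)
  then obtain \<rho> where \<rho>: "\<rho> > 0" "V.mball x \<rho> \<subseteq> W"
    using W(1) unfolding V.openin_mtopology by blast
  have xc: "x \<in> carrier_vec d" using x U by auto
  show ?thesis
  proof (rule that[OF \<rho>(1)])
    fix u assume u: "u \<in> carrier_vec d" "vnorm u < \<rho>" "x + u \<in> U"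
    have "vdist d x (x + u) = vnorm u"
      using xc u by (simp add: vdist_def vnorm_def L2_set_def scalar_prod_def power2_eq_square lessThan_atLeast0)
    then have "x + u \<in> V.mball x \<rho>" using xc u by (simp add: V.in_mball)
    then have "x + u \<in> W \<inter> U" using \<rho> u by auto
    then show "\<bar>g (x + u) - g x\<bar> \<le> e" unfolding W(2)[symmetric] by simp
  qed
qed

text \<open>Continuity of the partial derivatives is used along a path that changes one coordinate
  at a time; each piece contributes an error of at most e' |u|. Dividing \<open>e\<close> by d + 1
  instead of d makes sense for d = 0 too.\<close>

lemma C1_on_increment:
  assumes C1: "C1_on d U f" and U: "U \<subseteq> carrier_vec d" and x: "x \<in> carrier_vec d" and r: "r > 0"
    and ball: "\<And>u. u \<in> carrier_vec d \<Longrightarrow> vnorm u < r \<Longrightarrow> x + u \<in> U" and e: "e > 0"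
  obtains \<rho> where "\<rho> > 0"
    "\<And>u. u \<in> carrier_vec d \<Longrightarrow> vnorm u < \<rho> \<Longrightarrow> \<bar>f (x + u) - f x - gradient f x \<bullet> u\<bar> \<le> e * vnorm u"
proof -
  have x0: "x + 0\<^sub>v d \<in> U" using r by (intro ball) (auto simp: vnorm_def)
  then have xU: "x \<in> U" using x by simp
  define e' where "e' = e / (real d + 1)"
  have e': "e' > 0" using e by (simp add: e'_def add_nonneg_pos)
  have pd: "((\<lambda>t. f (y + t \<cdot>\<^sub>v unit_vec d j)) has_real_derivative partial j f y) (at 0)" if "j < d" "y \<in> U" for j y
  proof -
    have "(\<lambda>t. f (y + t \<cdot>\<^sub>v unit_vec d j)) differentiable (at 0)" using C1 that by (simp add: C1_on_def)
    moreover have "dim_vec y = d" using that U by auto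
    ultimately show ?thesis by (simp add: partial_def DERIV_deriv_iff_real_differentiable)
  qed
  have "\<forall>j<d. \<exists>\<rho>>0. \<forall>u. u \<in> carrier_vec d \<longrightarrow> vnorm u < \<rho> \<longrightarrow> x + u \<in> U \<longrightarrow> \<bar>partial j f (x + u) - partial j f x\<bar> \<le> e'"
  proof (intro allI impI)
    fix j assume j: "j < d"
    then have "continuous_map (subtopology (vec_topology d) U) euclideanreal (partial j f)"
      using C1 by (simp add: C1_on_def)
    from continuous_vec_topologyD[OF this U xU e']
    show "\<exists>\<rho>>0. \<forall>u. u \<in> carrier_vec d \<longrightarrow> vnorm u < \<rho> \<longrightarrow> x + u \<in> U \<longrightarrow> \<bar>partial j f (x + u) - partial j f x\<bar> \<le> e'"
      by metis
  qed
  then obtain R where R: "\<And>j. j < d \<Longrightarrow> R j > 0"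
    "\<And>j u. j < d \<Longrightarrow> u \<in> carrier_vec d \<Longrightarrow> vnorm u < R j \<Longrightarrow> x + u \<in> U \<Longrightarrow> \<bar>partial j f (x + u) - partial j f x\<bar> \<le> e'"
    by metis
  define \<rho> where "\<rho> = Min (insert r (R ` {..<d}))"
  have \<rho>: "\<rho> > 0" "\<rho> \<le> r" "\<And>j. j < d \<Longrightarrow> \<rho> \<le> R j" using r R(1) by (auto simp: \<rho>_def)
  show ?thesis
  proof (rule that[OF \<rho>(1)])
    fix u assume u: "u \<in> carrier_vec d" "vnorm u < \<rho>"
    \<comment> \<open>\<open>cut m\<close> keeps the first \<open>m\<close> entries of
      \<open>u\<close>. All points between consecutive cuts have entries bounded by those of
      \<open>u\<close>, hence stay in the ball.\<close>
    define cut where "cut = (\<lambda>m. Matrix.vec d (\<lambda>i. if i < m then u $ i else 0))"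
    have cut: "cut m \<in> carrier_vec d" for m by (simp add: cut_def)
    have step: "\<bar>f (x + cut (Suc m)) - f (x + cut m) - u $ m * partial m f x\<bar> \<le> e' * vnorm u" if m: "m < d" for m
    proof -
      have pt: "x + (cut m + t \<cdot>\<^sub>v unit_vec d m) \<in> U" "vnorm (cut m + t \<cdot>\<^sub>v unit_vec d m) \<le> vnorm u"
        if t: "t \<in> closed_segment 0 (u $ m)" for t
      proof -
        have tm: "\<bar>t\<bar> \<le> \<bar>u $ m\<bar>" using t by (auto simp: closed_segment_eq_real_ivl split: if_splits)
        show 1: "vnorm (cut m + t \<cdot>\<^sub>v unit_vec d m) \<le> vnorm u"
          by (rule vnorm_mono[of _ d]) (use cut u tm m in \<open>auto simp: cut_def unit_vec_def\<close>)
        show "x + (cut m + t \<cdot>\<^sub>v unit_vec d m) \<in> U" using 1 u \<rho> cut by (intro ball) auto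
      qed
      have assoc: "(x + cut m) + t \<cdot>\<^sub>v unit_vec d m = x + (cut m + t \<cdot>\<^sub>v unit_vec d m)" for t
        using x cut by (intro assoc_add_vec[of _ d]) auto
      have "\<bar>f ((x + cut m) + u $ m \<cdot>\<^sub>v unit_vec d m) - f ((x + cut m) + 0 \<cdot>\<^sub>v unit_vec d m) - (u $ m - 0) * partial m f x\<bar>
          \<le> e' * \<bar>u $ m - 0\<bar>"
      proof (rule increment_bound[where g = "\<lambda>t. f ((x + cut m) + t \<cdot>\<^sub>v unit_vec d m)"])
        fix t assume t: "t \<in> closed_segment 0 (u $ m)"
        show "((\<lambda>t. f ((x + cut m) + t \<cdot>\<^sub>v unit_vec d m)) has_real_derivative
            partial m f ((x + cut m) + t \<cdot>\<^sub>v unit_vec d m)) (at t)"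
          by (rule DERIV_line[of _ d]) (use x cut pd[OF m pt(1)[OF t]] assoc[of t] in auto)
        show "\<bar>partial m f ((x + cut m) + t \<cdot>\<^sub>v unit_vec d m) - partial m f x\<bar> \<le> e'"
          unfolding assoc by (rule R(2)[OF m]) (use pt[OF t] u \<rho>(3)[OF m] cut in auto)
      qed
      moreover have "(x + cut m) + u $ m \<cdot>\<^sub>v unit_vec d m = x + cut (Suc m)"
        unfolding assoc using m by (intro arg_cong[of _ _ "\<lambda>y. x + y"] eq_vecI) (auto simp: cut_def unit_vec_def less_Suc_eq)
      moreover have z: "0 \<cdot>\<^sub>v unit_vec d m = (0\<^sub>v d :: real Matrix.vec)" by (auto intro!: eq_vecI)
      have "(x + cut m) + 0 \<cdot>\<^sub>v unit_vec d m = x + cut m"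
        unfolding z using x cut[of m] by (intro right_zero_vec) auto
      moreover have "e' * \<bar>u $ m - 0\<bar> \<le> e' * vnorm u"
        using vec_entry_le_vnorm[OF u(1) m] e' by (intro mult_left_mono) auto
      ultimately show ?thesis by simp
    qed
    have d: "x + cut d = x + u" "x + cut 0 = x"
      using u x by (auto simp: cut_def intro!: eq_vecI)
    have "f (x + u) - f x = (\<Sum>m<d. f (x + cut (Suc m)) - f (x + cut m))"
      using sum_lessThan_telescope[of "\<lambda>m. f (x + cut m)" d] by (simp add: d)
    moreover have "gradient f x \<bullet> u = (\<Sum>m<d. u $ m * partial m f x)"
      using x u by (simp add: gradient_def scalar_prod_def lessThan_atLeast0 mult.commute)
    ultimately have "\<bar>f (x + u) - f x - gradient f x \<bullet> u\<bar>
        = \<bar>\<Sum>m<d. f (x + cut (Suc m)) - f (x + cut m) - u $ m * partial m f x\<bar>"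
      by (simp add: sum_subtractf)
    also have "\<dots> \<le> (\<Sum>m<d. e' * vnorm u)"
      by (intro order_trans[OF sum_abs] sum_mono step) auto
    also have "\<dots> = (e' * d) * vnorm u" by simp
    also have "\<dots> \<le> e * vnorm u"
      using e by (intro mult_right_mono) (auto simp: e'_def field_simps)
    finally show "\<bar>f (x + u) - f x - gradient f x \<bullet> u\<bar> \<le> e * vnorm u" .
  qed
qed

lemma mat_vec_norm_bound:
  assumes A: "A \<in> carrier_mat m d"
  obtains C where "C > 0" "\<And>u. u \<in> carrier_vec d \<Longrightarrow> vnorm (A *\<^sub>v u) \<le> C * vnorm u"
proof -
  have AA: "transpose_mat A * A \<in> carrier_mat d d" using A by auto
  obtain K where K: "K > 0" "\<And>u :: real Matrix.vec. u \<in> carrier_vec d \<Longrightarrow> \<bar>u \<bullet> ((transpose_mat A * A) *\<^sub>v u)\<bar> \<le> K * (u \<bullet> u)"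
    using form_bound[OF AA] by blast
  have "vnorm (A *\<^sub>v u) \<le> sqrt K * vnorm u" if u: "u \<in> carrier_vec d" for u
  proof -
    have Au: "A *\<^sub>v u \<in> carrier_vec m" using A u by simp
    have "(A *\<^sub>v u) \<bullet> (A *\<^sub>v u) = (transpose_mat A *\<^sub>v (A *\<^sub>v u)) \<bullet> u"
      by (rule transpose_vec_mult_scalar[OF A u Au, symmetric])
    also have "\<dots> = u \<bullet> ((transpose_mat A * A) *\<^sub>v u)"
      using A u Au by (simp add: comm_scalar_prod[of _ d] assoc_mult_mat_vec[of _ d m _ d])
    also have "\<dots> \<le> K * (u \<bullet> u)" using K(2)[OF u] by simp
    finally show ?thesis by (simp add: vnorm_def flip: real_sqrt_mult)
  qed
  then show ?thesis using K(1) that[of "sqrt K"] by simp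
qed

section \<open>Linear forms on sequences\<close>

definition fseq_unit :: "nat \<Rightarrow> nat \<Rightarrow> fseq" where
  "fseq_unit d j = fseq_of d (\<lambda>i. if i = j then 1 else 0)"

lemma fseq_unit_in [simp]: "fseq_unit d j \<in> seqs d" by (simp add: fseq_unit_def)

lemma seqs_sum_in: "(\<And>j. j \<in> J \<Longrightarrow> f j \<in> seqs d) \<Longrightarrow> (\<Sum>j\<in>J. f j) \<in> seqs d"
  by (rule Real_Vector_Spaces.subspace_sum[OF subspace_seqs])

lemma coord_sum: "coord (\<Sum>j\<in>J. f j) i = (\<Sum>j\<in>J. coord (f j) i)"
  by (induction J rule: infinite_finite_induct) auto

lemma fseq_expansion: "u \<in> seqs d \<Longrightarrow> u = (\<Sum>j<d. coord u j *\<^sub>R fseq_unit d j)"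
proof (rule fseq_eqI)
  fix i assume u: "u \<in> seqs d"
  show "coord u i = coord (\<Sum>j<d. coord u j *\<^sub>R fseq_unit d j) i"
    using u by (cases "i < d") (auto simp: coord_sum fseq_unit_def seqs_def if_distrib[of "\<lambda>x. _ * x"] cong: if_cong)
qed

text \<open>Riesz representation on \<open>seqs d\<close>; it turns the linear forms of directional
  derivatives into gradient vectors.\<close>

lemma linear_on_seqs_expansion:
  fixes f :: "fseq \<Rightarrow> real"
  assumes add: "\<And>u v. u \<in> seqs d \<Longrightarrow> v \<in> seqs d \<Longrightarrow> f (u + v) = f u + f v"
    and scale: "\<And>c u. u \<in> seqs d \<Longrightarrow> f (c *\<^sub>R u) = c * f u" and u: "u \<in> seqs d"
  shows "f u = inner (fseq_of d (\<lambda>j. f (fseq_unit d j))) u"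
proof -
  have f0: "f 0 = 0" using scale[of 0 0] by (simp add: seqs_def)
  have "f (\<Sum>j\<in>J. coord u j *\<^sub>R fseq_unit d j) = (\<Sum>j\<in>J. coord u j * f (fseq_unit d j))" if "finite J" for J
    using that
  proof (induction J)
    case (insert j J)
    have "f (coord u j *\<^sub>R fseq_unit d j + (\<Sum>j\<in>J. coord u j *\<^sub>R fseq_unit d j))
        = f (coord u j *\<^sub>R fseq_unit d j) + f (\<Sum>j\<in>J. coord u j *\<^sub>R fseq_unit d j)"
      by (rule add) (auto intro!: seqs_sum_in Real_Vector_Spaces.subspace_scale[OF subspace_seqs])
    then show ?case using insert by (simp add: scale)
  qed (simp add: f0)
  from this[of "{..<d}"] have "f u = (\<Sum>j<d. coord u j * f (fseq_unit d j))"
    using fseq_expansion[OF u] by simp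
  also have "\<dots> = inner (fseq_of d (\<lambda>j. f (fseq_unit d j))) u"
    by (subst inner_seqs[of _ d]) (auto simp: mult.commute)
  finally show ?thesis .
qed

section \<open>The generalized linear model in whitened coordinates\<close>

locale glm = exp_family k YY \<mu> for k :: nat and YY :: "real Matrix.vec set" and \<mu> :: "real Matrix.vec measure" +
  fixes d n :: nat and X :: "nat \<Rightarrow> real mat" and th0 :: "real Matrix.vec"
  assumes d: "d \<ge> 1" and n: "n \<ge> 1" and X: "\<And>i. i < n \<Longrightarrow> X i \<in> carrier_mat d k"
    and th0: "th0 \<in> param_space d k n \<mu> X"
    and columns: "columns_span d n X"
begin

definition \<Xi> :: "nat \<Rightarrow> real Matrix.vec \<Rightarrow> real Matrix.vec" where
  "\<Xi> i \<theta> = transpose_mat (X i) *\<^sub>v \<theta>"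

abbreviation F :: "real mat" where "F \<equiv> fisher d n \<mu> X th0"

lemma \<Xi>_carrier [simp]: "i < n \<Longrightarrow> \<Xi> i \<theta> \<in> carrier_vec k"
  using carrier_matD[OF X[of i]] by (intro carrier_vecI) (simp add: \<Xi>_def)

lemma \<Xi>_linear:
  assumes "i < n" "u \<in> carrier_vec d"
  shows "v \<in> carrier_vec d \<Longrightarrow> \<Xi> i (u + v) = \<Xi> i u + \<Xi> i v" "\<Xi> i (c \<cdot>\<^sub>v u) = c \<cdot>\<^sub>v \<Xi> i u"
  using X[OF assms(1)] assms(2)
  by (auto simp: \<Xi>_def mult_add_distrib_mat_vec[of _ k d] mult_mat_vec[of _ k d])

lemma th0_carrier: "th0 \<in> carrier_vec d"
  using th0 by (simp add: param_space_def)

lemma param_spaceD: "\<theta> \<in> param_space d k n \<mu> X \<Longrightarrow> i < n \<Longrightarrow> \<Xi> i \<theta> \<in> \<Omega>"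
  by (simp add: param_space_def \<Xi>_def)

text \<open>The matrix form of the Fisher information becomes an average of second cumulants, from
  which both its definiteness and the identity \<open>Q_0\<close> follow.\<close>

lemma fisher_form:
  assumes u: "u \<in> carrier_vec d" and v: "v \<in> carrier_vec d"
  shows "u \<bullet> (F *\<^sub>v v) = (\<Sum>i<n. \<kappa>2 (\<Xi> i th0) (\<Xi> i u) (\<Xi> i v)) / n"
proof -
  define h where "h = (\<lambda>i. hessian \<psi> (\<Xi> i th0))"
  define W where "W = (\<lambda>i. X i * h i * transpose_mat (X i))"
  have hc: "h i \<in> carrier_mat k k" if "i < n" for i using that by (auto simp: h_def hessian_def)
  have Wc: "W i \<in> carrier_mat d d" if "i < n" for i using X[OF that] hc[OF that] by (auto simp: W_def)
  have Fc: "F \<in> carrier_mat d d" by (simp add: fisher_def)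
  have F_entry: "F $$ (a, b) = (\<Sum>i<n. W i $$ (a, b)) / n" if "a < d" "b < d" for a b
    using that by (simp add: fisher_def W_def h_def \<Xi>_def)
  have form: "u \<bullet> (M *\<^sub>v v) = (\<Sum>a<d. \<Sum>b<d. u $ a * (M $$ (a, b) * v $ b))" if "M \<in> carrier_mat d d" for M
    using u v that by (auto simp: scalar_prod_def lessThan_atLeast0 sum_distrib_left intro!: sum.cong)
  have "u \<bullet> (F *\<^sub>v v) = (\<Sum>a<d. \<Sum>b<d. u $ a * ((\<Sum>i<n. W i $$ (a, b)) / n * v $ b))"
    unfolding form[OF Fc] by (intro sum.cong refl) (simp add: F_entry)
  also have "\<dots> = (\<Sum>a<d. \<Sum>b<d. \<Sum>i<n. u $ a * (W i $$ (a, b) * v $ b)) / n"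
  proof -
    have "u $ a * ((\<Sum>i<n. W i $$ (a, b)) / n * v $ b) = (\<Sum>i<n. u $ a * (W i $$ (a, b) * v $ b)) / n" for a b
      by (simp add: sum_distrib_left sum_distrib_right)
    then show ?thesis by (simp only: sum_divide_distrib)
  qed
  also have "(\<Sum>a<d. \<Sum>b<d. \<Sum>i<n. u $ a * (W i $$ (a, b) * v $ b)) = (\<Sum>a<d. \<Sum>i<n. \<Sum>b<d. u $ a * (W i $$ (a, b) * v $ b))"
    by (intro sum.cong refl sum.swap)
  also have "\<dots> = (\<Sum>i<n. \<Sum>a<d. \<Sum>b<d. u $ a * (W i $$ (a, b) * v $ b))" by (rule sum.swap)
  also have "\<dots> = (\<Sum>i<n. u \<bullet> (W i *\<^sub>v v))" by (intro sum.cong refl) (simp add: form[OF Wc])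
  also have "\<dots> = (\<Sum>i<n. \<kappa>2 (\<Xi> i th0) (\<Xi> i u) (\<Xi> i v))"
  proof (rule sum.cong[OF refl])
    fix i assume "i \<in> {..<n}"
    then have i: "i < n" by simp
    note Xi = X[OF i]
    have \<omega>: "\<Xi> i th0 \<in> \<Omega>" by (rule param_spaceD[OF th0 i])
    define x y where "x = \<Xi> i u" and "y = \<Xi> i v"
    have xy: "x \<in> carrier_vec k" "y \<in> carrier_vec k" using i by (auto simp: x_def y_def)
    have hy: "h i *\<^sub>v y \<in> carrier_vec k" using hc[OF i] xy by simp
    have "W i *\<^sub>v v = (X i * h i) *\<^sub>v (transpose_mat (X i) *\<^sub>v v)"
      unfolding W_def using Xi hc[OF i] v by (intro assoc_mult_mat_vec[of _ d k _ d]) auto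
    also have "\<dots> = X i *\<^sub>v (h i *\<^sub>v y)"
      using Xi hc[OF i] xy(2) unfolding y_def \<Xi>_def by (intro assoc_mult_mat_vec[of _ d k _ k]) auto
    finally have "u \<bullet> (W i *\<^sub>v v) = x \<bullet> (h i *\<^sub>v y)"
      using transpose_vec_mult_scalar[OF Xi hy u] by (simp add: x_def \<Xi>_def)
    also have "\<dots> = (\<Sum>a<k. x $ a * (\<Sum>b<k. h i $$ (a, b) * y $ b))"
      using xy hc[OF i] by (auto simp: scalar_prod_def lessThan_atLeast0 intro!: sum.cong)
    also have "\<dots> = (\<Sum>a<k. x $ a * \<kappa>2 (\<Xi> i th0) (unit_vec k a) y)"
    proof (rule sum.cong[OF refl])
      fix a assume "a \<in> {..<k}"
      then have a: "a < k" by simp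
      have "h i $$ (a, b) * y $ b = y $ b * \<kappa>2 (\<Xi> i th0) (unit_vec k b) (unit_vec k a)" if "b < k" for b
        using \<Omega>_carrier[OF \<omega>] a that
        by (simp add: h_def hessian_def partial2_psi[OF \<omega>] kappa2_sym[of _ "unit_vec k a"])
      then have "(\<Sum>b<k. h i $$ (a, b) * y $ b) = (\<Sum>b<k. y $ b * \<kappa>2 (\<Xi> i th0) (unit_vec k b) (unit_vec k a))"
        by (intro sum.cong) auto
      also have "\<dots> = \<kappa>2 (\<Xi> i th0) y (unit_vec k a)"
        by (rule kappa_unit_vec_sum(2)[OF \<omega> xy(2) _ xy(2), symmetric]) simp
      finally show "x $ a * (\<Sum>b<k. h i $$ (a, b) * y $ b) = x $ a * \<kappa>2 (\<Xi> i th0) (unit_vec k a) y"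
        by (simp add: kappa2_sym[of _ y])
    qed
    also have "\<dots> = \<kappa>2 (\<Xi> i th0) x y" by (rule kappa_unit_vec_sum(2)[OF \<omega> xy(1,2,2), symmetric])
    finally show "u \<bullet> (W i *\<^sub>v v) = \<kappa>2 (\<Xi> i th0) (\<Xi> i u) (\<Xi> i v)" by (simp add: x_def y_def)
  qed
  finally show ?thesis .
qed

text \<open>Such a vector is orthogonal to all columns, hence to their span, hence to
  itself.\<close>

lemma orthogonal_to_columns:
  assumes u: "u \<in> carrier_vec d" and 0: "\<And>i. i < n \<Longrightarrow> \<Xi> i u = 0\<^sub>v k"
  shows "u = 0\<^sub>v d"
proof -
  interpret vs: vec_space "TYPE(real)" d .
  define C where "C = (\<Union>i<n. set (cols (X i)))"
  have C: "C \<subseteq> carrier_vec d" using X by (force simp: C_def cols_def)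
  have span: "vs.span C = carrier_vec d" using columns by (simp add: columns_span_def C_def)
  have "u \<bullet> c = 0" if c: "c \<in> C" for c
  proof -
    obtain i where i: "i < n" "c \<in> set (cols (X i))" using c unfolding C_def by blast
    then obtain j where j: "j < k" "c = col (X i) j" using X[OF i(1)] by (auto simp: cols_def)
    have cc: "c \<in> carrier_vec d" using c C by auto
    have "\<Xi> i u $ j = c \<bullet> u" using j X[OF i(1)] by (simp add: \<Xi>_def)
    then have "c \<bullet> u = 0" using 0[OF i(1)] j by simp
    then show ?thesis using comm_scalar_prod[OF cc u] by simp
  qed
  then have "u \<in> vs.orthogonal_complement C" using u by (simp add: vs.orthogonal_complement_def)
  then have "u \<in> vs.orthogonal_complement (vs.span C)" using vs.in_orthogonal_complement_span[OF C] by simp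
  then have "u \<bullet> u = 0" using u by (simp add: span vs.orthogonal_complement_def)
  then show ?thesis using u scalar_prod_self_eq_0 by blast
qed

text \<open>If the form vanishes at \<open>u\<close>, so does every second cumulant, as they are
  nonnegative; by \<open>kappa2_eq_0\<close> every \<open>\<Xi> i u\<close> is zero, and the span
  condition gives u = 0.\<close>

lemma fisher_pos_def: "pos_def_mat d F"
  unfolding pos_def_mat_def
proof (intro conjI ballI impI)
  show Fc: "F \<in> carrier_mat d d" by (simp add: fisher_def)
  show "transpose_mat F = F"
  proof (rule eq_matI)
    fix a b assume "a < dim_row F" "b < dim_col F"
    then have ab: "a < d" "b < d" using Fc by auto
    have e: "unit_vec d a \<bullet> (F *\<^sub>v unit_vec d b) = F $$ (a, b)" if "a < d" "b < d" for a b
      using that mat_mult_unit_vec[OF Fc that] Fc by simp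
    have "unit_vec d a \<bullet> (F *\<^sub>v unit_vec d b) = unit_vec d b \<bullet> (F *\<^sub>v unit_vec d a)"
      using ab by (simp add: fisher_form kappa2_sym)
    then show "transpose_mat F $$ (a, b) = F $$ (a, b)" using ab Fc e by simp
  qed (use Fc in auto)
  fix u :: "real Matrix.vec" assume u: "u \<in> carrier_vec d" "u \<noteq> 0\<^sub>v d"
  have nn: "\<kappa>2 (\<Xi> i th0) (\<Xi> i u) (\<Xi> i u) \<ge> 0" if "i < n" for i
    using that by (intro kappa2_nonneg param_spaceD th0) auto
  have "(\<Sum>i<n. \<kappa>2 (\<Xi> i th0) (\<Xi> i u) (\<Xi> i u)) \<noteq> 0"
  proof
    assume "(\<Sum>i<n. \<kappa>2 (\<Xi> i th0) (\<Xi> i u) (\<Xi> i u)) = 0"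
    then have "\<kappa>2 (\<Xi> i th0) (\<Xi> i u) (\<Xi> i u) = 0" if "i < n" for i
      using nn that by (subst (asm) sum_nonneg_eq_0_iff) auto
    then have "\<Xi> i u = 0\<^sub>v k" if "i < n" for i
      using that kappa2_eq_0[OF param_spaceD[OF th0 that]] by simp
    then show False using orthogonal_to_columns[OF u(1)] u(2) by simp
  qed
  moreover have "(\<Sum>i<n. \<kappa>2 (\<Xi> i th0) (\<Xi> i u) (\<Xi> i u)) \<ge> 0" using nn by (intro sum_nonneg) auto
  ultimately show "u \<bullet> (F *\<^sub>v u) > 0" using n by (simp add: fisher_form[OF u(1,1)])
qed

end

text \<open>\<open>L\<close> is a triangular whitening matrix for n times the Fisher information and
  \<open>A\<close> its inverse. In the coordinates L (\<theta> - th0) the neighbourhoods become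
  Euclidean balls and the Hessian of the potential at the origin the identity.\<close>

locale glm_white = glm k YY \<mu> d n X th0
  for k :: nat and YY \<mu> d n X th0 +
  fixes L A :: "real mat" and s :: real
  assumes L: "L \<in> carrier_mat d d" "\<And>i j. i < d \<Longrightarrow> j < d \<Longrightarrow> i < j \<Longrightarrow> L $$ (i, j) = 0"
      "\<And>i. i < d \<Longrightarrow> L $$ (i, i) > 0"
    and A: "A \<in> carrier_mat d d" "A * L = 1\<^sub>m d" "L * A = 1\<^sub>m d"
    and det_L: "Determinant.det (real n \<cdot>\<^sub>m F) = (\<Prod>i<d. L $$ (i, i))\<^sup>2"
    and form_L: "\<And>u v. u \<in> carrier_vec d \<Longrightarrow> v \<in> carrier_vec d \<Longrightarrow>
      u \<bullet> ((real n \<cdot>\<^sub>m F) *\<^sub>v v) = (L *\<^sub>v u) \<bullet> (L *\<^sub>v v)"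
    and s: "s \<ge> 12"
    and nbhd: "nbhd d n \<mu> X th0 (2 * s) \<subseteq> param_space d k n \<mu> X"
    and delta3: "ereal (2 * s) * delta3 d n \<mu> X th0 (2 * s) * ereal (sqrt (real d / real n)) \<le> ereal (1 / 4)"
begin

section \<open>The whitening map\<close>

definition \<theta> :: "fseq \<Rightarrow> real Matrix.vec" where "\<theta> z = th0 + A *\<^sub>v vec_of d z"

definition lin :: "nat \<Rightarrow> fseq \<Rightarrow> real Matrix.vec" where "lin i u = \<Xi> i (A *\<^sub>v vec_of d u)"

definition \<omega> :: "nat \<Rightarrow> fseq \<Rightarrow> real Matrix.vec" where "\<omega> i z = \<Xi> i (\<theta> z)"

definition \<Theta>z :: "fseq set" where "\<Theta>z = {z \<in> seqs d. \<theta> z \<in> param_space d k n \<mu> X}"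

lemma Avec_carrier [simp]: "A *\<^sub>v vec_of d z \<in> carrier_vec d"
  using A(1) by (intro mult_mat_vec_carrier) auto

lemma \<theta>_carrier [simp]: "\<theta> z \<in> carrier_vec d"
  using th0_carrier by (simp add: \<theta>_def)

lemma Avec_linear:
  "A *\<^sub>v vec_of d (x + y) = A *\<^sub>v vec_of d x + A *\<^sub>v vec_of d y"
  "A *\<^sub>v vec_of d (c *\<^sub>R x) = c \<cdot>\<^sub>v (A *\<^sub>v vec_of d x)"
  "A *\<^sub>v vec_of d (x - y) = A *\<^sub>v vec_of d x - A *\<^sub>v vec_of d y"
  using A(1) by (auto simp: vec_of_linear mult_add_distrib_mat_vec[of _ d d]
      mult_mat_vec[of _ d d] mult_minus_distrib_mat_vec[of _ d d])

lemma \<theta>_line: "\<theta> (z + t *\<^sub>R u) = \<theta> z + t \<cdot>\<^sub>v (A *\<^sub>v vec_of d u)"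
proof -
  have "th0 + (A *\<^sub>v vec_of d z + t \<cdot>\<^sub>v (A *\<^sub>v vec_of d u)) = (th0 + A *\<^sub>v vec_of d z) + t \<cdot>\<^sub>v (A *\<^sub>v vec_of d u)"
    using th0_carrier by (intro assoc_add_vec[symmetric, of _ d]) auto
  then show ?thesis by (simp add: \<theta>_def Avec_linear)
qed

lemma \<theta>_diff: "\<theta> z - \<theta> z' = A *\<^sub>v vec_of d (z - z')"
proof -
  define a b where "a = A *\<^sub>v vec_of d z" and "b = A *\<^sub>v vec_of d z'"
  have "a \<in> carrier_vec d" "b \<in> carrier_vec d" by (auto simp: a_def b_def)
  then have "(th0 + a) - (th0 + b) = a - b" using th0_carrier by (auto intro!: eq_vecI)
  then show ?thesis by (simp add: \<theta>_def Avec_linear a_def b_def)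
qed

lemma \<theta>_0 [simp]: "\<theta> 0 = th0"
proof -
  have "A *\<^sub>v vec_of d 0 = 0\<^sub>v d" using A(1) by (auto simp: vec_of_linear intro!: eq_vecI)
  then show ?thesis using th0_carrier by (simp add: \<theta>_def)
qed

lemma L_A: "v \<in> carrier_vec d \<Longrightarrow> L *\<^sub>v (A *\<^sub>v v) = v"
  using assoc_mult_mat_vec[OF L(1) A(1), of v] A(3) by simp

lemma A_L: "v \<in> carrier_vec d \<Longrightarrow> A *\<^sub>v (L *\<^sub>v v) = v"
  using assoc_mult_mat_vec[OF A(1) L(1), of v] A(2) by simp

lemma \<theta>_surj:
  assumes "t \<in> carrier_vec d"
  shows "\<theta> (of_vec d (L *\<^sub>v (t - th0))) = t"
proof -
  have "L *\<^sub>v (t - th0) \<in> carrier_vec d" using L assms th0_carrier by simp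
  then have "\<theta> (of_vec d (L *\<^sub>v (t - th0))) = th0 + (t - th0)"
    using A_L[of "t - th0"] assms th0_carrier by (simp add: \<theta>_def)
  also have "\<dots> = t" using assms th0_carrier by (auto intro!: eq_vecI)
  finally show ?thesis .
qed

lemma \<theta>_inj: "z \<in> seqs d \<Longrightarrow> z' \<in> seqs d \<Longrightarrow> \<theta> z = \<theta> z' \<Longrightarrow> z = z'"
proof -
  assume z: "z \<in> seqs d" "z' \<in> seqs d" "\<theta> z = \<theta> z'"
  have "A *\<^sub>v vec_of d (z - z') = 0\<^sub>v d" using \<theta>_diff[of z z'] z(3) \<theta>_carrier[of z'] by (auto simp del: \<theta>_carrier)
  moreover have "L *\<^sub>v 0\<^sub>v d = 0\<^sub>v d" using L(1) by (auto intro!: eq_vecI)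
  ultimately have "vec_of d (z - z') = 0\<^sub>v d" using L_A[of "vec_of d (z - z')"] by simp
  moreover have "of_vec d (0\<^sub>v d) = 0" by (rule fseq_eqI) (simp add: of_vec_def)
  ultimately have "of_vec d (vec_of d (z - z')) = 0" by simp
  moreover have "z - z' \<in> seqs d" using z by (auto simp: seqs_def)
  ultimately show "z = z'" by simp
qed

lemma form_inner: "u \<in> seqs d \<Longrightarrow> (A *\<^sub>v vec_of d u) \<bullet> ((real n \<cdot>\<^sub>m F) *\<^sub>v (A *\<^sub>v vec_of d v)) = inner u v"
  by (simp add: form_L L_A vec_of_inner)

lemma fisher_carrier: "F \<in> carrier_mat d d" by (simp add: fisher_def)

lemma fisher_inner: "u \<in> seqs d \<Longrightarrow> (A *\<^sub>v vec_of d u) \<bullet> (F *\<^sub>v (A *\<^sub>v vec_of d v)) = inner u v / n"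
proof -
  assume u: "u \<in> seqs d"
  have "(real n \<cdot>\<^sub>m F) *\<^sub>v (A *\<^sub>v vec_of d v) = real n \<cdot>\<^sub>v (F *\<^sub>v (A *\<^sub>v vec_of d v))"
    by (rule smult_mat_mult_vec[OF fisher_carrier]) simp
  then have "real n * ((A *\<^sub>v vec_of d u) \<bullet> (F *\<^sub>v (A *\<^sub>v vec_of d v))) = inner u v"
    using form_inner[OF u, of v] mult_mat_vec_carrier[OF fisher_carrier Avec_carrier[of v]]
    by (simp add: scalar_prod_smult_distrib[of _ d])
  then show ?thesis using n by (simp add: field_simps)
qed

lemma norm_wrt_A: "u \<in> seqs d \<Longrightarrow> norm_wrt F (A *\<^sub>v vec_of d u) = norm u / sqrt n"
  by (simp add: norm_wrt_eq[OF fisher_pos_def] fisher_inner norm_eq_sqrt_inner real_sqrt_divide)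

lemma \<theta>_nbhd: "z \<in> seqs d \<Longrightarrow> \<theta> z \<in> nbhd d n \<mu> X th0 r \<longleftrightarrow> norm z \<le> r * sqrt d"
proof -
  assume z: "z \<in> seqs d"
  have "norm_wrt F (\<theta> z - th0) = norm z / sqrt n"
    using \<theta>_diff[of z 0] norm_wrt_A[OF z] by simp
  then show ?thesis using n by (simp add: nbhd_def real_sqrt_divide field_simps)
qed

lemma \<Theta>z_sub: "\<Theta>z \<subseteq> seqs d" by (auto simp: \<Theta>z_def)

lemma \<Theta>z_ball: "z \<in> seqs d \<Longrightarrow> norm z \<le> 2 * s * sqrt d \<Longrightarrow> z \<in> \<Theta>z"
  using nbhd \<theta>_nbhd[of z "2 * s"] by (auto simp: \<Theta>z_def)

lemma \<omega>_in: "z \<in> \<Theta>z \<Longrightarrow> i < n \<Longrightarrow> \<omega> i z \<in> \<Omega>"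
  by (auto simp: \<Theta>z_def \<omega>_def intro: param_spaceD)

lemma carriers [simp]: "i < n \<Longrightarrow> \<omega> i z \<in> carrier_vec k" "i < n \<Longrightarrow> lin i u \<in> carrier_vec k"
  by (auto simp: \<omega>_def lin_def)

lemma lin_linear:
  assumes "i < n"
  shows "lin i (u + v) = lin i u + lin i v" "lin i (c *\<^sub>R u) = c \<cdot>\<^sub>v lin i u"
  using assms by (simp_all add: lin_def Avec_linear \<Xi>_linear)

lemma \<omega>_line: "i < n \<Longrightarrow> \<omega> i (z + t *\<^sub>R u) = \<omega> i z + t \<cdot>\<^sub>v lin i u"
  by (simp add: \<omega>_def lin_def \<theta>_line \<Xi>_linear)

lemma \<Theta>z_segment:
  assumes z: "z \<in> \<Theta>z" "z' \<in> \<Theta>z" and t: "0 \<le> t" "t \<le> 1"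
  shows "z + t *\<^sub>R (z' - z) \<in> \<Theta>z"
proof -
  have S: "z \<in> seqs d" "z' \<in> seqs d" using z \<Theta>z_sub by auto
  have "\<Xi> i (\<theta> (z + t *\<^sub>R (z' - z))) \<in> \<Omega>" if i: "i < n" for i
  proof -
    have l: "lin i (z' - z) = \<omega> i z' - \<omega> i z"
    proof -
      have "\<omega> i z' = \<omega> i z + 1 \<cdot>\<^sub>v lin i (z' - z)" using \<omega>_line[OF i, of z 1 "z' - z"] by simp
      moreover have "dim_vec (lin i (z' - z)) = k" "dim_vec (\<omega> i z) = k" using carriers[OF i] by (auto intro: carrier_vecD)
      ultimately show ?thesis by (simp only:) (auto intro!: eq_vecI)
    qed
    have "\<omega> i z + t \<cdot>\<^sub>v (\<omega> i z' - \<omega> i z) \<in> \<Omega>"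
      using z i t by (intro natural_params_segment \<omega>_in)
    then show ?thesis using \<omega>_line[OF i, of z t "z' - z"] by (simp add: l \<omega>_def)
  qed
  then have "\<theta> (z + t *\<^sub>R (z' - z)) \<in> param_space d k n \<mu> X" by (simp add: param_space_def \<Xi>_def)
  moreover have "z + t *\<^sub>R (z' - z) \<in> seqs d" using S by (auto simp: seqs_def)
  ultimately show ?thesis by (simp add: \<Theta>z_def)
qed

section \<open>The potential and its derivatives along lines\<close>

definition V :: "(nat \<Rightarrow> real Matrix.vec) \<Rightarrow> fseq \<Rightarrow> real" where
  "V Y z = (\<Sum>i<n. \<psi> (\<omega> i z) - Y i \<bullet> \<omega> i z)"

definition G :: "(nat \<Rightarrow> real Matrix.vec) \<Rightarrow> fseq \<Rightarrow> fseq \<Rightarrow> real" where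
  "G Y z u = (\<Sum>i<n. \<kappa>1 (\<omega> i z) (lin i u) - Y i \<bullet> lin i u)"

definition grad :: "(nat \<Rightarrow> real Matrix.vec) \<Rightarrow> fseq \<Rightarrow> fseq" where
  "grad Y z = fseq_of d (\<lambda>j. G Y z (fseq_unit d j))"

definition Q :: "fseq \<Rightarrow> fseq \<Rightarrow> fseq \<Rightarrow> real" where
  "Q z u v = (\<Sum>i<n. \<kappa>2 (\<omega> i z) (lin i u) (lin i v))"

definition T :: "fseq \<Rightarrow> fseq \<Rightarrow> fseq \<Rightarrow> fseq \<Rightarrow> real" where
  "T z u v x = (\<Sum>i<n. \<kappa>3 (\<omega> i z) (lin i u) (lin i v) (lin i x))"

lemma nll_\<theta>: "nll n \<mu> X Y (\<theta> z) = V Y z / n"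
  by (simp add: nll_def V_def \<omega>_def \<Xi>_def)

lemma Q_linear:
  assumes "z \<in> \<Theta>z"
  shows "Q z (u + v) x = Q z u x + Q z v x" "Q z (c *\<^sub>R u) x = c * Q z u x"
  unfolding Q_def sum.distrib[symmetric] sum_distrib_left
  by (intro sum.cong refl; simp add: lin_linear kappa2_linear(1)[OF \<omega>_in[OF assms]] kappa2_linear(2)[OF \<omega>_in[OF assms] _ zero_carrier_vec])+

lemma T_linear:
  assumes "z \<in> \<Theta>z"
  shows "T z (u + v) x y = T z u x y + T z v x y" "T z (c *\<^sub>R u) x y = c * T z u x y"
  unfolding T_def sum.distrib[symmetric] sum_distrib_left
  by (intro sum.cong refl; simp add: lin_linear kappa3_linear(1)[OF \<omega>_in[OF assms]] kappa3_linear(2)[OF \<omega>_in[OF assms] _ zero_carrier_vec])+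

lemma Q_0: "u \<in> seqs d \<Longrightarrow> Q 0 u u = (norm u)\<^sup>2"
proof -
  assume u: "u \<in> seqs d"
  have "(A *\<^sub>v vec_of d u) \<bullet> (F *\<^sub>v (A *\<^sub>v vec_of d u)) = Q 0 u u / n"
    by (simp add: fisher_form Q_def \<omega>_def lin_def)
  then show ?thesis using n fisher_inner[OF u, of u] by (simp add: power2_norm_eq_inner)
qed

lemma G_inner:
  assumes Y: "\<And>i. i < n \<Longrightarrow> Y i \<in> carrier_vec k" and z: "z \<in> \<Theta>z" and u: "u \<in> seqs d"
  shows "inner (grad Y z) u = G Y z u"
  unfolding grad_def
proof (rule linear_on_seqs_expansion[symmetric, OF _ _ u])
  fix u v :: fseq and c :: real
  show "G Y z (u + v) = G Y z u + G Y z v"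
    unfolding G_def sum.distrib[symmetric]
    by (intro sum.cong refl)
      (use Y in \<open>simp add: lin_linear kappa1_linear[OF \<omega>_in[OF z]] scalar_prod_add_distrib[of _ k]\<close>)
  show "G Y z (c *\<^sub>R u) = c * G Y z u"
    unfolding G_def sum_distrib_left
    by (intro sum.cong refl)
      (use Y in \<open>simp add: lin_linear kappa1_linear(2)[OF \<omega>_in[OF z] _ zero_carrier_vec] scalar_prod_smult_distrib[of _ k] right_diff_distrib\<close>)
qed

lemma V_deriv:
  assumes Y: "\<And>i. i < n \<Longrightarrow> Y i \<in> carrier_vec k" and z: "z + t *\<^sub>R u \<in> \<Theta>z" and u: "u \<in> seqs d"
  shows "((\<lambda>t. V Y (z + t *\<^sub>R u)) has_real_derivative inner (grad Y (z + t *\<^sub>R u)) u) (at t)"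
proof -
  have "((\<lambda>t. \<Sum>i<n. \<psi> (\<omega> i z + t \<cdot>\<^sub>v lin i u) - (Y i \<bullet> \<omega> i z + t * (Y i \<bullet> lin i u))) has_real_derivative
      (\<Sum>i<n. \<kappa>1 (\<omega> i z + t \<cdot>\<^sub>v lin i u) (lin i u) - (0 + 1 * (Y i \<bullet> lin i u)))) (at t)"
  proof (intro DERIV_sum DERIV_diff psi_derivative)
    fix i assume "i \<in> {..<n}"
    then have i: "i < n" by simp
    show "\<omega> i z + t \<cdot>\<^sub>v lin i u \<in> \<Omega>" using \<omega>_in[OF z i] by (simp add: \<omega>_line[OF i])
    show "((\<lambda>t. Y i \<bullet> \<omega> i z + t * (Y i \<bullet> lin i u)) has_real_derivative 0 + 1 * (Y i \<bullet> lin i u)) (at t)"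
      by (auto intro!: derivative_eq_intros)
  qed auto
  moreover have "V Y (z + t *\<^sub>R u) = (\<Sum>i<n. \<psi> (\<omega> i z + t \<cdot>\<^sub>v lin i u) - (Y i \<bullet> \<omega> i z + t * (Y i \<bullet> lin i u)))" for t
    unfolding V_def
    by (intro sum.cong refl) (use Y in \<open>simp add: \<omega>_line scalar_prod_add_distrib[of _ k] scalar_prod_smult_distrib[of _ k]\<close>)
  moreover have "inner (grad Y (z + t *\<^sub>R u)) u = (\<Sum>i<n. \<kappa>1 (\<omega> i z + t \<cdot>\<^sub>v lin i u) (lin i u) - (0 + 1 * (Y i \<bullet> lin i u)))"
    using G_inner[where Y=Y, OF Y z u] by (simp add: G_def \<omega>_line)
  ultimately show ?thesis by simp
qed

text \<open>The form \<open>G\<close> is known to equal the inner product with \<open>grad\<close>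
  only inside \<open>\<Theta>z\<close>. So the derivative is found for \<open>G\<close> and then
  transferred on an interval of the line that stays inside, which exists because finitely many open
  conditions hold.\<close>

lemma grad_deriv:
  assumes Y: "\<And>i. i < n \<Longrightarrow> Y i \<in> carrier_vec k" and z: "z + t *\<^sub>R u \<in> \<Theta>z" "z \<in> seqs d" and u: "u \<in> seqs d" and v: "v \<in> seqs d"
  shows "((\<lambda>t. inner (grad Y (z + t *\<^sub>R u)) v) has_real_derivative Q (z + t *\<^sub>R u) u v) (at t)"
proof -
  have "((\<lambda>t. \<Sum>i<n. \<kappa>1 (\<omega> i z + t \<cdot>\<^sub>v lin i u) (lin i v) - Y i \<bullet> lin i v) has_real_derivative
      (\<Sum>i<n. \<kappa>2 (\<omega> i z + t \<cdot>\<^sub>v lin i u) (lin i u) (lin i v) - 0)) (at t)"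
  proof (intro DERIV_sum DERIV_diff kappa1_derivative DERIV_const)
    fix i assume "i \<in> {..<n}"
    then have i: "i < n" by simp
    show "\<omega> i z + t \<cdot>\<^sub>v lin i u \<in> \<Omega>" using \<omega>_in[OF z(1) i] by (simp add: \<omega>_line[OF i])
  qed auto
  moreover have "(\<Sum>i<n. \<kappa>2 (\<omega> i z + t \<cdot>\<^sub>v lin i u) (lin i u) (lin i v) - 0) = Q (z + t *\<^sub>R u) u v"
    unfolding Q_def by (intro sum.cong refl) (simp add: \<omega>_line)
  ultimately have 1: "((\<lambda>t. G Y (z + t *\<^sub>R u) v) has_real_derivative Q (z + t *\<^sub>R u) u v) (at t)"
    unfolding G_def by (simp add: \<omega>_line)
  obtain r where r: "r > 0" "\<And>h. \<bar>h\<bar> < r \<Longrightarrow> (z + t *\<^sub>R u) + h *\<^sub>R u \<in> \<Theta>z"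
  proof -
    have "\<forall>i\<in>{..<n}. \<exists>r>0. \<forall>h. \<bar>h\<bar> < r \<longrightarrow> \<omega> i (z + t *\<^sub>R u) + h \<cdot>\<^sub>v lin i u \<in> \<Omega>"
    proof
      fix i assume "i \<in> {..<n}"
      then have i: "i < n" by simp
      show "\<exists>r>0. \<forall>h. \<bar>h\<bar> < r \<longrightarrow> \<omega> i (z + t *\<^sub>R u) + h \<cdot>\<^sub>v lin i u \<in> \<Omega>"
        using natural_params_line[OF \<omega>_in[OF z(1) i] carriers(2)[OF i]] by metis
    qed
    then obtain \<rho> where \<rho>: "\<And>i. i < n \<Longrightarrow> \<rho> i > 0"
      "\<And>i h. i < n \<Longrightarrow> \<bar>h\<bar> < \<rho> i \<Longrightarrow> \<omega> i (z + t *\<^sub>R u) + h \<cdot>\<^sub>v lin i u \<in> \<Omega>"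
      unfolding Ball_def lessThan_iff by metis
    define r where "r = Min (insert 1 (\<rho> ` {..<n}))"
    have r: "r > 0" "\<And>i. i < n \<Longrightarrow> r \<le> \<rho> i" using \<rho>(1) by (auto simp: r_def)
    show ?thesis
    proof (rule that[OF r(1)])
      fix h :: real assume h: "\<bar>h\<bar> < r"
      have "\<omega> i ((z + t *\<^sub>R u) + h *\<^sub>R u) \<in> \<Omega>" if i: "i < n" for i
        unfolding \<omega>_line[OF i, of "z + t *\<^sub>R u"] using h r(2)[OF i] by (intro \<rho>(2)[OF i]) simp
      then have "\<theta> ((z + t *\<^sub>R u) + h *\<^sub>R u) \<in> param_space d k n \<mu> X"
        by (simp add: param_space_def \<omega>_def \<Xi>_def)
      moreover have "(z + t *\<^sub>R u) + h *\<^sub>R u \<in> seqs d" using z u by (auto simp: seqs_def)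
      ultimately show "(z + t *\<^sub>R u) + h *\<^sub>R u \<in> \<Theta>z" by (simp add: \<Theta>z_def)
    qed
  qed
  show ?thesis
  proof (rule has_field_derivative_transform_within[OF 1 r(1)])
    fix t' :: real assume t': "dist t' t < r"
    have "(z + t *\<^sub>R u) + (t' - t) *\<^sub>R u \<in> \<Theta>z" using t' by (intro r(2)) (simp add: dist_real_def)
    also have "(z + t *\<^sub>R u) + (t' - t) *\<^sub>R u = z + t' *\<^sub>R u" by (simp add: algebra_simps)
    finally show "G Y (z + t' *\<^sub>R u) v = inner (grad Y (z + t' *\<^sub>R u)) v" using G_inner[OF Y _ v] by simp
  qed simp
qed

lemma Q_deriv:
  assumes z: "z + t *\<^sub>R u \<in> \<Theta>z"
  shows "((\<lambda>t. Q (z + t *\<^sub>R u) v v') has_real_derivative T (z + t *\<^sub>R u) u v v') (at t)"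
proof -
  have "((\<lambda>t. \<Sum>i<n. \<kappa>2 (\<omega> i z + t \<cdot>\<^sub>v lin i u) (lin i v) (lin i v')) has_real_derivative
      (\<Sum>i<n. \<kappa>3 (\<omega> i z + t \<cdot>\<^sub>v lin i u) (lin i u) (lin i v) (lin i v'))) (at t)"
  proof (intro DERIV_sum kappa2_derivative)
    fix i assume "i \<in> {..<n}"
    then have i: "i < n" by simp
    show "\<omega> i z + t \<cdot>\<^sub>v lin i u \<in> \<Omega>" using \<omega>_in[OF z i] by (simp add: \<omega>_line[OF i])
  qed auto
  then show ?thesis by (simp add: Q_def T_def \<omega>_line)
qed

section \<open>The third derivative bound\<close>

definition D3 :: real where "D3 = real_of_ereal (delta3 d n \<mu> X th0 (2 * s))"

lemma delta3_ratio:
  assumes z: "z \<in> seqs d" "norm z \<le> 2 * s * sqrt d" and u: "u \<in> seqs d" "u \<noteq> 0"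
  shows "ereal (T z u u u / (norm u ^ 3 / sqrt n)) \<le> delta3 d n \<mu> X th0 (2 * s)"
proof -
  define w where "w = A *\<^sub>v vec_of d u"
  have zO: "\<Xi> i (\<theta> z) \<in> \<Omega>" "\<Xi> i th0 \<in> \<Omega>" if "i < n" for i
    using \<omega>_in[OF \<Theta>z_ball[OF z] that] param_spaceD[OF th0 that] by (auto simp: \<omega>_def)
  have w: "w \<in> carrier_vec d" by (simp add: w_def)
  have "w \<noteq> 0\<^sub>v d"
  proof
    assume "w = 0\<^sub>v d"
    then have "\<theta> u = \<theta> 0" using th0_carrier by (simp add: \<theta>_def[of u] w_def[symmetric])
    then show False using \<theta>_inj[OF u(1), of 0] u(2) by (simp add: seqs_def)
  qed
  then have mem: "(\<theta> z, w) \<in> nbhd d n \<mu> X th0 (2 * s) \<times> (carrier_vec d - {0\<^sub>v d})"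
    using \<theta>_nbhd[OF z(1)] z(2) w by auto
  have third: "(\<Sum>i<n. third_form \<psi> (transpose_mat (X i) *\<^sub>v \<theta> z) (transpose_mat (X i) *\<^sub>v w)) = T z u u u"
    unfolding T_def \<omega>_def lin_def w_def[symmetric]
    using third_form_psi[OF zO(1) \<Xi>_carrier] by (intro sum.cong refl) (simp add: \<Xi>_def)
  have hess: "(\<Sum>i<n. hessian_form \<psi> (transpose_mat (X i) *\<^sub>v th0) (transpose_mat (X i) *\<^sub>v w)) = (norm u)\<^sup>2"
    unfolding Q_0[OF u(1), symmetric] Q_def \<omega>_def lin_def w_def[symmetric] \<theta>_0
    using hessian_form_psi[OF zO(2) \<Xi>_carrier] by (intro sum.cong refl) (simp add: \<Xi>_def)
  \<comment> \<open>The power 3/2 of |u|^2 / n leaves n sqrt n in the denominator; one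
    \<open>n\<close> cancels against the average, which is why \<open>\<delta>\<close> is
    \<open>D3\<close> over the root of \<open>n\<close>.\<close>
  have pw: "((norm u)\<^sup>2 / n) powr (3 / 2) = norm u ^ 3 / (n * sqrt n)"
  proof -
    have nu: "norm u / sqrt n > 0" using u n by simp
    have "(norm u)\<^sup>2 / n = (norm u / sqrt n) powr real 2" using powr_realpow[OF nu, of 2] n by (simp add: power_divide)
    then have "((norm u)\<^sup>2 / n) powr (3 / 2) = (norm u / sqrt n) powr (real 2 * (3 / 2))" by (simp only: powr_powr)
    also have "real 2 * (3 / 2) = real 3" by simp
    also have "(norm u / sqrt n) powr real 3 = (norm u / sqrt n) ^ 3" by (rule powr_realpow[OF nu])
    finally show ?thesis using n by (simp add: power_divide power3_eq_cube)
  qed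
  have "ereal ((T z u u u / n) / ((norm u)\<^sup>2 / n) powr (3 / 2)) \<le> delta3 d n \<mu> X th0 (2 * s)"
    unfolding delta3_def third[symmetric] hess[symmetric] using SUP_upper[OF mem, where f = "\<lambda>(\<theta>, u). ereal
        (((\<Sum>i<n. third_form \<psi> (transpose_mat (X i) *\<^sub>v \<theta>) (transpose_mat (X i) *\<^sub>v u)) / real n)
         / ((\<Sum>i<n. hessian_form \<psi> (transpose_mat (X i) *\<^sub>v th0) (transpose_mat (X i) *\<^sub>v u)) / real n) powr (3 / 2))"]
    by simp
  also have "(T z u u u / n) / ((norm u)\<^sup>2 / n) powr (3 / 2) = T z u u u / (norm u ^ 3 / sqrt n)"
    unfolding pw using n by simp
  finally show ?thesis .
qed

text \<open>The supremum in \<open>delta3\<close> carries no absolute value; since the cubic form is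
  odd, the direction - u supplies the missing lower bound.\<close>

lemma T_neg: "z \<in> \<Theta>z \<Longrightarrow> T z (- u) (- u) (- u) = - T z u u u"
proof -
  assume z: "z \<in> \<Theta>z"
  have neg: "T z (- a) b c = - T z a b c" for a b c using T_linear(2)[OF z, of "- 1" a b c] by simp
  have sym: "T z a b c = T z b a c" "T z a b c = T z a c b" for a b c
    by (simp_all add: T_def kappa3_sym)
  have "T z (- u) (- u) (- u) = - T z u (- u) (- u)" by (rule neg)
  also have "T z u (- u) (- u) = T z (- u) u (- u)" by (rule sym)
  also have "\<dots> = - T z u u (- u)" by (rule neg)
  also have "T z u u (- u) = T z u (- u) u" by (rule sym)
  also have "\<dots> = T z (- u) u u" by (rule sym)
  also have "\<dots> = - T z u u u" by (rule neg)
  finally show ?thesis by simp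
qed

lemma delta3_eq: "delta3 d n \<mu> X th0 (2 * s) = ereal D3" and D3_nonneg: "D3 \<ge> 0"
proof -
  define u where "u = fseq_unit d 0"
  have "coord u 0 = 1" using d by (simp add: u_def fseq_unit_def)
  then have u0: "u \<noteq> 0" by auto
  have u: "u \<in> seqs d" "u \<noteq> 0" "- u \<in> seqs d" using u0 by (auto simp: u_def seqs_def fseq_unit_def)
  have z: "0 \<in> seqs d" "norm (0::fseq) \<le> 2 * s * sqrt d" using s by (auto simp: seqs_def)
  define x where "x = T 0 u u u / (norm u ^ 3 / sqrt n)"
  have "ereal x \<le> delta3 d n \<mu> X th0 (2 * s)" using delta3_ratio[OF z u(1,2)] by (simp add: x_def)
  moreover have "ereal (- x) \<le> delta3 d n \<mu> X th0 (2 * s)"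
    using delta3_ratio[OF z u(3)] u(2) T_neg[OF \<Theta>z_ball[OF z], of u] by (simp add: x_def)
  ultimately have nn: "delta3 d n \<mu> X th0 (2 * s) \<ge> 0"
    by (cases "x \<ge> 0") (auto intro: order_trans[rotated])
  \<comment> \<open>An infinite value would violate the smallness condition of the locale, where the
    other factors are positive.\<close>
  have "delta3 d n \<mu> X th0 (2 * s) \<noteq> \<infinity>"
  proof
    assume "delta3 d n \<mu> X th0 (2 * s) = \<infinity>"
    then show False using delta3 s d n by simp
  qed
  then show "delta3 d n \<mu> X th0 (2 * s) = ereal D3" "D3 \<ge> 0"
    using nn unfolding D3_def by (cases "delta3 d n \<mu> X th0 (2 * s)"; auto)+
qed

definition \<delta> :: real where "\<delta> = D3 / sqrt n"

lemma potential_glm: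
  assumes Y: "\<And>i. i < n \<Longrightarrow> Y i \<in> carrier_vec k"
  shows "potential d s \<delta> \<Theta>z (V Y) (grad Y) Q T"
proof
  show "0 \<le> \<delta>" using D3_nonneg by (simp add: \<delta>_def)
  have "2 * s * D3 * sqrt (real d / real n) \<le> 1 / 4" using delta3 by (simp add: delta3_eq)
  then show "2 * s * \<delta> * sqrt d \<le> 1 / 4" by (simp add: \<delta>_def real_sqrt_divide)
  show "Q z u u \<ge> 0" if "z \<in> \<Theta>z" for z u
    unfolding Q_def using \<omega>_in[OF that] by (intro sum_nonneg kappa2_nonneg) auto
  show "Q z u v = Q z v u" for z u v unfolding Q_def by (simp add: kappa2_sym)
  show "T z u v x = T z v u x" "T z u v x = T z u x v" for z u v x unfolding T_def by (simp_all add: kappa3_sym)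
  show "\<bar>T z u u u\<bar> \<le> \<delta> * norm u ^ 3" if z: "z \<in> seqs d" "norm z \<le> 2 * s * sqrt d" and u: "u \<in> seqs d" for z u
  proof (cases "u = 0")
    case True
    have "T z u u u = 0" using T_linear(2)[OF \<Theta>z_ball[OF z], of 0 u u u] True by simp
    then show ?thesis using True by simp
  next
    case False
    have le: "T z v v v \<le> \<delta> * norm v ^ 3" if "v \<in> seqs d" "v \<noteq> 0" for v
    proof -
      have "T z v v v / (norm v ^ 3 / sqrt n) \<le> D3" using delta3_ratio[OF z that] by (simp add: delta3_eq)
      then show ?thesis using that n by (simp add: \<delta>_def field_simps)
    qed
    have "- u \<in> seqs d" using u by (auto simp: seqs_def)
    then show ?thesis using le[OF u False] le[of "- u"] False T_neg[OF \<Theta>z_ball[OF z], of u] by simp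
  qed
qed (use d s Y \<Theta>z_sub \<Theta>z_ball \<Theta>z_segment V_deriv grad_deriv Q_deriv Q_linear T_linear Q_0 in
  \<open>auto simp: grad_def\<close>)

end

text \<open>The measurability part of Tonelli's theorem asks for a sigma-finite measure, so the
  integral over \<mu> is rewritten over a fixed member of the family, a probability measure, with
  the density moved into the integrand \<open>f\<close>.\<close>

lemma (in exp_family) log_partition_measurable:
  assumes g: "\<And>i. i < k \<Longrightarrow> (\<lambda>x. g x $ i) \<in> borel_measurable N" "\<And>x. x \<in> space N \<Longrightarrow> g x \<in> carrier_vec k"
  shows "(\<lambda>x. \<psi> (g x)) \<in> borel_measurable N" "{x \<in> space N. g x \<in> \<Omega>} \<in> sets N"
proof -
  obtain \<omega> where \<omega>: "\<omega> \<in> \<Omega>" using nonempty by auto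
  define P where "P = expfam \<mu> \<omega>"
  interpret P: prob_space P unfolding P_def by (rule prob_space_expfam[OF \<omega>])
  have sets_P: "sets P = sets \<mu>" by (simp add: P_def expfam_def)
  have coord_P: "(\<lambda>y. y $ i) \<in> borel_measurable P" if "i < k" for i
    using measurable_muI[OF vec_index_measurable[OF that]] sets_P by (simp cong: measurable_cong_sets)
  define f where "f = (\<lambda>x y. ennreal (exp ((\<Sum>i<k. g x $ i * y $ i) - (\<Sum>i<k. \<omega> $ i * y $ i) + \<psi> \<omega>)))"
  have "(\<lambda>(x, y). f x y) \<in> borel_measurable (N \<Otimes>\<^sub>M P)"
    unfolding f_def split_beta'
    by (intro measurable_compose[OF _ measurable_ennreal] measurable_compose[OF _ borel_measurable_exp]
        borel_measurable_add borel_measurable_diff borel_measurable_sum borel_measurable_times borel_measurable_const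
        measurable_compose[OF measurable_fst g(1)] measurable_compose[OF measurable_snd coord_P]) auto
  then have J: "(\<lambda>x. \<integral>\<^sup>+y. f x y \<partial>P) \<in> borel_measurable N" by (rule P.borel_measurable_nn_integral)
  have eq: "(\<integral>\<^sup>+y. ennreal (exp (g x \<bullet> y)) \<partial>\<mu>) = (\<integral>\<^sup>+y. f x y \<partial>P)" if x: "x \<in> space N" for x
  proof -
    have sp: "u \<bullet> y = (\<Sum>i<k. u $ i * y $ i)" if "y \<in> space \<mu>" for u y
      using space_mu_carrier[OF that] by (simp add: scalar_prod_def lessThan_atLeast0)
    have fm: "f x \<in> borel_measurable \<mu>"
    proof -
      have "f x \<in> borel_measurable P"
        unfolding f_def
        by (intro measurable_compose[OF _ measurable_ennreal] measurable_compose[OF _ borel_measurable_exp]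
            borel_measurable_add borel_measurable_diff borel_measurable_sum borel_measurable_times borel_measurable_const
            coord_P) auto
      then show ?thesis using sets_P by (simp cong: measurable_cong_sets)
    qed
    have dm: "(\<lambda>y. ennreal (exp (\<omega> \<bullet> y - \<psi> \<omega>))) \<in> borel_measurable \<mu>"
      using scalar_prod_measurable[OF \<Omega>_carrier[OF \<omega>]] by measurable
    have "(\<integral>\<^sup>+y. f x y \<partial>P) = (\<integral>\<^sup>+y. ennreal (exp (\<omega> \<bullet> y - \<psi> \<omega>)) * f x y \<partial>\<mu>)"
      unfolding P_def expfam_def by (rule nn_integral_density[OF dm fm])
    also have "\<dots> = (\<integral>\<^sup>+y. ennreal (exp (g x \<bullet> y)) \<partial>\<mu>)"
      by (intro nn_integral_cong) (simp add: f_def sp flip: ennreal_mult exp_add)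
    finally show ?thesis by simp
  qed
  have "\<psi> (g x) = ln (enn2real (\<integral>\<^sup>+y. f x y \<partial>P))" if x: "x \<in> space N" for x
  proof -
    have "(\<lambda>y. exp (g x \<bullet> y)) \<in> borel_measurable \<mu>"
      using scalar_prod_measurable[OF g(2)[OF x]] by measurable
    then have "(\<integral>y. exp (g x \<bullet> y) \<partial>\<mu>) = enn2real (\<integral>\<^sup>+y. ennreal (exp (g x \<bullet> y)) \<partial>\<mu>)"
      by (rule integral_eq_nn_integral) simp
    then show ?thesis by (simp add: log_partition_def eq[OF x])
  qed
  moreover have "(\<lambda>x. ln (enn2real (\<integral>\<^sup>+y. f x y \<partial>P))) \<in> borel_measurable N"
    using J by measurable
  ultimately show "(\<lambda>x. \<psi> (g x)) \<in> borel_measurable N" by (simp cong: measurable_cong)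
  have "{x \<in> space N. g x \<in> \<Omega>} = {x \<in> space N. (\<integral>\<^sup>+y. f x y \<partial>P) < \<infinity>}"
    using g(2) eq by (auto simp: natural_params_def)
  also have "\<dots> \<in> sets N" using J by measurable
  finally show "{x \<in> space N. g x \<in> \<Omega>} \<in> sets N" .
qed

context glm_white
begin

section \<open>Measurability, the law of the sample and the score\<close>

lemma \<Xi>_index_measurable: "i < n \<Longrightarrow> j < k \<Longrightarrow> (\<lambda>t. \<Xi> i t $ j) \<in> borel_measurable (lborel_vec d)"
proof -
  assume i: "i < n" and j: "j < k"
  have "(\<lambda>t. \<Sum>l<d. transpose_mat (X i) $$ (j, l) * t $ l) \<in> borel_measurable (lborel_vec d)"
    by (intro borel_measurable_sum borel_measurable_times borel_measurable_const vec_index_measurable) auto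
  moreover have "\<Xi> i t $ j = (\<Sum>l<d. transpose_mat (X i) $$ (j, l) * t $ l)" if "t \<in> space (lborel_vec d)" for t
    using that X[OF i] j by (auto simp: \<Xi>_def space_lborel_vec scalar_prod_def lessThan_atLeast0 intro!: sum.cong)
  ultimately show ?thesis by (simp cong: measurable_cong)
qed

lemma param_space_measurable: "param_space d k n \<mu> X \<in> sets (lborel_vec d)"
proof -
  have "{t \<in> space (lborel_vec d). \<forall>i\<in>{..<n}. t \<in> {t \<in> space (lborel_vec d). \<Xi> i t \<in> \<Omega>}} \<in> sets (lborel_vec d)"
    by (intro sets.sets_Collect_finite_All')
      (use n log_partition_measurable(2)[OF \<Xi>_index_measurable] in \<open>auto simp: lessThan_empty_iff\<close>)
  also have "{t \<in> space (lborel_vec d). \<forall>i\<in>{..<n}. t \<in> {t \<in> space (lborel_vec d). \<Xi> i t \<in> \<Omega>}} = param_space d k n \<mu> X"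
    by (auto simp: param_space_def space_lborel_vec \<Xi>_def)
  finally show ?thesis .
qed

lemma nll_measurable:
  assumes Y: "\<And>i. i < n \<Longrightarrow> Y i \<in> carrier_vec k"
  shows "nll n \<mu> X Y \<in> borel_measurable (lborel_vec d)"
proof -
  have "(\<lambda>t. (\<Sum>i<n. \<psi> (\<Xi> i t) - (\<Sum>j<k. Y i $ j * \<Xi> i t $ j)) / n) \<in> borel_measurable (lborel_vec d)"
    by (intro borel_measurable_divide borel_measurable_sum borel_measurable_diff borel_measurable_times
        borel_measurable_const log_partition_measurable(1) \<Xi>_index_measurable) auto
  moreover have "nll n \<mu> X Y t = (\<Sum>i<n. \<psi> (\<Xi> i t) - (\<Sum>j<k. Y i $ j * \<Xi> i t $ j)) / n" for t
    unfolding nll_def \<Xi>_def[symmetric] scalar_prod_def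
    by (simp add: carrier_vecD[OF \<Xi>_carrier] lessThan_atLeast0)
  ultimately show ?thesis by (simp cong: measurable_cong)
qed

lemma \<theta>_measurable: "\<theta> \<in> lborel_fseq d \<rightarrow>\<^sub>M lborel_vec d"
  using nn_integral_whitening(2)[OF L A(1,2) th0_carrier, of "\<lambda>_. 0"] by (simp add: \<theta>_def[abs_def])

lemma \<Theta>z_measurable: "\<Theta>z \<in> sets (lborel_fseq d)"
proof -
  have "\<theta> -` param_space d k n \<mu> X \<inter> space (lborel_fseq d) \<in> sets (lborel_fseq d)"
    by (rule measurable_sets[OF \<theta>_measurable param_space_measurable])
  also have "\<theta> -` param_space d k n \<mu> X \<inter> space (lborel_fseq d) = \<Theta>z"
    by (auto simp: \<Theta>z_def space_lborel_fseq)
  finally show ?thesis .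
qed

lemma V_measurable:
  assumes "\<And>i. i < n \<Longrightarrow> Y i \<in> carrier_vec k"
  shows "V Y \<in> borel_measurable (lborel_fseq d)"
proof -
  have "(\<lambda>z. n * nll n \<mu> X Y (\<theta> z)) \<in> borel_measurable (lborel_fseq d)"
    by (intro borel_measurable_times borel_measurable_const measurable_compose[OF \<theta>_measurable nll_measurable] assms)
  also have "(\<lambda>z. n * nll n \<mu> X Y (\<theta> z)) = V Y" using n by (auto simp: nll_\<theta>)
  finally show ?thesis .
qed

abbreviation law :: "(nat \<Rightarrow> real Matrix.vec) measure" where "law \<equiv> sample_law n \<mu> X th0"

lemma law_eq: "law = (\<Pi>\<^sub>M i\<in>{..<n}. expfam \<mu> (\<omega> i 0))"
  by (simp add: sample_law_def \<omega>_def \<Xi>_def)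

lemma zero_in: "(0::fseq) \<in> \<Theta>z"
  using s by (intro \<Theta>z_ball) (auto simp: seqs_def)

lemma prob_space_law: "prob_space law"
  unfolding law_eq using \<omega>_in[OF zero_in] by (intro prob_space_PiM prob_space_expfam) auto

lemma law_carrier:
  assumes "Y \<in> space law" "i < n"
  shows "Y i \<in> carrier_vec k"
proof -
  have "Y i \<in> space (expfam \<mu> (\<omega> i 0))" using assms by (auto simp: law_eq space_PiM)
  then show ?thesis using space_mu_carrier by (simp add: expfam_def)
qed

lemma score_measurable: "(\<lambda>Y. grad Y 0) \<in> law \<rightarrow>\<^sub>M lborel_fseq d"
proof (rule measurable_into_lborel_fseq)
  fix j assume j: "j < d"
  have "(\<lambda>Y. \<Sum>i<n. \<kappa>1 (\<omega> i 0) (lin i (fseq_unit d j)) - Y i \<bullet> lin i (fseq_unit d j)) \<in> borel_measurable law"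
  proof (intro borel_measurable_sum borel_measurable_diff borel_measurable_const)
    fix i assume "i \<in> {..<n}"
    then have i: "i < n" by simp
    have "(\<lambda>y. lin i (fseq_unit d j) \<bullet> y) \<in> borel_measurable (expfam \<mu> (\<omega> i 0))"
      using scalar_prod_measurable[OF carriers(2)[OF i]] by (simp add: expfam_def)
    then have "(\<lambda>Y. lin i (fseq_unit d j) \<bullet> Y i) \<in> borel_measurable law"
      unfolding law_eq
      by (rule measurable_compose[OF measurable_component_singleton[of i "{..<n}" "\<lambda>i. expfam \<mu> (\<omega> i 0)"], rotated])
        (use i in auto)
    moreover have "Y i \<bullet> lin i (fseq_unit d j) = lin i (fseq_unit d j) \<bullet> Y i" if "Y \<in> space law" for Y
      by (rule comm_scalar_prod[OF law_carrier[OF that i] carriers(2)[OF i]])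
    ultimately show "(\<lambda>Y. Y i \<bullet> lin i (fseq_unit d j)) \<in> borel_measurable law" by (simp cong: measurable_cong)
  qed
  then show "(\<lambda>Y. coord (grad Y 0) j) \<in> borel_measurable law" using j by (simp add: grad_def G_def)
qed (simp add: grad_def)

text \<open>By independence the moment generating function is a product, and its logarithm is
  exactly the first-order Taylor remainder of the potential at the origin, which
  \<open>V_upper\<close> bounds.\<close>

lemma score_mgf:
  assumes v: "v \<in> seqs d" "norm v \<le> 2 * s * sqrt d"
  shows "(\<integral>\<^sup>+Y. ennreal (exp (inner (- grad Y 0) v)) \<partial>law) \<le> ennreal (exp (13 / 24 * (norm v)\<^sup>2))"
proof -
  \<comment> \<open>The indices from \<open>n\<close> on get the law with index 0, because the
    product locale asks for a sigma-finite measure at every index.\<close>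
  define P where "P = (\<lambda>i. expfam \<mu> (\<omega> (if i < n then i else 0) 0))"
  have P_prob: "prob_space (P i)" for i
    unfolding P_def using n by (intro prob_space_expfam \<omega>_in[OF zero_in]) auto
  interpret P: product_sigma_finite P
    unfolding product_sigma_finite_def using P_prob prob_space_imp_sigma_finite by blast
  have law_P: "law = (\<Pi>\<^sub>M i\<in>{..<n}. P i)" unfolding law_eq by (rule PiM_cong) (auto simp: P_def)
  have \<omega>_sum: "\<omega> i 0 + lin i v = \<omega> i v" if "i < n" for i
    using \<omega>_line[OF that, of 0 1 v] by simp
  have meas: "(\<lambda>y. ennreal (exp (lin i v \<bullet> y))) \<in> borel_measurable (P i)" if "i < n" for i
    using scalar_prod_measurable[OF carriers(2)[OF that]] by (simp add: P_def expfam_def)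
  define c where "c = (\<Sum>i<n. \<kappa>1 (\<omega> i 0) (lin i v))"
  have "(\<integral>\<^sup>+Y. ennreal (exp (inner (- grad Y 0) v)) \<partial>law)
      = (\<integral>\<^sup>+Y. ennreal (exp (- c)) * (\<Prod>i<n. ennreal (exp (lin i v \<bullet> Y i))) \<partial>law)"
  proof (intro nn_integral_cong)
    fix Y assume Y: "Y \<in> space law"
    have "inner (- grad Y 0) v = (\<Sum>i<n. lin i v \<bullet> Y i) - c"
      using G_inner[OF law_carrier[OF Y] zero_in v(1)] comm_scalar_prod[OF law_carrier[OF Y] carriers(2)]
      by (simp add: G_def sum_subtractf c_def)
    then have "exp (inner (- grad Y 0) v) = exp (- c) * (\<Prod>i<n. exp (lin i v \<bullet> Y i))"
      by (simp only: exp_sum[symmetric] finite_lessThan exp_add[symmetric]) simp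
    then show "ennreal (exp (inner (- grad Y 0) v)) = ennreal (exp (- c)) * (\<Prod>i<n. ennreal (exp (lin i v \<bullet> Y i)))"
      by (simp only: prod_ennreal exp_ge_zero) (simp add: ennreal_mult prod_nonneg)
  qed
  also have "\<dots> = ennreal (exp (- c)) * (\<integral>\<^sup>+Y. (\<Prod>i<n. ennreal (exp (lin i v \<bullet> Y i))) \<partial>law)"
    unfolding law_P using meas
    by (intro nn_integral_cmult borel_measurable_prod measurable_compose[OF measurable_component_singleton]) auto
  also have "(\<integral>\<^sup>+Y. (\<Prod>i<n. ennreal (exp (lin i v \<bullet> Y i))) \<partial>law) = (\<Prod>i<n. \<integral>\<^sup>+y. ennreal (exp (lin i v \<bullet> y)) \<partial>P i)"
    unfolding law_P using meas by (intro P.product_nn_integral_prod) auto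
  also have "\<dots> = (\<Prod>i<n. ennreal (exp (\<psi> (\<omega> i v) - \<psi> (\<omega> i 0))))"
  proof (rule prod.cong[OF refl])
    fix i assume "i \<in> {..<n}"
    then have i: "i < n" by simp
    show "(\<integral>\<^sup>+y. ennreal (exp (lin i v \<bullet> y)) \<partial>P i) = ennreal (exp (\<psi> (\<omega> i v) - \<psi> (\<omega> i 0)))"
      using expfam_mgf[OF \<omega>_in[OF zero_in i] _ carriers(2)[OF i], of v] \<omega>_in[OF \<Theta>z_ball[OF v] i] i
      by (simp add: P_def \<omega>_sum)
  qed
  also have "ennreal (exp (- c)) * \<dots> = ennreal (exp ((\<Sum>i<n. \<psi> (\<omega> i v) - \<psi> (\<omega> i 0)) - c))"
  proof -
    have "exp ((\<Sum>i<n. \<psi> (\<omega> i v) - \<psi> (\<omega> i 0)) - c) = exp (- c) * (\<Prod>i<n. exp (\<psi> (\<omega> i v) - \<psi> (\<omega> i 0)))"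
      by (simp only: exp_sum[symmetric] finite_lessThan exp_add[symmetric]) simp
    then show ?thesis by (simp only: prod_ennreal exp_ge_zero) (simp add: ennreal_mult prod_nonneg)
  qed
  also have "\<dots> \<le> ennreal (exp (13 / 24 * (norm v)\<^sup>2))"
  proof -
    \<comment> \<open>The Taylor remainder of \<open>V Y\<close> does not depend on the data, whose
      contribution is linear; zero data are as good as any.\<close>
    define Y where "Y = (\<lambda>i::nat. 0\<^sub>v k :: real Matrix.vec)"
    have Y: "Y i \<in> carrier_vec k" for i by (simp add: Y_def)
    interpret potential d s \<delta> \<Theta>z "V Y" "grad Y" Q T by (rule potential_glm[OF Y])
    have "inner (grad Y 0) v = G Y 0 v" by (rule G_inner[OF Y zero_in v(1)])
    then have "V Y v - V Y 0 - inner (grad Y 0) v = (\<Sum>i<n. \<psi> (\<omega> i v) - \<psi> (\<omega> i 0)) - c"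
      using carriers by (simp add: V_def G_def Y_def c_def sum_subtractf)
    then show ?thesis using V_upper[of v] v by (simp add: R_def)
  qed
  finally show ?thesis .
qed

definition score_event :: "(nat \<Rightarrow> real Matrix.vec) set" where
  "score_event = {Y \<in> space law. norm (grad Y 0) \<le> 7 / 10 * s * sqrt d}"

lemma score_event:
  "score_event \<in> sets law" "measure law score_event \<ge> 1 - exp (- (d * s\<^sup>2 / 10))"
proof -
  note [measurable] = norm_measurable_fseq[OF score_measurable]
  show "score_event \<in> sets law" unfolding score_event_def by measurable
  have "(\<lambda>Y. - grad Y 0) \<in> law \<rightarrow>\<^sub>M lborel_fseq d"
  proof (rule measurable_into_lborel_fseq)
    show "(\<lambda>Y. coord (- grad Y 0) i) \<in> borel_measurable law" for i
      using measurable_compose[OF score_measurable coord_measurable[of i d]] by simp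
  qed (simp add: grad_def seqs_def)
  from score_tail[OF prob_space_law d s this score_mgf]
  show "measure law score_event \<ge> 1 - exp (- (d * s\<^sup>2 / 10))" by (simp add: score_event_def)
qed

lemma potential_score_glm:
  assumes "Y \<in> score_event"
  shows "potential_score d s \<delta> \<Theta>z (V Y) (grad Y) Q T"
  using assms law_carrier
  by (intro potential_score.intro potential_glm potential_score_axioms.intro) (auto simp: score_event_def)

text \<open>\<open>\<theta>\<close> maps \<open>\<Theta>z\<close> onto the parameter space and the
  potential is n times the negative log likelihood, so the unique minimiser is transported.
  Uniqueness also determines the choice made by \<open>arg_min\<close>.\<close>

lemma MLE_whitened:
  assumes Y: "Y \<in> score_event"
  shows "MLE_unique d k n \<mu> X Y" "MLE d k n \<mu> X Y = \<theta> (potential_score.zh d s (grad Y))"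
proof -
  interpret PS: potential_score d s \<delta> \<Theta>z "V Y" "grad Y" Q T by (rule potential_score_glm[OF Y])
  have min: "is_arg_min (nll n \<mu> X Y) (\<lambda>t. t \<in> param_space d k n \<mu> X) t \<longleftrightarrow> t = \<theta> PS.zh" for t
  proof
    have zh_in: "\<theta> PS.zh \<in> param_space d k n \<mu> X" using PS.zh_in_\<Theta> by (simp add: \<Theta>z_def)
    have ex: "\<exists>z\<in>\<Theta>z. \<theta> z = t" if "t \<in> param_space d k n \<mu> X" for t
    proof
      show "\<theta> (of_vec d (L *\<^sub>v (t - th0))) = t" using that by (intro \<theta>_surj) (simp add: param_space_def)
      then show "of_vec d (L *\<^sub>v (t - th0)) \<in> \<Theta>z" using that by (simp add: \<Theta>z_def)
    qed
    show "t = \<theta> PS.zh" if t: "is_arg_min (nll n \<mu> X Y) (\<lambda>t. t \<in> param_space d k n \<mu> X) t"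
    proof -
      obtain z where z: "z \<in> \<Theta>z" "\<theta> z = t" using ex[of t] t by (auto simp: is_arg_min_def)
      have "\<not> V Y PS.zh / n < V Y z / n" using t zh_in z(2) by (auto simp: is_arg_min_def nll_\<theta>)
      then have "\<not> V Y PS.zh < V Y z" using n divide_strict_right_mono[of "V Y PS.zh" "V Y z" "real n"] by auto
      then show ?thesis using PS.minimizer_unique(2)[OF z(1)] z(2) by auto
    qed
    have "\<not> nll n \<mu> X Y t < nll n \<mu> X Y (\<theta> PS.zh)" if t: "t \<in> param_space d k n \<mu> X" for t
    proof -
      obtain z where z: "z \<in> \<Theta>z" "\<theta> z = t" using ex[OF t] by auto
      show ?thesis using PS.minimizer_unique(1)[OF z(1)] n
        by (simp add: nll_\<theta> z(2)[symmetric] divide_right_mono not_less)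
    qed
    then show "is_arg_min (nll n \<mu> X Y) (\<lambda>t. t \<in> param_space d k n \<mu> X) t" if "t = \<theta> PS.zh"
      using that zh_in by (auto simp: is_arg_min_def)
  qed
  show "MLE_unique d k n \<mu> X Y" by (simp add: MLE_unique_def min)
  show "MLE d k n \<mu> X Y = \<theta> PS.zh" by (simp add: MLE_def arg_min_def min)
qed

end

section \<open>The prior and the posterior in whitened coordinates\<close>

text \<open>D stands for delta01 and K for exp (d M0), when these are finite.\<close>

locale glm_prior = glm_white k YY \<mu> d n X th0 L A s
  for k :: nat and YY \<mu> d n X th0 and L A :: "real mat" and s :: real +
  fixes p0 :: "real Matrix.vec \<Rightarrow> real" and D K :: real
  assumes p0_measurable: "p0 \<in> borel_measurable (lborel_vec d)"
    and p0_pos: "\<And>t. t \<in> param_space d k n \<mu> X \<Longrightarrow> p0 t > 0"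
    and p0_le: "\<And>t. t \<in> param_space d k n \<mu> X \<Longrightarrow> p0 t \<le> K * p0 th0"
    and p0_C1: "C1_on d (nbhd d n \<mu> X th0 (2 * s)) p0"
    and D: "\<And>t. t \<in> nbhd d n \<mu> X th0 (2 * s) \<Longrightarrow> dual_norm_wrt F (gradient (\<lambda>t. ln (p0 t)) t) \<le> D"
begin

text \<open>The gradient that the chain rule gives for \<open>p0\<close> composed with the whitening
  map, written as the vector representing a linear form.\<close>

definition gp :: "fseq \<Rightarrow> fseq" where
  "gp z = fseq_of d (\<lambda>j. gradient p0 (\<theta> z) \<bullet> (A *\<^sub>v vec_of d (fseq_unit d j)))"

definition glp :: "fseq \<Rightarrow> fseq" where "glp z = (1 / p0 (\<theta> z)) *\<^sub>R gp z"

lemma gradient_carrier: "gradient f (\<theta> z) \<in> carrier_vec d"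
  using \<theta>_carrier[of z] by (auto simp: gradient_def)

lemma gp_inner: "u \<in> seqs d \<Longrightarrow> inner (gp z) u = gradient p0 (\<theta> z) \<bullet> (A *\<^sub>v vec_of d u)"
  unfolding gp_def
  by (rule linear_on_seqs_expansion[symmetric])
    (auto simp: Avec_linear scalar_prod_add_distrib[OF gradient_carrier] scalar_prod_smult_distrib[OF gradient_carrier])

lemma gradient_ln:
  assumes t: "t \<in> nbhd d n \<mu> X th0 (2 * s)"
  shows "gradient (\<lambda>t. ln (p0 t)) t = (1 / p0 t) \<cdot>\<^sub>v gradient p0 t"
proof -
  have td: "dim_vec t = d" "t \<in> carrier_vec d" using t by (auto simp: nbhd_def)
  have pos: "p0 t > 0" using t nbhd p0_pos by auto
  have "partial j (\<lambda>t. ln (p0 t)) t = 1 / p0 t * partial j p0 t" if j: "j < d" for j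
  proof -
    have z: "t + 0 \<cdot>\<^sub>v unit_vec d j = t" using td by (auto intro!: eq_vecI)
    have "(\<lambda>r. p0 (t + r \<cdot>\<^sub>v unit_vec d j)) differentiable (at 0)" using p0_C1 t j by (simp add: C1_on_def)
    then have "((\<lambda>r. p0 (t + r \<cdot>\<^sub>v unit_vec d j)) has_real_derivative partial j p0 t) (at 0)"
      by (simp add: partial_def td DERIV_deriv_iff_real_differentiable)
    then have "((\<lambda>r. ln (p0 (t + r \<cdot>\<^sub>v unit_vec d j))) has_real_derivative partial j p0 t / p0 t) (at 0)"
      by (auto intro!: derivative_eq_intros simp: z pos)
    then show ?thesis by (simp add: partial_def[of j "\<lambda>t. ln (p0 t)"] td DERIV_imp_deriv)
  qed
  then show ?thesis using td by (auto simp: gradient_def intro!: eq_vecI)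
qed

text \<open>\<open>C1_on\<close> speaks of the original coordinates. The strict bound on |z| leaves
  room for a Euclidean ball around \<open>\<theta> z\<close> inside the neighbourhood, and operator
  bounds for \<open>L\<close> and \<open>A\<close> convert distances both ways.\<close>

lemma p0_derivative:
  assumes z: "z \<in> seqs d" "norm z < 2 * s * sqrt d"
  shows "((\<lambda>z. p0 (\<theta> z)) has_derivative (\<lambda>u. inner (gp z) u)) (at z within seqs d)"
  unfolding has_derivative_within_alt
proof (intro conjI allI impI)
  show "bounded_linear (inner (gp z))" by (rule bounded_linear_inner_right)
  fix e :: real assume e: "e > 0"
  obtain CA where CA: "CA > 0" "\<And>u :: real Matrix.vec. u \<in> carrier_vec d \<Longrightarrow> vnorm (A *\<^sub>v u) \<le> CA * vnorm u"
    using mat_vec_norm_bound[OF A(1)] by blast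
  obtain CL where CL: "CL > 0" "\<And>u :: real Matrix.vec. u \<in> carrier_vec d \<Longrightarrow> vnorm (L *\<^sub>v u) \<le> CL * vnorm u"
    using mat_vec_norm_bound[OF L(1)] by blast
  define r where "r = (2 * s * sqrt d - norm z) / CL"
  have r: "r > 0" using z(2) CL(1) by (simp add: r_def)
  have ball: "\<theta> z + u \<in> nbhd d n \<mu> X th0 (2 * s)" if u: "u \<in> carrier_vec d" "vnorm u < r" for u
  proof -
    have Lu: "L *\<^sub>v u \<in> carrier_vec d" using L(1) u by simp
    define x where "x = of_vec d (L *\<^sub>v u)"
    have "\<theta> (z + 1 *\<^sub>R x) = \<theta> z + 1 \<cdot>\<^sub>v (A *\<^sub>v vec_of d x)" by (rule \<theta>_line)
    also have "A *\<^sub>v vec_of d x = u" using Lu A_L[OF u(1)] by (simp add: x_def)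
    finally have eq: "\<theta> z + u = \<theta> (z + x)" by simp
    have "norm x = vnorm (L *\<^sub>v u)" using vnorm_eq_norm[OF Lu] by (simp add: x_def)
    also have "\<dots> \<le> CL * vnorm u" by (rule CL(2)[OF u(1)])
    also have "\<dots> \<le> CL * r" using u(2) CL(1) by (intro mult_left_mono) auto
    also have "\<dots> = 2 * s * sqrt d - norm z" using CL(1) by (simp add: r_def)
    finally have "norm (z + x) \<le> 2 * s * sqrt d" using norm_triangle_ineq[of z x] by linarith
    moreover have "z + x \<in> seqs d" using z(1) by (auto simp: seqs_def x_def of_vec_def)
    ultimately show ?thesis unfolding eq using \<theta>_nbhd by blast
  qed
  have "nbhd d n \<mu> X th0 (2 * s) \<subseteq> carrier_vec d" by (auto simp: nbhd_def)
  from C1_on_increment[OF p0_C1 this \<theta>_carrier r ball divide_pos_pos[OF e CA(1)]]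
  obtain \<rho> where \<rho>: "\<rho> > 0"
    "\<And>u. u \<in> carrier_vec d \<Longrightarrow> vnorm u < \<rho> \<Longrightarrow> \<bar>p0 (\<theta> z + u) - p0 (\<theta> z) - gradient p0 (\<theta> z) \<bullet> u\<bar> \<le> e / CA * vnorm u"
    by blast
  show "\<exists>\<delta>>0. \<forall>y\<in>seqs d. norm (y - z) < \<delta> \<longrightarrow>
      norm (p0 (\<theta> y) - p0 (\<theta> z) - inner (gp z) (y - z)) \<le> e * norm (y - z)"
  proof (intro exI[of _ "\<rho> / CA"] conjI ballI impI)
    show "\<rho> / CA > 0" using \<rho> CA by simp
    fix y assume y: "y \<in> seqs d" "norm (y - z) < \<rho> / CA"
    define x where "x = y - z"
    have x: "x \<in> seqs d" using y z by (auto simp: x_def seqs_def)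
    define u where "u = A *\<^sub>v vec_of d x"
    have u: "u \<in> carrier_vec d" by (simp add: u_def)
    have vu: "vnorm u \<le> CA * norm x"
      using CA(2)[of "vec_of d x"] vnorm_eq_norm[of "vec_of d x" d] x by (simp add: u_def)
    have "CA * norm x < \<rho>" using y CA(1) by (simp add: x_def field_simps)
    then have small: "vnorm u < \<rho>" using vu by linarith
    have "\<theta> (z + 1 *\<^sub>R x) = \<theta> z + 1 \<cdot>\<^sub>v u" unfolding u_def by (rule \<theta>_line)
    then have "\<theta> y = \<theta> z + u" by (simp add: x_def)
    moreover have "inner (gp z) x = gradient p0 (\<theta> z) \<bullet> u" using gp_inner[OF x] by (simp add: u_def)
    ultimately have "norm (p0 (\<theta> y) - p0 (\<theta> z) - inner (gp z) x) \<le> e / CA * vnorm u"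
      using \<rho>(2)[OF u small] by simp
    also have "\<dots> \<le> e / CA * (CA * norm x)" using vu e CA(1) by (intro mult_left_mono) auto
    also have "\<dots> = e * norm x" using CA(1) by simp
    finally show "norm (p0 (\<theta> y) - p0 (\<theta> z) - inner (gp z) (y - z)) \<le> e * norm (y - z)"
      by (simp add: x_def)
  qed
qed

lemma p0_ball_pos: "z \<in> seqs d \<Longrightarrow> norm z \<le> 2 * s * sqrt d \<Longrightarrow> p0 (\<theta> z) > 0"
  using \<Theta>z_ball[of z] p0_pos by (auto simp: \<Theta>z_def)

lemma ln_p0_derivative:
  assumes z: "z \<in> seqs d" "norm z < 2 * s * sqrt d"
  shows "((\<lambda>z. ln (p0 (\<theta> z))) has_derivative (\<lambda>u. inner (glp z) u)) (at z within seqs d)"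
proof -
  have "((\<lambda>z. ln (p0 (\<theta> z))) has_derivative (\<lambda>u. inner (gp z) u * (1 / p0 (\<theta> z)))) (at z within seqs d)"
    using p0_ball_pos[OF z(1)] z(2) by (auto intro!: derivative_eq_intros p0_derivative z simp: divide_inverse)
  then show ?thesis by (simp add: glp_def mult.commute)
qed

text \<open>The gradient is tested against itself: \<open>dual_norm_wrt_bound\<close> brings in the
  dual norm, and whitening contributes the factor \<open>1 / sqrt n\<close>.\<close>

lemma glp_bound:
  assumes z: "z \<in> seqs d" "norm z < 2 * s * sqrt d"
  shows "norm (glp z) \<le> D / sqrt n"
proof (cases "glp z = 0")
  case True
  have "0 \<le> dual_norm_wrt F (gradient (\<lambda>t. ln (p0 t)) th0)" by (simp add: dual_norm_wrt_def)
  also have "\<dots> \<le> D" using \<theta>_nbhd[of 0 "2 * s"] s by (intro D) (auto simp: seqs_def)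
  finally show ?thesis using True by simp
next
  case False
  define u where "u = glp z"
  have u: "u \<in> seqs d" by (auto simp: u_def glp_def gp_def seqs_def)
  have t: "\<theta> z \<in> nbhd d n \<mu> X th0 (2 * s)" using \<theta>_nbhd[OF z(1)] z(2) by simp
  have "(norm u)\<^sup>2 = inner (glp z) u" by (simp add: power2_norm_eq_inner u_def)
  also have "\<dots> = 1 / p0 (\<theta> z) * inner (gp z) u" by (simp add: glp_def)
  also have "\<dots> = gradient (\<lambda>t. ln (p0 t)) (\<theta> z) \<bullet> (A *\<^sub>v vec_of d u)"
    unfolding gradient_ln[OF t] using gp_inner[OF u] smult_scalar_prod_distrib[OF gradient_carrier Avec_carrier] by simp
  also have "\<dots> \<le> dual_norm_wrt F (gradient (\<lambda>t. ln (p0 t)) (\<theta> z)) * norm_wrt F (A *\<^sub>v vec_of d u)"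
    using dual_norm_wrt_bound[OF fisher_pos_def gradient_carrier Avec_carrier, of "\<lambda>t. ln (p0 t)" z u] by simp
  also have "\<dots> \<le> D * (norm u / sqrt n)"
    unfolding norm_wrt_A[OF u] using D[OF t] by (intro mult_right_mono) auto
  finally have "norm u * norm u \<le> D / sqrt n * norm u" by (simp add: power2_eq_square)
  moreover have "norm u > 0" using False by (simp add: u_def)
  ultimately show ?thesis unfolding u_def[symmetric] by (simp only: mult_le_cancel_right_pos)
qed

lemma D_nonneg: "D \<ge> 0"
proof -
  have "0 \<le> dual_norm_wrt F (gradient (\<lambda>t. ln (p0 t)) th0)" by (simp add: dual_norm_wrt_def)
  also have "\<dots> \<le> D" using \<theta>_nbhd[of 0 "2 * s"] s by (intro D) (auto simp: seqs_def)
  finally show ?thesis .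
qed

lemma potential_prior_glm:
  assumes Y: "Y \<in> score_event" and small: "D / sqrt n + 3 * s * \<delta> * d \<le> 1 / 4"
  shows "potential_prior d s \<delta> \<Theta>z (V Y) (grad Y) Q T (\<lambda>z. p0 (\<theta> z)) glp (D / sqrt n) K"
proof -
  interpret PS: potential_score d s \<delta> \<Theta>z "V Y" "grad Y" Q T by (rule potential_score_glm[OF Y])
  have "Y \<in> space law" using Y by (simp add: score_event_def)
  then have Yc: "\<And>i. i < n \<Longrightarrow> Y i \<in> carrier_vec k" by (rule law_carrier)
  show ?thesis
    by (unfold_locales)
      (use small V_measurable[OF Yc] \<Theta>z_measurable measurable_compose[OF \<theta>_measurable p0_measurable]
        p0_pos p0_le ln_p0_derivative glp_bound D_nonneg in
        \<open>auto simp: \<Theta>z_def PS.R_def glp_def gp_def seqs_def\<close>)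
qed

end

lemma ennreal_divide_self_le: "(x::ennreal) / x \<le> 1"
  by (cases "x = 0 \<or> x = \<top>") (auto simp: ennreal_divide_self less_top)

lemma norm_diff_measurable_fseq:
  assumes "a \<in> seqs d"
  shows "(\<lambda>z. norm (z - a)) \<in> borel_measurable (lborel_fseq d)"
  using assms by (intro norm_measurable_fseq measurable_into_lborel_fseq) (auto simp: space_lborel_fseq seqs_def)

lemma TV_le_1:
  assumes "\<And>B. B \<in> sets P \<Longrightarrow> measure P B \<le> 1" "\<And>B. B \<in> sets P \<Longrightarrow> measure Q B \<le> 1"
  shows "TV P Q \<le> 1"
  unfolding TV_def
proof (rule SUP_least)
  fix B assume B: "B \<in> sets P"
  have "\<bar>measure P B - measure Q B\<bar> \<le> 1"
    using assms[OF B] measure_nonneg[of P B] measure_nonneg[of Q B] by linarith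
  then show "ereal \<bar>measure P B - measure Q B\<bar> \<le> 1" by simp
qed

context glm_prior
begin

text \<open>The determinant of \<open>A\<close>, that is, the Jacobian of the whitening map.\<close>

definition jac :: real where "jac = (\<Prod>i<d. 1 / L $$ (i, i))"

lemma jac_pos: "jac > 0"
  unfolding jac_def using L(3) by (intro prod_pos) auto

lemma nn_integral_whitened:
  assumes f: "f \<in> borel_measurable (lborel_vec d)" and B: "B \<in> sets (lborel_vec d)"
  shows "(\<integral>\<^sup>+x. f x * indicator B x \<partial>lborel_vec d)
    = ennreal jac * (\<integral>\<^sup>+z. indicator (\<theta> -` B \<inter> seqs d) z * f (\<theta> z) \<partial>lborel_fseq d)"
    "\<theta> -` B \<inter> seqs d \<in> sets (lborel_fseq d)"
proof -
  note [measurable] = f B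
  have "(\<lambda>x. f x * indicator B x) \<in> borel_measurable (lborel_vec d)" by measurable
  from nn_integral_whitening(1)[OF L A(1,2) th0_carrier this]
  have "(\<integral>\<^sup>+x. f x * indicator B x \<partial>lborel_vec d)
      = ennreal jac * (\<integral>\<^sup>+z. f (\<theta> z) * indicator B (\<theta> z) \<partial>lborel_fseq d)"
    by (simp add: jac_def \<theta>_def)
  also have "(\<integral>\<^sup>+z. f (\<theta> z) * indicator B (\<theta> z) \<partial>lborel_fseq d)
      = (\<integral>\<^sup>+z. indicator (\<theta> -` B \<inter> seqs d) z * f (\<theta> z) \<partial>lborel_fseq d)"
    by (intro nn_integral_cong) (auto simp: space_lborel_fseq indicator_def)
  finally show "(\<integral>\<^sup>+x. f x * indicator B x \<partial>lborel_vec d)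
    = ennreal jac * (\<integral>\<^sup>+z. indicator (\<theta> -` B \<inter> seqs d) z * f (\<theta> z) \<partial>lborel_fseq d)" .
  show "\<theta> -` B \<inter> seqs d \<in> sets (lborel_fseq d)"
    using measurable_sets[OF \<theta>_measurable B] by (simp add: space_lborel_fseq)
qed

section \<open>Posterior and Gaussian as integrals over sequences\<close>

definition wt :: "(nat \<Rightarrow> real Matrix.vec) \<Rightarrow> real Matrix.vec \<Rightarrow> real" where
  "wt Y t = indicator (param_space d k n \<mu> X) t * (exp (- real n * nll n \<mu> X Y t) * p0 t)"

definition zw :: "(nat \<Rightarrow> real Matrix.vec) \<Rightarrow> fseq \<Rightarrow> real" where
  "zw Y z = indicator \<Theta>z z * (exp (- V Y z) * p0 (\<theta> z))"

lemma wt_measurable: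
  assumes "\<And>i. i < n \<Longrightarrow> Y i \<in> carrier_vec k"
  shows "(\<lambda>t. ennreal (wt Y t)) \<in> borel_measurable (lborel_vec d)"
proof -
  note [measurable] = nll_measurable[OF assms] p0_measurable param_space_measurable
  show ?thesis unfolding wt_def by measurable
qed

lemma wt_\<theta>: "z \<in> seqs d \<Longrightarrow> wt Y (\<theta> z) = zw Y z"
  using n by (auto simp: wt_def zw_def nll_\<theta> \<Theta>z_def indicator_def)

lemma posterior_eq: "posterior d k n \<mu> X p0 Y =
  density (lborel_vec d) (\<lambda>t. ennreal (wt Y t) / (\<integral>\<^sup>+t. ennreal (wt Y t) \<partial>lborel_vec d))"
  by (simp add: posterior_def wt_def Let_def)

lemma posterior_emeasure:
  assumes Y: "\<And>i. i < n \<Longrightarrow> Y i \<in> carrier_vec k" and B: "B \<in> sets (lborel_vec d)"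
  shows "emeasure (posterior d k n \<mu> X p0 Y) B
    = (\<integral>\<^sup>+t. ennreal (wt Y t) * indicator B t \<partial>lborel_vec d) / (\<integral>\<^sup>+t. ennreal (wt Y t) \<partial>lborel_vec d)"
proof -
  define I where "I = (\<integral>\<^sup>+t. ennreal (wt Y t) \<partial>lborel_vec d)"
  note [measurable] = wt_measurable[OF Y] B
  have "emeasure (posterior d k n \<mu> X p0 Y) B = (\<integral>\<^sup>+t. ennreal (wt Y t) / I * indicator B t \<partial>lborel_vec d)"
    unfolding posterior_eq I_def[symmetric] by (intro emeasure_density) measurable
  also have "\<dots> = (\<integral>\<^sup>+t. ennreal (wt Y t) * indicator B t / I \<partial>lborel_vec d)"
    by (intro nn_integral_cong) (auto simp: indicator_def)
  also have "\<dots> = (\<integral>\<^sup>+t. ennreal (wt Y t) * indicator B t \<partial>lborel_vec d) / I"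
    by (intro nn_integral_divide) measurable
  finally show ?thesis by (simp add: I_def)
qed

text \<open>Holds whatever the normalising integral is, since in \<open>ennreal\<close> a quotient x
  / x is at most 1 even for 0 and top. It serves the case where the comparison theorem does not
  apply.\<close>

lemma posterior_le_1:
  assumes Y: "\<And>i. i < n \<Longrightarrow> Y i \<in> carrier_vec k" and B: "B \<in> sets (lborel_vec d)"
  shows "measure (posterior d k n \<mu> X p0 Y) B \<le> 1"
proof -
  have "(\<integral>\<^sup>+t. ennreal (wt Y t) * indicator B t \<partial>lborel_vec d) \<le> (\<integral>\<^sup>+t. ennreal (wt Y t) \<partial>lborel_vec d)"
    by (intro nn_integral_mono) (auto simp: indicator_def)
  from divide_right_mono_ennreal[OF this, of "\<integral>\<^sup>+t. ennreal (wt Y t) \<partial>lborel_vec d"]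
  have "emeasure (posterior d k n \<mu> X p0 Y) B
      \<le> (\<integral>\<^sup>+t. ennreal (wt Y t) \<partial>lborel_vec d) / (\<integral>\<^sup>+t. ennreal (wt Y t) \<partial>lborel_vec d)"
    by (subst posterior_emeasure[OF Y B])
  also have "\<dots> \<le> 1" by (rule ennreal_divide_self_le)
  finally show ?thesis by (simp add: measure_def enn2real_leI)
qed

text \<open>The Jacobian cancels between numerator and normalising constant; positivity and
  finiteness of the latter allow the passage to real numbers.\<close>

lemma posterior_whitened:
  assumes Y: "\<And>i. i < n \<Longrightarrow> Y i \<in> carrier_vec k" and B: "B \<in> sets (lborel_vec d)"
    and W: "(\<integral>\<^sup>+z. ennreal (zw Y z) \<partial>lborel_fseq d) > 0" "(\<integral>\<^sup>+z. ennreal (zw Y z) \<partial>lborel_fseq d) < \<infinity>"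
  shows "measure (posterior d k n \<mu> X p0 Y) B
    = enn2real (\<integral>\<^sup>+z. indicator (\<theta> -` B \<inter> seqs d) z * ennreal (zw Y z) \<partial>lborel_fseq d)
      / enn2real (\<integral>\<^sup>+z. ennreal (zw Y z) \<partial>lborel_fseq d)"
proof -
  define W where "W = (\<integral>\<^sup>+z. ennreal (zw Y z) \<partial>lborel_fseq d)"
  define WB where "WB = (\<integral>\<^sup>+z. indicator (\<theta> -` B \<inter> seqs d) z * ennreal (zw Y z) \<partial>lborel_fseq d)"
  have le: "WB \<le> W" unfolding W_def WB_def by (intro nn_integral_mono) (auto simp: indicator_def)
  obtain a b where ab: "WB = ennreal a" "a \<ge> 0" "W = ennreal b" "b > 0"
    using W le unfolding W_def[symmetric] by (cases WB; cases W) (auto simp: less_top[symmetric] top_unique)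
  have wm: "(\<lambda>t. ennreal (wt Y t)) \<in> borel_measurable (lborel_vec d)" by (rule wt_measurable[OF Y])
  have 1: "(\<integral>\<^sup>+t. ennreal (wt Y t) * indicator B t \<partial>lborel_vec d) = ennreal jac * WB"
    unfolding nn_integral_whitened(1)[OF wm B] WB_def
    by (intro arg_cong2[where f = "(*)"] refl nn_integral_cong) (simp add: wt_\<theta> space_lborel_fseq)
  have "(\<integral>\<^sup>+t. ennreal (wt Y t) \<partial>lborel_vec d)
      = (\<integral>\<^sup>+t. ennreal (wt Y t) * indicator (space (lborel_vec d)) t \<partial>lborel_vec d)"
    by (intro nn_integral_cong) simp
  also have "\<dots> = ennreal jac * W"
    unfolding nn_integral_whitened(1)[OF wm sets.top] W_def
    by (intro arg_cong2[where f = "(*)"] refl nn_integral_cong) (simp add: wt_\<theta> space_lborel_fseq space_lborel_vec)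
  finally have 2: "(\<integral>\<^sup>+t. ennreal (wt Y t) \<partial>lborel_vec d) = ennreal jac * W" .
  have "emeasure (posterior d k n \<mu> X p0 Y) B = ennreal jac * WB / (ennreal jac * W)"
    unfolding 1[symmetric] 2[symmetric] by (rule posterior_emeasure[OF Y B])
  also have "\<dots> = ennreal (a / b)"
    unfolding ab(1,3) using ab jac_pos by (simp add: divide_ennreal flip: ennreal_mult)
  finally have "emeasure (posterior d k n \<mu> X p0 Y) B = ennreal (a / b)" .
  then show ?thesis
    unfolding W_def[symmetric] WB_def[symmetric] ab(1,3) using ab by (simp add: measure_def)
qed

text \<open>The Gaussian is specified by its covariance, and its density inverts that again; so the
  precision n F returns, and the determinant of the covariance is the squared Jacobian.\<close>

lemma H_inverse: "mat_inv (mat_inv (real n \<cdot>\<^sub>m F)) = real n \<cdot>\<^sub>m F" "Determinant.det (mat_inv (real n \<cdot>\<^sub>m F)) = jac\<^sup>2"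
proof -
  define H where "H = real n \<cdot>\<^sub>m F"
  have H: "H \<in> carrier_mat d d" using fisher_carrier by (simp add: H_def)
  have prod: "(\<Prod>i<d. L $$ (i, i)) * jac = 1"
    unfolding jac_def prod.distrib[symmetric] using L(3) by (intro prod.neutral) (auto simp: less_imp_neq[symmetric])
  then have det: "Determinant.det H * jac\<^sup>2 = 1"
    using det_L by (simp add: H_def power_mult_distrib[symmetric])
  then have "Determinant.det H \<noteq> 0" by auto
  note inv = mat_inv_inverse[OF H this]
  show "mat_inv (mat_inv (real n \<cdot>\<^sub>m F)) = real n \<cdot>\<^sub>m F"
    using mat_inv_unique[OF inv(1) H inv(3)] by (simp add: H_def)
  have "Determinant.det H * Determinant.det (mat_inv H) = 1" using det_mult[OF H inv(1)] inv(2) by simp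
  then show "Determinant.det (mat_inv (real n \<cdot>\<^sub>m F)) = jac\<^sup>2"
    using det by (metis H_def mult_cancel_left mult_zero_left zero_neq_one)
qed

text \<open>The determinant in the Gaussian normalisation is the square of the Jacobian, so the
  change of variables leaves exactly the standard Gaussian around \<open>zh\<close>.\<close>

lemma gaussian_whitened:
  assumes Y: "Y \<in> score_event" and B: "B \<in> sets (lborel_vec d)"
  shows "measure (laplace_gaussian d k n \<mu> X th0 Y) B
    = enn2real (\<integral>\<^sup>+z. indicator (\<theta> -` B \<inter> seqs d) z
        * ennreal (exp (- (norm (z - potential_score.zh d s (grad Y)))\<^sup>2 / 2)) \<partial>lborel_fseq d) / sqrt (2 * pi) ^ d"
proof -
  interpret PS: potential_score d s \<delta> \<Theta>z "V Y" "grad Y" Q T by (rule potential_score_glm[OF Y])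
  define m where "m = \<theta> PS.zh"
  have m: "m \<in> carrier_vec d" by (simp add: m_def)
  define H where "H = real n \<cdot>\<^sub>m F"
  have H: "H \<in> carrier_mat d d" using fisher_carrier by (simp add: H_def)
  define g where "g = (\<lambda>x. ennreal (exp (- ((x - m) \<bullet> (H *\<^sub>v (x - m))) / 2) / sqrt ((2 * pi) ^ d * jac\<^sup>2)))"
  have gm: "g \<in> borel_measurable (lborel_vec d)"
  proof -
    define h where "h = (\<lambda>x :: real Matrix.vec. ennreal (exp (- (\<Sum>i<d. (x $ i - m $ i) * (\<Sum>j<d. H $$ (i, j) * (x $ j - m $ j))) / 2) / sqrt ((2 * pi) ^ d * jac\<^sup>2)))"
    have c: "(\<lambda>x :: real Matrix.vec. x $ i) \<in> borel_measurable (lborel_vec d)" if "i < d" for i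
      by (rule vec_index_measurable[OF that])
    have "h \<in> borel_measurable (lborel_vec d)"
      unfolding h_def
      by (intro measurable_compose[OF _ measurable_ennreal] borel_measurable_divide measurable_compose[OF _ borel_measurable_exp]
          borel_measurable_uminus borel_measurable_sum borel_measurable_times borel_measurable_diff borel_measurable_const c) auto
    moreover have "g x = h x" if "x \<in> space (lborel_vec d)" for x
      using that m H by (auto simp: g_def h_def space_lborel_vec scalar_prod_def lessThan_atLeast0 intro!: sum.cong)
    ultimately show ?thesis by (simp cong: measurable_cong)
  qed
  have lap: "laplace_gaussian d k n \<mu> X th0 Y = density (lborel_vec d) g"
    by (simp add: laplace_gaussian_def gaussian_def MLE_whitened[OF Y] H_inverse g_def m_def H_def)
  define Z where "Z = sqrt (2 * pi) ^ d"
  have Z: "Z > 0" by (simp add: Z_def)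
  define E where "E = (\<lambda>z. exp (- (norm (z - PS.zh))\<^sup>2 / 2))"
  have g_\<theta>: "g (\<theta> z) = ennreal (1 / (Z * jac)) * ennreal (E z)" if z: "z \<in> seqs d" for z
  proof -
    have "z - PS.zh \<in> seqs d" using z PS.zh(1) by (auto simp: seqs_def)
    then have "(\<theta> z - m) \<bullet> (H *\<^sub>v (\<theta> z - m)) = (norm (z - PS.zh))\<^sup>2"
      unfolding m_def \<theta>_diff H_def by (simp add: form_inner power2_norm_eq_inner)
    moreover have "sqrt ((2 * pi) ^ d * jac\<^sup>2) = Z * jac"
      using jac_pos by (simp only: real_sqrt_mult real_sqrt_power Z_def real_sqrt_abs) simp
    ultimately show ?thesis using Z jac_pos by (simp add: g_def E_def flip: ennreal_mult)
  qed
  define I where "I = (\<integral>\<^sup>+z. indicator (\<theta> -` B \<inter> seqs d) z * ennreal (E z) \<partial>lborel_fseq d)"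
  have Em: "(\<lambda>z. ennreal (E z)) \<in> borel_measurable (lborel_fseq d)"
    using norm_diff_measurable_fseq[OF PS.zh(1)] unfolding E_def by measurable
  note [measurable] = Em nn_integral_whitened(2)[OF gm B]
  have "emeasure (laplace_gaussian d k n \<mu> X th0 Y) B = (\<integral>\<^sup>+x. g x * indicator B x \<partial>lborel_vec d)"
    unfolding lap by (rule emeasure_density[OF gm B])
  also have "\<dots> = ennreal jac * (\<integral>\<^sup>+z. indicator (\<theta> -` B \<inter> seqs d) z * g (\<theta> z) \<partial>lborel_fseq d)"
    by (rule nn_integral_whitened(1)[OF gm B])
  also have "(\<integral>\<^sup>+z. indicator (\<theta> -` B \<inter> seqs d) z * g (\<theta> z) \<partial>lborel_fseq d)
      = (\<integral>\<^sup>+z. ennreal (1 / (Z * jac)) * (indicator (\<theta> -` B \<inter> seqs d) z * ennreal (E z)) \<partial>lborel_fseq d)"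
    by (intro nn_integral_cong) (simp add: g_\<theta> space_lborel_fseq mult_ac)
  also have "\<dots> = ennreal (1 / (Z * jac)) * I"
    unfolding I_def by (intro nn_integral_cmult) measurable
  also have "ennreal jac * \<dots> = ennreal (1 / Z) * I"
    using Z jac_pos by (simp add: mult.assoc[symmetric] flip: ennreal_mult)
  finally show ?thesis using Z by (simp add: measure_def enn2real_mult I_def E_def Z_def)
qed

lemma gaussian_le_1:
  assumes Y: "Y \<in> score_event" and B: "B \<in> sets (lborel_vec d)"
  shows "measure (laplace_gaussian d k n \<mu> X th0 Y) B \<le> 1"
proof -
  interpret PS: potential_score d s \<delta> \<Theta>z "V Y" "grad Y" Q T by (rule potential_score_glm[OF Y])
  interpret TI: translation_invariant_space "lborel_fseq d" d "sqrt (2 * pi) ^ d"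
    by (rule translation_invariant_space_fseq[OF d])
  define E where "E = (\<lambda>z. ennreal (exp (- (norm (z - PS.zh))\<^sup>2 / 2)))"
  have "(\<integral>\<^sup>+z. indicator (\<theta> -` B \<inter> seqs d) z * E z \<partial>lborel_fseq d) \<le> (\<integral>\<^sup>+z. E z \<partial>lborel_fseq d)"
    by (intro nn_integral_mono) (auto simp: indicator_def)
  also have "\<dots> = ennreal (sqrt (2 * pi) ^ d)"
  proof -
    have "E \<in> borel_measurable (lborel_fseq d)"
      using norm_diff_measurable_fseq[OF PS.zh(1)] unfolding E_def by measurable
    from TI.translation[OF this, of PS.zh] show ?thesis
      using PS.zh(1) TI.gaussian_integral by (simp add: E_def space_lborel_fseq)
  qed
  finally show ?thesis
    unfolding gaussian_whitened[OF Y B] E_def by (simp add: enn2real_leI divide_le_eq)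
qed

text \<open>If a + 3 b exceeds 1/4 the right side is above 1 and bounds the total variation distance
  trivially. Otherwise the comparison theorem applies, and 3072 = 3 * 1024 because \<eta> = a + 3 b
  \<le> 3 (a + b).\<close>

lemma TV_bound:
  assumes Y: "Y \<in> score_event"
  shows "TV (posterior d k n \<mu> X p0 Y) (laplace_gaussian d k n \<mu> X th0 Y)
    \<le> ereal (3072 * (D / sqrt n + s * D3 * (d / sqrt n) + K * exp (- (d * (s / 12)\<^sup>2))))"
proof -
  have "Y \<in> space law" using Y by (simp add: score_event_def)
  then have Yc: "\<And>i. i < n \<Longrightarrow> Y i \<in> carrier_vec k" by (rule law_carrier)
  have sets: "sets (posterior d k n \<mu> X p0 Y) = sets (lborel_vec d)" by (simp add: posterior_eq)
  have th0p: "p0 th0 > 0" by (rule p0_pos[OF th0])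
  have K: "K \<ge> 1" using p0_le[OF th0] th0p by simp
  define a where "a = D / sqrt n"
  define b where "b = s * \<delta> * d"
  define e where "e = K * exp (- (d * (s / 12)\<^sup>2))"
  have nn: "a \<ge> 0" "b \<ge> 0" "e \<ge> 0" using D_nonneg D3_nonneg K s by (auto simp: a_def b_def e_def \<delta>_def)
  have "TV (posterior d k n \<mu> X p0 Y) (laplace_gaussian d k n \<mu> X th0 Y) \<le> ereal (3072 * (a + b + e))"
  proof (cases "a + 3 * b \<le> 1 / 4")
    case False
    have "TV (posterior d k n \<mu> X p0 Y) (laplace_gaussian d k n \<mu> X th0 Y) \<le> 1"
      using posterior_le_1[OF Yc] gaussian_le_1[OF Y] by (intro TV_le_1) (auto simp: sets)
    also have "(1::ereal) \<le> ereal (3072 * (a + b + e))"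
    proof -
      have "1 \<le> 3072 * (a + b + e)" using False nn by argo
      then show ?thesis by simp
    qed
    finally show ?thesis .
  next
    case True
    interpret PP: potential_prior d s \<delta> \<Theta>z "V Y" "grad Y" Q T "\<lambda>z. p0 (\<theta> z)" glp "D / sqrt n" K
      by (rule potential_prior_glm[OF Y]) (use True in \<open>simp add: a_def b_def\<close>)
    have w: "PP.weight z = zw Y z" for z by (simp add: PP.weight_def zw_def)
    note PC = PP.posterior_comparison[unfolded w]
    show ?thesis
      unfolding TV_def
    proof (rule SUP_least)
      fix B assume "B \<in> sets (posterior d k n \<mu> X p0 Y)"
      then have B: "B \<in> sets (lborel_vec d)" by (simp add: sets)
      have "\<bar>measure (posterior d k n \<mu> X p0 Y) B - measure (laplace_gaussian d k n \<mu> X th0 Y) B\<bar> \<le> 1024 * (PP.\<eta> + e)"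
        unfolding posterior_whitened[where Y = Y, OF Yc B PC(1,2), simplified] gaussian_whitened[OF Y B] e_def
        using measurable_sets[OF \<theta>_measurable B] by (intro PC(3)) (simp add: space_lborel_fseq)
      also have "\<dots> \<le> 3072 * (a + b + e)" using nn by (simp add: PP.\<eta>_def a_def b_def)
      finally show "ereal \<bar>measure (posterior d k n \<mu> X p0 Y) B - measure (laplace_gaussian d k n \<mu> X th0 Y) B\<bar>
          \<le> ereal (3072 * (a + b + e))" by simp
    qed
  qed
  then show ?thesis by (simp add: a_def b_def e_def \<delta>_def)
qed

end

context glm_white
begin

text \<open>Passage to extended reals. The hypothesis makes \<open>delta01\<close> finite and
  thereby forces the regularity in its definition. If the prior is unbounded relative to
  \<open>p0 th0\<close>, the right side is infinite; otherwise the supremum is a real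
  \<open>K\<close>.\<close>

lemma TV_bound_ereal:
  assumes prior: "prior_density d p0" "\<And>t. t \<in> param_space d k n \<mu> X \<Longrightarrow> p0 t > 0"
    and delta01: "delta01 d n \<mu> X th0 p0 (2 * s) \<le> ereal (sqrt (real n * real d) / 6)"
    and Y: "Y \<in> score_event"
  shows "TV (posterior d k n \<mu> X p0 Y) (laplace_gaussian d k n \<mu> X th0 Y)
    \<le> ereal 3072 * (delta01 d n \<mu> X th0 p0 (2 * s) / ereal (sqrt (real n))
        + ereal s * delta3 d n \<mu> X th0 (2 * s) * ereal (real d / sqrt (real n))
        + exp_ereal (ereal (real d) * (M0 d k n \<mu> X th0 p0 - ereal ((s / 12)\<^sup>2))))"
proof -
  define U where "U = nbhd d n \<mu> X th0 (2 * s)"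
  define dn where "dn = (\<lambda>t. dual_norm_wrt F (gradient (\<lambda>t. ln (p0 t)) t))"
  have C1: "C1_on d U p0" "\<forall>t\<in>U. p0 t > 0"
    using delta01 unfolding delta01_def U_def[symmetric] by (auto split: if_splits)
  then have d01: "delta01 d n \<mu> X th0 p0 (2 * s) = (SUP t\<in>U. ereal (dn t))"
    by (simp add: delta01_def U_def dn_def)
  have th0U: "th0 \<in> U" using \<theta>_nbhd[of 0 "2 * s"] s by (simp add: U_def seqs_def)
  have "0 \<le> ereal (dn th0)" by (simp add: dn_def dual_norm_wrt_def)
  also have "\<dots> \<le> (SUP t\<in>U. ereal (dn t))" by (rule SUP_upper[OF th0U])
  finally obtain D where D0: "(SUP t\<in>U. ereal (dn t)) = ereal D" "D \<ge> 0"
    using delta01 unfolding d01 by (cases "SUP t\<in>U. ereal (dn t)") auto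
  have D_le: "dn t \<le> D" if "t \<in> U" for t using SUP_upper[OF that, of "\<lambda>t. ereal (dn t)"] D0(1) by simp
  define M where "M = (SUP t\<in>param_space d k n \<mu> X. ereal (p0 t / p0 th0))"
  have th0p: "p0 th0 > 0" by (rule prior(2)[OF th0])
  have M1: "1 \<le> M" unfolding M_def by (rule SUP_upper2[OF th0]) (use th0p in \<open>simp add: one_ereal_def\<close>)
  show ?thesis
  proof (cases "M = \<infinity>")
    case True
    have "exp_ereal (ereal (real d) * (M0 d k n \<mu> X th0 p0 - ereal ((s / 12)\<^sup>2))) = \<infinity>"
      using d True by (simp add: M0_def M_def[symmetric] ln_ereal_def exp_ereal_def)
    then show ?thesis using D0(2) D3_nonneg s by (simp add: d01 D0(1) delta3_eq)
  next
    case False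
    then obtain K where K: "M = ereal K" "K \<ge> 1" using M1 by (cases M) (auto simp: one_ereal_def)
    interpret glm_prior k YY \<mu> d n X th0 L A s p0 D K
    proof
      show "p0 \<in> borel_measurable (lborel_vec d)" using prior(1) by (simp add: prior_density_def)
      show "p0 t > 0" if "t \<in> param_space d k n \<mu> X" for t by (rule prior(2)[OF that])
      show "C1_on d (nbhd d n \<mu> X th0 (2 * s)) p0" using C1(1) by (simp add: U_def)
      show "p0 t \<le> K * p0 th0" if "t \<in> param_space d k n \<mu> X" for t
      proof -
        have "ereal (p0 t / p0 th0) \<le> M" unfolding M_def by (rule SUP_upper[OF that])
        then show ?thesis using th0p by (simp add: K(1) field_simps)
      qed
      show "dual_norm_wrt F (gradient (\<lambda>t. ln (p0 t)) t) \<le> D" if "t \<in> nbhd d n \<mu> X th0 (2 * s)" for t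
        using D_le[of t] that by (simp add: U_def dn_def)
    qed
    \<comment> \<open>\<open>K\<close> is exp (d M0): the factor d in the exponent undoes the
      division in \<open>M0\<close>.\<close>
    have "real d * (ln K / real d - (s / 12)\<^sup>2) = ln K + - (real d * (s / 12)\<^sup>2)"
      using d by (simp add: right_diff_distrib)
    then have "exp (real d * (ln K / real d - (s / 12)\<^sup>2)) = K * exp (- (real d * (s / 12)\<^sup>2))"
      using K(2) by (simp only: exp_add) simp
    then have "exp_ereal (ereal (real d) * (M0 d k n \<mu> X th0 p0 - ereal ((s / 12)\<^sup>2)))
        = ereal (K * exp (- (real d * (s / 12)\<^sup>2)))"
      using K(2) d by (simp add: M0_def M_def[symmetric] K(1) ln_ereal_def exp_ereal_def)
    then have "ereal 3072 * (delta01 d n \<mu> X th0 p0 (2 * s) / ereal (sqrt (real n))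
        + ereal s * delta3 d n \<mu> X th0 (2 * s) * ereal (real d / sqrt (real n))
        + exp_ereal (ereal (real d) * (M0 d k n \<mu> X th0 p0 - ereal ((s / 12)\<^sup>2))))
      = ereal (3072 * (D / sqrt n + s * D3 * (d / sqrt n) + K * exp (- (d * (s / 12)\<^sup>2))))"
      unfolding d01 D0(1) delta3_eq using n by simp
    then show ?thesis using TV_bound[OF Y] by (simp only:)
  qed
qed

end

theorem proposition4p7:
  shows "\<exists>C::real. C > 0 \<and>
    (\<forall>(d::nat) (k::nat) (n::nat) (YY :: real Matrix.vec set) (\<mu> :: real Matrix.vec measure)
      (X :: nat \<Rightarrow> real Matrix.mat) (th0 :: real Matrix.vec) (p0 :: real Matrix.vec \<Rightarrow> real) (s::real).
      d \<ge> 1 \<longrightarrow> k \<ge> 1 \<longrightarrow> n \<ge> 1 \<longrightarrow>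
      regular_minimal_family k YY \<mu> \<longrightarrow>
      (\<forall>i<n. X i \<in> carrier_mat d k) \<longrightarrow>
      th0 \<in> param_space d k n \<mu> X \<longrightarrow>
      prior_density d p0 \<longrightarrow>
      (\<forall>\<theta>\<in>param_space d k n \<mu> X. p0 \<theta> > 0) \<longrightarrow>
      columns_span d n X \<longrightarrow>
      s \<ge> 12 \<longrightarrow>
      nbhd d n \<mu> X th0 (2 * s) \<subseteq> param_space d k n \<mu> X \<longrightarrow>
      ereal (2 * s) * delta3 d n \<mu> X th0 (2 * s) * ereal (sqrt (real d / real n)) \<le> ereal (1 / 4) \<longrightarrow>
      delta01 d n \<mu> X th0 p0 (2 * s) \<le> ereal (sqrt (real n * real d) / 6) \<longrightarrow>
      (\<exists>E \<in> sets (sample_law n \<mu> X th0).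
         measure (sample_law n \<mu> X th0) E \<ge> 1 - exp (- (real d * s\<^sup>2 / 10)) \<and>
         (\<forall>Y\<in>E. MLE_unique d k n \<mu> X Y \<and>
            TV (posterior d k n \<mu> X p0 Y) (laplace_gaussian d k n \<mu> X th0 Y)
              \<le> ereal C *
                 (delta01 d n \<mu> X th0 p0 (2 * s) / ereal (sqrt (real n))
                  + ereal s * delta3 d n \<mu> X th0 (2 * s) * ereal (real d / sqrt (real n))
                  + exp_ereal (ereal (real d) * (M0 d k n \<mu> X th0 p0 - ereal ((s / 12)\<^sup>2)))))))"
proof (intro exI[of _ 3072] conjI allI impI)
  fix d k n :: nat and YY and \<mu> :: "real Matrix.vec measure" and X :: "nat \<Rightarrow> real Matrix.mat"
    and th0 :: "real Matrix.vec" and p0 :: "real Matrix.vec \<Rightarrow> real" and s :: real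
  assume d: "d \<ge> 1" and k: "k \<ge> 1" and n: "n \<ge> 1" and fam: "regular_minimal_family k YY \<mu>"
    and X: "\<forall>i<n. X i \<in> carrier_mat d k" and th0: "th0 \<in> param_space d k n \<mu> X"
    and prior: "prior_density d p0" "\<forall>\<theta>\<in>param_space d k n \<mu> X. p0 \<theta> > 0"
    and cols: "columns_span d n X" and s: "s \<ge> 12"
    and nb: "nbhd d n \<mu> X th0 (2 * s) \<subseteq> param_space d k n \<mu> X"
    and d3: "ereal (2 * s) * delta3 d n \<mu> X th0 (2 * s) * ereal (sqrt (real d / real n)) \<le> ereal (1 / 4)"
    and d01: "delta01 d n \<mu> X th0 p0 (2 * s) \<le> ereal (sqrt (real n * real d) / 6)"
  interpret glm k YY \<mu> d n X th0
  proof
    show "natural_params k \<mu> \<noteq> {}" using th0 n by (auto simp: param_space_def)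
  qed (use d n fam X th0 cols in auto)
  have pd: "pos_def_mat d (real n \<cdot>\<^sub>m fisher d n \<mu> X th0)"
  proof -
    have F: "F \<in> carrier_mat d d" "transpose_mat F = F"
      "\<And>u. u \<in> carrier_vec d \<Longrightarrow> u \<noteq> 0\<^sub>v d \<Longrightarrow> u \<bullet> (F *\<^sub>v u) > 0"
      using fisher_pos_def by (auto simp: pos_def_mat_def)
    then have "u \<bullet> ((real n \<cdot>\<^sub>m F) *\<^sub>v u) = real n * (u \<bullet> (F *\<^sub>v u))" if "u \<in> carrier_vec d" for u
      using that by (simp add: smult_mat_mult_vec[OF F(1) that] scalar_prod_smult_distrib[of _ d])
    then show ?thesis using F n by (auto simp: pos_def_mat_def smult_mat_transpose)
  qed
  show "\<exists>E\<in>sets (sample_law n \<mu> X th0).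
      1 - exp (- (real d * s\<^sup>2 / 10)) \<le> Sigma_Algebra.measure (sample_law n \<mu> X th0) E \<and>
      (\<forall>Y\<in>E. MLE_unique d k n \<mu> X Y \<and>
        TV (posterior d k n \<mu> X p0 Y) (laplace_gaussian d k n \<mu> X th0 Y)
          \<le> ereal 3072 * (delta01 d n \<mu> X th0 p0 (2 * s) / ereal (sqrt (real n))
              + ereal s * delta3 d n \<mu> X th0 (2 * s) * ereal (real d / sqrt (real n))
              + exp_ereal (ereal (real d) * (M0 d k n \<mu> X th0 p0 - ereal ((s / 12)\<^sup>2)))))"
  proof (rule Cholesky[OF pd])
    fix L A assume LA:
      "L \<in> carrier_mat d d" "\<And>i j. i < d \<Longrightarrow> j < d \<Longrightarrow> i < j \<Longrightarrow> L $$ (i, j) = 0"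
      "\<And>i. i < d \<Longrightarrow> L $$ (i, i) > 0" "transpose_mat L * L = real n \<cdot>\<^sub>m F"
      "A \<in> carrier_mat d d" "A * L = 1\<^sub>m d" "L * A = 1\<^sub>m d"
      "Determinant.det (real n \<cdot>\<^sub>m F) = (\<Prod>i<d. L $$ (i, i))\<^sup>2"
      "\<And>u v. u \<in> carrier_vec d \<Longrightarrow> v \<in> carrier_vec d \<Longrightarrow> u \<bullet> ((real n \<cdot>\<^sub>m F) *\<^sub>v v) = (L *\<^sub>v u) \<bullet> (L *\<^sub>v v)"
    interpret glm_white k YY \<mu> d n X th0 L A s
      by unfold_locales (fact LA s nb d3)+
    show ?thesis
    proof (intro bexI[of _ score_event] conjI ballI)
      show "1 - exp (- (real d * s\<^sup>2 / 10)) \<le> Sigma_Algebra.measure (sample_law n \<mu> X th0) score_event"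
        by (rule score_event(2))
      fix Y assume Y: "Y \<in> score_event"
      show "MLE_unique d k n \<mu> X Y" by (rule MLE_whitened(1)[OF Y])
      show "TV (posterior d k n \<mu> X p0 Y) (laplace_gaussian d k n \<mu> X th0 Y)
            \<le> ereal 3072 * (delta01 d n \<mu> X th0 p0 (2 * s) / ereal (sqrt (real n))
                + ereal s * delta3 d n \<mu> X th0 (2 * s) * ereal (real d / sqrt (real n))
                + exp_ereal (ereal (real d) * (M0 d k n \<mu> X th0 p0 - ereal ((s / 12)\<^sup>2))))"
        using prior(2) by (intro TV_bound_ereal[OF prior(1) _ d01 Y]) auto
    qed (rule score_event(1))
  qed
qed simp

end
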